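(* Let $Z,\tau>0$, let $\kappa:[0,Z]\to(0,\infty)$ be a function and let $h:[0,Z]\to[h_-,h_+]\subset(1/2,1)$ be continuous. Let $\Phi:\mathbb{R}\to\mathbb{R}$ be a continuous function with Hermite index $1$, and let $J(1)=\mathbb{E}[\Phi(X)X]$ with $X\sim\mathcal N(0,1)$. Let $m=\{m(z,H)\}_{z\ge0,\,H\in[h_-,h_+]}$ be a centered, continuous real Gaussian field with $\mathbb{E}[m(z,H)^2]=1$ for all $z,H$, such that there exists a continuous function $\mathbf r:[h_-,h_+]^2\to(0,\infty)$ with $$\lim_{z_1-z_2\to\infty}\ \sup_{(H_1,H_2)\in[h_-,h_+]^2}\bigl|\mathbf r(H_1,H_2)-(z_1-z_2)^{2-H_1-H_2}\,\mathbb{E}[m(z_1,H_1)m(z_2,H_2)]\bigr|=0.$$ For $z\in[0,Z]$ let $$\nu^\varepsilon(z)=\varepsilon^{\kappa(z)-\tau}\,\Phi\bigl(m(z/\varepsilon^2,h(z))\bigr),$$ and let $a^\varepsilon(Z,s)$ be the transmitted wave associated with $\nu^\varepsilon$, $\tau$ and the source function $f$ (defined in the context). Let $\gamma(z):=\tau-\kappa(z)$ and assume $h(z)=(2-\gamma(z))/2$ for all $z\in[0,Z]$. Then, as $\varepsilon\to0$, $\{a^\varepsilon(Z,s)\}_s$ converges in distribution, in the space of continuous functions endowed with the uniform topology, to the random process $$\widetilde a(Z,s)=f\bigl(s-\tfrac12S_h(Z)\bigr),$$ where $S_h$ is a centered Gaussian process with covariance, for $z_1,z_2\ge0$, $$\mathbb{E}[S_h(z_1)S_h(z_2)]=J(1)^2\int_0^{z_1}du_1\int_0^{z_2}du_2\,\widetilde{\mathcal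 R}(u_1,u_2),$$ $$\widetilde{\mathcal R}(u_1,u_2)=\mathcal R(u_1,u_2;h(u_1),h(u_2))\,|u_1-u_2|^{h(u_1)+h(u_2)-2},$$ $$\mathcal R(z_1,z_2;H_1,H_2)=\mathbf r(H_1,H_2)1_{z_1\ge z_2}+\mathbf r(H_2,H_1)1_{z_1<z_2}.$$
   Context: Hermite index. $P_k$ is the $k$th (probabilists') Hermite polynomial. A function $g$ with $\mathbb{E}[g(X)^2]<\infty$, $X\sim\mathcal N(0,1)$, has Hermite index $K$ if $\mathbb{E}[g(X)P_k(X)]=0$ for $0\le k<K$ and $\mathbb{E}[g(X)P_K(X)]\ne0$. Transmitted wave. The source $f:\mathbb{R}\to\mathbb{R}$ is a continuous integrable function whose Fourier transform $\hat f(\omega)=\int_{-\infty}^\infty e^{i\omega s}f(s)\,ds$ is integrable. For each $\omega\in\mathbb{R}$ the propagator $P^\varepsilon_\omega(z)$, $z\in[0,Z]$, is the $2\times2$ complex matrix solving $$\frac{dP^\varepsilon_\omega}{dz}(z)=\frac{i\omega}{2}\nu^\varepsilon(z)\begin{pmatrix}1&-e^{-2i\omega z/\varepsilon^\tau}\\ e^{2i\omega z/\varepsilon^\tau}&-1\end{pmatrix}P^\varepsilon_\omega(z),\qquad P^\varepsilon_\omega(0)=\begin{pmatrix}1&0\\0&1\end{pmatrix}.$$ It has the form $P^\varepsilon_\omega=\begin{pmatrix}\alpha^\varepsilon_\omega&\overline{\beta^\varepsilon_\omega}\\ \beta^\varepsilon_\omega&\overline{\alpha^\varepsilon_\omega}\end{pmatrix}$.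 The transmission coefficient is $T^\varepsilon_\omega(z)=1/\overline{\alpha^\varepsilon_\omega}(z)$, and the transmitted wave is $$a^\varepsilon(Z,s)=\frac1{2\pi}\int_{-\infty}^\infty e^{-is\omega}T^\varepsilon_\omega(Z)\hat f(\omega)\,d\omega.$$ *)

theory Defs
  imports
    "HOL-Probability.Probability"
    "HOL-Computational_Algebra.Polynomial"
begin

(* Probabilists' Hermite polynomials, by the recursion P_{k+1} = x P_k - P_k'. *)
primrec hermite :: "nat \<Rightarrow> real poly" where
  "hermite 0 = 1"
| "hermite (Suc k) = [:0, 1:] * hermite k - pderiv (hermite k)"

definition hermite_index :: "(real \<Rightarrow> real) \<Rightarrow> nat \<Rightarrow> bool" where
  "hermite_index g K \<longleftrightarrow>
     g \<in> borel_measurable borel \<and>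
     integrable std_normal_distribution (\<lambda>x. (g x)\<^sup>2) \<and>
     (\<forall>k<K. (LINT x|std_normal_distribution. g x * poly (hermite k) x) = 0) \<and>
     (LINT x|std_normal_distribution. g x * poly (hermite K) x) \<noteq> 0"

(* Degenerate (almost surely constant) variables count as Gaussian. *)
definition gaussian_rv :: "'w measure \<Rightarrow> ('w \<Rightarrow> real) \<Rightarrow> bool" where
  "gaussian_rv M X \<longleftrightarrow>
     X \<in> borel_measurable M \<and>
     ((\<exists>\<mu> \<sigma>. 0 < \<sigma> \<and> distributed M lborel X (\<lambda>x. ennreal (normal_density \<mu> \<sigma> x))) \<or>
      (\<exists>\<mu>. AE w in M. X w = \<mu>))"

definition gaussian_process :: "'w measure \<Rightarrow> 'i set \<Rightarrow> ('i \<Rightarrow> 'w \<Rightarrow> real) \<Rightarrow> bool" where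
  "gaussian_process M I X \<longleftrightarrow>
     prob_space M \<and>
     (\<forall>F c. finite F \<and> F \<subseteq> I \<longrightarrow> gaussian_rv M (\<lambda>w. \<Sum>i\<in>F. c i * X i w))"

definition centered_gaussian_process ::
  "'w measure \<Rightarrow> 'i set \<Rightarrow> ('i \<Rightarrow> 'w \<Rightarrow> real) \<Rightarrow> bool" where
  "centered_gaussian_process M I X \<longleftrightarrow>
     gaussian_process M I X \<and> (\<forall>i\<in>I. (LINT w|M. X i w) = 0)"

definition fourier :: "(real \<Rightarrow> real) \<Rightarrow> real \<Rightarrow> complex" where
  "fourier f \<omega> = (LINT s|lborel. iexp (\<omega> * s) * complex_of_real (f s))"

definition oscillation_matrix :: "real \<Rightarrow> real \<Rightarrow> real \<Rightarrow> real \<Rightarrow> complex^2^2" where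
  "oscillation_matrix \<tau> \<epsilon> \<omega> z =
     vector [vector [1, - iexp (- (2 * \<omega> * z / \<epsilon> powr \<tau>))],
             vector [iexp (2 * \<omega> * z / \<epsilon> powr \<tau>), - 1]]"

(* P solves the propagator equation at frequency \<omega> on [0,Z], driven by the medium \<nu>. *)
definition is_propagator ::
  "real \<Rightarrow> real \<Rightarrow> real \<Rightarrow> (real \<Rightarrow> real) \<Rightarrow> real \<Rightarrow> (real \<Rightarrow> complex^2^2) \<Rightarrow> bool" where
  "is_propagator Z \<tau> \<epsilon> \<nu> \<omega> P \<longleftrightarrow>
     P 0 = mat 1 \<and>
     (\<forall>z\<in>{0..Z}.
        (P has_vector_derivative
           map_matrix (\<lambda>c. \<i> * complex_of_real \<omega> / 2 * complex_of_real (\<nu> z) * c)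
             (oscillation_matrix \<tau> \<epsilon> \<omega> z ** P z))
        (at z within {0..Z}))"

definition transmission_coeff :: "complex^2^2 \<Rightarrow> complex" where
  "transmission_coeff P = 1 / cnj (P $ 1 $ 1)"

(* The first argument of P is the frequency. *)
definition transmitted_wave ::
  "(real \<Rightarrow> real) \<Rightarrow> (real \<Rightarrow> real \<Rightarrow> complex^2^2) \<Rightarrow> real \<Rightarrow> real \<Rightarrow> complex" where
  "transmitted_wave f P Z s =
     1 / (2 * pi) *
     (LINT \<omega>|lborel. iexp (- (s * \<omega>)) * transmission_coeff (P \<omega> Z) * fourier f \<omega>)"

definition conv_in_distribution ::
  "'e filter \<Rightarrow> 'w measure \<Rightarrow> ('e \<Rightarrow> 'w \<Rightarrow> 'b::topological_space) \<Rightarrow>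
   'v measure \<Rightarrow> ('v \<Rightarrow> 'b) \<Rightarrow> bool" where
  "conv_in_distribution L M X N Y \<longleftrightarrow>
     (\<forall>\<^sub>F \<epsilon> in L. X \<epsilon> \<in> borel_measurable M) \<and>
     Y \<in> borel_measurable N \<and>
     (\<forall>\<phi>::'b \<Rightarrow> real. continuous_on UNIV \<phi> \<and> bounded (range \<phi>) \<longrightarrow>
        ((\<lambda>\<epsilon>. LINT w|M. \<phi> (X \<epsilon> w)) \<longlongrightarrow> (LINT v|N. \<phi> (Y v))) L)"

(* Convergence in distribution of processes indexed by the real line, as random elements of
   the bounded continuous functions with the supremum norm. The membership conditions
   ensure that Bcontfun is applied only to paths on which it is meaningful. *)
definition conv_in_distribution_uniform ::
  "'e filter \<Rightarrow> 'w measure \<Rightarrow> ('e \<Rightarrow> 'w \<Rightarrow> real \<Rightarrow> complex) \<Rightarrow>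
   'v measure \<Rightarrow> ('v \<Rightarrow> real \<Rightarrow> complex) \<Rightarrow> bool" where
  "conv_in_distribution_uniform L M X N Y \<longleftrightarrow>
     (\<forall>\<^sub>F \<epsilon> in L. \<forall>w\<in>space M. X \<epsilon> w \<in> bcontfun) \<and>
     (\<forall>v\<in>space N. Y v \<in> bcontfun) \<and>
     conv_in_distribution L M (\<lambda>\<epsilon> w. Bcontfun (X \<epsilon> w)) N (\<lambda>v. Bcontfun (Y v))"

definition \<R> :: "(real \<Rightarrow> real \<Rightarrow> real) \<Rightarrow> real \<Rightarrow> real \<Rightarrow> real \<Rightarrow> real \<Rightarrow> real" where
  "\<R> r z\<^sub>1 z\<^sub>2 H\<^sub>1 H\<^sub>2 = (if z\<^sub>1 \<ge> z\<^sub>2 then r H\<^sub>1 H\<^sub>2 else r H\<^sub>2 H\<^sub>1)"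

(* On the diagonal the exponent is negative and 0 powr a = 0; this is a null set in the
   covariance integral below. *)
definition \<R>_tilde :: "(real \<Rightarrow> real \<Rightarrow> real) \<Rightarrow> (real \<Rightarrow> real) \<Rightarrow> real \<Rightarrow> real \<Rightarrow> real" where
  "\<R>_tilde r h u\<^sub>1 u\<^sub>2 =
     \<R> r u\<^sub>1 u\<^sub>2 (h u\<^sub>1) (h u\<^sub>2) * \<bar>u\<^sub>1 - u\<^sub>2\<bar> powr (h u\<^sub>1 + h u\<^sub>2 - 2)"

definition is_S_process ::
  "real \<Rightarrow> real \<Rightarrow> (real \<Rightarrow> real \<Rightarrow> real) \<Rightarrow> (real \<Rightarrow> real) \<Rightarrow>
   'v measure \<Rightarrow> (real \<Rightarrow> 'v \<Rightarrow> real) \<Rightarrow> bool" where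
  "is_S_process Z J r h N S \<longleftrightarrow>
     centered_gaussian_process N {0..Z} S \<and>
     (\<forall>z\<^sub>1\<in>{0..Z}. \<forall>z\<^sub>2\<in>{0..Z}.
        (LINT v|N. S z\<^sub>1 v * S z\<^sub>2 v) =
        J\<^sup>2 * (LBINT u\<^sub>1=0..z\<^sub>1. (LBINT u\<^sub>2=0..z\<^sub>2. \<R>_tilde r h u\<^sub>1 u\<^sub>2)))"

end

theory Submission
  imports Defs
begin

text \<open>
  As \<open>\<kappa> - \<tau> = 2 h - 2\<close>, the medium is \<open>\<nu>(z) = \<epsilon> powr (2 h(z) - 2) * \<Phi>(m(z/\<epsilon>\<^sup>2, h(z)))\<close>.
  Its covariance converges off the diagonal to \<open>J(1)\<^sup>2\<close> times the limit kernel, and is bounded by a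
  constant times \<open>\<bar>u - v\<bar> powr (2 h_lo - 2)\<close>; so the increments of \<open>V(z) = \<integral>\<^sub>0\<^sup>z \<nu>\<close> and of
  \<open>W(z) = \<integral>\<^sub>0\<^sup>z \<nu>(u) e\<^sup>i\<^sup>c\<^sup>u du\<close>, \<open>c = 2\<omega>/\<epsilon>\<^sup>\<tau>\<close>, have variance of order
  \<open>\<bar>\<Delta>z\<bar> powr (2 h_lo)\<close> with \<open>2 h_lo > 1\<close>, and those of \<open>W\<close> vanish in the limit by the
  Riemann--Lebesgue lemma.

  Removing the phases \<open>exp (\<plusminus> i \<omega> V / 2)\<close> from \<open>\<alpha>\<close> and \<open>\<beta>\<close> leaves a system driven only by
  \<open>\<integral> exp (i \<omega> V) dW\<close>. Because the regularity exceeds one half, a Young inequality, in terms of the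
  quadratic variation along dyadic partitions, bounds its solution pathwise, whence the transmission
  coefficient is close to \<open>exp (i \<omega> V(Z) / 2)\<close> in probability for each \<open>\<omega> \<noteq> 0\<close>. It is bounded by one,
  so the transmitted wave is close to \<open>f(s - V(Z)/2)\<close>, uniformly in \<open>s\<close>, by dominated convergence.

  Finally, the part of \<open>\<Phi>\<close> orthogonal to the first Hermite polynomial contributes nothing to \<open>V(Z)\<close>
  in the limit, and the other part is Gaussian with convergent variance. The limit covariance is
  positive semidefinite as a limit of covariances, and a process with this covariance is obtained
  from white noise by a Cholesky decomposition along a dense sequence of times.
\<close>

text \<open>The exponent \<open>2 * h z - 2\<close> is exactly the one at which the amplitudes
  absorb the rescaling of distances by \<epsilon>^2 in the correlation of m, so the covariance
  itself has a limit. The singularity \<open>\<bar>u - v\<bar> powr (2 * lo - 2)\<close> is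
  integrable, hence the convergence holds in L1 of the square. That single fact serves three times:
  for the variance of V(Z), for the oscillating integrals whatever the speed at which
  \<epsilon>^\<tau> vanishes relative to \<epsilon>^2, and for the positivity of the limit
  covariance. Two obstacles shape the rest. The medium is unbounded as \<epsilon> tends to 0, so
  Gronwall estimates are useless and only the integrals V and W may enter the bounds. The space of
  bounded continuous functions is not separable, so measurability must be traced to finitely many
  samples of the medium, and tightness is not sought in path space: the approximating wave is a
  continuous function of the one real variable V(Z), whose second moments are bounded, and
  compactness comes from images of intervals.\<close>

section \<open>Centered normal variables\<close>

text \<open>The sign of \<open>\<sigma>\<close> is irrelevant, and \<open>\<sigma> = 0\<close> describes the constant zero.\<close>
definition centered_normal :: "'w measure \<Rightarrow> ('w \<Rightarrow> real) \<Rightarrow> real \<Rightarrow> bool" where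
  "centered_normal M X \<sigma> \<longleftrightarrow> X \<in> borel_measurable M \<and>
     (\<forall>t. (LINT w|M. iexp (t * X w)) = complex_of_real (exp (- ((\<sigma> * t)\<^sup>2) / 2)))"

lemma char_std_normal_scaled:
  "(LINT x|std_normal_distribution. iexp (t * (\<sigma> * x))) = complex_of_real (exp (- ((\<sigma> * t)\<^sup>2) / 2))"
proof -
  have "char std_normal_distribution (\<sigma> * t) = complex_of_real (exp (- ((\<sigma> * t)\<^sup>2) / 2))"
    by (simp add: char_std_normal_distribution)
  then show ?thesis
    unfolding char_def by (simp only: mult.assoc mult.commute mult.left_commute)
qed

text \<open>By Levy's uniqueness theorem the characteristic function fixes the law. Expectations
  under \<open>M\<close> thus become integrals against one fixed normal law, with \<sigma> only a
  scale factor in the integrand, where dominated convergence can act.\<close>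

lemma centered_normal_distr:
  assumes "prob_space M" and X: "centered_normal M X \<sigma>"
  shows "distr M borel X = distr std_normal_distribution borel (\<lambda>x. \<sigma> * x)"
proof (rule Levy_uniqueness)
  interpret prob_space M by fact
  interpret G: real_distribution std_normal_distribution by (rule real_dist_normal_dist)
  have [measurable]: "X \<in> borel_measurable M" using X by (simp add: centered_normal_def)
  show "real_distribution (distr M borel X)" by simp
  show "real_distribution (distr std_normal_distribution borel (\<lambda>x. \<sigma> * x))"
    by (intro G.real_distribution_distr) simp
  show "char (distr M borel X) = char (distr std_normal_distribution borel (\<lambda>x. \<sigma> * x))"
    using X char_std_normal_scaled[of _ \<sigma>]
    by (auto simp: char_def integral_distr centered_normal_def fun_eq_iff)
qed

lemma centered_normal_integral:
  fixes \<psi> :: "real \<Rightarrow> 'b::{banach,second_countable_topology}"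
  assumes "prob_space M" and X: "centered_normal M X \<sigma>" and [measurable]: "\<psi> \<in> borel_measurable borel"
  shows "(LINT w|M. \<psi> (X w)) = (LINT x|std_normal_distribution. \<psi> (\<sigma> * x))"
    and "integrable M (\<lambda>w. \<psi> (X w)) \<longleftrightarrow> integrable std_normal_distribution (\<lambda>x. \<psi> (\<sigma> * x))"
proof -
  have [measurable]: "X \<in> borel_measurable M" using X by (simp add: centered_normal_def)
  have [simp]: "(*) \<sigma> \<in> borel_measurable std_normal_distribution" by simp
  have "(LINT w|M. \<psi> (X w)) = integral\<^sup>L (distr M borel X) \<psi>" by (simp add: integral_distr)
  then show "(LINT w|M. \<psi> (X w)) = (LINT x|std_normal_distribution. \<psi> (\<sigma> * x))"
    by (simp add: centered_normal_distr[OF assms(1,2)] integral_distr)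
  have "integrable M (\<lambda>w. \<psi> (X w)) \<longleftrightarrow> integrable (distr M borel X) \<psi>" by (simp add: integrable_distr_eq)
  then show "integrable M (\<lambda>w. \<psi> (X w)) \<longleftrightarrow> integrable std_normal_distribution (\<lambda>x. \<psi> (\<sigma> * x))"
    by (simp add: centered_normal_distr[OF assms(1,2)] integrable_distr_eq)
qed

lemma centered_normal_moments:
  assumes "prob_space M" and X: "centered_normal M X \<sigma>"
  shows "integrable M X" "(LINT w|M. X w) = 0"
    "integrable M (\<lambda>w. (X w)\<^sup>2)" "(LINT w|M. (X w)\<^sup>2) = \<sigma>\<^sup>2"
proof -
  note I = centered_normal_integral[OF assms]
  note m = integrable_std_normal_distribution_moment integral_std_normal_distribution_moment_odd
     std_normal_distribution_even_moments
  show "integrable M X" using I(2)[of "\<lambda>x. x"] m(1)[of 1] by (simp)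
  show "(LINT w|M. X w) = 0" using I(1)[of "\<lambda>x. x"] m(2)[of 1] by simp
  show "integrable M (\<lambda>w. (X w)\<^sup>2)"
    using I(2)[of "\<lambda>x. x\<^sup>2"] m(1)[of 2] by (simp add: power_mult_distrib)
  have "(LINT x|std_normal_distribution. x ^ (2 * 1)) = fact (2 * 1) / (2^1 * fact 1)"
    using m(3)[of 1] has_bochner_integral_integral_eq by blast
  then show "(LINT w|M. (X w)\<^sup>2) = \<sigma>\<^sup>2"
    using I(1)[of "\<lambda>x. x\<^sup>2"] by (simp add: power_mult_distrib)
qed

text \<open>Centering turns the density case into a scale family and forces the constant of the
  degenerate case to be 0.\<close>

lemma gaussian_rv_imp_centered_normal:
  assumes "prob_space M" and X: "gaussian_rv M X" and 0: "(LINT w|M. X w) = 0"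
  shows "centered_normal M X (sqrt (LINT w|M. (X w)\<^sup>2))"
proof -
  interpret prob_space M by fact
  have Xm[measurable]: "X \<in> borel_measurable M" using X by (simp add: gaussian_rv_def)
  have "\<exists>\<sigma>\<ge>0. centered_normal M X \<sigma>"
  proof (cases "\<exists>\<mu> \<sigma>. 0 < \<sigma> \<and> distributed M lborel X (\<lambda>x. ennreal (normal_density \<mu> \<sigma> x))")
    case True
    then obtain \<mu> \<sigma> where \<sigma>: "0 < \<sigma>" and D: "distributed M lborel X (normal_density \<mu> \<sigma>)" by auto
    have "\<mu> = 0" using normal_distributed_expectation[OF \<sigma> D] 0 by simp
    have D1: "distributed M lborel (\<lambda>x. (X x - \<mu>) / \<sigma>) std_normal_density"
      using D normal_standard_normal_convert[OF \<sigma>] by blast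
    have "(LINT w|M. iexp (t * X w)) = complex_of_real (exp (- ((\<sigma> * t)\<^sup>2) / 2))" for t
    proof -
      have "distr M lborel (\<lambda>x. (X x - \<mu>) / \<sigma>) = std_normal_distribution"
        using D1 by (simp add: distributed_def)
      then have "(LINT x|std_normal_distribution. iexp (t * (\<sigma> * x))) = (LINT x|distr M lborel (\<lambda>x. (X x - \<mu>) / \<sigma>). iexp (t * (\<sigma> * x)))"
        by simp
      also have "\<dots> = (LINT w|M. iexp (t * (\<sigma> * ((X w - \<mu>) / \<sigma>))))"
        by (rule integral_distr) auto
      also have "\<dots> = (LINT w|M. iexp (t * X w))" using \<sigma> \<open>\<mu> = 0\<close> by simp
      finally have "(LINT x|std_normal_distribution. iexp (t * (\<sigma> * x))) = (LINT w|M. iexp (t * X w))" .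
      then show ?thesis using char_std_normal_scaled by metis
    qed
    then show ?thesis using \<sigma> by (auto simp: centered_normal_def intro!: exI[of _ \<sigma>])
  next
    case False
    then obtain \<mu> where \<mu>: "AE w in M. X w = \<mu>" using X by (auto simp: gaussian_rv_def)
    have "(LINT w|M. X w) = (LINT w|M. \<mu>)" by (rule integral_cong_AE) (use \<mu> in auto)
    then have "\<mu> = 0" using 0 by (simp add: prob_space)
    have "(LINT w|M. iexp (t * X w)) = (LINT w|M. 1)" for t
      by (rule integral_cong_AE) (use \<mu> \<open>\<mu> = 0\<close> in auto)
    then show ?thesis by (auto simp: centered_normal_def prob_space intro!: exI[of _ 0])
  qed
  then obtain \<sigma> where \<sigma>: "\<sigma> \<ge> 0" "centered_normal M X \<sigma>" by blast
  then show ?thesis using centered_normal_moments(4)[OF assms(1) \<sigma>(2)] by simp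
qed

lemma centered_normal_imp_gaussian_rv:
  assumes "prob_space M" and X: "centered_normal M X \<sigma>"
  shows "gaussian_rv M X"
proof (cases "\<sigma> = 0")
  case True
  interpret prob_space M by fact
  have Xm[measurable]: "X \<in> borel_measurable M" using X by (simp add: centered_normal_def)
  have "AE w in M. (X w)\<^sup>2 = 0"
    using centered_normal_moments(3,4)[OF assms] True
    by (subst integral_nonneg_eq_0_iff_AE[symmetric]) auto
  then show ?thesis by (auto simp: gaussian_rv_def)
next
  case False
  interpret prob_space M by fact
  have Xm[measurable]: "X \<in> borel_measurable M" using X by (simp add: centered_normal_def)
  define s where "s = \<bar>\<sigma>\<bar>"
  have s: "s > 0" using False by (simp add: s_def)
  have X: "centered_normal M X s"
    using X by (simp add: s_def centered_normal_def power_mult_distrib)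
  have "distr M lborel (\<lambda>x. (X x - 0) / s) = distr (distr M borel X) lborel (\<lambda>x. x / s)"
    by (subst distr_distr) (auto simp: o_def)
  also have "\<dots> = distr std_normal_distribution lborel (\<lambda>x. x)"
    unfolding centered_normal_distr[OF assms(1) X] using s by (subst distr_distr) (auto simp: o_def)
  also have "\<dots> = std_normal_distribution"
    by (rule distr_id2) auto
  finally have "distributed M lborel (\<lambda>x. (X x - 0) / s) std_normal_density"
    by (simp add: distributed_def)
  then have "distributed M lborel X (normal_density 0 s)"
    using normal_standard_normal_convert[OF s, of X 0] by blast
  then show ?thesis using s by (auto simp: gaussian_rv_def)
qed

text \<open>No convergence of the variances is assumed: it is forced by that of the characteristic
  functions.\<close>

lemma centered_normal_limit:
  assumes "prob_space M" and X: "\<And>n::nat. \<exists>s. centered_normal M (X n) s"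
    and [measurable]: "Y \<in> borel_measurable M" and lim: "AE w in M. (\<lambda>n. X n w) \<longlonglongrightarrow> Y w"
  shows "centered_normal M Y (sqrt (LINT w|M. (Y w)\<^sup>2))"
proof -
  interpret prob_space M by fact
  obtain s where s: "\<And>n. centered_normal M (X n) (s n)" using X by metis
  have [measurable]: "X n \<in> borel_measurable M" for n using s by (auto simp: centered_normal_def)
  \<comment> \<open>These numbers lie in (0, 1], so an escape of the variances to infinity would
    show as the limit 0, which is excluded below.\<close>
  define c where "c n = exp (- ((s n)\<^sup>2 / 2))" for n
  define \<phi> where "\<phi> t = (LINT w|M. iexp (t * Y w))" for t
  have 1: "(LINT w|M. iexp (t * X n w)) = complex_of_real (c n powr t\<^sup>2)" for n t
    using s[of n]
    by (simp add: centered_normal_def c_def powr_def power_mult_distrib mult_ac)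
  have conv: "(\<lambda>n. complex_of_real (c n powr t\<^sup>2)) \<longlonglongrightarrow> \<phi> t" for t
    unfolding 1[symmetric] \<phi>_def
  proof (rule integral_dominated_convergence[where w="\<lambda>_. 1"])
    show "AE x in M. (\<lambda>i. iexp (t * X i x)) \<longlonglongrightarrow> iexp (t * Y x)"
      using lim by eventually_elim (intro tendsto_intros)
  qed auto
  define L where "L = Re (\<phi> 1)"
  have cL: "c \<longlonglongrightarrow> L"
    using tendsto_Re[OF conv[of 1]] by (simp add: L_def c_def[abs_def])
  then have L0: "L \<ge> 0" by (rule LIMSEQ_le_const) (auto simp: c_def)
  have \<phi>: "\<phi> t = complex_of_real (L powr t\<^sup>2)" if "t \<noteq> 0" for t
  proof -
    have "(\<lambda>n. c n powr t\<^sup>2) \<longlonglongrightarrow> L powr t\<^sup>2"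
      using that by (intro tendsto_powr'[OF cL]) (auto simp: c_def)
    then have "(\<lambda>n. complex_of_real (c n powr t\<^sup>2)) \<longlonglongrightarrow> complex_of_real (L powr t\<^sup>2)" by (rule tendsto_of_real)
    then show ?thesis using conv LIMSEQ_unique by blast
  qed
  have \<phi>0: "\<phi> 0 = 1" by (simp add: \<phi>_def prob_space)
  \<comment> \<open>A vanishing limit would make the characteristic function of Y zero off the
    origin and 1 at the origin, against its continuity.\<close>
  have "L \<noteq> 0"
  proof
    assume "L = 0"
    interpret Y: real_distribution "distr M borel Y" by simp
    have "char (distr M borel Y) = \<phi>" by (auto simp: char_def \<phi>_def integral_distr)
    then have "\<phi> \<midarrow>0\<rightarrow> 1" using Y.isCont_char[of 0] \<phi>0 by (simp add: isCont_def)
    moreover have "\<phi> \<midarrow>0\<rightarrow> 0"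
      by (rule Lim_transform_eventually[OF tendsto_const])
         (use \<phi> \<open>L = 0\<close> in \<open>auto simp: eventually_at_filter intro!: always_eventually\<close>)
    ultimately show False using LIM_unique by fastforce
  qed
  then have L: "L > 0" using L0 by simp
  have "L \<le> 1" by (rule LIMSEQ_le_const2[OF cL]) (auto simp: c_def)
  then have lnL: "ln L \<le> 0" using L by simp
  define \<sigma> where "\<sigma> = sqrt (- 2 * ln L)"
  have \<sigma>2: "\<sigma>\<^sup>2 = - 2 * ln L" "\<sigma> \<ge> 0" using lnL by (auto simp: \<sigma>_def)
  have "\<phi> t = complex_of_real (exp (- ((\<sigma> * t)\<^sup>2) / 2))" for t
  proof (cases "t = 0")
    case False
    have "L powr t\<^sup>2 = exp (- ((\<sigma> * t)\<^sup>2) / 2)" using L by (simp add: powr_def power_mult_distrib \<sigma>2)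
    then show ?thesis using \<phi>[OF False] by simp
  qed (simp add: \<phi>0)
  then have Y: "centered_normal M Y \<sigma>" by (simp add: centered_normal_def \<phi>_def)
  moreover have "sqrt (LINT w|M. (Y w)\<^sup>2) = \<sigma>"
    using centered_normal_moments(4)[OF assms(1) Y] \<sigma>2(2) by simp
  ultimately show ?thesis by simp
qed

text \<open>Here the limit of the variances is known beforehand, which identifies the variance of Y
  without uniform integrability.\<close>

lemma centered_normal_limit_variance:
  assumes "prob_space M" and X: "\<And>n::nat. centered_normal M (X n) (s n)"
    and [measurable]: "Y \<in> borel_measurable M" and lim: "AE w in M. (\<lambda>n. X n w) \<longlonglongrightarrow> Y w"
    and s: "(\<lambda>n. (s n)\<^sup>2) \<longlonglongrightarrow> v"
  shows "centered_normal M Y (sqrt v)"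
proof -
  interpret prob_space M by fact
  have [measurable]: "X n \<in> borel_measurable M" for n using X by (auto simp: centered_normal_def)
  have v: "0 \<le> v" by (rule LIMSEQ_le_const[OF s]) auto
  have "(LINT w|M. iexp (t * Y w)) = complex_of_real (exp (- ((sqrt v * t)\<^sup>2) / 2))" for t
  proof (rule LIMSEQ_unique)
    show "(\<lambda>n. LINT w|M. iexp (t * X n w)) \<longlonglongrightarrow> (LINT w|M. iexp (t * Y w))"
    proof (rule integral_dominated_convergence[where w="\<lambda>_. 1"])
      show "AE x in M. (\<lambda>i. iexp (t * X i x)) \<longlonglongrightarrow> iexp (t * Y x)"
        using lim by eventually_elim (intro tendsto_intros)
    qed auto
    have "(\<lambda>n. exp (- ((s n)\<^sup>2 * t\<^sup>2) / 2)) \<longlonglongrightarrow> exp (- (v * t\<^sup>2) / 2)"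
      by (intro tendsto_intros s) auto
    then have "(\<lambda>n. complex_of_real (exp (- ((s n * t)\<^sup>2) / 2))) \<longlonglongrightarrow> complex_of_real (exp (- ((sqrt v * t)\<^sup>2) / 2))"
      using v by (intro tendsto_of_real) (simp add: power_mult_distrib)
    then show "(\<lambda>n. LINT w|M. iexp (t * X n w)) \<longlonglongrightarrow> complex_of_real (exp (- ((sqrt v * t)\<^sup>2) / 2))"
      using X by (simp only: centered_normal_def)
  qed
  then show ?thesis by (simp only: centered_normal_def) simp
qed

section \<open>Square integrability and trigonometric approximation\<close>

text \<open>The sign of c is deduced from the positivity of the form. The lemma yields the
  Cauchy-Schwarz inequality both for integrals and for positive semidefinite kernels.\<close>

lemma nonneg_quadratic_discriminant:
  fixes a b c :: real
  assumes "\<And>t. 0 \<le> a + 2 * t * b + t\<^sup>2 * c"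
  shows "b\<^sup>2 \<le> a * c"
proof (cases "c = 0")
  case True
  have "b = 0"
  proof (rule ccontr)
    assume "b \<noteq> 0"
    \<comment> \<open>At this point the form, which is affine for c = 0, takes the value -1.\<close>
    then show False using assms[of "- (a + 1) / (2 * b)"] True by (simp add: field_simps)
  qed
  then show ?thesis using True by simp
next
  case False
  have "0 \<le> c"
  proof (rule ccontr)
    assume c: "\<not> 0 \<le> c"
    have a: "0 \<le> a" using assms[of 0] by simp
    \<comment> \<open>Then \<open>t\<^sup>2 * c = - (a + 1)\<close>, and the values of the form at t
      and -t add up to -2.\<close>
    define t where "t = sqrt ((a + 1) / (- c))"
    have "0 \<le> (a + 1) / (- c)" using a c by (intro divide_nonneg_nonneg) auto
    then have "t\<^sup>2 = (a + 1) / (- c)" unfolding t_def by (rule real_sqrt_pow2)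
    then have "t\<^sup>2 * c = - (a + 1)" using c by simp
    then show False using assms[of t] assms[of "- t"] a by simp
  qed
  then have "0 < c" using False by simp
  moreover have "0 \<le> a - b\<^sup>2 / c" using assms[of "- b / c"] False by (simp add: power2_eq_square field_simps)
  ultimately show ?thesis by (simp add: field_simps)
qed

lemma integrable_mult_of_squares:
  fixes f g :: "'a \<Rightarrow> 'b::{real_normed_algebra,banach,second_countable_topology}"
  assumes [measurable]: "f \<in> borel_measurable M" "g \<in> borel_measurable M"
    and f: "integrable M (\<lambda>x. (norm (f x))\<^sup>2)" and g: "integrable M (\<lambda>x. (norm (g x))\<^sup>2)"
  shows "integrable M (\<lambda>x. f x * g x)" "integrable M (\<lambda>x. norm (f x) * norm (g x))"
proof -
  have le: "norm (f x) * norm (g x) \<le> (norm (f x))\<^sup>2 + (norm (g x))\<^sup>2" for x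
  proof -
    have "2 * (norm (f x) * norm (g x)) \<le> (norm (f x))\<^sup>2 + (norm (g x))\<^sup>2"
      using sum_squares_bound[of "norm (f x)" "norm (g x)"] by simp
    moreover have "0 \<le> norm (f x) * norm (g x)" by simp
    ultimately show ?thesis by linarith
  qed
  have i: "integrable M (\<lambda>x. (norm (f x))\<^sup>2 + (norm (g x))\<^sup>2)" using f g by simp
  show "integrable M (\<lambda>x. f x * g x)"
    by (rule Bochner_Integration.integrable_bound[OF i])
       (auto intro!: AE_I2 order_trans[OF norm_mult_ineq] order_trans[OF le])
  show "integrable M (\<lambda>x. norm (f x) * norm (g x))"
    by (rule Bochner_Integration.integrable_bound[OF i]) (auto intro!: AE_I2 order_trans[OF le])
qed

lemma integrable_square_add:
  fixes f g :: "'a \<Rightarrow> 'b::{real_normed_vector,second_countable_topology}"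
  assumes [measurable]: "f \<in> borel_measurable M" "g \<in> borel_measurable M"
    and f: "integrable M (\<lambda>x. (norm (f x))\<^sup>2)" and g: "integrable M (\<lambda>x. (norm (g x))\<^sup>2)"
  shows "integrable M (\<lambda>x. (norm (f x + g x))\<^sup>2)"
    "(LINT x|M. (norm (f x + g x))\<^sup>2) \<le> 2 * (LINT x|M. (norm (f x))\<^sup>2) + 2 * (LINT x|M. (norm (g x))\<^sup>2)"
proof -
  have le: "(norm (f x + g x))\<^sup>2 \<le> 2 * (norm (f x))\<^sup>2 + 2 * (norm (g x))\<^sup>2" for x
  proof -
    have "(norm (f x + g x))\<^sup>2 \<le> (norm (f x) + norm (g x))\<^sup>2"
      by (intro power_mono norm_triangle_ineq) simp
    also have "\<dots> \<le> 2 * (norm (f x))\<^sup>2 + 2 * (norm (g x))\<^sup>2"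
      using sum_squares_bound[of "norm (f x)" "norm (g x)"] by (simp add: power2_sum)
    finally show ?thesis .
  qed
  have i: "integrable M (\<lambda>x. 2 * (norm (f x))\<^sup>2 + 2 * (norm (g x))\<^sup>2)" using f g by simp
  show I: "integrable M (\<lambda>x. (norm (f x + g x))\<^sup>2)"
    by (rule Bochner_Integration.integrable_bound[OF i]) (auto intro!: AE_I2 order_trans[OF le])
  have "(LINT x|M. (norm (f x + g x))\<^sup>2) \<le> (LINT x|M. 2 * (norm (f x))\<^sup>2 + 2 * (norm (g x))\<^sup>2)"
    by (intro integral_mono I i le)
  also have "\<dots> = 2 * (LINT x|M. (norm (f x))\<^sup>2) + 2 * (LINT x|M. (norm (g x))\<^sup>2)" using f g by simp
  finally show "(LINT x|M. (norm (f x + g x))\<^sup>2) \<le> 2 * (LINT x|M. (norm (f x))\<^sup>2) + 2 * (LINT x|M. (norm (g x))\<^sup>2)" .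
qed

lemma Cauchy_Schwarz_integral:
  fixes f g :: "'a \<Rightarrow> 'b::{real_normed_algebra,banach,second_countable_topology}"
  assumes m: "f \<in> borel_measurable M" "g \<in> borel_measurable M"
    and f: "integrable M (\<lambda>x. (norm (f x))\<^sup>2)" and g: "integrable M (\<lambda>x. (norm (g x))\<^sup>2)"
  shows "norm (LINT x|M. f x * g x) \<le> sqrt (LINT x|M. (norm (f x))\<^sup>2) * sqrt (LINT x|M. (norm (g x))\<^sup>2)"
proof -
  note i = integrable_mult_of_squares[OF m f g]
  have "(LINT x|M. norm (f x) * norm (g x))\<^sup>2 \<le> (LINT x|M. (norm (f x))\<^sup>2) * (LINT x|M. (norm (g x))\<^sup>2)"
  proof (rule nonneg_quadratic_discriminant)
    fix t :: real
    have "0 \<le> (LINT x|M. (norm (f x) + t * norm (g x))\<^sup>2)" by simp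
    also have "\<dots> = (LINT x|M. (norm (f x))\<^sup>2 + 2 * t * (norm (f x) * norm (g x)) + t\<^sup>2 * (norm (g x))\<^sup>2)"
      by (intro Bochner_Integration.integral_cong refl) (simp add: power2_eq_square algebra_simps)
    also have "\<dots> = (LINT x|M. (norm (f x))\<^sup>2) + 2 * t * (LINT x|M. norm (f x) * norm (g x)) + t\<^sup>2 * (LINT x|M. (norm (g x))\<^sup>2)"
      using f g i by simp
    finally show "0 \<le> (LINT x|M. (norm (f x))\<^sup>2) + 2 * t * (LINT x|M. norm (f x) * norm (g x)) + t\<^sup>2 * (LINT x|M. (norm (g x))\<^sup>2)" .
  qed
  then have "(LINT x|M. norm (f x) * norm (g x)) \<le> sqrt ((LINT x|M. (norm (f x))\<^sup>2) * (LINT x|M. (norm (g x))\<^sup>2))"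
    by (rule real_le_rsqrt)
  moreover have "norm (LINT x|M. f x * g x) \<le> (LINT x|M. norm (f x) * norm (g x))"
    by (rule order_trans[OF integral_norm_bound])
       (intro integral_mono integrable_norm i norm_mult_ineq)
  ultimately show ?thesis by (simp add: real_sqrt_mult)
qed

text \<open>Split F G - f g as (F - f) G + f (G - g); the norms of \<open>G n\<close> stay bounded
  because \<open>G n\<close> converges.\<close>

lemma tendsto_integral_mult_L2:
  fixes f g :: "'a \<Rightarrow> 'b::{real_normed_algebra,banach,second_countable_topology}"
    and F G :: "nat \<Rightarrow> 'a \<Rightarrow> 'b"
  assumes m[measurable]: "f \<in> borel_measurable M" "g \<in> borel_measurable M"
      "\<And>n. F n \<in> borel_measurable M" "\<And>n. G n \<in> borel_measurable M"
    and f: "integrable M (\<lambda>x. (norm (f x))\<^sup>2)" and g: "integrable M (\<lambda>x. (norm (g x))\<^sup>2)"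
    and F: "\<And>n. integrable M (\<lambda>x. (norm (F n x))\<^sup>2)" and G: "\<And>n. integrable M (\<lambda>x. (norm (G n x))\<^sup>2)"
    and Ff: "(\<lambda>n. LINT x|M. (norm (F n x - f x))\<^sup>2) \<longlonglongrightarrow> 0"
    and Gg: "(\<lambda>n. LINT x|M. (norm (G n x - g x))\<^sup>2) \<longlonglongrightarrow> 0"
  shows "(\<lambda>n. LINT x|M. F n x * G n x) \<longlonglongrightarrow> (LINT x|M. f x * g x)"
proof -
  have dF: "integrable M (\<lambda>x. (norm (F n x - f x))\<^sup>2)" for n
    using integrable_square_add(1)[of "F n" M "\<lambda>x. - f x"] F f m by simp
  have dG: "integrable M (\<lambda>x. (norm (G n x - g x))\<^sup>2)" for n
    using integrable_square_add(1)[of "G n" M "\<lambda>x. - g x"] G g m by simp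
  let ?A = "\<lambda>n. LINT x|M. (norm (F n x - f x))\<^sup>2" and ?B = "\<lambda>n. LINT x|M. (norm (G n x - g x))\<^sup>2"
  let ?a = "LINT x|M. (norm (f x))\<^sup>2" and ?b = "LINT x|M. (norm (g x))\<^sup>2"
  have Gb: "(LINT x|M. (norm (G n x))\<^sup>2) \<le> 2 * ?B n + 2 * ?b" for n
    using integrable_square_add(2)[of "\<lambda>x. G n x - g x" M g] dG g m by simp
  have bound: "norm ((LINT x|M. F n x * G n x) - (LINT x|M. f x * g x)) \<le>
      sqrt (?A n) * sqrt (2 * ?B n + 2 * ?b) + sqrt ?a * sqrt (?B n)" for n
  proof -
    have i1: "integrable M (\<lambda>x. (F n x - f x) * G n x)" "integrable M (\<lambda>x. f x * (G n x - g x))"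
      "integrable M (\<lambda>x. F n x * G n x)" "integrable M (\<lambda>x. f x * g x)"
      by (intro integrable_mult_of_squares m borel_measurable_diff dF dG f g F G)+
    have "(LINT x|M. F n x * G n x) - (LINT x|M. f x * g x) =
        (LINT x|M. (F n x - f x) * G n x + f x * (G n x - g x))"
      using i1 by (subst Bochner_Integration.integral_diff[symmetric])
        (auto intro!: Bochner_Integration.integral_cong simp: algebra_simps)
    also have "\<dots> = (LINT x|M. (F n x - f x) * G n x) + (LINT x|M. f x * (G n x - g x))"
      using i1 by simp
    also have "norm \<dots> \<le> sqrt (?A n) * sqrt (LINT x|M. (norm (G n x))\<^sup>2) + sqrt ?a * sqrt (?B n)"
      by (intro order_trans[OF norm_triangle_ineq] add_mono Cauchy_Schwarz_integral m borel_measurable_diff dF dG f g F G)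
    also have "\<dots> \<le> sqrt (?A n) * sqrt (2 * ?B n + 2 * ?b) + sqrt ?a * sqrt (?B n)"
      by (intro add_mono mult_left_mono real_sqrt_le_mono Gb order_refl) simp
    finally show ?thesis .
  qed
  have "(\<lambda>n. sqrt (?A n) * sqrt (2 * ?B n + 2 * ?b) + sqrt ?a * sqrt (?B n)) \<longlonglongrightarrow>
      sqrt 0 * sqrt (2 * 0 + 2 * ?b) + sqrt ?a * sqrt 0"
    by (intro tendsto_intros Ff Gg)
  then have "(\<lambda>n. sqrt (?A n) * sqrt (2 * ?B n + 2 * ?b) + sqrt ?a * sqrt (?B n)) \<longlonglongrightarrow> 0" by simp
  then have "(\<lambda>n. (LINT x|M. F n x * G n x) - (LINT x|M. f x * g x)) \<longlonglongrightarrow> 0"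
    by (rule Lim_null_comparison[rotated]) (intro always_eventually allI bound)
  then show ?thesis by (rule LIM_zero_cancel)
qed

section \<open>Finite exponential sums and their density in the Gaussian L2 space\<close>

definition trig :: "(complex \<times> real) list \<Rightarrow> real \<Rightarrow> complex" where
  "trig xs x = (\<Sum>(c, t)\<leftarrow>xs. c * iexp (t * x))"

lemma trig_simps: "trig [] x = 0" "trig ((c, t) # xs) x = c * iexp (t * x) + trig xs x"
  "trig (xs @ ys) x = trig xs x + trig ys x"
  by (simp_all add: trig_def)

lemma trig_scale: "trig (map (\<lambda>(c, t). (d * c, s + t)) xs) x = d * iexp (s * x) * trig xs x"
  by (induction xs) (auto simp: trig_simps algebra_simps exp_add)

text \<open>Frequencies may repeat in a list, so a product is a concatenation of scaled and shifted
  copies of \<open>ys\<close>, and no terms have to be collected.\<close>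

lemma trig_mult: "\<exists>zs. \<forall>x. trig zs x = trig xs x * trig ys x"
proof (induction xs)
  case Nil show ?case by (rule exI[of _ "[]"]) (simp add: trig_simps)
next
  case (Cons a xs)
  then obtain zs where "\<forall>x. trig zs x = trig xs x * trig ys x" by blast
  then show ?case
    by (intro exI[of _ "map (\<lambda>(c, t). (fst a * c, snd a + t)) ys @ zs"])
       (cases a, simp only: trig_simps trig_scale, simp add: algebra_simps)
qed

lemma trig_rescale: "trig (map (\<lambda>(c, t). (c, t * s)) xs) x = trig xs (s * x)"
  by (induction xs) (auto simp: trig_simps mult_ac)

lemma trig_conv_sum: "trig xs x = (\<Sum>j<length xs. fst (xs ! j) * iexp (snd (xs ! j) * x))"
  unfolding trig_def by (simp add: sum_list_sum_nth case_prod_unfold lessThan_atLeast0)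

lemma continuous_trig: "continuous_on S (trig xs)"
  unfolding trig_conv_sum[abs_def] by (intro continuous_intros)

lemma trig_measurable[measurable]: "trig xs \<in> borel_measurable borel"
  by (rule borel_measurable_continuous_onI[OF continuous_trig])

lemma trig_bounded: "\<exists>C. \<forall>x. norm (trig xs x) \<le> C"
  unfolding trig_conv_sum
  by (intro exI[of _ "\<Sum>j<length xs. norm (fst (xs ! j))"] allI sum_norm_le) (simp add: norm_mult)

text \<open>The real Stone-Weierstrass theorem, for the algebra of those real functions on the
  circle that are exponential sums in the angle. Sines and cosines, that is \<open>Im\<close> and
  \<open>Re\<close>, separate the points.\<close>

lemma circle_trig_approx:
  fixes F :: "complex \<Rightarrow> real"
  assumes F: "continuous_on (sphere 0 1) F" and e: "0 < e"
  shows "\<exists>xs. \<forall>\<theta>. norm (complex_of_real (F (iexp \<theta>)) - trig xs \<theta>) < e"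
proof -
  let ?P = "\<lambda>f. continuous_on (sphere (0::complex) 1) f \<and> (\<exists>xs. \<forall>\<theta>. complex_of_real (f (iexp \<theta>)) = trig xs \<theta>)"
  have "\<exists>g. ?P g \<and> (\<forall>x\<in>sphere 0 1. \<bar>F x - g x\<bar> < e)"
  proof (rule Stone_Weierstrass_HOL)
    show "?P (\<lambda>x. c)" for c
      by (auto intro!: exI[of _ "[(of_real c, 0)]"] simp: trig_simps)
    show "?P (\<lambda>x. f x + g x)" if fg: "?P f \<and> ?P g" for f g
    proof -
      obtain xs ys where "\<forall>\<theta>. complex_of_real (f (iexp \<theta>)) = trig xs \<theta>" "\<forall>\<theta>. complex_of_real (g (iexp \<theta>)) = trig ys \<theta>"
        using fg by blast
      then have "\<forall>\<theta>. complex_of_real (f (iexp \<theta>) + g (iexp \<theta>)) = trig (xs @ ys) \<theta>" by (simp only: trig_simps of_real_add simp_thms)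
      then show ?thesis using fg by (blast intro: continuous_on_add)
    qed
    show "?P (\<lambda>x. f x * g x)" if fg: "?P f \<and> ?P g" for f g
    proof -
      obtain xs ys where xy: "\<forall>\<theta>. complex_of_real (f (iexp \<theta>)) = trig xs \<theta>" "\<forall>\<theta>. complex_of_real (g (iexp \<theta>)) = trig ys \<theta>"
        using fg by blast
      obtain zs where "\<forall>\<theta>. trig zs \<theta> = trig xs \<theta> * trig ys \<theta>" using trig_mult by blast
      then have "\<forall>\<theta>. complex_of_real (f (iexp \<theta>) * g (iexp \<theta>)) = trig zs \<theta>" using xy by (simp only: of_real_mult simp_thms)
      then show ?thesis using fg by (blast intro: continuous_on_mult)
    qed
    show "\<exists>f. ?P f \<and> f x \<noteq> f y" if xy: "x \<in> sphere 0 1 \<and> y \<in> sphere 0 1 \<and> x \<noteq> y" for x y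
    proof -
      have Re: "complex_of_real (Re (iexp \<theta>)) = trig [(1/2, 1), (1/2, -1)] \<theta>" for \<theta>
        by (simp add: trig_simps complex_eq_iff Re_exp Im_exp)
      have Im: "complex_of_real (Im (iexp \<theta>)) = trig [(- \<i>/2, 1), (\<i>/2, -1)] \<theta>" for \<theta>
        by (simp add: trig_simps complex_eq_iff Re_exp Im_exp)
      have "?P Re" "?P Im" using Re Im continuous_on_Re[OF continuous_on_id] continuous_on_Im[OF continuous_on_id] by blast+
      then show ?thesis using xy complex_eq_iff by blast
    qed
  qed (use F e in auto)
  then obtain g xs where g: "\<forall>x\<in>sphere 0 1. \<bar>F x - g x\<bar> < e" and xs: "\<forall>\<theta>. complex_of_real (g (iexp \<theta>)) = trig xs \<theta>"
    by blast
  have "norm (complex_of_real (F (iexp \<theta>)) - trig xs \<theta>) < e" for \<theta>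
  proof -
    have "\<bar>F (iexp \<theta>) - g (iexp \<theta>)\<bar> < e" using g by simp
    then show ?thesis unfolding xs[rule_format, symmetric] of_real_diff[symmetric] norm_of_real .
  qed
  then show ?thesis by blast
qed

text \<open>Periodise g with half period p and approximate uniformly on the circle. For
  \<open>\<bar>x\<bar> \<ge> p\<close> the function g vanishes while the periodic sum is only
  bounded by \<open>C + e\<close>; there the linear term takes over. Linear growth is harmless under
  the normal law, and its slope is as small as desired for large p.\<close>

lemma compact_support_trig_approx:
  fixes g :: "real \<Rightarrow> real"
  assumes g: "continuous_on UNIV g" and L: "0 < L" and supp: "\<And>x. L \<le> \<bar>x\<bar> \<Longrightarrow> g x = 0"
    and C: "\<And>x. \<bar>g x\<bar> \<le> C" and p: "L < p" and e: "0 < e"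
  shows "\<exists>xs. \<forall>x. norm (complex_of_real (g x) - trig xs x) \<le> e + (C + e) * (\<bar>x\<bar> / p)"
proof -
  define F where "F z = g (p * Arg z / pi)" for z
  have p0: "0 < p" using L p by simp
  have C0: "0 \<le> C" using C[of 0] by simp
  let ?c = "cos (pi * L / p)"
  have c1: "-1 < ?c"
  proof -
    have "cos pi < cos (pi * L / p)" by (rule cos_monotone_0_pi) (use L p p0 in \<open>auto simp: field_simps\<close>)
    then show ?thesis by simp
  qed
  \<comment> \<open>\<open>Arg\<close> jumps at -1, so F is glued from two closed arcs: one avoids
    -1, on the other F is zero because the support of g is inside \<open>{-L..L}\<close>.\<close>
  have "continuous_on ({z \<in> sphere 0 1. ?c \<le> Re z} \<union> {z \<in> sphere 0 1. Re z \<le> ?c}) F"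
  proof (rule continuous_on_closed_Un)
    have sph: "{z \<in> sphere (0::complex) 1. ?c \<le> Re z} = sphere 0 1 \<inter> {z. ?c \<le> Re z}"
      "{z \<in> sphere (0::complex) 1. Re z \<le> ?c} = sphere 0 1 \<inter> {z. Re z \<le> ?c}" by auto
    show "closed {z \<in> sphere (0::complex) 1. ?c \<le> Re z}" "closed {z \<in> sphere (0::complex) 1. Re z \<le> ?c}"
      unfolding sph by (intro closed_Int closed_sphere closed_halfspace_Re_ge closed_halfspace_Re_le)+
    have nz: "z \<notin> \<real>\<^sub>\<le>\<^sub>0" if "z \<in> {z \<in> sphere 0 1. ?c \<le> Re z}" for z
    proof
      assume "z \<in> \<real>\<^sub>\<le>\<^sub>0"
      then obtain r where r: "z = of_real r" "r \<le> 0" by (auto elim: nonpos_Reals_cases)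
      then have "r = -1" using that by auto
      then show False using that r c1 by simp
    qed
    have "continuous_on {z \<in> sphere 0 1. ?c \<le> Re z} Arg"
      by (intro continuous_at_imp_continuous_on ballI continuous_at_Arg nz)
    then have "continuous_on {z \<in> sphere 0 1. ?c \<le> Re z} (g \<circ> (\<lambda>z. p * Arg z / pi))"
      using p0 by (intro continuous_on_compose continuous_on_divide continuous_on_mult continuous_on_const continuous_on_subset[OF g subset_UNIV]) auto
    then show "continuous_on {z \<in> sphere 0 1. ?c \<le> Re z} F" by (simp add: F_def[abs_def] o_def)
    have "F z = 0" if z: "z \<in> {z \<in> sphere 0 1. Re z \<le> ?c}" for z
      unfolding F_def
    proof (rule supp, rule ccontr)
      assume "\<not> L \<le> \<bar>p * Arg z / pi\<bar>"
      then have "\<bar>Arg z\<bar> < pi * L / p" using p0 by (simp add: abs_mult field_simps)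
      then have "cos (pi * L / p) < cos \<bar>Arg z\<bar>"
        by (intro cos_monotone_0_pi) (use p p0 in \<open>auto simp: field_simps\<close>)
      moreover have "Re z = cos (Arg z)"
        using Arg_eq[of z] z by (metis (no_types, lifting) Re_exp exp_zero mem_Collect_eq mem_sphere_0 Re_i_times Im_complex_of_real Im_i_times Re_complex_of_real minus_zero mult_1 norm_zero of_real_1 zero_neq_one)
      ultimately show False using z by simp
    qed
    then show "continuous_on {z \<in> sphere 0 1. Re z \<le> ?c} F"
      by (subst continuous_on_cong[OF refl, where g="\<lambda>_. 0"]) auto
  qed
  moreover have "{z \<in> sphere 0 1. ?c \<le> Re z} \<union> {z \<in> sphere 0 1. Re z \<le> ?c} = sphere (0::complex) 1" by auto
  ultimately have "continuous_on (sphere 0 1) F" by simp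
  from circle_trig_approx[OF this e] obtain xs where xs: "\<And>\<theta>. norm (complex_of_real (F (iexp \<theta>)) - trig xs \<theta>) < e" by blast
  have "norm (complex_of_real (g x) - trig (map (\<lambda>(c, t). (c, t * (pi / p))) xs) x) \<le> e + (C + e) * (\<bar>x\<bar> / p)" for x
  proof (cases "\<bar>x\<bar> < p")
    case True
    have "pi * \<bar>x\<bar> < pi * p" using True by simp
    then have "\<bar>pi / p * x\<bar> < pi" using p0 by (simp add: abs_mult field_simps)
    then have "Arg (iexp (pi / p * x)) = pi / p * x"
      unfolding abs_less_iff by (intro Arg_unique[of 1]) simp_all
    then have "F (iexp (pi / p * x)) = g x" using p0 by (simp add: F_def)
    then have "norm (complex_of_real (g x) - trig xs (pi / p * x)) \<le> e" using xs[of "pi / p * x"] by simp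
    moreover have "0 \<le> (C + e) * (\<bar>x\<bar> / p)" using C0 e p0 by simp
    ultimately show ?thesis unfolding trig_rescale by linarith
  next
    case False
    then have "g x = 0" using p by (intro supp) simp
    moreover have "norm (trig xs (pi / p * x)) \<le> C + e"
      using xs[of "pi / p * x"] C[of "p * Arg (iexp (pi / p * x)) / pi"]
        norm_triangle_sub[of "trig xs (pi / p * x)" "complex_of_real (F (iexp (pi / p * x)))"]
      by (simp add: F_def norm_minus_commute del: of_real_mult of_real_divide)
    moreover have "C + e \<le> (C + e) * (\<bar>x\<bar> / p)" using False C0 e p0 mult_left_mono[of 1 "\<bar>x\<bar> / p" "C + e"] by simp
    ultimately show ?thesis unfolding trig_rescale using e by simp
  qed
  then show ?thesis by blast
qed

lemma trig_L2_dense: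
  fixes \<Phi> :: "real \<Rightarrow> real"
  assumes cont: "continuous_on UNIV \<Phi>" and sq: "integrable std_normal_distribution (\<lambda>x. (\<Phi> x)\<^sup>2)" and e: "0 < e"
  shows "\<exists>xs. (LINT x|std_normal_distribution. (norm (trig xs x - complex_of_real (\<Phi> x)))\<^sup>2) < e"
proof -
  interpret G: real_distribution std_normal_distribution by (rule real_dist_normal_dist)
  have [measurable]: "\<Phi> \<in> borel_measurable borel" using cont by (rule borel_measurable_continuous_onI)
  \<comment> \<open>A continuous cut-off, equal to 1 for \<open>\<bar>x\<bar> \<le> n\<close> and to
    0 from \<open>n + 1\<close> on.\<close>
  define \<theta> where "\<theta> n x = max 0 (min 1 (real (Suc n) - \<bar>x\<bar>))" for n :: nat and x :: real
  have \<theta>: "0 \<le> \<theta> n x" "\<theta> n x \<le> 1" for n x by (auto simp: \<theta>_def)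
  have cont\<theta>: "continuous_on UNIV (\<theta> n)" for n unfolding \<theta>_def by (intro continuous_intros)
  then have [measurable]: "\<theta> n \<in> borel_measurable borel" for n by (rule borel_measurable_continuous_onI)
  have "(\<lambda>n. LINT x|std_normal_distribution. (\<Phi> x * \<theta> n x - \<Phi> x)\<^sup>2) \<longlonglongrightarrow> (LINT x|std_normal_distribution. 0)"
  proof (rule integral_dominated_convergence[where w="\<lambda>x. (\<Phi> x)\<^sup>2"])
    show "AE x in std_normal_distribution. (\<lambda>n. (\<Phi> x * \<theta> n x - \<Phi> x)\<^sup>2) \<longlonglongrightarrow> 0"
    proof (intro AE_I2)
      fix x :: real
      obtain m :: nat where m: "\<bar>x\<bar> < real m" using reals_Archimedean2 by blast
      have "\<forall>\<^sub>F n in sequentially. (\<Phi> x * \<theta> n x - \<Phi> x)\<^sup>2 = 0"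
        using eventually_ge_at_top[of m] by eventually_elim (use m in \<open>auto simp: \<theta>_def\<close>)
      then show "(\<lambda>n. (\<Phi> x * \<theta> n x - \<Phi> x)\<^sup>2) \<longlonglongrightarrow> 0" by (rule tendsto_eventually)
    qed
    show "AE x in std_normal_distribution. norm ((\<Phi> x * \<theta> n x - \<Phi> x)\<^sup>2) \<le> (\<Phi> x)\<^sup>2" for n
    proof (intro AE_I2)
      fix x
      have "(\<Phi> x * \<theta> n x - \<Phi> x)\<^sup>2 = (\<Phi> x)\<^sup>2 * (1 - \<theta> n x)\<^sup>2" by (simp add: power2_eq_square algebra_simps)
      also have "\<dots> \<le> (\<Phi> x)\<^sup>2 * 1" using \<theta>[of n x] by (intro mult_left_mono power_le_one) auto
      finally show "norm ((\<Phi> x * \<theta> n x - \<Phi> x)\<^sup>2) \<le> (\<Phi> x)\<^sup>2" by simp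
    qed
  qed (use sq in auto)
  then have "\<forall>\<^sub>F n in sequentially. (LINT x|std_normal_distribution. (\<Phi> x * \<theta> n x - \<Phi> x)\<^sup>2) < e / 4"
    using e by (intro order_tendstoD(2)) auto
  from eventually_happens'[OF sequentially_bot this]
  obtain n where n: "(LINT x|std_normal_distribution. (\<Phi> x * \<theta> n x - \<Phi> x)\<^sup>2) < e / 4" ..
  define g where "g x = \<Phi> x * \<theta> n x" for x
  have cg: "continuous_on UNIV g" unfolding g_def by (intro continuous_intros cont cont\<theta>)
  then have [measurable]: "g \<in> borel_measurable borel" by (rule borel_measurable_continuous_onI)
  have supp: "g x = 0" if "real (Suc n) \<le> \<bar>x\<bar>" for x using that by (simp add: g_def \<theta>_def)
  obtain C where C: "\<And>x. \<bar>g x\<bar> \<le> C"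
  proof -
    have "bounded (g ` {-real (Suc n)..real (Suc n)})"
      by (intro compact_imp_bounded compact_continuous_image continuous_on_subset[OF cg]) auto
    then obtain C where C: "\<And>x. x \<in> {-real (Suc n)..real (Suc n)} \<Longrightarrow> \<bar>g x\<bar> \<le> C"
      unfolding bounded_iff real_norm_def by (metis imageI)
    have "\<bar>g x\<bar> \<le> max C 0" for x
      using C[of x] supp[of x] by (cases "\<bar>x\<bar> \<le> real (Suc n)") (auto simp: abs_le_iff)
    then show ?thesis using that by blast
  qed
  have C0: "0 \<le> C" using C[of 0] by simp
  \<comment> \<open>With \<eta> and p chosen so that \<eta>^2 and (C + \<eta>)^2 / p^2 are at most e
    / 32, the squared error is at most (e / 16) (1 + x^2), of Gaussian mean e / 8. Twice this and
    twice the cut-off error, which is below e / 4, stay below e.\<close>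
  define \<eta> where "\<eta> = min 1 (sqrt (e / 32))"
  have \<eta>: "0 < \<eta>" "\<eta>\<^sup>2 \<le> e / 32"
  proof -
    show "0 < \<eta>" using e by (simp add: \<eta>_def)
    have "\<eta>\<^sup>2 \<le> (sqrt (e / 32))\<^sup>2" using e by (intro power_mono) (auto simp: \<eta>_def)
    then show "\<eta>\<^sup>2 \<le> e / 32" using e by simp
  qed
  define p where "p = max (real (Suc n) + 1) ((C + \<eta>) / sqrt (e / 32))"
  have p: "real (Suc n) < p" by (simp add: p_def)
  have p0: "0 < p" using p by (meson of_nat_0_le_iff le_less_trans)
  have Cp: "(C + \<eta>)\<^sup>2 / p\<^sup>2 \<le> e / 32"
  proof -
    have "(C + \<eta>) / sqrt (e / 32) \<le> p" by (simp add: p_def)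
    then have "(C + \<eta>) / p \<le> sqrt (e / 32)" using p0 e by (simp add: field_simps)
    then have "((C + \<eta>) / p)\<^sup>2 \<le> (sqrt (e / 32))\<^sup>2" using C0 \<eta> p0 by (intro power_mono) auto
    then show ?thesis using e by (simp add: power_divide)
  qed
  obtain xs where xs: "\<And>x. norm (complex_of_real (g x) - trig xs x) \<le> \<eta> + (C + \<eta>) * (\<bar>x\<bar> / p)"
    using compact_support_trig_approx[OF cg _ supp C p \<eta>(1)] by auto
  obtain B where B: "\<And>x. norm (trig xs x) \<le> B" using trig_bounded by blast
  have sqb: "(norm (trig xs x - complex_of_real (g x)))\<^sup>2 \<le> e / 16 + e / 16 * x\<^sup>2" for x
  proof -
    have "(norm (trig xs x - complex_of_real (g x)))\<^sup>2 \<le> (\<eta> + (C + \<eta>) * (\<bar>x\<bar> / p))\<^sup>2"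
      using xs[of x] by (intro power_mono) (auto simp: norm_minus_commute)
    also have "\<dots> \<le> 2 * \<eta>\<^sup>2 + 2 * ((C + \<eta>) * (\<bar>x\<bar> / p))\<^sup>2"
      using sum_squares_bound[of \<eta> "(C + \<eta>) * (\<bar>x\<bar> / p)"] by (simp add: power2_sum)
    also have "((C + \<eta>) * (\<bar>x\<bar> / p))\<^sup>2 = (C + \<eta>)\<^sup>2 / p\<^sup>2 * x\<^sup>2" by (simp add: power_mult_distrib power_divide)
    also have "\<dots> \<le> e / 32 * x\<^sup>2" by (intro mult_right_mono Cp) simp
    finally show ?thesis using \<eta> by simp
  qed
  have x2: "integrable std_normal_distribution (\<lambda>x. x\<^sup>2)" "(LINT x|std_normal_distribution. x\<^sup>2) = 1"
    using integrable_std_normal_distribution_moment[of 2]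
      std_normal_distribution_even_moments(1)[of 1] by simp_all
  have int1: "integrable std_normal_distribution (\<lambda>x. (norm (trig xs x - complex_of_real (g x)))\<^sup>2)"
    by (rule Bochner_Integration.integrable_bound[where f="\<lambda>x. e / 16 + e / 16 * x\<^sup>2"])
       (use x2 sqb in \<open>auto intro!: AE_I2 order_trans[OF _ abs_ge_self]\<close>)
  have int2: "integrable std_normal_distribution (\<lambda>x. (norm (complex_of_real (g x) - complex_of_real (\<Phi> x)))\<^sup>2)"
  proof (rule Bochner_Integration.integrable_bound[OF sq])
    show "AE x in std_normal_distribution. norm ((norm (complex_of_real (g x) - complex_of_real (\<Phi> x)))\<^sup>2) \<le> norm ((\<Phi> x)\<^sup>2)"
    proof (intro AE_I2)
      fix x
      have "(g x - \<Phi> x)\<^sup>2 = (\<Phi> x)\<^sup>2 * (1 - \<theta> n x)\<^sup>2" by (simp add: g_def power2_eq_square algebra_simps)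
      also have "\<dots> \<le> (\<Phi> x)\<^sup>2 * 1" using \<theta>[of n x] by (intro mult_left_mono power_le_one) auto
      finally show "norm ((norm (complex_of_real (g x) - complex_of_real (\<Phi> x)))\<^sup>2) \<le> norm ((\<Phi> x)\<^sup>2)"
        unfolding of_real_diff[symmetric] norm_of_real by simp
    qed
  qed simp
  have "(LINT x|std_normal_distribution. (norm (trig xs x - complex_of_real (\<Phi> x)))\<^sup>2) \<le>
     2 * (LINT x|std_normal_distribution. (norm (trig xs x - complex_of_real (g x)))\<^sup>2) +
     2 * (LINT x|std_normal_distribution. (norm (complex_of_real (g x) - complex_of_real (\<Phi> x)))\<^sup>2)"
    using integrable_square_add(2)[OF _ _ int1 int2] by simp
  also have "(LINT x|std_normal_distribution. (norm (trig xs x - complex_of_real (g x)))\<^sup>2) \<le>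
      (LINT x|std_normal_distribution. e / 16 + e / 16 * x\<^sup>2)"
    using x2 by (intro integral_mono int1 sqb) auto
  also have "\<dots> = e / 8" using x2 G.prob_space by simp
  also have "(LINT x|std_normal_distribution. (norm (complex_of_real (g x) - complex_of_real (\<Phi> x)))\<^sup>2) < e / 4"
    using n unfolding of_real_diff[symmetric] norm_of_real g_def by simp
  finally show ?thesis using e by (intro exI[of _ xs]) simp
qed

section \<open>Mehler's expansion for exponential sums of two correlated normal variables\<close>

definition gaussian_pair :: "'w measure \<Rightarrow> ('w \<Rightarrow> real) \<Rightarrow> ('w \<Rightarrow> real) \<Rightarrow> real \<Rightarrow> bool" where
  "gaussian_pair M X Y \<rho> \<longleftrightarrow> X \<in> borel_measurable M \<and> Y \<in> borel_measurable M \<and>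
     (\<forall>s t. (LINT w|M. iexp (s * X w + t * Y w)) = complex_of_real (exp (- (s\<^sup>2 + 2 * \<rho> * s * t + t\<^sup>2) / 2)))"

text \<open>Up to the factor i^n this is the mean of the sum against the n-th Hermite polynomial,
  since exp (i t x) has the n-th Hermite mean (i t)^n exp (-t^2 / 2).\<close>

definition hermite_moment :: "(complex \<times> real) list \<Rightarrow> nat \<Rightarrow> complex" where
  "hermite_moment xs n = (\<Sum>j<length xs. fst (xs ! j) * complex_of_real (exp (- (snd (xs ! j))\<^sup>2 / 2) * snd (xs ! j) ^ n))"

text \<open>The joint characteristic function at (s, -t) is the product of the marginal ones with
  exp (\<rho> s t), and each term of the power series of the latter separates s from t. The double
  sum over frequencies thus becomes a squared modulus for every power of \<rho>.\<close>

lemma gaussian_pair_trig_covariance: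
  assumes M: "prob_space M" and XY: "gaussian_pair M X Y \<rho>"
  shows "(\<lambda>n. complex_of_real (\<rho> ^ n / fact n * (norm (hermite_moment xs n))\<^sup>2)) sums
    (LINT w|M. trig xs (X w) * cnj (trig xs (Y w)))"
proof -
  interpret prob_space M by fact
  have [measurable]: "X \<in> borel_measurable M" "Y \<in> borel_measurable M" using XY by (auto simp: gaussian_pair_def)
  define N where "N = length xs"
  define c where "c j = fst (xs ! j)" for j
  define t where "t j = snd (xs ! j)" for j
  define d where "d j = c j * complex_of_real (exp (- (t j)\<^sup>2 / 2))" for j
  have tr: "trig xs x = (\<Sum>j<N. c j * iexp (t j * x))" for x
    by (simp add: trig_conv_sum N_def c_def t_def)
  have A: "hermite_moment xs n = (\<Sum>j<N. d j * complex_of_real (t j ^ n))" for n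
    by (simp add: hermite_moment_def N_def c_def t_def d_def mult.assoc)
  have i: "integrable M (\<lambda>w. iexp (t j * X w + - t k * Y w))" for j k
    by (rule integrable_iexp) (simp_all only: Im_complex_of_real, measurable)
  have "(LINT w|M. trig xs (X w) * cnj (trig xs (Y w))) =
     (LINT w|M. (\<Sum>j<N. \<Sum>k<N. c j * cnj (c k) * iexp (t j * X w + - t k * Y w)))"
  proof (intro Bochner_Integration.integral_cong refl)
    fix w
    have "iexp (t j * X w + - t k * Y w) = iexp (t j * X w) * cnj (iexp (t k * Y w))" for j k
      by (simp add: exp_cnj exp_add[symmetric] algebra_simps)
    then show "trig xs (X w) * cnj (trig xs (Y w)) = (\<Sum>j<N. \<Sum>k<N. c j * cnj (c k) * iexp (t j * X w + - t k * Y w))"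
      unfolding tr cnj_sum sum_product by (intro sum.cong refl) (simp only: complex_cnj_mult mult_ac)
  qed
  also have "\<dots> = (\<Sum>j<N. \<Sum>k<N. c j * cnj (c k) * (LINT w|M. iexp (t j * X w + - t k * Y w)))"
    by (subst Bochner_Integration.integral_sum, intro Bochner_Integration.integrable_sum integrable_mult_right i,
        intro sum.cong refl, subst Bochner_Integration.integral_sum, intro integrable_mult_right i,
        intro sum.cong refl integral_mult_right_zero)
  also have "\<dots> = (\<Sum>j<N. \<Sum>k<N. d j * cnj (d k) * complex_of_real (exp (\<rho> * t j * t k)))"
  proof (intro sum.cong refl)
    fix j k
    have "(LINT w|M. iexp (t j * X w + - t k * Y w)) = complex_of_real (exp (- ((t j)\<^sup>2 + 2 * \<rho> * t j * (- t k) + (- t k)\<^sup>2) / 2))"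
      using XY unfolding gaussian_pair_def by blast
    also have "- ((t j)\<^sup>2 + 2 * \<rho> * t j * (- t k) + (- t k)\<^sup>2) / 2 = - (t j)\<^sup>2 / 2 + (- (t k)\<^sup>2 / 2 + \<rho> * t j * t k)"
      by (simp add: field_simps)
    finally show "c j * cnj (c k) * (LINT w|M. iexp (t j * X w + - t k * Y w)) = d j * cnj (d k) * complex_of_real (exp (\<rho> * t j * t k))"
      unfolding exp_add d_def by simp
  qed
  finally have E: "(LINT w|M. trig xs (X w) * cnj (trig xs (Y w))) =
     (\<Sum>j<N. \<Sum>k<N. d j * cnj (d k) * complex_of_real (exp (\<rho> * t j * t k)))" .
  have "(\<lambda>n. \<Sum>j<N. \<Sum>k<N. d j * cnj (d k) * complex_of_real ((\<rho> * t j * t k) ^ n /\<^sub>R fact n)) sums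
     (\<Sum>j<N. \<Sum>k<N. d j * cnj (d k) * complex_of_real (exp (\<rho> * t j * t k)))"
    by (intro sums_sum sums_mult sums_of_real exp_converges)
  moreover have "(\<Sum>j<N. \<Sum>k<N. d j * cnj (d k) * complex_of_real ((\<rho> * t j * t k) ^ n /\<^sub>R fact n)) =
     complex_of_real (\<rho> ^ n / fact n * (norm (hermite_moment xs n))\<^sup>2)" for n
  proof -
    have "complex_of_real ((norm (hermite_moment xs n))\<^sup>2) = (\<Sum>j<N. \<Sum>k<N. d j * complex_of_real (t j ^ n) * (cnj (d k) * complex_of_real (t k ^ n)))"
      unfolding complex_norm_square A cnj_sum sum_product by simp
    then have "complex_of_real (\<rho> ^ n / fact n * (norm (hermite_moment xs n))\<^sup>2) =
        complex_of_real (\<rho> ^ n / fact n) * (\<Sum>j<N. \<Sum>k<N. d j * complex_of_real (t j ^ n) * (cnj (d k) * complex_of_real (t k ^ n)))"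
      by (simp only: of_real_mult)
    also have "\<dots> = (\<Sum>j<N. \<Sum>k<N. d j * cnj (d k) * complex_of_real ((\<rho> * t j * t k) ^ n /\<^sub>R fact n))"
      unfolding sum_distrib_left by (intro sum.cong refl) (simp add: power_mult_distrib divide_inverse mult_ac)
    finally show ?thesis by simp
  qed
  ultimately show ?thesis unfolding E by simp
qed

lemma hermite_moment_0:
  "hermite_moment xs 0 = (LINT x|std_normal_distribution. trig xs x)"
proof -
  interpret G: real_distribution std_normal_distribution by (rule real_dist_normal_dist)
  have "(LINT x|std_normal_distribution. trig xs x) =
    (\<Sum>j<length xs. fst (xs ! j) * (LINT x|std_normal_distribution. iexp (snd (xs ! j) * x)))"
    unfolding trig_conv_sum by (subst Bochner_Integration.integral_sum) (auto intro!: integrable_mult_right G.integrable_iexp)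
  also have "\<dots> = hermite_moment xs 0"
    using char_std_normal_distribution by (simp add: hermite_moment_def char_def fun_eq_iff)
  finally show ?thesis by simp
qed

text \<open>This is the characteristic function differentiated under the integral; the difference
  quotients are dominated by \<open>\<bar>x\<bar>\<close>.\<close>

lemma integral_std_normal_mult_iexp:
  "(LINT x|std_normal_distribution. complex_of_real x * iexp (t * x)) = \<i> * complex_of_real (t * exp (- t\<^sup>2 / 2))"
proof -
  interpret G: real_distribution std_normal_distribution by (rule real_dist_normal_dist)
  define h where "h n = inverse (real (Suc n))" for n
  have h: "h \<longlonglongrightarrow> 0" "h n \<noteq> 0" "0 < h n" for n unfolding h_def using LIMSEQ_inverse_real_of_nat by auto
  have h': "filterlim h (at 0) sequentially" using h by (simp add: filterlim_at)
  have ch: "(LINT x|std_normal_distribution. iexp (s * x)) = complex_of_real (exp (- s\<^sup>2 / 2))" for s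
    using char_std_normal_distribution by (simp add: char_def fun_eq_iff)
  have L1: "(\<lambda>n. LINT x|std_normal_distribution. (iexp ((t + h n) * x) - iexp (t * x)) / h n) \<longlonglongrightarrow>
      (LINT x|std_normal_distribution. \<i> * (complex_of_real x * iexp (t * x)))"
  proof (rule integral_dominated_convergence[where w="\<lambda>x. \<bar>x\<bar>"])
    show "integrable std_normal_distribution (\<lambda>x. \<bar>x\<bar>)"
      using integrable_std_normal_distribution_moment[of 1] by simp
    show "AE x in std_normal_distribution. (\<lambda>n. (iexp ((t + h n) * x) - iexp (t * x)) / h n) \<longlonglongrightarrow> \<i> * (complex_of_real x * iexp (t * x))"
    proof (intro AE_I2)
      fix x
      have "((\<lambda>z. exp (\<i> * z * complex_of_real x)) has_field_derivative \<i> * complex_of_real x * exp (\<i> * complex_of_real t * complex_of_real x)) (at (complex_of_real t))"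
        by (auto intro!: derivative_eq_intros)
      then have "(\<lambda>k. (exp (\<i> * (complex_of_real t + k) * complex_of_real x) - exp (\<i> * complex_of_real t * complex_of_real x)) / k) \<midarrow>0\<rightarrow>
         \<i> * complex_of_real x * exp (\<i> * complex_of_real t * complex_of_real x)"
        by (simp add: DERIV_def)
      moreover have "filterlim (\<lambda>n. complex_of_real (h n)) (at 0) sequentially"
        using h by (auto simp: filterlim_at intro!: tendsto_eq_intros)
      ultimately have "(\<lambda>n. (exp (\<i> * (complex_of_real t + h n) * complex_of_real x) - exp (\<i> * complex_of_real t * complex_of_real x)) / h n) \<longlonglongrightarrow>
         \<i> * complex_of_real x * exp (\<i> * complex_of_real t * complex_of_real x)"
        by (rule filterlim_compose)
      then show "(\<lambda>n. (iexp ((t + h n) * x) - iexp (t * x)) / h n) \<longlonglongrightarrow> \<i> * (complex_of_real x * iexp (t * x))"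
        by (simp add: mult.assoc)
    qed
    show "AE x in std_normal_distribution. norm ((iexp ((t + h n) * x) - iexp (t * x)) / h n) \<le> \<bar>x\<bar>" for n
    proof (intro AE_I2)
      fix x
      have "iexp ((t + h n) * x) - iexp (t * x) = iexp (t * x) * (iexp (h n * x) - 1)"
        by (simp add: algebra_simps exp_add)
      then have "norm (iexp ((t + h n) * x) - iexp (t * x)) \<le> \<bar>h n * x\<bar>"
        using iexp_approx1[of "h n * x" 0] by (simp add: norm_mult)
      then show "norm ((iexp ((t + h n) * x) - iexp (t * x)) / h n) \<le> \<bar>x\<bar>"
        using h(3)[of n] by (simp add: norm_divide abs_mult divide_le_eq mult.commute)
    qed
  qed auto
  have eq: "(LINT x|std_normal_distribution. (iexp ((t + h n) * x) - iexp (t * x)) / h n) =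
      complex_of_real ((exp (- (t + h n)\<^sup>2 / 2) - exp (- t\<^sup>2 / 2)) / h n)" for n
  proof -
    have "(LINT x|std_normal_distribution. (iexp ((t + h n) * x) - iexp (t * x)) / h n) =
       ((LINT x|std_normal_distribution. iexp ((t + h n) * x)) - (LINT x|std_normal_distribution. iexp (t * x))) / h n"
      by (subst Bochner_Integration.integral_diff[symmetric]) (auto intro!: G.integrable_iexp)
    then show ?thesis unfolding ch by simp
  qed
  have L2: "(\<lambda>n. complex_of_real ((exp (- (t + h n)\<^sup>2 / 2) - exp (- t\<^sup>2 / 2)) / h n)) \<longlonglongrightarrow> complex_of_real (- t * exp (- t\<^sup>2 / 2))"
  proof (rule tendsto_of_real)
    have "((\<lambda>s. exp (- s\<^sup>2 / 2)) has_field_derivative - t * exp (- t\<^sup>2 / 2)) (at t)"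
      by (auto intro!: derivative_eq_intros)
    then have "(\<lambda>k. (exp (- (t + k)\<^sup>2 / 2) - exp (- t\<^sup>2 / 2)) / k) \<midarrow>0\<rightarrow> - t * exp (- t\<^sup>2 / 2)"
      by (simp add: DERIV_def)
    then show "(\<lambda>n. (exp (- (t + h n)\<^sup>2 / 2) - exp (- t\<^sup>2 / 2)) / h n) \<longlonglongrightarrow> - t * exp (- t\<^sup>2 / 2)"
      by (rule filterlim_compose[OF _ h'])
  qed
  have "(LINT x|std_normal_distribution. \<i> * (complex_of_real x * iexp (t * x))) = complex_of_real (- t * exp (- t\<^sup>2 / 2))"
    using L1 L2 unfolding eq by (rule LIMSEQ_unique)
  then have "\<i> * (LINT x|std_normal_distribution. complex_of_real x * iexp (t * x)) = complex_of_real (- t * exp (- t\<^sup>2 / 2))"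
    by simp
  then have "- \<i> * (\<i> * (LINT x|std_normal_distribution. complex_of_real x * iexp (t * x))) = - \<i> * complex_of_real (- t * exp (- t\<^sup>2 / 2))"
    by (rule arg_cong)
  then show ?thesis by simp
qed

lemma hermite_moment_1:
  "\<i> * hermite_moment xs 1 = (LINT x|std_normal_distribution. trig xs x * complex_of_real x)"
proof -
  interpret G: real_distribution std_normal_distribution by (rule real_dist_normal_dist)
  have i: "integrable std_normal_distribution (\<lambda>x. complex_of_real x * iexp (t * x))" for t
    by (rule Bochner_Integration.integrable_bound[OF integrable_std_normal_distribution_moment[of 1]]) (auto simp: norm_mult)
  have "(LINT x|std_normal_distribution. trig xs x * complex_of_real x) =
    (LINT x|std_normal_distribution. (\<Sum>j<length xs. fst (xs ! j) * (complex_of_real x * iexp (snd (xs ! j) * x))))"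
    unfolding trig_conv_sum sum_distrib_right by (simp only: mult_ac)
  also have "\<dots> = (\<Sum>j<length xs. fst (xs ! j) * (LINT x|std_normal_distribution. complex_of_real x * iexp (snd (xs ! j) * x)))"
    by (subst Bochner_Integration.integral_sum) (intro integrable_mult_right i, intro sum.cong refl integral_mult_right_zero)
  also have "\<dots> = \<i> * hermite_moment xs 1"
    unfolding integral_std_normal_mult_iexp hermite_moment_def sum_distrib_left by (intro sum.cong refl) simp
  finally show ?thesis by simp
qed

section \<open>Covariance of a function at two correlated normal variables\<close>

text \<open>From the m-th term on, a factor \<open>\<bar>\<rho>\<bar> ^ m\<close> can be taken out,
  and what remains is bounded by the full series of g. In this way Hermite rank m turns into decay
  of order \<rho>^m.\<close>

lemma sums_tail_bound:
  fixes f :: "nat \<Rightarrow> complex" and g :: "nat \<Rightarrow> real"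
  assumes f: "f sums s" and g: "g sums S" and \<rho>: "\<bar>\<rho>\<bar> \<le> 1"
    and le: "\<And>n. norm (f n) \<le> \<bar>\<rho>\<bar> ^ n * g n" and g0: "\<And>n. 0 \<le> g n"
  shows "norm (s - (\<Sum>n<m. f n)) \<le> \<bar>\<rho>\<bar> ^ m * S"
proof -
  have sf: "(\<lambda>n. f (n + m)) sums (s - (\<Sum>n<m. f n))" by (rule sums_split_initial_segment[OF f])
  have sg: "(\<lambda>n. g (n + m)) sums (S - (\<Sum>n<m. g n))" by (rule sums_split_initial_segment[OF g])
  have b: "norm (f (n + m)) \<le> \<bar>\<rho>\<bar> ^ m * g (n + m)" for n
  proof -
    have "norm (f (n + m)) \<le> \<bar>\<rho>\<bar> ^ n * (\<bar>\<rho>\<bar> ^ m * g (n + m))" using le[of "n + m"] by (simp add: power_add mult.assoc)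
    also have "\<dots> \<le> 1 * (\<bar>\<rho>\<bar> ^ m * g (n + m))"
      using \<rho> g0 by (intro mult_right_mono power_le_one) auto
    finally show ?thesis by simp
  qed
  have sg': "(\<lambda>n. \<bar>\<rho>\<bar> ^ m * g (n + m)) sums (\<bar>\<rho>\<bar> ^ m * (S - (\<Sum>n<m. g n)))" by (rule sums_mult[OF sg])
  have "norm (suminf (\<lambda>n. f (n + m))) \<le> suminf (\<lambda>n. \<bar>\<rho>\<bar> ^ m * g (n + m))"
    by (rule norm_suminf_le[OF b sums_summable[OF sg']])
  then have "norm (s - (\<Sum>n<m. f n)) \<le> \<bar>\<rho>\<bar> ^ m * (S - (\<Sum>n<m. g n))"
    using sums_unique[OF sf] sums_unique[OF sg'] by simp
  also have "\<dots> \<le> \<bar>\<rho>\<bar> ^ m * S" using g0 by (intro mult_left_mono) (auto intro: sum_nonneg)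
  finally show ?thesis .
qed

lemma gaussian_pair_marginals:
  assumes "gaussian_pair M X Y \<rho>"
  shows "centered_normal M X 1" "centered_normal M Y 1"
proof -
  have *: "(LINT w|M. iexp (s * X w + t * Y w)) = complex_of_real (exp (- (s\<^sup>2 + 2 * \<rho> * s * t + t\<^sup>2) / 2))" for s t
    using assms unfolding gaussian_pair_def by blast
  show "centered_normal M X 1" using assms *[of _ 0] by (simp add: centered_normal_def gaussian_pair_def)
  show "centered_normal M Y 1" using assms *[of 0] by (simp add: centered_normal_def gaussian_pair_def)
qed

text \<open>Correlation 1 is admissible because \<open>gaussian_pair\<close> refers to
  characteristic functions and not to a joint density. In this case the expansion becomes Parseval's
  identity, which supplies the majorant of \<open>sums_tail_bound\<close>.\<close>

lemma gaussian_pair_diag: "gaussian_pair std_normal_distribution (\<lambda>x. x) (\<lambda>x. x) 1"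
proof -
  have "(LINT x|std_normal_distribution. iexp (s * x + t * x)) = complex_of_real (exp (- (s\<^sup>2 + 2 * 1 * s * t + t\<^sup>2) / 2))" for s t
  proof -
    have "(LINT x|std_normal_distribution. iexp (s * x + t * x)) = char std_normal_distribution (s + t)"
      by (simp add: char_def algebra_simps)
    then show ?thesis by (simp add: char_std_normal_distribution power2_sum algebra_simps)
  qed
  then show ?thesis by (simp add: gaussian_pair_def)
qed

lemma trig_square_integrable:
  assumes "prob_space M" and [measurable]: "X \<in> borel_measurable M"
  shows "integrable M (\<lambda>w. (norm (trig xs (X w)))\<^sup>2)"
proof -
  interpret prob_space M by fact
  obtain B where B: "\<And>x. norm (trig xs x) \<le> B" using trig_bounded by blast
  have "(norm (trig xs x))\<^sup>2 \<le> B\<^sup>2" for x using B by (intro power_mono) auto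
  then show ?thesis by (intro integrable_const_bound[where B="B\<^sup>2"]) auto
qed

text \<open>A function of Hermite rank \<open>m\<close> of two standard normal variables with correlation \<open>\<rho>\<close> has
  covariance of order \<open>\<rho> ^ m\<close>; the expansion is exact for trigonometric polynomials, because
  \<open>exp (\<rho> s t)\<close> is a power series in \<open>\<rho>\<close>, and they are dense.\<close>
theorem gaussian_pair_covariance:
  fixes \<Phi> :: "real \<Rightarrow> real"
  assumes M: "prob_space M" and XY: "gaussian_pair M X Y \<rho>" and \<rho>: "\<bar>\<rho>\<bar> \<le> 1"
    and cont: "continuous_on UNIV \<Phi>" and sq: "integrable std_normal_distribution (\<lambda>x. (\<Phi> x)\<^sup>2)"
    and mean: "(LINT x|std_normal_distribution. \<Phi> x) = 0"
  defines "S \<equiv> (LINT x|std_normal_distribution. (\<Phi> x)\<^sup>2)"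
  shows "\<bar>LINT w|M. \<Phi> (X w) * \<Phi> (Y w)\<bar> \<le> \<bar>\<rho>\<bar> * S"
    and "\<bar>(LINT w|M. \<Phi> (X w) * \<Phi> (Y w)) - \<rho> * (LINT x|std_normal_distribution. \<Phi> x * x)\<^sup>2\<bar> \<le> \<rho>\<^sup>2 * S"
proof -
  interpret prob_space M by fact
  have [measurable]: "cnj \<in> borel_measurable borel"
    by (intro borel_measurable_continuous_onI continuous_intros)
  let ?G = "std_normal_distribution"
  interpret G: real_distribution ?G by (rule real_dist_normal_dist)
  have [measurable]: "\<Phi> \<in> borel_measurable borel" using cont by (rule borel_measurable_continuous_onI)
  have [measurable]: "X \<in> borel_measurable M" "Y \<in> borel_measurable M" using XY by (auto simp: gaussian_pair_def)
  note X = gaussian_pair_marginals(1)[OF XY] and Y = gaussian_pair_marginals(2)[OF XY]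
  have "\<exists>xs. (LINT x|?G. (norm (trig xs x - complex_of_real (\<Phi> x)))\<^sup>2) < inverse (real (Suc n))" for n
    by (rule trig_L2_dense[OF cont sq]) simp
  then obtain q where q: "\<And>n. (LINT x|?G. (norm (trig (q n) x - complex_of_real (\<Phi> x)))\<^sup>2) < inverse (real (Suc n))"
    by metis
  have qG: "(\<lambda>n. LINT x|?G. (norm (trig (q n) x - complex_of_real (\<Phi> x)))\<^sup>2) \<longlonglongrightarrow> 0"
    by (rule Lim_null_comparison[OF _ LIMSEQ_inverse_real_of_nat])
       (use q in \<open>auto intro!: always_eventually less_imp_le\<close>)
  have tr: "(LINT w|M. \<psi> (X w)) = (LINT x|?G. \<psi> x)" "(LINT w|M. \<psi> (Y w)) = (LINT x|?G. \<psi> x)"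
    "integrable M (\<lambda>w. \<psi> (X w)) \<longleftrightarrow> integrable ?G \<psi>" "integrable M (\<lambda>w. \<psi> (Y w)) \<longleftrightarrow> integrable ?G \<psi>"
    if [measurable]: "\<psi> \<in> borel_measurable borel" for \<psi> :: "real \<Rightarrow> real"
    using centered_normal_integral[OF M X that] centered_normal_integral[OF M Y that] by simp_all
  have sqc: "integrable ?G (\<lambda>x. (norm (complex_of_real (\<Phi> x)))\<^sup>2)" using sq by simp
  \<comment> \<open>The approximants are complex, but since \<Phi> is real their conjugates
    approximate it equally well.\<close>
  have cov: "(\<lambda>n. LINT w|M. trig (q n) (X w) * cnj (trig (q n) (Y w))) \<longlonglongrightarrow> (LINT w|M. complex_of_real (\<Phi> (X w)) * complex_of_real (\<Phi> (Y w)))"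
  proof (rule tendsto_integral_mult_L2)
    show "integrable M (\<lambda>x. (norm (complex_of_real (\<Phi> (X x))))\<^sup>2)" "integrable M (\<lambda>x. (norm (complex_of_real (\<Phi> (Y x))))\<^sup>2)"
      using tr(3,4)[of "\<lambda>x. (norm (complex_of_real (\<Phi> x)))\<^sup>2"] sqc by simp_all
    show "integrable M (\<lambda>x. (norm (trig (q n) (X x)))\<^sup>2)" "integrable M (\<lambda>x. (norm (cnj (trig (q n) (Y x))))\<^sup>2)" for n
      unfolding complex_mod_cnj by (intro trig_square_integrable M; measurable)+
    show "(\<lambda>n. LINT x|M. (norm (trig (q n) (X x) - complex_of_real (\<Phi> (X x))))\<^sup>2) \<longlonglongrightarrow> 0"
      using qG by (subst tr(1)[of "\<lambda>x. (norm (trig (q _) x - complex_of_real (\<Phi> x)))\<^sup>2"]) auto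
    have "norm (cnj (trig (q n) (Y x)) - complex_of_real (\<Phi> (Y x))) = norm (trig (q n) (Y x) - complex_of_real (\<Phi> (Y x)))" for n x
      by (metis complex_cnj_complex_of_real complex_cnj_diff complex_mod_cnj)
    then show "(\<lambda>n. LINT x|M. (norm (cnj (trig (q n) (Y x)) - complex_of_real (\<Phi> (Y x))))\<^sup>2) \<longlonglongrightarrow> 0"
      using qG by (simp only:) (subst tr(2)[of "\<lambda>x. (norm (trig (q _) x - complex_of_real (\<Phi> x)))\<^sup>2"], auto)
  qed measurable
  have dG: "integrable ?G (\<lambda>x. (norm (trig (q n) x))\<^sup>2)" for n by (rule trig_square_integrable[OF G.prob_space_axioms]) simp
  have A0: "(\<lambda>n. hermite_moment (q n) 0) \<longlonglongrightarrow> (LINT x|?G. complex_of_real (\<Phi> x) * 1)"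
    unfolding hermite_moment_0 using sqc dG qG
    by (intro tendsto_integral_mult_L2[where G="\<lambda>_ _. 1" and F="\<lambda>n. trig (q n)", simplified]) auto
  have x2: "integrable ?G (\<lambda>x. (norm (complex_of_real x))\<^sup>2)" using integrable_std_normal_distribution_moment[of 2] by simp
  have A1: "(\<lambda>n. \<i> * hermite_moment (q n) 1) \<longlonglongrightarrow> (LINT x|?G. complex_of_real (\<Phi> x) * complex_of_real x)"
    unfolding hermite_moment_1 using sqc dG qG x2
    by (intro tendsto_integral_mult_L2) auto
  have S: "(\<lambda>n. LINT x|?G. trig (q n) x * cnj (trig (q n) x)) \<longlonglongrightarrow> (LINT x|?G. complex_of_real (\<Phi> x) * complex_of_real (\<Phi> x))"
  proof (rule tendsto_integral_mult_L2)
    have "norm (cnj (trig (q n) x) - complex_of_real (\<Phi> x)) = norm (trig (q n) x - complex_of_real (\<Phi> x))" for n x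
      by (metis complex_cnj_complex_of_real complex_cnj_diff complex_mod_cnj)
    then show "(\<lambda>n. LINT x|?G. (norm (cnj (trig (q n) x) - complex_of_real (\<Phi> x)))\<^sup>2) \<longlonglongrightarrow> 0" using qG by simp
  qed (use sqc dG qG in \<open>simp_all only: complex_mod_cnj\<close>, measurable)
  have Seq: "(LINT x|?G. trig (q n) x * cnj (trig (q n) x)) = complex_of_real (LINT x|?G. (norm (trig (q n) x))\<^sup>2)" for n
    unfolding complex_norm_square[symmetric] by (rule integral_complex_of_real)
  have tail: "norm ((LINT w|M. trig (q n) (X w) * cnj (trig (q n) (Y w))) -
      (\<Sum>k<m. complex_of_real (\<rho> ^ k / fact k * (norm (hermite_moment (q n) k))\<^sup>2)))
      \<le> \<bar>\<rho>\<bar> ^ m * (LINT x|?G. (norm (trig (q n) x))\<^sup>2)" for n m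
  proof (rule sums_tail_bound[OF gaussian_pair_trig_covariance[OF M XY] _ \<rho>])
    have "(\<lambda>k. complex_of_real (1 ^ k / fact k * (norm (hermite_moment (q n) k))\<^sup>2)) sums (LINT x|?G. trig (q n) x * cnj (trig (q n) x))"
      using gaussian_pair_trig_covariance[OF G.prob_space_axioms gaussian_pair_diag, of "q n"] .
    then show "(\<lambda>k. (norm (hermite_moment (q n) k))\<^sup>2 / fact k) sums (LINT x|?G. (norm (trig (q n) x))\<^sup>2)"
      unfolding Seq sums_of_real_iff by simp
  qed (simp_all add: norm_mult power_abs norm_divide norm_power)
  \<comment> \<open>Limits of the coefficients are needed only below m: the tails are controlled
    uniformly in n by the second moments of the approximants.\<close>
  have ineq: "norm ((LINT w|M. complex_of_real (\<Phi> (X w)) * complex_of_real (\<Phi> (Y w))) - (\<Sum>k<m. complex_of_real (\<rho> ^ k / fact k * B k)))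
      \<le> \<bar>\<rho>\<bar> ^ m * norm (LINT x|?G. complex_of_real (\<Phi> x) * complex_of_real (\<Phi> x))"
    if B: "\<And>k. k < m \<Longrightarrow> (\<lambda>n. (norm (hermite_moment (q n) k))\<^sup>2) \<longlonglongrightarrow> B k" for m B
  proof (rule LIMSEQ_le)
    show "(\<lambda>n. norm ((LINT w|M. trig (q n) (X w) * cnj (trig (q n) (Y w))) -
      (\<Sum>k<m. complex_of_real (\<rho> ^ k / fact k * (norm (hermite_moment (q n) k))\<^sup>2)))) \<longlonglongrightarrow>
      norm ((LINT w|M. complex_of_real (\<Phi> (X w)) * complex_of_real (\<Phi> (Y w))) - (\<Sum>k<m. complex_of_real (\<rho> ^ k / fact k * B k)))"
      by (intro tendsto_norm tendsto_diff cov tendsto_sum tendsto_of_real tendsto_mult tendsto_const B) simp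
    show "(\<lambda>n. \<bar>\<rho>\<bar> ^ m * norm (LINT x|?G. trig (q n) x * cnj (trig (q n) x))) \<longlonglongrightarrow>
       \<bar>\<rho>\<bar> ^ m * norm (LINT x|?G. complex_of_real (\<Phi> x) * complex_of_real (\<Phi> x))"
      by (intro tendsto_norm tendsto_mult tendsto_const S)
    show "\<exists>N. \<forall>n\<ge>N. norm ((LINT w|M. trig (q n) (X w) * cnj (trig (q n) (Y w))) -
      (\<Sum>k<m. complex_of_real (\<rho> ^ k / fact k * (norm (hermite_moment (q n) k))\<^sup>2)))
      \<le> \<bar>\<rho>\<bar> ^ m * norm (LINT x|?G. trig (q n) x * cnj (trig (q n) x))"
      using tail unfolding Seq norm_of_real by simp
  qed
  have eqs: "(LINT w|M. complex_of_real (\<Phi> (X w)) * complex_of_real (\<Phi> (Y w))) = complex_of_real (LINT w|M. \<Phi> (X w) * \<Phi> (Y w))"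
    "(LINT x|?G. complex_of_real (\<Phi> x) * complex_of_real (\<Phi> x)) = complex_of_real S"
    unfolding of_real_mult[symmetric] S_def power2_eq_square by (rule integral_complex_of_real)+
  have S0: "0 \<le> S" by (simp add: S_def)
  \<comment> \<open>The approximants need not have mean zero; the term k = 0 disappears only in the
    limit.\<close>
  have B0: "(\<lambda>n. (norm (hermite_moment (q n) 0))\<^sup>2) \<longlonglongrightarrow> 0"
    using tendsto_power[OF tendsto_norm[OF A0], of 2] mean by simp
  have B1: "(\<lambda>n. (norm (hermite_moment (q n) 1))\<^sup>2) \<longlonglongrightarrow> (LINT x|?G. \<Phi> x * x)\<^sup>2"
  proof -
    have "(LINT x|?G. complex_of_real (\<Phi> x) * complex_of_real x) = complex_of_real (LINT x|?G. \<Phi> x * x)"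
      unfolding of_real_mult[symmetric] by (rule integral_complex_of_real)
    then have "(norm (LINT x|?G. complex_of_real (\<Phi> x) * complex_of_real x))\<^sup>2 = (LINT x|?G. \<Phi> x * x)\<^sup>2"
      by (simp only: norm_of_real power2_abs)
    then show ?thesis using tendsto_power[OF tendsto_norm[OF A1], of 2] by (simp add: norm_mult)
  qed
  show "\<bar>LINT w|M. \<Phi> (X w) * \<Phi> (Y w)\<bar> \<le> \<bar>\<rho>\<bar> * S"
    using ineq[of 1 "\<lambda>_. 0"] B0 S0 unfolding eqs by simp
  have "norm (complex_of_real (LINT w|M. \<Phi> (X w) * \<Phi> (Y w)) - complex_of_real (\<rho> * (LINT x|?G. \<Phi> x * x)\<^sup>2)) \<le> \<bar>\<rho>\<bar> ^ 2 * S"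
  proof -
    define B where "B k = (if k = 0 then 0 else (LINT x|?G. \<Phi> x * x)\<^sup>2)" for k :: nat
    have B: "(\<lambda>n. (norm (hermite_moment (q n) k))\<^sup>2) \<longlonglongrightarrow> B k" if "k < 2" for k
    proof -
      have "k = 0 \<or> k = 1" using that by auto
      then show ?thesis using B0 B1 by (auto simp: B_def)
    qed
    have e: "(\<Sum>k<2. complex_of_real (\<rho> ^ k / fact k * B k)) = complex_of_real (\<rho> * (LINT x|?G. \<Phi> x * x)\<^sup>2)"
      by (simp add: B_def numeral_2_eq_2)
    have "norm ((LINT w|M. complex_of_real (\<Phi> (X w)) * complex_of_real (\<Phi> (Y w))) - (\<Sum>k<2. complex_of_real (\<rho> ^ k / fact k * B k)))
      \<le> \<bar>\<rho>\<bar> ^ 2 * norm (LINT x|?G. complex_of_real (\<Phi> x) * complex_of_real (\<Phi> x))"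
      by (rule ineq) (rule B)
    then show ?thesis using S0 unfolding eqs e norm_of_real by simp
  qed
  then show "\<bar>(LINT w|M. \<Phi> (X w) * \<Phi> (Y w)) - \<rho> * (LINT x|std_normal_distribution. \<Phi> x * x)\<^sup>2\<bar> \<le> \<rho>\<^sup>2 * S"
    unfolding of_real_diff[symmetric] norm_of_real by simp
qed

section \<open>Dyadic variation\<close>

text \<open>The square root of the quadratic variation along one dyadic partition. Its square is a
  sum over increments, so in the random case its mean is a sum of variances.\<close>

definition dyadic_var :: "real \<Rightarrow> nat \<Rightarrow> (real \<Rightarrow> 'a::real_normed_vector) \<Rightarrow> real" where
  "dyadic_var T n g = L2_set (\<lambda>k. norm (g (T * real (Suc k) / 2 ^ n) - g (T * real k / 2 ^ n))) {..<2 ^ n}"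

definition dyadic_bound :: "real \<Rightarrow> real \<Rightarrow> real \<Rightarrow> (real \<Rightarrow> 'a::real_normed_vector) \<Rightarrow> bool" where
  "dyadic_bound T q A g \<longleftrightarrow> (\<forall>n. dyadic_var T n g \<le> A * q ^ n)"

lemma dyadic_var_nonneg: "0 \<le> dyadic_var T n g"
  by (simp add: dyadic_var_def L2_set_nonneg)

lemma dyadic_bound_nonneg: "dyadic_bound T q A g \<Longrightarrow> 0 \<le> A"
  using dyadic_var_nonneg[of T 0 g] by (auto simp: dyadic_bound_def dest!: spec[of _ 0])

lemma dyadic_increment_le:
  "k < 2 ^ n \<Longrightarrow> norm (g (T * real (Suc k) / 2 ^ n) - g (T * real k / 2 ^ n)) \<le> dyadic_var T n g"
  unfolding dyadic_var_def
  using member_le_L2_set[of "{..<2 ^ n}" k "\<lambda>k. norm (g (T * real (Suc k) / 2 ^ n) - g (T * real k / 2 ^ n))"]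
  by simp

lemma dyadic_point_refine: "T * real (2 * k) / 2 ^ Suc n = T * real k / 2 ^ n"
  by simp

text \<open>A dyadic point of level n + 1 is of level n or lies one increment to the right of such a
  point. One increment per level leads back to 0 or to the end point, and these sum
  geometrically.\<close>

lemma dyadic_sup_le:
  assumes g: "dyadic_bound T q A g" and q: "0 \<le> q" "q < 1" and k: "k \<le> 2 ^ n"
  shows "norm (g (T * real k / 2 ^ n) - g 0) \<le> A / (1 - q)"
proof -
  have A: "0 \<le> A" using g by (rule dyadic_bound_nonneg)
  have "norm (g (T * real k / 2 ^ n) - g 0) \<le> (\<Sum>j\<le>n. A * q ^ j)" using k
  proof (induction n arbitrary: k)
    case 0
    then have "k = 0 \<or> k = 1" by auto
    moreover have "norm (g T - g 0) \<le> A"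
      using dyadic_increment_le[of 0 0 g T] g by (auto simp: dyadic_bound_def dest!: spec[of _ 0])
    ultimately show ?case using A by auto
  next
    case (Suc n)
    show ?case
    proof (cases "even k")
      case True
      then obtain j where j: "k = 2 * j" by blast
      have "norm (g (T * real j / 2 ^ n) - g 0) \<le> (\<Sum>j\<le>n. A * q ^ j)" using Suc j by auto
      moreover have "0 \<le> A * q ^ Suc n" using A q by simp
      ultimately show ?thesis unfolding j dyadic_point_refine by simp
    next
      case False
      then obtain j where j: "k = Suc (2 * j)" by (metis oddE Suc_eq_plus1)
      have "norm (g (T * real j / 2 ^ n) - g 0) \<le> (\<Sum>j\<le>n. A * q ^ j)" using Suc j by auto
      moreover have "norm (g (T * real (Suc (2 * j)) / 2 ^ Suc n) - g (T * real (2 * j) / 2 ^ Suc n)) \<le> A * q ^ Suc n"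
        using dyadic_increment_le[of "2 * j" "Suc n" g T] g Suc.prems j
        by (auto simp: dyadic_bound_def intro: order_trans simp del: power_Suc of_nat_Suc)
      moreover have "norm (g (T * real k / 2 ^ Suc n) - g 0) \<le>
          norm (g (T * real (Suc (2 * j)) / 2 ^ Suc n) - g (T * real (2 * j) / 2 ^ Suc n)) + norm (g (T * real j / 2 ^ n) - g 0)"
        unfolding j dyadic_point_refine
        using norm_triangle_ineq[of "g (T * real (Suc (2 * j)) / 2 ^ Suc n) - g (T * real j / 2 ^ n)" "g (T * real j / 2 ^ n) - g 0"]
        by (simp del: of_nat_Suc)
      ultimately show ?thesis by simp
    qed
  qed
  also have "\<dots> = A * (\<Sum>j\<le>n. q ^ j)" by (simp add: sum_distrib_left)
  also have "\<dots> \<le> A * (1 / (1 - q))"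
  proof (rule mult_left_mono[OF _ A])
    have "(\<Sum>j\<le>n. q ^ j) \<le> (\<Sum>j. q ^ j)" using q by (intro sum_le_suminf summable_geometric) auto
    then show "(\<Sum>j\<le>n. q ^ j) \<le> 1 / (1 - q)" using suminf_geometric[of q] q by simp
  qed
  finally show ?thesis by simp
qed

section \<open>Young's inequality along dyadic partitions\<close>

lemma sum_pairs: "a \<le> b \<Longrightarrow> sum f {2 * a..<2 * b} = (\<Sum>l\<in>{a..<b}. f (2 * l) + f (Suc (2 * l)))"
  for f :: "nat \<Rightarrow> 'a::comm_monoid_add"
proof (induction b rule: dec_induct)
  case (step b)
  have "{2 * a..<2 * Suc b} = insert (Suc (2 * b)) (insert (2 * b) {2 * a..<2 * b})" using step by auto
  then show ?case using step by (simp add: ac_simps)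
qed simp

lemma L2_set_even_odd_le:
  shows "L2_set (\<lambda>l. a (2 * l)) {..<N} \<le> L2_set a {..<2 * N}"
    and "L2_set (\<lambda>l. a (Suc (2 * l))) {..<N} \<le> L2_set a {..<2 * N}"
proof -
  have e: "(\<Sum>l<2 * N. (a l)\<^sup>2) = (\<Sum>l<N. (a (2 * l))\<^sup>2 + (a (Suc (2 * l)))\<^sup>2)"
    using sum_pairs[of 0 N "\<lambda>l. (a l)\<^sup>2"] by (simp add: lessThan_atLeast0)
  show "L2_set (\<lambda>l. a (2 * l)) {..<N} \<le> L2_set a {..<2 * N}"
    "L2_set (\<lambda>l. a (Suc (2 * l))) {..<N} \<le> L2_set a {..<2 * N}"
    unfolding L2_set_def e by (auto intro!: real_sqrt_le_mono sum_mono)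
qed

lemma dyadic_cross_sum_le:
  fixes g U :: "real \<Rightarrow> complex"
  shows "(\<Sum>l<2 ^ p. norm (g (T * real (Suc (2 * l)) / 2 ^ Suc p) - g (T * real (2 * l) / 2 ^ Suc p)) *
            norm (U (T * real (Suc (Suc (2 * l))) / 2 ^ Suc p) - U (T * real (Suc (2 * l)) / 2 ^ Suc p)))
     \<le> dyadic_var T (Suc p) g * dyadic_var T (Suc p) U"
proof -
  define a where "a k = norm (g (T * real (Suc k) / 2 ^ Suc p) - g (T * real k / 2 ^ Suc p))" for k
  define b where "b k = norm (U (T * real (Suc k) / 2 ^ Suc p) - U (T * real k / 2 ^ Suc p))" for k
  have v: "dyadic_var T (Suc p) g = L2_set a {..<2 * 2 ^ p}" "dyadic_var T (Suc p) U = L2_set b {..<2 * 2 ^ p}"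
    by (simp_all add: dyadic_var_def a_def[abs_def] b_def[abs_def])
  have "(\<Sum>l<2 ^ p. a (2 * l) * b (Suc (2 * l))) \<le> (\<Sum>l<2 ^ p. \<bar>a (2 * l)\<bar> * \<bar>b (Suc (2 * l))\<bar>)"
    by (simp add: a_def b_def)
  also have "\<dots> \<le> L2_set (\<lambda>l. a (2 * l)) {..<2 ^ p} * L2_set (\<lambda>l. b (Suc (2 * l))) {..<2 ^ p}"
    by (rule L2_set_mult_ineq)
  also have "\<dots> \<le> L2_set a {..<2 * 2 ^ p} * L2_set b {..<2 * 2 ^ p}"
    by (intro mult_mono L2_set_even_odd_le L2_set_nonneg)
  finally show ?thesis unfolding v a_def b_def .
qed

text \<open>Left-point Riemann-Stieltjes sum over the k-th interval of level n, with the mesh of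
  level n + i. The index l is global, counted from 0 in the fine partition.\<close>

definition dyadic_riemann :: "real \<Rightarrow> (real \<Rightarrow> complex) \<Rightarrow> (real \<Rightarrow> complex) \<Rightarrow> nat \<Rightarrow> nat \<Rightarrow> nat \<Rightarrow> complex" where
  "dyadic_riemann T g U n i k = (\<Sum>l\<in>{k * 2 ^ i..<k * 2 ^ i + 2 ^ i}.
     g (T * real l / 2 ^ (n + i)) * (U (T * real (Suc l) / 2 ^ (n + i)) - U (T * real l / 2 ^ (n + i))))"

lemma dyadic_riemann_0:
  "dyadic_riemann T g U n 0 k = g (T * real k / 2 ^ n) * (U (T * real (Suc k) / 2 ^ n) - U (T * real k / 2 ^ n))"
  by (simp add: dyadic_riemann_def)

text \<open>Halving a cell changes the left-point sum on the right half only, by the increment of g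
  over the left half times that of U over the right half.\<close>

lemma dyadic_riemann_Suc:
  "dyadic_riemann T g U n (Suc i) k - dyadic_riemann T g U n i k = (\<Sum>l\<in>{k * 2 ^ i..<k * 2 ^ i + 2 ^ i}.
     (g (T * real (Suc (2 * l)) / 2 ^ Suc (n + i)) - g (T * real (2 * l) / 2 ^ Suc (n + i))) *
     (U (T * real (Suc (Suc (2 * l))) / 2 ^ Suc (n + i)) - U (T * real (Suc (2 * l)) / 2 ^ Suc (n + i))))"
proof -
  have e: "{k * 2 ^ Suc i..<k * 2 ^ Suc i + 2 ^ Suc i} = {2 * (k * 2 ^ i)..<2 * (k * 2 ^ i + 2 ^ i)}"
    by (simp add: algebra_simps)
  have e2: "T * real (Suc l) / 2 ^ (n + i) = T * real (Suc (Suc (2 * l))) / 2 ^ Suc (n + i)" for l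
    by (simp add: field_simps)
  have e3: "T * real l / 2 ^ (n + i) = T * real (2 * l) / 2 ^ Suc (n + i)" for l
    by simp
  have alg: "a * (u - v) + b * (w - u) - a * (w - v) = (b - a) * (w - u)" for a b u v w :: complex
    by (simp add: algebra_simps)
  show ?thesis unfolding dyadic_riemann_def add_Suc_right e sum_pairs[OF le_add1] sum_subtractf[symmetric]
  proof (rule sum.cong[OF refl], goal_cases)
    case (1 l)
    show ?case unfolding e2[of l] e3[of l] by (rule alg)
  qed
qed

text \<open>Young's inequality for sums, with the dyadic quadratic variation at level n decaying like
  \<open>q ^ (2 * n)\<close>: passing from one level to the next changes the Riemann sums by products of
  increments of \<open>g\<close> and \<open>U\<close>, which are summable over the levels because \<open>q < 1\<close>.\<close>
lemma dyadic_young: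
  assumes g: "dyadic_bound T q A g" and U: "dyadic_bound T q B U" and q: "0 \<le> q" "q < 1"
    and G: "\<And>n k. k \<le> 2 ^ n \<Longrightarrow> norm (g (T * real k / 2 ^ n)) \<le> G"
    and I: "\<And>n k. k < 2 ^ n \<Longrightarrow> (\<lambda>i. dyadic_riemann T g U n i k) \<longlonglongrightarrow> I (T * real (Suc k) / 2 ^ n) - I (T * real k / 2 ^ n)"
  shows "dyadic_bound T q (B * (G + A / (1 - q))) I"
  unfolding dyadic_bound_def
proof
  fix n
  have A: "0 \<le> A" and B: "0 \<le> B" using g U by (auto dest: dyadic_bound_nonneg)
  have G0: "0 \<le> G" using G[of 0 0] norm_ge_zero order_trans by blast
  let ?S = "\<lambda>i. L2_set (\<lambda>k. norm (dyadic_riemann T g U n i k)) {..<2 ^ n}"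
  have S: "?S i \<le> G * (B * q ^ n) + (\<Sum>j<i. A * B * q ^ n * q ^ j)" for i
  proof (induction i)
    case 0
    have "?S 0 \<le> L2_set (\<lambda>k. G * norm (U (T * real (Suc k) / 2 ^ n) - U (T * real k / 2 ^ n))) {..<2 ^ n}"
      by (rule L2_set_mono) (auto simp: dyadic_riemann_0 norm_mult intro!: mult_right_mono G simp del: of_nat_Suc)
    also have "\<dots> = G * dyadic_var T n U" using G0 by (simp add: dyadic_var_def L2_set_right_distrib)
    finally show ?case using U G0 by (auto simp: dyadic_bound_def intro: order_trans mult_left_mono)
  next
    case (Suc i)
    have "?S (Suc i) \<le> ?S i + L2_set (\<lambda>k. norm (dyadic_riemann T g U n (Suc i) k - dyadic_riemann T g U n i k)) {..<2 ^ n}"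
      by (rule order_trans[OF _ L2_set_triangle_ineq], rule L2_set_mono)
         (auto intro: order_trans[OF _ norm_triangle_ineq])
    \<comment> \<open>Passing to the sum of absolute values costs nothing here: the intervals of
      level n together contain all cells of level n + i exactly once, and one Cauchy-Schwarz
      inequality bounds the whole sum.\<close>
    also have "L2_set (\<lambda>k. norm (dyadic_riemann T g U n (Suc i) k - dyadic_riemann T g U n i k)) {..<2 ^ n}
        \<le> (\<Sum>k<2 ^ n. norm (dyadic_riemann T g U n (Suc i) k - dyadic_riemann T g U n i k))"
      by (rule L2_set_le_sum) auto
    also have "\<dots> \<le> (\<Sum>k<2 ^ n. \<Sum>l\<in>{k * 2 ^ i..<k * 2 ^ i + 2 ^ i}.
         norm (g (T * real (Suc (2 * l)) / 2 ^ Suc (n + i)) - g (T * real (2 * l) / 2 ^ Suc (n + i))) *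
         norm (U (T * real (Suc (Suc (2 * l))) / 2 ^ Suc (n + i)) - U (T * real (Suc (2 * l)) / 2 ^ Suc (n + i))))"
      unfolding dyadic_riemann_Suc by (intro sum_mono sum_norm_le) (simp add: norm_mult)
    also have "\<dots> \<le> dyadic_var T (Suc (n + i)) g * dyadic_var T (Suc (n + i)) U"
      unfolding sum.nat_group using dyadic_cross_sum_le[of g T "n + i" U] by (simp add: power_add)
    also have "\<dots> \<le> (A * q ^ Suc (n + i)) * (B * q ^ Suc (n + i))"
      using g U A q by (intro mult_mono) (auto simp: dyadic_bound_def dyadic_var_nonneg simp del: power_Suc)
    also have "\<dots> = A * B * (q ^ (n + i) * (q * q ^ Suc (n + i)))" by (simp add: algebra_simps)
    \<comment> \<open>Of the two decaying factors one is given up. The other splits into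
      \<open>q ^ n\<close>, which is the decay to be shown for I, and \<open>q ^ i\<close>, which
      makes the levels summable.\<close>
    also have "\<dots> \<le> A * B * (q ^ (n + i) * 1)"
      using A B q by (intro mult_left_mono) (auto intro!: mult_nonneg_nonneg mult_le_one power_le_one)
    finally show ?case using Suc by (simp add: power_add mult_ac)
  qed
  have geo: "(\<Sum>j<i. q ^ j) \<le> 1 / (1 - q)" for i
  proof -
    have "(\<Sum>j<i. q ^ j) \<le> (\<Sum>j. q ^ j)" using q by (intro sum_le_suminf summable_geometric) auto
    then show ?thesis using suminf_geometric[of q] q by simp
  qed
  have S': "?S i \<le> B * (G + A / (1 - q)) * q ^ n" for i
  proof -
    have "(\<Sum>j<i. A * B * q ^ n * q ^ j) = A * B * q ^ n * (\<Sum>j<i. q ^ j)" by (simp add: sum_distrib_left)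
    also have "\<dots> \<le> A * B * q ^ n * (1 / (1 - q))" using A B q by (intro mult_left_mono geo) auto
    finally show ?thesis using S[of i] by (simp add: algebra_simps)
  qed
  have "?S \<longlonglongrightarrow> dyadic_var T n I"
    unfolding dyadic_var_def L2_set_def by (intro tendsto_intros I) auto
  then show "dyadic_var T n I \<le> B * (G + A / (1 - q)) * q ^ n"
    by (rule LIMSEQ_le_const2) (use S' in auto)
qed

section \<open>Riemann sums and dyadic bounds of differentiable functions\<close>

lemma increment_le_of_derivative_le:
  fixes F :: "real \<Rightarrow> 'a::real_normed_vector"
  assumes "a \<le> b" and F: "\<And>x. x \<in> {a..b} \<Longrightarrow> (F has_vector_derivative F' x) (at x within {a..b})"
    and B: "\<And>x. x \<in> {a..b} \<Longrightarrow> norm (F' x) \<le> B"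
  shows "norm (F b - F a) \<le> B * (b - a)"
proof -
  have "norm (F b - F a) \<le> B * norm (b - a)"
  proof (rule differentiable_bound[of "{a..b}" F "\<lambda>x h. h *\<^sub>R F' x"])
    show "\<And>x. x \<in> {a..b} \<Longrightarrow> (F has_derivative (\<lambda>h. h *\<^sub>R F' x)) (at x within {a..b})"
      using F by (simp add: has_vector_derivative_def)
    show "onorm (\<lambda>h. h *\<^sub>R F' x) \<le> B" if "x \<in> {a..b}" for x
    proof (rule onorm_bound)
      show "0 \<le> B" using order_trans[OF norm_ge_zero B[OF that]] .
      show "norm (h *\<^sub>R F' x) \<le> B * norm h" for h
        using mult_left_mono[OF B[OF that], of "norm h"] by (simp add: mult.commute)
    qed
  qed (use assms in auto)
  then show ?thesis using assms(1) by simp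
qed

text \<open>On a cell with left end a the function g(a) U - I has derivative (g(a) - g) u, which is
  small by uniform continuity. The mean value inequality gives the error of each cell.\<close>

lemma dyadic_riemann_tendsto:
  assumes T: "0 < T" and g: "continuous_on {0..T} g" and u: "continuous_on {0..T} u"
    and U: "\<And>x. x \<in> {0..T} \<Longrightarrow> (U has_vector_derivative u x) (at x within {0..T})"
    and I: "\<And>x. x \<in> {0..T} \<Longrightarrow> (I has_vector_derivative g x * u x) (at x within {0..T})"
    and k: "k < 2 ^ n"
  shows "(\<lambda>i. dyadic_riemann T g U n i k) \<longlonglongrightarrow> I (T * real (Suc k) / 2 ^ n) - I (T * real k / 2 ^ n)"
proof (rule LIMSEQ_I)
  fix r :: real assume r: "0 < r"
  obtain L where L: "\<And>x. x \<in> {0..T} \<Longrightarrow> norm (u x) \<le> L"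
    using compact_imp_bounded[OF compact_continuous_image[OF u compact_Icc]] unfolding bounded_iff by (metis imageI)
  have L0: "0 \<le> L" using T order_trans[OF norm_ge_zero L[of 0]] by simp
  define e where "e = r / ((L + 1) * T)"
  have e: "0 < e" using r L0 T by (simp add: e_def)
  obtain d where d: "0 < d" "\<And>x y. x \<in> {0..T} \<Longrightarrow> y \<in> {0..T} \<Longrightarrow> dist y x < d \<Longrightarrow> dist (g y) (g x) < e"
    using uniformly_continuous_onE[OF compact_uniformly_continuous[OF g compact_Icc] e] by metis
  have "(\<lambda>i. T / 2 ^ i) \<longlonglongrightarrow> 0" by (rule LIMSEQ_divide_realpow_zero) simp
  then obtain N where N: "\<And>i. i \<ge> N \<Longrightarrow> T / 2 ^ i < d"
    using d(1) T by (auto simp: LIMSEQ_iff)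
  show "\<exists>no. \<forall>i\<ge>no. norm (dyadic_riemann T g U n i k - (I (T * real (Suc k) / 2 ^ n) - I (T * real k / 2 ^ n))) < r"
  proof (intro exI allI impI)
    fix i assume i: "i \<ge> N"
    define t where "t l = T * real l / 2 ^ (n + i)" for l
    have step: "norm (g (t l) * (U (t (Suc l)) - U (t l)) - (I (t (Suc l)) - I (t l))) \<le> e * L * (T / 2 ^ (n + i))"
      if l: "l < 2 ^ (n + i)" for l
    proof -
      have "real (Suc l) \<le> real (2 ^ (n + i))" using l by (intro of_nat_mono) simp
      then have tt: "t (Suc l) \<le> T"
        using T by (simp add: t_def divide_le_eq del: of_nat_Suc)
      have t0: "0 \<le> t l" using T by (simp add: t_def)
      have tS: "t (Suc l) - t l = T / 2 ^ (n + i)" by (simp add: t_def diff_divide_distrib[symmetric] algebra_simps)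
      have "0 < T / 2 ^ (n + i)" using T by simp
      then have le: "t l \<le> t (Suc l)" using tS by linarith
      have small: "T / 2 ^ (n + i) < d" using i by (intro N) simp
      have sub: "{t l..t (Suc l)} \<subseteq> {0..T}" using tt t0 by auto
      let ?F = "\<lambda>x. g (t l) * U x - I x"
      have "norm (?F (t (Suc l)) - ?F (t l)) \<le> e * L * (t (Suc l) - t l)"
      proof (rule increment_le_of_derivative_le[OF le])
        fix x assume x: "x \<in> {t l..t (Suc l)}"
        then have xT: "x \<in> {0..T}" using sub by auto
        show "(?F has_vector_derivative (g (t l) - g x) * u x) (at x within {t l..t (Suc l)})"
          using has_vector_derivative_within_subset[OF U[OF xT] sub] has_vector_derivative_within_subset[OF I[OF xT] sub]
          by (auto intro!: derivative_eq_intros simp: algebra_simps)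
        have "dist (g (t l)) (g x) < e"
          using x xT sub le tS small by (intro d(2)) (auto simp: dist_real_def)
        then show "norm ((g (t l) - g x) * u x) \<le> e * L"
          unfolding norm_mult using e L0 by (intro mult_mono L xT) (auto simp: dist_norm)
      qed
      then show ?thesis unfolding tS by (simp add: algebra_simps)
    qed
    have sub: "l < 2 ^ (n + i)" if "l \<in> {k * 2 ^ i..<k * 2 ^ i + 2 ^ i}" for l
    proof -
      have "Suc k * 2 ^ i \<le> 2 ^ n * 2 ^ i" using k by (intro mult_right_mono) auto
      then show ?thesis using that by (simp add: power_add)
    qed
    have p: "T * real (k * 2 ^ i) / 2 ^ (n + i) = T * real k / 2 ^ n"
      "T * real (k * 2 ^ i + 2 ^ i) / 2 ^ (n + i) = T * real (Suc k) / 2 ^ n"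
      by (simp_all add: power_add field_simps)
    have tel: "(\<Sum>l\<in>{k * 2 ^ i..<k * 2 ^ i + 2 ^ i}. I (t (Suc l)) - I (t l)) = I (T * real (Suc k) / 2 ^ n) - I (T * real k / 2 ^ n)"
      by (subst sum_Suc_diff', simp) (simp only: t_def p)
    have "dyadic_riemann T g U n i k - (I (T * real (Suc k) / 2 ^ n) - I (T * real k / 2 ^ n)) =
       (\<Sum>l\<in>{k * 2 ^ i..<k * 2 ^ i + 2 ^ i}. g (t l) * (U (t (Suc l)) - U (t l)) - (I (t (Suc l)) - I (t l)))"
      unfolding tel[symmetric] sum_subtractf[symmetric] dyadic_riemann_def t_def by (simp add: sum_subtractf)
    also have "norm \<dots> \<le> (\<Sum>l\<in>{k * 2 ^ i..<k * 2 ^ i + 2 ^ i}. e * L * (T / 2 ^ (n + i)))"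
      by (intro sum_norm_le step sub)
    also have "\<dots> = e * L * T / 2 ^ n" by (simp add: power_add)
    also have "\<dots> \<le> e * L * T" using e L0 T divide_left_mono[of 1 "2 ^ n" "e * L * T"] by simp
    also have "\<dots> < e * ((L + 1) * T)" using e T by (simp add: algebra_simps)
    also have "\<dots> = r" using L0 T by (simp add: e_def)
    finally show "norm (dyadic_riemann T g U n i k - (I (T * real (Suc k) / 2 ^ n) - I (T * real k / 2 ^ n))) < r" .
  qed
qed

text \<open>With Lipschitz constant L the quadratic variation of level n is at most (L T)^2 / 2^n,
  whence the condition on q^2. The constant obtained is of no use as a bound; its existence permits
  the absorption argument of \<open>dyadic_young_ode\<close>.\<close>

lemma dyadic_bound_exists:
  fixes g :: "real \<Rightarrow> complex"
  assumes T: "0 < T" and g': "continuous_on {0..T} g'"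
    and g: "\<And>x. x \<in> {0..T} \<Longrightarrow> (g has_vector_derivative g' x) (at x within {0..T})"
    and q: "1 / 2 \<le> q\<^sup>2" "0 < q"
  shows "\<exists>A. dyadic_bound T q A g"
proof -
  obtain L where L: "\<And>x. x \<in> {0..T} \<Longrightarrow> norm (g' x) \<le> L"
    using compact_imp_bounded[OF compact_continuous_image[OF g' compact_Icc]] unfolding bounded_iff by (metis imageI)
  have L0: "0 \<le> L" using T order_trans[OF norm_ge_zero L[of 0]] by simp
  have "dyadic_var T n g \<le> L * T * q ^ n" for n
  proof -
    have inc: "norm (g (T * real (Suc k) / 2 ^ n) - g (T * real k / 2 ^ n)) \<le> L * (T / 2 ^ n)" if k: "k < 2 ^ n" for k
    proof -
      have "real (Suc k) \<le> real (2 ^ n)" using k by (intro of_nat_mono) simp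
      then have tt: "T * real (Suc k) / 2 ^ n \<le> T" using T by (simp add: divide_le_eq del: of_nat_Suc)
      have t0: "0 \<le> T * real k / 2 ^ n" using T by simp
      have sub: "{T * real k / 2 ^ n..T * real (Suc k) / 2 ^ n} \<subseteq> {0..T}" using tt t0 by auto
      have "norm (g (T * real (Suc k) / 2 ^ n) - g (T * real k / 2 ^ n)) \<le> L * (T * real (Suc k) / 2 ^ n - T * real k / 2 ^ n)"
      proof (rule increment_le_of_derivative_le[where F=g and F'=g'])
        show "T * real k / 2 ^ n \<le> T * real (Suc k) / 2 ^ n" using T by (intro divide_right_mono) auto
        fix x assume "x \<in> {T * real k / 2 ^ n..T * real (Suc k) / 2 ^ n}"
        then have x: "x \<in> {0..T}" using sub by blast
        show "(g has_vector_derivative g' x) (at x within {T * real k / 2 ^ n..T * real (Suc k) / 2 ^ n})"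
          by (rule has_vector_derivative_within_subset[OF g[OF x] sub])
        show "norm (g' x) \<le> L" by (rule L[OF x])
      qed
      then show ?thesis by (simp add: diff_divide_distrib[symmetric] algebra_simps)
    qed
    have "(dyadic_var T n g)\<^sup>2 = (\<Sum>k<(2::nat) ^ n. (norm (g (T * real (Suc k) / 2 ^ n) - g (T * real k / 2 ^ n)))\<^sup>2)"
      unfolding dyadic_var_def L2_set_def by (rule real_sqrt_pow2) (simp add: sum_nonneg)
    also have "\<dots> \<le> (\<Sum>k<(2::nat) ^ n. (L * (T / 2 ^ n))\<^sup>2)"
      by (rule sum_mono, rule power_mono[OF inc]) auto
    also have "\<dots> = (L * T)\<^sup>2 * (1 / 2) ^ n" by (simp add: power2_eq_square power_divide)
    also have "\<dots> \<le> (L * T)\<^sup>2 * (q\<^sup>2) ^ n" by (intro mult_left_mono power_mono q) auto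
    also have "\<dots> = (L * T * q ^ n)\<^sup>2" by (metis power_mult_distrib power_mult mult.commute)
    finally have "(dyadic_var T n g)\<^sup>2 \<le> (L * T * q ^ n)\<^sup>2" .
    moreover have "0 \<le> L * T * q ^ n" using L0 T q(2) by simp
    ultimately show ?thesis by (rule power2_le_imp_le)
  qed
  then show ?thesis by (auto simp: dyadic_bound_def)
qed

text \<open>A least constant can be compared with the bounds that Young's inequality yields for the
  same function; mere finiteness would not permit this.\<close>

lemma dyadic_bound_least:
  assumes "dyadic_bound T q A0 g" and q: "0 < q"
  obtains A where "dyadic_bound T q A g" "\<And>A'. dyadic_bound T q A' g \<Longrightarrow> A \<le> A'"
proof -
  define A where "A = (SUP n. dyadic_var T n g / q ^ n)"
  have bdd: "bdd_above (range (\<lambda>n. dyadic_var T n g / q ^ n))"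
    using assms by (intro bdd_aboveI2[where M=A0]) (auto simp: dyadic_bound_def divide_le_eq)
  show ?thesis
  proof
    show "dyadic_bound T q A g"
      unfolding dyadic_bound_def
    proof
      fix n
      have "dyadic_var T n g / q ^ n \<le> A" unfolding A_def by (rule cSUP_upper[OF _ bdd]) simp
      then show "dyadic_var T n g \<le> A * q ^ n" using q by (simp add: divide_le_eq)
    qed
    show "A \<le> A'" if "dyadic_bound T q A' g" for A'
      unfolding A_def using that q by (intro cSUP_least) (auto simp: dyadic_bound_def divide_le_eq)
  qed
qed

section \<open>The propagator as a two-mode system\<close>

text \<open>Let A1 and A2 be the least constants of a and b, and c = 1 / (1 - q). Young's inequality
  gives \<open>A1 \<le> 2 * (B * c) * A2\<close> and \<open>A2 \<le> B + 2 * (B * c) * A1\<close>.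
  As \<open>B * c\<close> is at most 1 / 4, the right-hand occurrences are absorbed and A1 is at
  most B. Neither the size of u1 and u2 nor that of the derivatives of a and b enters the
  result.\<close>

lemma dyadic_young_ode:
  fixes a b :: "real \<Rightarrow> complex"
  assumes T: "0 < T" and q: "1 / 2 \<le> q\<^sup>2" "0 < q" "q < 1"
    and u: "continuous_on {0..T} u1" "continuous_on {0..T} u2"
    and U1: "\<And>x. x \<in> {0..T} \<Longrightarrow> (U1 has_vector_derivative u1 x) (at x within {0..T})"
    and U2: "\<And>x. x \<in> {0..T} \<Longrightarrow> (U2 has_vector_derivative u2 x) (at x within {0..T})"
    and a: "\<And>x. x \<in> {0..T} \<Longrightarrow> (a has_vector_derivative b x * u1 x) (at x within {0..T})"
    and b: "\<And>x. x \<in> {0..T} \<Longrightarrow> (b has_vector_derivative a x * u2 x) (at x within {0..T})"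
    and init: "a 0 = 1" "b 0 = 0"
    and B1: "dyadic_bound T q B U1" and B2: "dyadic_bound T q B U2"
    and small: "4 * B / (1 - q) \<le> 1"
  shows "norm (a T - 1) \<le> B"
proof -
  have ca: "continuous_on {0..T} a" and cb: "continuous_on {0..T} b"
    using has_vector_derivative_continuous[OF a] has_vector_derivative_continuous[OF b] by (auto simp: continuous_on_eq_continuous_within)
  define c where "c = 1 / (1 - q)"
  have c1: "1 \<le> c" using q by (simp add: c_def)
  have B0: "0 \<le> B" using B1 by (rule dyadic_bound_nonneg)
  have Bc: "B * c \<le> 1 / 4" using small by (simp add: c_def field_simps)
  obtain A1 where A1: "dyadic_bound T q A1 a" "\<And>A'. dyadic_bound T q A' a \<Longrightarrow> A1 \<le> A'"
    using dyadic_bound_least dyadic_bound_exists[OF T _ a q(1,2)] u cb q(2) by (metis continuous_on_mult)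
  obtain A2 where A2: "dyadic_bound T q A2 b" "\<And>A'. dyadic_bound T q A' b \<Longrightarrow> A2 \<le> A'"
    using dyadic_bound_least dyadic_bound_exists[OF T _ b q(1,2)] u ca q(2) by (metis continuous_on_mult)
  have A0: "0 \<le> A1" "0 \<le> A2" using A1 A2 by (auto dest: dyadic_bound_nonneg)
  have sa: "norm (a (T * real k / 2 ^ n)) \<le> 1 + A1 * c" if "k \<le> 2 ^ n" for n k
    using dyadic_sup_le[OF A1(1) _ q(3) that] q init norm_triangle_sub[of "a (T * real k / 2 ^ n)" 1]
    by (simp add: c_def)
  have sb: "norm (b (T * real k / 2 ^ n)) \<le> A2 * c" if "k \<le> 2 ^ n" for n k
    using dyadic_sup_le[OF A2(1) _ q(3) that] q init by (simp add: c_def)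
  have "dyadic_bound T q (B * (A2 * c + A2 / (1 - q))) a"
    using q by (intro dyadic_young[OF A2(1) B1 _ q(3)] sb dyadic_riemann_tendsto[OF T cb u(1) U1 a]) auto
  then have 1: "A1 \<le> 2 * (B * c) * A2" using A1(2) by (force simp: c_def algebra_simps)
  have "dyadic_bound T q (B * ((1 + A1 * c) + A1 / (1 - q))) b"
    using q by (intro dyadic_young[OF A1(1) B2 _ q(3)] sa dyadic_riemann_tendsto[OF T ca u(2) U2 b]) auto
  then have 2: "A2 \<le> B + 2 * (B * c) * A1" using A2(2) by (force simp: c_def algebra_simps)
  have "A1 \<le> A2 / 2" using order_trans[OF 1 mult_right_mono[OF _ A0(2), of _ "1/2"]] Bc by simp
  moreover have "2 * (B * c) * A1 \<le> 1 / 2 * A1" using Bc A0 by (intro mult_right_mono) auto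
  ultimately have "A1 \<le> B" using 2 A0 by linarith
  moreover have "norm (a (T * real 1 / 2 ^ 0) - a (T * real 0 / 2 ^ 0)) \<le> dyadic_var T 0 a"
    using dyadic_increment_le[of 0 0 a T] by simp
  moreover have "dyadic_var T 0 a \<le> A1" using A1(1) by (auto simp: dyadic_bound_def dest!: spec[of _ 0])
  ultimately show ?thesis using init by simp
qed

lemma dyadic_bound_mono_norm:
  assumes f: "dyadic_bound T q A f" and C: "0 \<le> C"
    and le: "\<And>x y. norm (g x - g y) \<le> C * norm (f x - f y)"
  shows "dyadic_bound T q (C * A) g"
  unfolding dyadic_bound_def
proof
  fix n
  have "dyadic_var T n g \<le> L2_set (\<lambda>k. C * norm (f (T * real (Suc k) / 2 ^ n) - f (T * real k / 2 ^ n))) {..<2 ^ n}"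
    unfolding dyadic_var_def by (intro L2_set_mono le) auto
  also have "\<dots> = C * dyadic_var T n f" using C by (simp add: dyadic_var_def L2_set_right_distrib)
  also have "\<dots> \<le> C * (A * q ^ n)" using f C by (auto simp: dyadic_bound_def intro: mult_left_mono)
  finally show "dyadic_var T n g \<le> C * A * q ^ n" by (simp add: mult.assoc)
qed

lemma norm_iexp_diff_le: "norm (iexp x - iexp y) \<le> \<bar>x - y\<bar>"
proof -
  have "iexp (x - y) = iexp x / iexp y" by (simp add: right_diff_distrib exp_diff)
  then have "iexp x - iexp y = iexp y * (iexp (x - y) - 1)" by (simp add: field_simps)
  then have "norm (iexp x - iexp y) = norm (iexp (x - y) - 1)" by (simp add: norm_mult)
  also have "\<dots> \<le> \<bar>x - y\<bar>" using iexp_approx1[of "x - y" 0] by simp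
  finally show ?thesis .
qed

lemma energy_identity:
  fixes a b k w :: complex
  assumes "cnj k = - k"
  shows "a * cnj (k * (a - w * b)) + k * (a - w * b) * cnj a =
    b * cnj (k * (cnj w * a - b)) + k * (cnj w * a - b) * cnj b"
proof -
  have e: "cnj (k * (a - w * b)) = - k * (cnj a - cnj w * cnj b)"
    "cnj (k * (cnj w * a - b)) = - k * (w * cnj a - cnj b)" using assms by simp_all
  show ?thesis unfolding e by (simp add: algebra_simps)
qed

text \<open>The first column of the propagator, which is closed under the equation and contains the
  entry that defines the transmission coefficient. The number c stands for
  \<open>2 * \<omega> / \<epsilon> powr \<tau>\<close>.\<close>

locale two_mode_system =
  fixes T \<omega> c :: real and \<nu> :: "real \<Rightarrow> real" and \<alpha> \<beta> :: "real \<Rightarrow> complex"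
  assumes T: "0 < T" and \<nu>: "continuous_on {0..T} \<nu>"
    and \<alpha>: "\<And>x. x \<in> {0..T} \<Longrightarrow> (\<alpha> has_vector_derivative
          \<i> * \<omega> / 2 * \<nu> x * (\<alpha> x - iexp (- (c * x)) * \<beta> x)) (at x within {0..T})"
    and \<beta>: "\<And>x. x \<in> {0..T} \<Longrightarrow> (\<beta> has_vector_derivative
          \<i> * \<omega> / 2 * \<nu> x * (iexp (c * x) * \<alpha> x - \<beta> x)) (at x within {0..T})"
    and init: "\<alpha> 0 = 1" "\<beta> 0 = 0"
begin

definition "V x = integral {0..x} \<nu>"
definition "W x = integral {0..x} (\<lambda>u. \<nu> u * iexp (c * u))"

lemma V: "x \<in> {0..T} \<Longrightarrow> (V has_vector_derivative \<nu> x) (at x within {0..T})"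
  unfolding V_def[abs_def] by (rule integral_has_vector_derivative[OF \<nu>])

lemma W: "x \<in> {0..T} \<Longrightarrow> (W has_vector_derivative \<nu> x * iexp (c * x)) (at x within {0..T})"
  unfolding W_def[abs_def]
  by (rule integral_has_vector_derivative) (intro continuous_intros \<nu>)

lemma V_0: "V 0 = 0" by (simp add: V_def)

lemma V': "x \<in> {0..T} \<Longrightarrow>
  ((\<lambda>x. iexp (k * V x)) has_vector_derivative \<i> * k * \<nu> x * iexp (k * V x)) (at x within {0..T})"
proof -
  assume x: "x \<in> {0..T}"
  have d: "((\<lambda>x. k * V x) has_vector_derivative k * \<nu> x) (at x within {0..T})"
    using V[OF x] by (rule has_vector_derivative_mult_right)
  have "(iexp has_vector_derivative \<i> * iexp (k * V x)) (at (k * V x) within (\<lambda>x. k * V x) ` {0..T})"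
    by (rule has_vector_derivative_iexp)
  from vector_diff_chain_within[OF d this]
  show ?thesis by (simp add: o_def scaleR_conv_of_real mult_ac)
qed

lemma cont_V: "continuous_on {0..T} V"
  using has_vector_derivative_continuous[OF V] by (auto simp: continuous_on_eq_continuous_within)

text \<open>The generator lies in the Lie algebra su(1,1), so the indefinite form is conserved. This
  is the only source of the bound 1 on the transmission coefficient.\<close>

lemma energy: "(norm (\<alpha> T))\<^sup>2 - (norm (\<beta> T))\<^sup>2 = 1"
proof -
  let ?E = "\<lambda>x. \<alpha> x * cnj (\<alpha> x) - \<beta> x * cnj (\<beta> x)"
  have "(?E has_vector_derivative 0) (at x within {0..T})" if x: "x \<in> {0..T}" for x
  proof -
    note c1 = bounded_linear.has_vector_derivative[OF bounded_linear_cnj \<alpha>[OF x]]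
    note c2 = bounded_linear.has_vector_derivative[OF bounded_linear_cnj \<beta>[OF x]]
    have e: "iexp (- (c * x)) * iexp (c * x) = 1" by (simp add: exp_add[symmetric])
    have c: "cnj (iexp (c * x)) = iexp (- (c * x))" "cnj (iexp (- (c * x))) = iexp (c * x)"
      by (simp_all add: exp_cnj)
    define w where "w = iexp (- (c * x))"
    define v where "v = iexp (c * x)"
    define k where "k = \<i> * \<omega> / 2 * \<nu> x"
    have ck: "cnj k = - k" by (simp add: k_def)
    define \<alpha>' where "\<alpha>' = k * (\<alpha> x - w * \<beta> x)"
    define \<beta>' where "\<beta>' = k * (v * \<alpha> x - \<beta> x)"
    have cw: "cnj w = v" "cnj v = w" using c by (auto simp: w_def v_def)
    have "(?E has_vector_derivative (\<alpha> x * cnj \<alpha>' + \<alpha>' * cnj (\<alpha> x)) - (\<beta> x * cnj \<beta>' + \<beta>' * cnj (\<beta> x))) (at x within {0..T})"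
      unfolding \<alpha>'_def \<beta>'_def w_def v_def k_def
      by (intro has_vector_derivative_diff has_vector_derivative_mult c1 c2 \<alpha>[OF x] \<beta>[OF x])
    moreover have "(\<alpha> x * cnj \<alpha>' + \<alpha>' * cnj (\<alpha> x)) - (\<beta> x * cnj \<beta>' + \<beta>' * cnj (\<beta> x)) = 0"
      unfolding \<alpha>'_def \<beta>'_def cw(1)[symmetric] using energy_identity[OF ck] by simp
    ultimately show ?thesis by simp
  qed
  then obtain e where "\<And>x. x \<in> {0..T} \<Longrightarrow> ?E x = e"
    using has_vector_derivative_zero_constant[of "{0..T}" ?E] by auto
  from this[of T] this[of 0] have "?E T = ?E 0" using T by simp
  then have "complex_of_real ((norm (\<alpha> T))\<^sup>2 - (norm (\<beta> T))\<^sup>2) = 1"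
    unfolding of_real_diff complex_norm_square using init by simp
  then show ?thesis by (metis of_real_eq_1_iff)
qed

lemma norm_\<alpha>_ge_1: "1 \<le> norm (\<alpha> T)"
  using energy power2_le_imp_le[of 1 "norm (\<alpha> T)"] zero_le_power2[of "norm (\<beta> T)"] by simp

text \<open>K may be large and is fixed first; \<delta> multiplies the whole of B, so smallness of W
  alone makes the error small. This asymmetry is what the probabilistic estimate uses.\<close>

lemma close:
  assumes q: "1 / 2 \<le> q\<^sup>2" "0 < q" "q < 1"
    and K: "dyadic_bound T q K V" and \<delta>: "dyadic_bound T q \<delta> W"
    and B: "B = \<bar>\<omega>\<bar> / 2 * (\<delta> * (1 + \<bar>\<omega>\<bar> * K / (1 - q)))"
    and small: "4 * B / (1 - q) \<le> 1"
  shows "norm (1 / cnj (\<alpha> T) - iexp (\<omega> / 2 * V T)) \<le> B"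
proof -
  define g where "g x = iexp (\<omega> * V x)" for x
  define w where "w x = \<nu> x * iexp (c * x)" for x
  define U where "U x = integral {0..x} (\<lambda>u. g u * w u)" for x
  have cg: "continuous_on {0..T} g" unfolding g_def by (intro continuous_intros cont_V)
  have cw: "continuous_on {0..T} w" unfolding w_def by (intro continuous_intros \<nu>)
  have U: "(U has_vector_derivative g x * w x) (at x within {0..T})" if "x \<in> {0..T}" for x
    unfolding U_def[abs_def] by (rule integral_has_vector_derivative) (use that in \<open>auto intro!: continuous_intros cg cw\<close>)
  have g: "dyadic_bound T q (\<bar>\<omega>\<bar> * K) g"
    by (rule dyadic_bound_mono_norm[OF K])
       (use norm_iexp_diff_le in \<open>auto simp: g_def abs_mult[symmetric] right_diff_distrib simp del: of_real_mult\<close>)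
  \<comment> \<open>Young's inequality with \<open>norm (g x) = 1\<close> and the dyadic constant
    \<open>\<bar>\<omega>\<bar> * K\<close> of g, which it inherits from V because
    \<open>iexp\<close> is Lipschitz.\<close>
  have "dyadic_bound T q (\<delta> * (1 + \<bar>\<omega>\<bar> * K / (1 - q))) U"
    using q W by (intro dyadic_young[OF g \<delta> _ q(3)] dyadic_riemann_tendsto[OF T cg cw _ U]) (auto simp: g_def w_def)
  moreover have "0 \<le> \<bar>\<omega>\<bar> / 2" by simp
  moreover have "norm (\<i> * \<omega> / 2 * U x - \<i> * \<omega> / 2 * U y) \<le> \<bar>\<omega>\<bar> / 2 * norm (U x - U y)" for x y
    unfolding right_diff_distrib[symmetric] by (simp add: norm_mult)
  moreover have "norm (cnj (\<i> * \<omega> / 2 * U x) - cnj (\<i> * \<omega> / 2 * U y)) \<le> \<bar>\<omega>\<bar> / 2 * norm (U x - U y)" for x y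
    unfolding complex_cnj_diff[symmetric] complex_mod_cnj right_diff_distrib[symmetric] by (simp add: norm_mult)
  ultimately have UB: "dyadic_bound T q B (\<lambda>x. \<i> * \<omega> / 2 * U x)" "dyadic_bound T q B (\<lambda>x. cnj (\<i> * \<omega> / 2 * U x))"
    unfolding B by (metis dyadic_bound_mono_norm)+
  define a where "a x = \<alpha> x * iexp (- \<omega> / 2 * V x)" for x
  define b where "b x = \<beta> x * iexp (\<omega> / 2 * V x)" for x
  have e1: "iexp (- \<omega> / 2 * V x) * iexp (\<omega> / 2 * V x) = 1" for x by (simp add: exp_add[symmetric])
  have e2: "iexp (\<omega> / 2 * V x) * iexp (\<omega> / 2 * V x) = g x" for x by (simp add: exp_add[symmetric] g_def)
  have e3: "cnj (g x) * g x = 1" for x by (simp add: exp_add[symmetric] g_def exp_cnj)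
  have e4: "iexp (- \<omega> / 2 * V x) = cnj (g x) * iexp (\<omega> / 2 * V x)" for x
    by (simp add: exp_add[symmetric] g_def exp_cnj)
  have a': "(a has_vector_derivative b x * cnj (\<i> * \<omega> / 2 * (g x * w x))) (at x within {0..T})" if x: "x \<in> {0..T}" for x
  proof -
    have "\<alpha> x * (\<i> * complex_of_real (- \<omega> / 2) * \<nu> x * iexp (- \<omega> / 2 * V x)) +
        \<i> * \<omega> / 2 * \<nu> x * (\<alpha> x - iexp (- (c * x)) * \<beta> x) * iexp (- \<omega> / 2 * V x)
       = - (\<i> * \<omega> / 2 * \<nu> x * (iexp (- (c * x)) * \<beta> x) * iexp (- \<omega> / 2 * V x))"
      by (simp add: algebra_simps)
    also have "\<dots> = b x * cnj (\<i> * \<omega> / 2 * (g x * w x))"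
      unfolding e4 b_def w_def by (simp add: exp_cnj algebra_simps)
    finally have eq: "\<alpha> x * (\<i> * complex_of_real (- \<omega> / 2) * \<nu> x * iexp (- \<omega> / 2 * V x)) +
        \<i> * \<omega> / 2 * \<nu> x * (\<alpha> x - iexp (- (c * x)) * \<beta> x) * iexp (- \<omega> / 2 * V x)
       = b x * cnj (\<i> * \<omega> / 2 * (g x * w x))" .
    show ?thesis
      using has_vector_derivative_mult[OF \<alpha>[OF x] V'[OF x, of "- \<omega> / 2"]]
      unfolding eq a_def[abs_def] .
  qed
  have b': "(b has_vector_derivative a x * (\<i> * \<omega> / 2 * (g x * w x))) (at x within {0..T})" if x: "x \<in> {0..T}" for x
  proof -
    have "\<beta> x * (\<i> * complex_of_real (\<omega> / 2) * \<nu> x * iexp (\<omega> / 2 * V x)) +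
        \<i> * \<omega> / 2 * \<nu> x * (iexp (c * x) * \<alpha> x - \<beta> x) * iexp (\<omega> / 2 * V x)
       = \<i> * \<omega> / 2 * \<nu> x * (iexp (c * x) * \<alpha> x) * iexp (\<omega> / 2 * V x)"
      by (simp add: algebra_simps)
    also have "\<dots> = \<alpha> x * (\<i> * \<omega> / 2 * w x) * (iexp (\<omega> / 2 * V x) * (iexp (- \<omega> / 2 * V x) * iexp (\<omega> / 2 * V x)))"
      unfolding e1 w_def by (simp add: algebra_simps)
    also have "\<dots> = a x * (\<i> * \<omega> / 2 * w x) * (iexp (\<omega> / 2 * V x) * iexp (\<omega> / 2 * V x))"
      unfolding a_def by (simp only: mult_ac)
    also have "\<dots> = a x * (\<i> * \<omega> / 2 * (g x * w x))" unfolding e2 by (simp only: mult_ac)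
    finally have eq: "\<beta> x * (\<i> * complex_of_real (\<omega> / 2) * \<nu> x * iexp (\<omega> / 2 * V x)) +
        \<i> * \<omega> / 2 * \<nu> x * (iexp (c * x) * \<alpha> x - \<beta> x) * iexp (\<omega> / 2 * V x)
       = a x * (\<i> * \<omega> / 2 * (g x * w x))" .
    show ?thesis
      using has_vector_derivative_mult[OF \<beta>[OF x] V'[OF x, of "\<omega> / 2"]]
      unfolding eq b_def[abs_def] .
  qed
  have "norm (a T - 1) \<le> B"
  proof (rule dyadic_young_ode[OF T q, of "\<lambda>x. cnj (\<i> * \<omega> / 2 * (g x * w x))" "\<lambda>x. \<i> * \<omega> / 2 * (g x * w x)"])
    show "((\<lambda>x. cnj (\<i> * \<omega> / 2 * U x)) has_vector_derivative cnj (\<i> * \<omega> / 2 * (g x * w x))) (at x within {0..T})"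
      if "x \<in> {0..T}" for x
      by (intro bounded_linear.has_vector_derivative[OF bounded_linear_cnj] has_vector_derivative_mult_right U that)
    show "((\<lambda>x. \<i> * \<omega> / 2 * U x) has_vector_derivative \<i> * \<omega> / 2 * (g x * w x)) (at x within {0..T})"
      if "x \<in> {0..T}" for x
      by (intro has_vector_derivative_mult_right U that)
    show "(a has_vector_derivative b x * cnj (\<i> * \<omega> / 2 * (g x * w x))) (at x within {0..T})" if "x \<in> {0..T}" for x
      using a'[OF that] .
    show "(b has_vector_derivative a x * (\<i> * \<omega> / 2 * (g x * w x))) (at x within {0..T})" if "x \<in> {0..T}" for x
      using b'[OF that] .
    show "continuous_on {0..T} (\<lambda>x. \<i> * \<omega> / 2 * (g x * w x))" "continuous_on {0..T} (\<lambda>x. cnj (\<i> * \<omega> / 2 * (g x * w x)))"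
      by (rule continuous_on_cnj continuous_on_mult continuous_on_const cg cw)+
    show "a 0 = 1" "b 0 = 0" using init by (simp_all add: a_def b_def V_0)
  qed (rule UB small)+
  \<comment> \<open>The error is that of \<open>cnj (a T)\<close> divided by
    \<open>cnj (\<alpha> T)\<close>, and the modulus of the latter is at least 1.\<close>
  moreover have "norm (1 / cnj (\<alpha> T) - iexp (\<omega> / 2 * V T)) \<le> norm (a T - 1)"
  proof -
    have nz: "\<alpha> T \<noteq> 0" using norm_\<alpha>_ge_1 by auto
    have "iexp (\<omega> / 2 * V T) * cnj (\<alpha> T) = cnj (a T)" by (simp add: a_def exp_cnj)
    then have "1 / cnj (\<alpha> T) - iexp (\<omega> / 2 * V T) = (1 - cnj (a T)) / cnj (\<alpha> T)"
      using nz by (simp add: field_simps)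
    then have "norm (1 / cnj (\<alpha> T) - iexp (\<omega> / 2 * V T)) = norm (cnj (1 - a T)) / norm (\<alpha> T)"
      by (simp add: norm_divide)
    also have "\<dots> = norm (a T - 1) / norm (\<alpha> T)" by (simp only: complex_mod_cnj norm_minus_commute)
    also have "\<dots> \<le> norm (a T - 1)" using norm_\<alpha>_ge_1 by (simp add: divide_le_eq mult_le_cancel_left1)
    finally show ?thesis .
  qed
  ultimately show ?thesis by simp
qed

end

section \<open>Euler schemes and Fourier integrals as random continuous functions\<close>

primrec euler :: "(nat \<Rightarrow> 'a \<Rightarrow> 'a) \<Rightarrow> real \<Rightarrow> 'a::real_vector \<Rightarrow> nat \<Rightarrow> 'a" where
  "euler F \<delta> x 0 = x"
| "euler F \<delta> x (Suc k) = euler F \<delta> x k + \<delta> *\<^sub>R F k (euler F \<delta> x k)"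

text \<open>Its purpose is measurability: the solution at T becomes a limit of explicit functions of
  finitely many samples. With a right-hand side independent of the state it also gives convergence
  of Riemann sums.\<close>

lemma euler_tendsto:
  fixes x :: "real \<Rightarrow> 'a::real_normed_vector"
  assumes T: "0 < T"
    and x: "\<And>s. s \<in> {0..T} \<Longrightarrow> (x has_vector_derivative F s (x s)) (at s within {0..T})"
    and cont: "continuous_on {0..T} (\<lambda>s. F s (x s))"
    and lip: "\<And>s y z. s \<in> {0..T} \<Longrightarrow> norm (F s y - F s z) \<le> L * norm (y - z)" and L: "0 \<le> L"
  shows "(\<lambda>n. euler (\<lambda>k. F (T * real k / real (Suc n))) (T / real (Suc n)) (x 0) (Suc n)) \<longlonglongrightarrow> x T"
proof (rule LIMSEQ_I)
  fix r :: real assume r: "0 < r"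
  \<comment> \<open>With local errors governed by e, the total error below is
    \<open>T * e * exp (L * T)\<close>, that is \<open>r / 2\<close>.\<close>
  define e where "e = r / (2 * T * exp (L * T))"
  have e: "0 < e" using r T by (simp add: e_def)
  obtain d where d: "0 < d" "\<And>s t. s \<in> {0..T} \<Longrightarrow> t \<in> {0..T} \<Longrightarrow> dist t s < d \<Longrightarrow> dist (F t (x t)) (F s (x s)) < e"
    using uniformly_continuous_onE[OF compact_uniformly_continuous[OF cont compact_Icc] e] by metis
  have "(\<lambda>n. T / real (Suc n)) \<longlonglongrightarrow> 0"
    using tendsto_mult_right_zero[OF LIMSEQ_inverse_real_of_nat, of T] by (simp add: divide_inverse)
  then obtain N where N: "\<And>n. n \<ge> N \<Longrightarrow> T / real (Suc n) < d"
    using d(1) T by (auto simp: LIMSEQ_iff)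
  show "\<exists>no. \<forall>n\<ge>no. norm (euler (\<lambda>k. F (T * real k / real (Suc n))) (T / real (Suc n)) (x 0) (Suc n) - x T) < r"
  proof (intro exI allI impI)
    fix n assume n: "n \<ge> N"
    define \<delta> where "\<delta> = T / real (Suc n)"
    define t where "t k = T * real k / real (Suc n)" for k
    let ?E = "euler (\<lambda>k. F (t k)) \<delta> (x 0)"
    have \<delta>: "0 < \<delta>" "\<delta> < d" using T N[OF n] by (auto simp: \<delta>_def)
    have tn: "t (Suc n) = T" by (simp add: t_def)
    \<comment> \<open>A discrete Gronwall inequality: a step multiplies the old error by at most
      \<open>1 + \<delta> * L\<close> and adds at most \<open>\<delta> * e\<close>.\<close>
    have bnd: "norm (?E k - x (t k)) \<le> real k * (\<delta> * e) * (1 + \<delta> * L) ^ k" if "k \<le> Suc n" for k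
      using that
    proof (induction k)
      case 0 then show ?case by (simp add: t_def)
    next
      case (Suc k)
      have "real (Suc k) \<le> real (Suc n)" using Suc by (simp only: of_nat_le_iff)
      then have tt: "t (Suc k) \<le> T" using T by (simp add: t_def divide_le_eq del: of_nat_Suc)
      have t0: "0 \<le> t k" using T by (simp add: t_def)
      have tS: "t (Suc k) - t k = \<delta>" by (simp add: t_def \<delta>_def diff_divide_distrib[symmetric] algebra_simps)
      have le: "t k \<le> t (Suc k)" using tS \<delta> by linarith
      have sub: "{t k..t (Suc k)} \<subseteq> {0..T}" using tt t0 by auto
      have tk: "t k \<in> {0..T}" using tt t0 le by auto
      let ?G = "\<lambda>s. x s - s *\<^sub>R F (t k) (x (t k))"
      have "norm (?G (t (Suc k)) - ?G (t k)) \<le> e * norm (t (Suc k) - t k)"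
      proof (rule differentiable_bound[of "{t k..t (Suc k)}" ?G "\<lambda>s h. h *\<^sub>R (F s (x s) - F (t k) (x (t k)))"])
        fix s assume s: "s \<in> {t k..t (Suc k)}"
        then have sT: "s \<in> {0..T}" using sub by blast
        have "(?G has_vector_derivative F s (x s) - F (t k) (x (t k))) (at s within {t k..t (Suc k)})"
          using has_vector_derivative_within_subset[OF x[OF sT] sub] by (auto intro!: derivative_eq_intros)
        then show "(?G has_derivative (\<lambda>h. h *\<^sub>R (F s (x s) - F (t k) (x (t k))))) (at s within {t k..t (Suc k)})"
          by (simp add: has_vector_derivative_def)
        have "norm (F s (x s) - F (t k) (x (t k))) < e"
          using d(2)[OF tk sT] s tS \<delta> by (auto simp: dist_norm)
        then have "norm (h *\<^sub>R (F s (x s) - F (t k) (x (t k)))) \<le> e * norm h" for h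
          using mult_left_mono[of "norm (F s (x s) - F (t k) (x (t k)))" e "norm h"] by (simp add: mult.commute)
        then show "onorm (\<lambda>h. h *\<^sub>R (F s (x s) - F (t k) (x (t k)))) \<le> e" using e by (intro onorm_bound) auto
      qed (use le in auto)
      then have loc: "norm (x (t (Suc k)) - x (t k) - \<delta> *\<^sub>R F (t k) (x (t k))) \<le> \<delta> * e"
        unfolding tS[symmetric] using tS \<delta> by (simp add: algebra_simps)
      have "?E (Suc k) - x (t (Suc k)) = (?E k - x (t k)) + \<delta> *\<^sub>R (F (t k) (?E k) - F (t k) (x (t k)))
         - (x (t (Suc k)) - x (t k) - \<delta> *\<^sub>R F (t k) (x (t k)))"
        by (simp add: algebra_simps)
      also have "norm \<dots> \<le> norm (?E k - x (t k)) + norm (\<delta> *\<^sub>R (F (t k) (?E k) - F (t k) (x (t k)))) + \<delta> * e"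
        by (rule order_trans[OF norm_triangle_ineq4 add_mono[OF norm_triangle_ineq loc]])
      also have "norm (\<delta> *\<^sub>R (F (t k) (?E k) - F (t k) (x (t k)))) \<le> \<delta> * (L * norm (?E k - x (t k)))"
        using lip[OF tk] \<delta> by (simp add: mult_left_mono)
      finally have "norm (?E (Suc k) - x (t (Suc k))) \<le> (1 + \<delta> * L) * norm (?E k - x (t k)) + \<delta> * e"
        by (simp add: algebra_simps)
      also have "\<dots> \<le> (1 + \<delta> * L) * (real k * (\<delta> * e) * (1 + \<delta> * L) ^ k) + \<delta> * e * (1 + \<delta> * L) ^ Suc k"
      proof (intro add_mono mult_left_mono)
        have "1 \<le> (1 + \<delta> * L) ^ Suc k" using \<delta> L by (intro one_le_power) simp
        then show "\<delta> * e \<le> \<delta> * e * (1 + \<delta> * L) ^ Suc k" using \<delta> e mult_left_mono[of 1 "(1 + \<delta> * L) ^ Suc k" "\<delta> * e"] by simp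
      qed (use Suc \<delta> L in auto)
      also have "\<dots> = real (Suc k) * (\<delta> * e) * (1 + \<delta> * L) ^ Suc k" by (simp add: algebra_simps)
      finally show ?case .
    qed
    have "(1 + \<delta> * L) ^ Suc n \<le> exp (\<delta> * L) ^ Suc n"
      using \<delta> L exp_ge_add_one_self[of "\<delta> * L"] by (intro power_mono) auto
    also have "\<dots> = exp (L * T)" unfolding exp_of_nat_mult[symmetric] \<delta>_def by (simp add: field_simps)
    finally have p: "(1 + \<delta> * L) ^ Suc n \<le> exp (L * T)" .
    have "norm (?E (Suc n) - x T) \<le> real (Suc n) * (\<delta> * e) * (1 + \<delta> * L) ^ Suc n"
      using bnd[of "Suc n"] tn by simp
    also have "\<dots> \<le> real (Suc n) * (\<delta> * e) * exp (L * T)" using p \<delta> e by (intro mult_left_mono) auto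
    also have "\<dots> = r / 2" using T by (simp add: \<delta>_def e_def)
    also have "\<dots> < r" using r by simp
    finally show "norm (euler (\<lambda>k. F (T * real k / real (Suc n))) (T / real (Suc n)) (x 0) (Suc n) - x T) < r"
      by (simp add: t_def \<delta>_def)
  qed
qed

section \<open>Fourier integrals with a bounded multiplier, in the uniform norm\<close>

definition fourier_bcf :: "(real \<Rightarrow> complex) \<Rightarrow> (real \<Rightarrow> complex) \<Rightarrow> real \<Rightarrow>\<^sub>C complex" where
  "fourier_bcf g u = Bcontfun (\<lambda>s. LINT \<omega>|lborel. iexp (- (s * \<omega>)) * u \<omega> * g \<omega>)"

context
  fixes g :: "real \<Rightarrow> complex"
  assumes g: "integrable lborel g"
begin

lemma integrable_bounded_mult:
  assumes [measurable]: "u \<in> borel_measurable borel" and C: "\<And>\<omega>. norm (u \<omega>) \<le> C"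
  shows "integrable lborel (\<lambda>\<omega>. u \<omega> * g \<omega>)"
proof (rule Bochner_Integration.integrable_bound)
  show "integrable lborel (\<lambda>\<omega>. C * norm (g \<omega>))" using g by simp
  have [measurable]: "g \<in> borel_measurable borel" using g by auto
  show "(\<lambda>\<omega>. u \<omega> * g \<omega>) \<in> borel_measurable lborel" by simp
  show "AE \<omega> in lborel. norm (u \<omega> * g \<omega>) \<le> norm (C * norm (g \<omega>))"
  proof (intro always_eventually allI)
    fix \<omega>
    have "0 \<le> C" using order_trans[OF norm_ge_zero C] .
    then show "norm (u \<omega> * g \<omega>) \<le> norm (C * norm (g \<omega>))"
      using mult_right_mono[OF C, of "norm (g \<omega>)"] by (simp add: norm_mult abs_mult)
  qed
qed

lemma fourier_integrand_integrable:
  assumes [measurable]: "u \<in> borel_measurable borel" and C: "\<And>\<omega>. norm (u \<omega>) \<le> C"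
  shows "integrable lborel (\<lambda>\<omega>. iexp (- (s * \<omega>)) * u \<omega> * g \<omega>)"
  by (rule integrable_bounded_mult[of _ C]) (use C in \<open>auto simp: norm_mult\<close>)

lemma fourier_bcontfun:
  assumes [measurable]: "u \<in> borel_measurable borel" and C: "\<And>\<omega>. norm (u \<omega>) \<le> C"
  shows "(\<lambda>s. LINT \<omega>|lborel. iexp (- (s * \<omega>)) * u \<omega> * g \<omega>) \<in> bcontfun"
proof (rule bcontfun_normI)
  note I = fourier_integrand_integrable[OF assms] integrable_bounded_mult[OF assms]
  have [measurable]: "g \<in> borel_measurable borel" using g by auto
  show "continuous_on UNIV (\<lambda>s. LINT \<omega>|lborel. iexp (- (s * \<omega>)) * u \<omega> * g \<omega>)"
    unfolding continuous_on_sequentially o_def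
  proof safe
    fix s :: real and t :: "nat \<Rightarrow> real" assume t: "t \<longlonglongrightarrow> s"
    show "(\<lambda>n. LINT \<omega>|lborel. iexp (- (t n * \<omega>)) * u \<omega> * g \<omega>) \<longlonglongrightarrow> (LINT \<omega>|lborel. iexp (- (s * \<omega>)) * u \<omega> * g \<omega>)"
    proof (rule integral_dominated_convergence[where w="\<lambda>\<omega>. norm (u \<omega> * g \<omega>)"])
      show "integrable lborel (\<lambda>\<omega>. norm (u \<omega> * g \<omega>))" using I(2) by simp
      show "AE \<omega> in lborel. (\<lambda>n. iexp (- (t n * \<omega>)) * u \<omega> * g \<omega>) \<longlonglongrightarrow> iexp (- (s * \<omega>)) * u \<omega> * g \<omega>"
        using t by (intro always_eventually allI tendsto_intros)
    qed (auto simp: norm_mult)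
  qed
  show "norm (LINT \<omega>|lborel. iexp (- (s * \<omega>)) * u \<omega> * g \<omega>) \<le> (LINT \<omega>|lborel. norm (u \<omega> * g \<omega>))" for s
    by (rule order_trans[OF integral_norm_bound]) (simp add: norm_mult)
qed

lemma apply_fourier_bcf:
  assumes "u \<in> borel_measurable borel" "\<And>\<omega>. norm (u \<omega>) \<le> C"
  shows "fourier_bcf g u s = (LINT \<omega>|lborel. iexp (- (s * \<omega>)) * u \<omega> * g \<omega>)"
  unfolding fourier_bcf_def by (subst Bcontfun_inverse[OF fourier_bcontfun[OF assms]]) (rule refl)

text \<open>The supremum over s is exchanged for an integral over \<omega>, to which Fubini's
  theorem and dominated convergence apply.\<close>

lemma dist_fourier_bcf_le:
  assumes u: "u \<in> borel_measurable borel" "\<And>\<omega>. norm (u \<omega>) \<le> C"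
    and v: "v \<in> borel_measurable borel" "\<And>\<omega>. norm (v \<omega>) \<le> D"
  shows "dist (fourier_bcf g u) (fourier_bcf g v) \<le> (LINT \<omega>|lborel. norm (u \<omega> - v \<omega>) * norm (g \<omega>))"
proof (rule dist_bound)
  fix s
  have "dist (fourier_bcf g u s) (fourier_bcf g v s) =
     norm (LINT \<omega>|lborel. iexp (- (s * \<omega>)) * u \<omega> * g \<omega> - iexp (- (s * \<omega>)) * v \<omega> * g \<omega>)"
    unfolding dist_norm apply_fourier_bcf[OF u] apply_fourier_bcf[OF v]
    by (subst Bochner_Integration.integral_diff[OF fourier_integrand_integrable[OF u] fourier_integrand_integrable[OF v]]) (rule refl)
  also have "\<dots> \<le> (LINT \<omega>|lborel. norm (iexp (- (s * \<omega>)) * u \<omega> * g \<omega> - iexp (- (s * \<omega>)) * v \<omega> * g \<omega>))"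
    by (rule integral_norm_bound)
  also have "\<dots> = (LINT \<omega>|lborel. norm (u \<omega> - v \<omega>) * norm (g \<omega>))"
    by (intro Bochner_Integration.integral_cong refl)
       (simp add: norm_mult[symmetric] left_diff_distrib[symmetric] right_diff_distrib[symmetric] mult.assoc, simp add: norm_mult)
  finally show "dist (fourier_bcf g u s) (fourier_bcf g v s) \<le> (LINT \<omega>|lborel. norm (u \<omega> - v \<omega>) * norm (g \<omega>))" .
qed

lemma fourier_bcf_tendsto:
  assumes u: "\<And>n. u n \<in> borel_measurable borel" "\<And>n \<omega>. norm (u n \<omega>) \<le> C"
    and lim: "\<And>\<omega>. (\<lambda>n. u n \<omega>) \<longlonglongrightarrow> v \<omega>"
  shows "(\<lambda>n. fourier_bcf g (u n)) \<longlonglongrightarrow> fourier_bcf g v"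
proof -
  have v: "v \<in> borel_measurable borel" by (rule borel_measurable_LIMSEQ_metric[OF u(1)]) (use lim in auto)
  have vC: "norm (v \<omega>) \<le> C" for \<omega>
    by (rule LIMSEQ_le_const2[OF tendsto_norm[OF lim]]) (use u in auto)
  note [measurable] = u(1) v
  have [measurable]: "g \<in> borel_measurable borel" using g by auto
  have "(\<lambda>n. LINT \<omega>|lborel. norm (u n \<omega> - v \<omega>) * norm (g \<omega>)) \<longlonglongrightarrow> (LINT \<omega>|(lborel::real measure). 0)"
  proof (rule integral_dominated_convergence[where w="\<lambda>\<omega>. (C + C) * norm (g \<omega>)"])
    show "integrable lborel (\<lambda>\<omega>. (C + C) * norm (g \<omega>))" using g by simp
    show "AE \<omega> in lborel. (\<lambda>n. norm (u n \<omega> - v \<omega>) * norm (g \<omega>)) \<longlonglongrightarrow> 0"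
    proof (intro always_eventually allI)
      fix \<omega>
      have "(\<lambda>n. norm (u n \<omega> - v \<omega>)) \<longlonglongrightarrow> 0" using lim by (simp add: LIM_zero tendsto_norm_zero)
      then show "(\<lambda>n. norm (u n \<omega> - v \<omega>) * norm (g \<omega>)) \<longlonglongrightarrow> 0" by (rule tendsto_mult_left_zero)
    qed
    show "AE \<omega> in lborel. norm (norm (u n \<omega> - v \<omega>) * norm (g \<omega>)) \<le> (C + C) * norm (g \<omega>)" for n
    proof (intro always_eventually allI)
      fix \<omega>
      have "norm (u n \<omega> - v \<omega>) \<le> C + C"
        by (rule order_trans[OF norm_triangle_ineq4 add_mono[OF u(2) vC]])
      then show "norm (norm (u n \<omega> - v \<omega>) * norm (g \<omega>)) \<le> (C + C) * norm (g \<omega>)"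
        using mult_right_mono[of "norm (u n \<omega> - v \<omega>)" "C + C" "norm (g \<omega>)"] by simp
    qed
  qed auto
  then have "(\<lambda>n. LINT \<omega>|lborel. norm (u n \<omega> - v \<omega>) * norm (g \<omega>)) \<longlonglongrightarrow> 0" by simp
  then have "(\<lambda>n. dist (fourier_bcf g (u n)) (fourier_bcf g v)) \<longlonglongrightarrow> 0"
  proof (rule Lim_null_comparison[rotated], intro always_eventually allI)
    show "norm (dist (fourier_bcf g (u n)) (fourier_bcf g v)) \<le> (LINT \<omega>|lborel. norm (u n \<omega> - v \<omega>) * norm (g \<omega>))" for n
      unfolding real_norm_def abs_of_nonneg[OF zero_le_dist] by (rule dist_fourier_bcf_le[OF u v vC])
  qed
  then show ?thesis by (rule iffD2[OF tendsto_dist_iff])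
qed

text \<open>The space of bounded continuous functions is not separable; measurability is inherited from
  continuous functions of finitely many samples.\<close>
lemma fourier_bcf_measurable:
  fixes t :: "nat \<Rightarrow> real \<Rightarrow> (nat \<Rightarrow> real) \<Rightarrow> complex"
  assumes t: "\<And>n y. (\<lambda>\<omega>. t n \<omega> y) \<in> borel_measurable borel" "\<And>n \<omega>. continuous_on UNIV (t n \<omega>)"
      "\<And>n \<omega> y. norm (t n \<omega> y) \<le> C"
    and y: "\<And>n k. (\<lambda>w. y n w k) \<in> borel_measurable M"
    and lim: "\<And>\<omega> w. w \<in> space M \<Longrightarrow> (\<lambda>n. t n \<omega> (y n w)) \<longlonglongrightarrow> u w \<omega>"
  shows "(\<lambda>w. fourier_bcf g (u w)) \<in> borel_measurable M"
proof (rule borel_measurable_LIMSEQ_metric)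
  fix n
  \<comment> \<open>A continuous map is Borel whatever its target. Its source, a sequence of
    samples, has a Borel algebra generated by the coordinates, so measurability of each sample
    suffices.\<close>
  have "continuous_on UNIV (\<lambda>y. fourier_bcf g (\<lambda>\<omega>. t n \<omega> y))"
    unfolding continuous_on_sequentially o_def
  proof safe
    fix x :: "nat \<Rightarrow> nat \<Rightarrow> real" and a assume "x \<longlonglongrightarrow> a"
    then show "(\<lambda>k. fourier_bcf g (\<lambda>\<omega>. t n \<omega> (x k))) \<longlonglongrightarrow> fourier_bcf g (\<lambda>\<omega>. t n \<omega> a)"
      using t(2)[of n] by (intro fourier_bcf_tendsto[OF t(1,3)]) (simp add: continuous_on_sequentially o_def)
  qed
  then have "(\<lambda>y. fourier_bcf g (\<lambda>\<omega>. t n \<omega> y)) \<in> borel_measurable borel"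
    by (rule borel_measurable_continuous_onI)
  moreover have "y n \<in> borel_measurable M"
    by (rule measurable_coordinatewise_then_product) (rule y)
  ultimately show "(\<lambda>w. fourier_bcf g (\<lambda>\<omega>. t n \<omega> (y n w))) \<in> borel_measurable M"
    by (rule measurable_compose[rotated])
next
  fix w assume "w \<in> space M"
  then show "(\<lambda>n. fourier_bcf g (\<lambda>\<omega>. t n \<omega> (y n w))) \<longlonglongrightarrow> fourier_bcf g (u w)"
    by (intro fourier_bcf_tendsto[OF t(1,3)] lim)
qed

end

section \<open>The Euler scheme of the two-mode system and its measurability\<close>

definition mode_step :: "real \<Rightarrow> real \<Rightarrow> real \<Rightarrow> real \<Rightarrow> complex \<times> complex \<Rightarrow> complex \<times> complex" where
  "mode_step \<omega> c s v x = (\<i> * \<omega> / 2 * v * (fst x - iexp (- (c * s)) * snd x), \<i> * \<omega> / 2 * v * (iexp (c * s) * fst x - snd x))"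

text \<open>The argument is a whole sequence, although only its entries 0 to n enter, so that one
  type serves every n.\<close>

definition mode_euler :: "real \<Rightarrow> real \<Rightarrow> real \<Rightarrow> nat \<Rightarrow> (nat \<Rightarrow> real) \<Rightarrow> complex" where
  "mode_euler T \<omega> c n y =
     fst (euler (\<lambda>k. mode_step \<omega> c (T * real k / real (Suc n)) (y k)) (T / real (Suc n)) (1, 0) (Suc n))"

lemma (in two_mode_system) mode_euler_tendsto:
  "(\<lambda>n. mode_euler T \<omega> c n (\<lambda>k. \<nu> (T * real k / real (Suc n)))) \<longlonglongrightarrow> \<alpha> T"
proof -
  obtain B where B: "\<And>x. x \<in> {0..T} \<Longrightarrow> \<bar>\<nu> x\<bar> \<le> B"
    using compact_imp_bounded[OF compact_continuous_image[OF \<nu> compact_Icc]] unfolding bounded_iff real_norm_def by (metis imageI)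
  have B0: "0 \<le> B" using T order_trans[OF abs_ge_zero B[of 0]] by simp
  have ca: "continuous_on {0..T} \<alpha>" and cb: "continuous_on {0..T} \<beta>"
    using has_vector_derivative_continuous[OF \<alpha>] has_vector_derivative_continuous[OF \<beta>] by (auto simp: continuous_on_eq_continuous_within)
  have "(\<lambda>n. euler (\<lambda>k. mode_step \<omega> c (T * real k / real (Suc n)) (\<nu> (T * real k / real (Suc n)))) (T / real (Suc n)) (\<alpha> 0, \<beta> 0) (Suc n)) \<longlonglongrightarrow> (\<alpha> T, \<beta> T)"
  proof (rule euler_tendsto[where x="\<lambda>s. (\<alpha> s, \<beta> s)" and F="\<lambda>s. mode_step \<omega> c s (\<nu> s)", OF T])
    show "((\<lambda>s. (\<alpha> s, \<beta> s)) has_vector_derivative mode_step \<omega> c s (\<nu> s) (\<alpha> s, \<beta> s)) (at s within {0..T})" if "s \<in> {0..T}" for s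
      unfolding mode_step_def fst_conv snd_conv by (rule has_vector_derivative_Pair[OF \<alpha>[OF that] \<beta>[OF that]])
    show "continuous_on {0..T} (\<lambda>s. mode_step \<omega> c s (\<nu> s) (\<alpha> s, \<beta> s))"
      unfolding mode_step_def fst_conv snd_conv by (intro continuous_intros ca cb \<nu>)
    show "norm (mode_step \<omega> c s (\<nu> s) y - mode_step \<omega> c s (\<nu> s) z) \<le> (\<bar>\<omega>\<bar> * B * 2) * norm (y - z)" if s: "s \<in> {0..T}" for s y z
    proof -
      define u where "u = y - z"
      have n1: "norm (fst u) \<le> norm u" "norm (snd u) \<le> norm u"
        using norm_fst_le[of "fst u" "snd u"] norm_snd_le[of "snd u" "fst u"] by simp_all
      let ?w = "mode_step \<omega> c s (\<nu> s) u"
      have e: "mode_step \<omega> c s (\<nu> s) y - mode_step \<omega> c s (\<nu> s) z = ?w"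
        by (simp add: mode_step_def u_def algebra_simps prod_eq_iff)
      have f: "norm (fst u - iexp (- (c * s)) * snd u) \<le> norm u + norm u"
        using n1 by (intro order_trans[OF norm_triangle_ineq4] add_mono) (simp_all add: norm_mult)
      have g: "norm (iexp (c * s) * fst u - snd u) \<le> norm u + norm u"
        using n1 by (intro order_trans[OF norm_triangle_ineq4] add_mono) (simp_all add: norm_mult)
      have k: "norm (\<i> * complex_of_real \<omega> / 2 * complex_of_real (\<nu> s)) \<le> \<bar>\<omega>\<bar> / 2 * B"
        using mult_left_mono[OF B[OF s], of "\<bar>\<omega>\<bar> / 2"] by (simp add: norm_mult)
      have "norm (fst ?w) \<le> \<bar>\<omega>\<bar> / 2 * B * (norm u + norm u)" "norm (snd ?w) \<le> \<bar>\<omega>\<bar> / 2 * B * (norm u + norm u)"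
        unfolding mode_step_def fst_conv snd_conv norm_mult[of "\<i> * complex_of_real \<omega> / 2 * complex_of_real (\<nu> s)"]
        using mult_mono[OF k f] mult_mono[OF k g] B0 by simp_all
      moreover have "norm ?w \<le> norm (fst ?w) + norm (snd ?w)" by (metis norm_Pair_le prod.collapse)
      ultimately show ?thesis unfolding e by (simp add: u_def algebra_simps)
    qed
  qed (use B0 in simp)
  from tendsto_fst[OF this] show ?thesis using init by (simp add: mode_euler_def)
qed

lemma mode_step_measurable:
  assumes [measurable]: "\<omega> \<in> borel_measurable N" "c \<in> borel_measurable N" "y \<in> borel_measurable N"
    and E: "E \<in> borel_measurable N"
  shows "(\<lambda>x. mode_step (\<omega> x) (c x) s (y x) (E x)) \<in> borel_measurable N"
proof -
  have "fst \<in> borel_measurable (borel :: (complex \<times> complex) measure)" "snd \<in> borel_measurable (borel :: (complex \<times> complex) measure)"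
    by (intro borel_measurable_continuous_onI continuous_intros)+
  note [measurable] = measurable_compose[OF E this(1)] measurable_compose[OF E this(2)]
  show ?thesis unfolding mode_step_def by (intro borel_measurable_Pair) measurable
qed

lemma mode_euler_measurable:
  assumes m: "\<omega> \<in> borel_measurable N" "c \<in> borel_measurable N" "\<And>k. y k \<in> borel_measurable N"
  shows "(\<lambda>x. mode_euler T (\<omega> x) (c x) n (\<lambda>k. y k x)) \<in> borel_measurable N"
proof -
  have "(\<lambda>x. euler (\<lambda>k. mode_step (\<omega> x) (c x) (T * real k / real (Suc n)) (y k x)) (T / real (Suc n)) (1, 0) j) \<in> borel_measurable N" for j
  proof (induction j)
    case (Suc j)
    show ?case unfolding euler.simps
      by (intro borel_measurable_add borel_measurable_scaleR borel_measurable_const mode_step_measurable Suc m)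
  qed simp
  from this[of "Suc n"] show ?thesis unfolding mode_euler_def
    by (rule measurable_compose) (intro borel_measurable_continuous_onI continuous_intros)
qed

lemma mode_euler_continuous: "continuous_on UNIV (mode_euler T \<omega> c n)"
proof -
  have y: "continuous_on UNIV (\<lambda>y::nat \<Rightarrow> real. y k)" for k by (rule continuous_on_product_coordinates)
  have "continuous_on UNIV (\<lambda>y. euler (\<lambda>k. mode_step \<omega> c (T * real k / real (Suc n)) (y k)) (T / real (Suc n)) (1, 0) j)" for j
  proof (induction j)
    case (Suc j)
    then show ?case unfolding euler.simps mode_step_def by (intro continuous_intros y)
  qed simp
  then show ?thesis unfolding mode_euler_def[abs_def] by (intro continuous_intros)
qed

text \<open>Agrees with \<open>1 / cnj z\<close> where \<open>\<bar>z\<bar> \<ge> 1\<close>, as is the case for the exact solution, and is bounded and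
  continuous everywhere, hence also applicable to the Euler approximations.\<close>
definition inv_cnj :: "complex \<Rightarrow> complex" where
  "inv_cnj z = z / complex_of_real (max 1 ((norm z)\<^sup>2))"

lemma inv_cnj_eq: "1 \<le> norm z \<Longrightarrow> inv_cnj z = 1 / cnj z"
proof -
  assume z: "1 \<le> norm z"
  then have "1 \<le> (norm z)\<^sup>2" by simp
  then have "inv_cnj z = z / (z * cnj z)" by (simp add: inv_cnj_def max_absorb2 complex_norm_square[symmetric])
  then show ?thesis using z by auto
qed

lemma norm_inv_cnj_le: "norm (inv_cnj z) \<le> 1"
proof -
  have "norm z \<le> max 1 ((norm z)\<^sup>2)"
  proof (cases "norm z \<le> 1")
    case False
    then have "norm z * 1 \<le> norm z * norm z" by (intro mult_left_mono) auto
    then show ?thesis by (simp add: power2_eq_square le_max_iff_disj)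
  qed simp
  then show ?thesis unfolding inv_cnj_def norm_divide norm_of_real by (simp add: divide_le_eq)
qed

lemma inv_cnj_continuous: "continuous_on UNIV inv_cnj"
  unfolding inv_cnj_def[abs_def] by (intro continuous_intros) (auto simp: max_def)

section \<open>The Riemann--Lebesgue lemma\<close>

text \<open>The property is stable under L1 approximation, since the integrals differ by at most the
  L1 distance, uniformly in l. The countable unions and the limits in the inductions below are
  reduced to it.\<close>

lemma oscillating_integral_tendsto_approx:
  fixes F :: "real \<Rightarrow> real"
  assumes F: "integrable lborel F"
    and approx: "\<And>e. 0 < e \<Longrightarrow> \<exists>G. integrable lborel G \<and> (LINT v|lborel. \<bar>F v - G v\<bar>) \<le> e \<and>
       ((\<lambda>l::real. LINT v|lborel. G v *\<^sub>R iexp (l * v)) \<longlongrightarrow> 0) at_infinity"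
  shows "((\<lambda>l::real. LINT v|lborel. F v *\<^sub>R iexp (l * v)) \<longlongrightarrow> 0) at_infinity"
proof (rule tendstoI)
  fix e :: real assume e: "0 < e"
  obtain G where G: "integrable lborel G" "(LINT v|lborel. \<bar>F v - G v\<bar>) \<le> e / 2"
    and lim: "((\<lambda>l::real. LINT v|lborel. G v *\<^sub>R iexp (l * v)) \<longlongrightarrow> 0) at_infinity"
    using approx[of "e / 2"] e by auto
  have I: "integrable lborel (\<lambda>v. H v *\<^sub>R iexp (l * v))" if "integrable lborel H" for H :: "real \<Rightarrow> real" and l
    using that by (rule Bochner_Integration.integrable_bound) (use that in \<open>auto intro!: borel_measurable_scaleR\<close>)
  have "\<forall>\<^sub>F l in at_infinity. norm (LINT v|lborel. G v *\<^sub>R iexp (l * v)) < e / 2"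
    using tendstoD[OF lim, of "e / 2"] e by simp
  then show "\<forall>\<^sub>F l in at_infinity. dist (LINT v|lborel. F v *\<^sub>R iexp (l * v)) 0 < e"
  proof eventually_elim
    case (elim l)
    have "(LINT v|lborel. F v *\<^sub>R iexp (l * v)) - (LINT v|lborel. G v *\<^sub>R iexp (l * v)) =
        (LINT v|lborel. (F v - G v) *\<^sub>R iexp (l * v))"
      by (subst Bochner_Integration.integral_diff[OF I[OF F] I[OF G(1)], symmetric]) (simp add: scaleR_diff_left)
    also have "norm \<dots> \<le> (LINT v|lborel. norm ((F v - G v) *\<^sub>R iexp (l * v)))" by (rule integral_norm_bound)
    also have "\<dots> \<le> e / 2" using G by simp
    finally show ?case
      using elim norm_triangle_sub[of "LINT v|lborel. F v *\<^sub>R iexp (l * v)" "LINT v|lborel. G v *\<^sub>R iexp (l * v)"] by simp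
  qed
qed

lemma oscillating_integral_interval:
  "((\<lambda>l::real. LINT v|lborel. indicator {a..b} v *\<^sub>R iexp (l * v)) \<longlongrightarrow> 0) at_infinity"
proof (cases "a \<le> b")
  case True
  have eq: "norm (LINT v|lborel. indicator {a..b} v *\<^sub>R iexp (l * v)) \<le> 2 / \<bar>l\<bar>" if "l \<noteq> 0" for l
  proof -
    have d: "((\<lambda>v. iexp (l * v) / (\<i> * l)) has_vector_derivative iexp (l * v)) (at v within {a..b})" for v
    proof -
      have "((\<lambda>v. l * v) has_vector_derivative l) (at v within {a..b})"
        by (auto intro!: derivative_eq_intros)
      from vector_diff_chain_within[OF this has_vector_derivative_iexp]
      have "((\<lambda>v. iexp (l * v)) has_vector_derivative l *\<^sub>R (\<i> * iexp (l * v))) (at v within {a..b})"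
        by (simp add: o_def)
      from has_vector_derivative_divide[OF this, of "\<i> * l"] show ?thesis
        using that by (simp add: scaleR_conv_of_real)
    qed
    have "continuous_on {a..b} (\<lambda>v. iexp (l * v))" by (intro continuous_intros)
    from integral_FTC_Icc[OF True d this]
    have "(LINT v|lborel. indicator {a..b} v *\<^sub>R iexp (l * v)) = (iexp (l * b) - iexp (l * a)) / (\<i> * l)"
      by (simp add: diff_divide_distrib)
    also have "norm \<dots> \<le> 2 / \<bar>l\<bar>"
      using norm_triangle_ineq4[of "iexp (l * b)" "iexp (l * a)"]
      by (simp add: norm_divide norm_mult divide_right_mono)
    finally show ?thesis .
  qed
  have "filterlim (\<lambda>l::real. norm l) at_top at_infinity" by (rule filterlim_norm_at_top)
  then have "filterlim (\<lambda>l::real. \<bar>l\<bar>) at_infinity at_infinity"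
    unfolding real_norm_def by (rule filterlim_at_top_imp_at_infinity)
  then have "((\<lambda>l::real. 2 / \<bar>l\<bar>) \<longlongrightarrow> 0) at_infinity"
    by (rule tendsto_divide_0[OF tendsto_const])
  then show ?thesis
    by (rule Lim_null_comparison[rotated]) (use eq in \<open>auto simp: eventually_at_infinity intro!: exI[of _ 1]\<close>)
next
  case False
  then show ?thesis by simp
qed

text \<open>Induction over the Dynkin system generated by intervals. The intersection with a fixed
  interval keeps complements of finite measure.\<close>

lemma oscillating_integral_indicator:
  assumes "A \<in> sets borel"
  shows "((\<lambda>l::real. LINT v|lborel. indicator (A \<inter> {-N..N}) v *\<^sub>R iexp (l * v)) \<longlongrightarrow> 0) at_infinity"
proof -
  let ?I = "{-N..N::real}"
  have Int: "Int_stable (range (\<lambda>(a, b::real). {a..b}))"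
    by (auto simp: Int_stable_def)
  have fin: "integrable lborel (indicator (B \<inter> ?I) :: real \<Rightarrow> real)" if "B \<in> sets borel" for B
  proof (rule integrable_real_indicator)
    have "emeasure lborel (B \<inter> ?I) \<le> emeasure lborel ?I" using that by (intro emeasure_mono) auto
    also have "\<dots> < \<infinity>" by (simp add: emeasure_lborel_Icc_eq)
    finally show "emeasure lborel (B \<inter> ?I) < \<infinity>" .
  qed (use that in auto)
  have fin': "integrable lborel (\<lambda>v. indicator (B \<inter> ?I) v *\<^sub>R iexp (l * v))" if "B \<in> sets borel" for B l
    by (rule Bochner_Integration.integrable_bound[OF fin[OF that]]) (use that in auto)
  have G: "range (\<lambda>(a, b::real). {a..b}) \<subseteq> Pow UNIV" by simp
  have "A \<in> sigma_sets UNIV (range (\<lambda>(a, b::real). {a..b}))"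
    using assms by (simp add: borel_eq_atLeastAtMost)
  with Int G show ?thesis
  proof (induction rule: sigma_sets_induct_disjoint)
    case (basic A)
    then obtain a b where "A = {a..b}" by auto
    then have "A \<inter> ?I = {max a (-N)..min b N}" by auto
    then show ?case by (simp only: oscillating_integral_interval)
  next
    case empty show ?case by simp
  next
    case (compl A)
    then have A: "A \<in> sets borel" by (simp add: borel_eq_atLeastAtMost)
    have "(LINT v|lborel. indicator ((UNIV - A) \<inter> ?I) v *\<^sub>R iexp (l * v)) =
      (LINT v|lborel. indicator ?I v *\<^sub>R iexp (l * v)) - (LINT v|lborel. indicator (A \<inter> ?I) v *\<^sub>R iexp (l * v))" for l
    proof -
      have I: "integrable lborel (\<lambda>v. indicator ?I v *\<^sub>R iexp (l * v))" using fin'[of UNIV l] by simp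
      show ?thesis
        unfolding Bochner_Integration.integral_diff[OF I fin'[OF A], symmetric]
        by (intro Bochner_Integration.integral_cong) (auto split: split_indicator)
    qed
    then show ?case using tendsto_diff[OF oscillating_integral_interval[of "-N" N] compl(2)] by simp
  next
    case (union A)
    then have A: "range A \<subseteq> sets borel" by (simp add: borel_eq_atLeastAtMost)
    have [measurable]: "A n \<in> sets borel" for n using A by auto
    show ?case
    proof (rule oscillating_integral_tendsto_approx)
      show "integrable lborel (indicator (\<Union> (range A) \<inter> ?I) :: real \<Rightarrow> real)" using A by (intro fin) auto
      fix e :: real assume e: "0 < e"
      let ?G = "\<lambda>n v. indicator ((\<Union>i<n. A i) \<inter> ?I) v :: real"
      have "(\<lambda>n. LINT v|lborel. \<bar>indicator (\<Union> (range A) \<inter> ?I) v - ?G n v\<bar>) \<longlonglongrightarrow> (LINT v|(lborel::real measure). 0)"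
      proof (rule integral_dominated_convergence[where w="indicator (UNIV \<inter> ?I)"])
        show "AE v in lborel. (\<lambda>n. \<bar>indicator (\<Union> (range A) \<inter> ?I) v - ?G n v\<bar>) \<longlonglongrightarrow> (0::real)"
        proof (intro always_eventually allI)
          fix v
          show "(\<lambda>n. \<bar>indicator (\<Union> (range A) \<inter> ?I) v - ?G n v\<bar>) \<longlonglongrightarrow> (0::real)"
          proof (cases "\<exists>i. v \<in> A i")
            case True
            then obtain i where i: "v \<in> A i" ..
            have "\<forall>\<^sub>F n in sequentially. \<bar>indicator (\<Union> (range A) \<inter> ?I) v - ?G n v\<bar> = (0::real)"
              using eventually_gt_at_top[of i] by eventually_elim (use i in \<open>auto split: split_indicator\<close>)
            then show ?thesis by (rule tendsto_eventually)
          next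
            case False
            then have "(\<lambda>n. \<bar>indicator (\<Union> (range A) \<inter> ?I) v - ?G n v\<bar>) = (\<lambda>n. 0::real)" by auto
            then show ?thesis by simp
          qed
        qed
        show "integrable lborel (indicator (UNIV \<inter> ?I) :: real \<Rightarrow> real)" by (rule fin) simp
      qed (auto split: split_indicator)
      then obtain n where n: "(LINT v|lborel. \<bar>indicator (\<Union> (range A) \<inter> ?I) v - ?G n v\<bar>) < e"
        using order_tendstoD(2)[of _ "0::real" sequentially e] e eventually_happens by fastforce
      have "(LINT v|lborel. ?G n v *\<^sub>R iexp (l * v)) = (\<Sum>i<n. LINT v|lborel. indicator (A i \<inter> ?I) v *\<^sub>R iexp (l * v))" for l
      proof -
        have "?G n v = (\<Sum>i<n. indicator (A i \<inter> ?I) v)" for v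
        proof -
          have eq: "(\<Union>i<n. A i) \<inter> ?I = (\<Union>i<n. A i \<inter> ?I)" by auto
          have "disjoint_family_on (\<lambda>i. A i \<inter> ?I) {..<n}" using union(1) by (auto simp: disjoint_family_on_def)
          then show ?thesis unfolding eq by (intro indicator_UN_disjoint) auto
        qed
        note this[abs_def]
        then show ?thesis unfolding scaleR_sum_left
          by (simp only: scaleR_sum_left) (rule Bochner_Integration.integral_sum, rule fin', simp)
      qed
      moreover have "((\<lambda>l::real. \<Sum>i<n. LINT v|lborel. indicator (A i \<inter> ?I) v *\<^sub>R iexp (l * v)) \<longlongrightarrow> (\<Sum>i<n. 0)) at_infinity"
        by (intro tendsto_sum union)
      ultimately have "((\<lambda>l::real. LINT v|lborel. ?G n v *\<^sub>R iexp (l * v)) \<longlongrightarrow> 0) at_infinity" by simp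
      moreover have "integrable lborel (?G n)" by (rule fin) auto
      ultimately show "\<exists>G. integrable lborel G \<and> (LINT v|lborel. \<bar>indicator (\<Union> (range A) \<inter> ?I) v - G v\<bar>) \<le> e \<and>
        ((\<lambda>l::real. LINT v|lborel. G v *\<^sub>R iexp (l * v)) \<longlongrightarrow> 0) at_infinity"
        using n by (intro exI[of _ "?G n"]) auto
    qed
  qed
qed

text \<open>The induction over integrable functions starts from indicators of sets of finite
  measure, which are truncated to bounded sets first.\<close>

theorem riemann_lebesgue:
  fixes F :: "real \<Rightarrow> real"
  assumes "integrable lborel F"
  shows "((\<lambda>l::real. LINT v|lborel. F v *\<^sub>R iexp (l * v)) \<longlongrightarrow> 0) at_infinity"
  using assms
proof (induction rule: integrable_induct)
  case (base A c)
  then have A[measurable]: "A \<in> sets borel" and fin: "emeasure lborel A < \<infinity>" by auto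
  have I: "integrable lborel (indicator B :: real \<Rightarrow> real)" if "B \<subseteq> A" "B \<in> sets borel" for B
  proof (rule integrable_real_indicator)
    have "emeasure lborel B \<le> emeasure lborel A" using that by (intro emeasure_mono) auto
    then show "emeasure lborel B < \<infinity>" using fin by (rule order.strict_trans1)
  qed (use that in auto)
  show ?case
  proof (rule oscillating_integral_tendsto_approx)
    show "integrable lborel (\<lambda>x. indicator A x *\<^sub>R c)" using I[of A] A by simp
    fix e :: real assume e: "0 < e"
    let ?G = "\<lambda>n::nat. \<lambda>v. indicator (A \<inter> {-real n..real n}) v * c :: real"
    have "(\<lambda>n. LINT v|lborel. \<bar>indicator A v *\<^sub>R c - ?G n v\<bar>) \<longlonglongrightarrow> (LINT v|(lborel::real measure). 0)"
    proof (rule integral_dominated_convergence[where w="\<lambda>v. indicator A v * \<bar>c\<bar>"])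
      show "AE v in lborel. (\<lambda>n. \<bar>indicator A v *\<^sub>R c - ?G n v\<bar>) \<longlonglongrightarrow> 0"
      proof (intro always_eventually allI)
        fix v :: real
        obtain m :: nat where m: "\<bar>v\<bar> < real m" using reals_Archimedean2 by blast
        have "\<forall>\<^sub>F n in sequentially. \<bar>indicator A v *\<^sub>R c - ?G n v\<bar> = 0"
          using eventually_ge_at_top[of m] by eventually_elim (use m in \<open>auto split: split_indicator\<close>)
        then show "(\<lambda>n. \<bar>indicator A v *\<^sub>R c - ?G n v\<bar>) \<longlonglongrightarrow> 0" by (rule tendsto_eventually)
      qed
      show "integrable lborel (\<lambda>v. indicator A v * \<bar>c\<bar>)" using I[of A] A by simp
    qed (auto split: split_indicator)
    then obtain n where n: "(LINT v|lborel. \<bar>indicator A v *\<^sub>R c - ?G n v\<bar>) < e"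
      using order_tendstoD(2)[of _ "0::real" sequentially e] e eventually_happens by fastforce
    have "(LINT v|lborel. ?G n v *\<^sub>R iexp (l * v)) = c *\<^sub>R (LINT v|lborel. indicator (A \<inter> {-real n..real n}) v *\<^sub>R iexp (l * v))" for l
      by (subst integral_scaleR_right[symmetric]) (simp add: mult_ac)
    moreover have "((\<lambda>l::real. c *\<^sub>R (LINT v|lborel. indicator (A \<inter> {-real n..real n}) v *\<^sub>R iexp (l * v))) \<longlongrightarrow> c *\<^sub>R 0) at_infinity"
      by (intro tendsto_intros oscillating_integral_indicator A)
    ultimately have "((\<lambda>l::real. LINT v|lborel. ?G n v *\<^sub>R iexp (l * v)) \<longlongrightarrow> 0) at_infinity" by simp
    moreover have "integrable lborel (?G n)" by (intro integrable_mult_left I) auto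
    ultimately show "\<exists>G. integrable lborel G \<and> (LINT v|lborel. \<bar>indicator A v *\<^sub>R c - G v\<bar>) \<le> e \<and>
        ((\<lambda>l::real. LINT v|lborel. G v *\<^sub>R iexp (l * v)) \<longlongrightarrow> 0) at_infinity"
      using n by (intro exI[of _ "?G n"]) auto
  qed
next
  case (add f g)
  have I: "integrable lborel (\<lambda>v. H v *\<^sub>R iexp (l * v))" if "integrable lborel H" for H :: "real \<Rightarrow> real" and l
    using that by (rule Bochner_Integration.integrable_bound) (use that in \<open>auto intro!: borel_measurable_scaleR\<close>)
  show ?case using tendsto_add[OF add(3,4)] I[OF add(1)] I[OF add(2)]
    by (simp add: scaleR_add_left Bochner_Integration.integral_add)
next
  case (lim f s)
  show ?case
  proof (rule oscillating_integral_tendsto_approx[OF lim(4)])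
    fix e :: real assume e: "0 < e"
    have "(\<lambda>i. LINT v|lborel. \<bar>f v - s i v\<bar>) \<longlonglongrightarrow> (LINT v|(lborel::real measure). 0)"
    proof (rule integral_dominated_convergence[where w="\<lambda>v. 3 * \<bar>f v\<bar>"])
      show "AE v in lborel. (\<lambda>i. \<bar>f v - s i v\<bar>) \<longlonglongrightarrow> 0"
      proof (intro always_eventually allI)
        fix v
        have "(\<lambda>i. \<bar>f v - s i v\<bar>) \<longlonglongrightarrow> \<bar>f v - f v\<bar>" using lim(2)[of v] by (intro tendsto_intros) auto
        then show "(\<lambda>i. \<bar>f v - s i v\<bar>) \<longlonglongrightarrow> 0" by simp
      qed
      show "AE v in lborel. norm \<bar>f v - s i v\<bar> \<le> 3 * \<bar>f v\<bar>" for i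
      proof (intro always_eventually allI)
        show "norm \<bar>f v - s i v\<bar> \<le> 3 * \<bar>f v\<bar>" for v using lim(3)[of v i] abs_triangle_ineq4[of "f v" "s i v"] by simp
      qed
    qed (use lim in auto)
    then obtain n where "(LINT v|lborel. \<bar>f v - s n v\<bar>) < e"
      using order_tendstoD(2)[of _ "0::real" sequentially e] e eventually_happens by fastforce
    then show "\<exists>G. integrable lborel G \<and> (LINT v|lborel. \<bar>f v - G v\<bar>) \<le> e \<and>
        ((\<lambda>l::real. LINT v|lborel. G v *\<^sub>R iexp (l * v)) \<longlongrightarrow> 0) at_infinity"
      using lim(1,5) by (intro exI[of _ "s n"]) auto
  qed
qed

section \<open>Fourier inversion\<close>

lemma integral_iexp_gaussian:
  assumes n: "0 < (n::real)"
  shows "(LINT \<omega>|lborel. iexp (\<omega> * y) * complex_of_real (exp (- (\<omega> / n)\<^sup>2 / 2))) = complex_of_real (n * sqrt (2 * pi) * exp (- (n * y)\<^sup>2 / 2))"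
proof -
  have "(LINT \<omega>|lborel. iexp (\<omega> * y) * complex_of_real (exp (- (\<omega> / n)\<^sup>2 / 2))) =
      \<bar>n\<bar> *\<^sub>R (LINT x|lborel. iexp ((0 + n * x) * y) * complex_of_real (exp (- ((0 + n * x) / n)\<^sup>2 / 2)))"
    using n by (intro lborel_integral_real_affine) simp
  also have "(LINT x|lborel. iexp ((0 + n * x) * y) * complex_of_real (exp (- ((0 + n * x) / n)\<^sup>2 / 2))) =
     (LINT x|lborel. sqrt (2 * pi) *\<^sub>R (std_normal_density x *\<^sub>R iexp (n * y * x)))"
    using n by (intro Bochner_Integration.integral_cong refl) (simp add: std_normal_density_def scaleR_conv_of_real mult_ac)
  also have "\<dots> = sqrt (2 * pi) *\<^sub>R (LINT x|std_normal_distribution. iexp (n * y * x))"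
    by (subst integral_density) (auto simp del: scaleR_scaleR)
  also have "(LINT x|std_normal_distribution. iexp (n * y * x)) = char std_normal_distribution (n * y)"
    by (simp add: char_def)
  finally show ?thesis using n by (simp add: char_std_normal_distribution scaleR_conv_of_real)
qed

lemma fourier_measurable:
  assumes f: "integrable lborel f"
  shows "fourier f \<in> borel_measurable borel"
proof -
  have [measurable]: "f \<in> borel_measurable borel" using f by auto
  show ?thesis unfolding fourier_def[abs_def] by measurable
qed

text \<open>f need not be bounded. Away from s its own share is bounded by the L1 norm times the
  largest value \<open>?c n\<close> of the density at distance d, and the share of the constant
  \<open>f s\<close> by Chebyshev's inequality; near s continuity is used.\<close>

lemma gaussian_mollifier_tendsto:
  fixes f :: "real \<Rightarrow> real"
  assumes f: "integrable lborel f" and cont: "isCont f s"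
  shows "(\<lambda>n. LINT t|lborel. f t * normal_density s (1 / real (Suc n)) t) \<longlonglongrightarrow> f s"
proof (rule LIMSEQ_I)
  fix r :: real assume r: "0 < r"
  have [measurable]: "f \<in> borel_measurable borel" using f by auto
  obtain d where d: "0 < d" "\<And>t. \<bar>t - s\<bar> < d \<Longrightarrow> \<bar>f t - f s\<bar> < r / 2"
    using cont r unfolding continuous_at_eps_delta dist_real_def by (metis half_gt_zero)
  let ?N = "\<lambda>n t. normal_density s (1 / real (Suc n)) t"
  let ?c = "\<lambda>n. real (Suc n) / sqrt (2 * pi) * exp (- (real (Suc n) * d)\<^sup>2 / 2)"
  have N: "?N n t = real (Suc n) / sqrt (2 * pi) * exp (- (real (Suc n) * (t - s))\<^sup>2 / 2)" for n t
    by (simp add: normal_density_def real_sqrt_divide real_sqrt_mult power_mult_distrib divide_simps)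
  have Nint: "integrable lborel (?N n)" "(LINT t|lborel. ?N n t) = 1" for n
    by (simp_all add: integral_normal_density integrable_normal_density del: of_nat_Suc)
  have N2: "has_bochner_integral lborel (\<lambda>t. ?N n t * (t - s)\<^sup>2) ((1 / real (Suc n))\<^sup>2)" for n
  proof -
    have e: "fact (2 * 1) / ((2 / (1 / real (Suc n))\<^sup>2) ^ 1 * fact 1) = (1 / real (Suc n))\<^sup>2"
      by (simp add: power2_eq_square del: of_nat_Suc)
    have "0 < 1 / real (Suc n)" by simp
    from normal_moment_even[OF this, of s 1] show ?thesis unfolding e by (simp only: mult_1_right)
  qed
  have fN: "integrable lborel (\<lambda>t. f t * ?N n t)" for n
  proof (rule Bochner_Integration.integrable_bound)
    show "integrable lborel (\<lambda>t. real (Suc n) / sqrt (2 * pi) * f t)" using f by simp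
    show "AE t in lborel. norm (f t * ?N n t) \<le> norm (real (Suc n) / sqrt (2 * pi) * f t)"
    proof (intro AE_I2)
      fix t
      have "?N n t \<le> real (Suc n) / sqrt (2 * pi) * 1" unfolding N by (intro mult_left_mono) auto
      then have "\<bar>f t\<bar> * ?N n t \<le> \<bar>f t\<bar> * (real (Suc n) / sqrt (2 * pi))" by (intro mult_left_mono) auto
      moreover have "norm (f t * ?N n t) = \<bar>f t\<bar> * ?N n t" by (simp add: abs_mult)
      moreover have "norm (real (Suc n) / sqrt (2 * pi) * f t) = \<bar>f t\<bar> * (real (Suc n) / sqrt (2 * pi))"
        by (simp add: abs_mult)
      ultimately show "norm (f t * ?N n t) \<le> norm (real (Suc n) / sqrt (2 * pi) * f t)" by simp
    qed
  qed simp
  have pt: "\<bar>f t - f s\<bar> * ?N n t \<le> r / 2 * ?N n t + \<bar>f t\<bar> * ?c n + \<bar>f s\<bar> / d\<^sup>2 * (?N n t * (t - s)\<^sup>2)" for n t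
  proof (cases "\<bar>t - s\<bar> < d")
    case True
    have "\<bar>f t - f s\<bar> * ?N n t \<le> r / 2 * ?N n t" using d(2)[OF True] by (intro mult_right_mono) auto
    moreover have "0 \<le> \<bar>f t\<bar> * ?c n" "0 \<le> \<bar>f s\<bar> / d\<^sup>2 * (?N n t * (t - s)\<^sup>2)" by auto
    ultimately show ?thesis by linarith
  next
    case False
    then have d2: "d\<^sup>2 \<le> (t - s)\<^sup>2" using d by (simp add: abs_le_square_iff[symmetric])
    have "\<bar>f t - f s\<bar> * ?N n t \<le> \<bar>f t\<bar> * ?N n t + \<bar>f s\<bar> * ?N n t"
      unfolding distrib_right[symmetric] by (intro mult_right_mono) auto
    moreover have "\<bar>f t\<bar> * ?N n t \<le> \<bar>f t\<bar> * ?c n"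
      unfolding N using d2 by (intro mult_left_mono) (auto simp: power_mult_distrib intro!: divide_right_mono mult_left_mono)
    moreover have "\<bar>f s\<bar> * ?N n t \<le> \<bar>f s\<bar> / d\<^sup>2 * (?N n t * (t - s)\<^sup>2)"
    proof -
      have "\<bar>f s\<bar> * ?N n t * 1 \<le> \<bar>f s\<bar> * ?N n t * ((t - s)\<^sup>2 / d\<^sup>2)"
        using d2 d by (intro mult_left_mono) auto
      then show ?thesis by (simp add: mult_ac)
    qed
    moreover have "0 \<le> r / 2 * ?N n t" using r by simp
    ultimately show ?thesis by linarith
  qed
  have bound: "\<bar>(LINT t|lborel. f t * ?N n t) - f s\<bar> \<le>
     r / 2 + (LINT t|lborel. \<bar>f t\<bar>) * ?c n + \<bar>f s\<bar> / d\<^sup>2 * (1 / real (Suc n))\<^sup>2" for n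
  proof -
    have "(LINT t|lborel. f t * ?N n t) - f s = (LINT t|lborel. f t * ?N n t) - (LINT t|lborel. f s * ?N n t)"
      using Nint by simp
    also have "\<dots> = (LINT t|lborel. (f t - f s) * ?N n t)"
      using fN Nint by (subst Bochner_Integration.integral_diff[symmetric]) (auto simp: algebra_simps)
    also have "\<bar>\<dots>\<bar> \<le> (LINT t|lborel. \<bar>(f t - f s) * ?N n t\<bar>)" using integral_norm_bound[of lborel "\<lambda>t. (f t - f s) * ?N n t"] by simp
    also have "\<dots> \<le> (LINT t|lborel. r / 2 * ?N n t + \<bar>f t\<bar> * ?c n + \<bar>f s\<bar> / d\<^sup>2 * (?N n t * (t - s)\<^sup>2))"
    proof (rule integral_mono)
      have "integrable lborel (\<lambda>t. f t * ?N n t - f s * ?N n t)" using fN Nint by simp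
      then show "integrable lborel (\<lambda>t. \<bar>(f t - f s) * ?N n t\<bar>)" by (simp add: algebra_simps)
      show "integrable lborel (\<lambda>t. r / 2 * ?N n t + \<bar>f t\<bar> * ?c n + \<bar>f s\<bar> / d\<^sup>2 * (?N n t * (t - s)\<^sup>2))"
        using f Nint N2 by (auto simp: has_bochner_integral_iff)
      show "\<bar>(f t - f s) * ?N n t\<bar> \<le> r / 2 * ?N n t + \<bar>f t\<bar> * ?c n + \<bar>f s\<bar> / d\<^sup>2 * (?N n t * (t - s)\<^sup>2)" for t
        using pt[of t n] by (simp add: abs_mult)
    qed
    also have "\<dots> = r / 2 + (LINT t|lborel. \<bar>f t\<bar>) * ?c n + \<bar>f s\<bar> / d\<^sup>2 * (1 / real (Suc n))\<^sup>2"
      using f Nint N2[of n] by (simp add: has_bochner_integral_iff del: of_nat_Suc)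
    finally show ?thesis .
  qed
  have c0: "?c \<longlonglongrightarrow> 0"
  proof -
    have lim: "(\<lambda>n::nat. (real (Suc n) / sqrt (2 * pi)) * (2 / (real (Suc n) * d)\<^sup>2)) \<longlonglongrightarrow> 0"
    proof -
      have "(\<lambda>n. 2 / (sqrt (2 * pi) * d\<^sup>2) * inverse (real (Suc n))) \<longlonglongrightarrow> 2 / (sqrt (2 * pi) * d\<^sup>2) * 0"
        by (intro tendsto_intros LIMSEQ_inverse_real_of_nat)
      moreover have "2 / (sqrt (2 * pi) * d\<^sup>2) * inverse x = x / sqrt (2 * pi) * (2 / (x * d)\<^sup>2)" if "x \<noteq> 0" for x
        using that by (simp add: divide_simps power2_eq_square)
      ultimately show ?thesis by (simp del: of_nat_Suc)
    qed
    have le: "norm (?c n) \<le> (real (Suc n) / sqrt (2 * pi)) * (2 / (real (Suc n) * d)\<^sup>2)" for n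
    proof -
      let ?x = "(real (Suc n) * d)\<^sup>2 / 2"
      have x: "0 < ?x" using d by simp
      \<comment> \<open>The crude bound exp (-x) \<le> 1 / x already beats the linear factor in
        front.\<close>
      have "?x \<le> exp ?x" using exp_ge_add_one_self[of ?x] by linarith
      then have "exp (- ?x) \<le> 1 / ?x" using x by (simp add: exp_minus field_simps)
      then have "exp (- (real (Suc n) * d)\<^sup>2 / 2) \<le> 2 / (real (Suc n) * d)\<^sup>2" by (simp del: of_nat_Suc)
      then have "?c n \<le> (real (Suc n) / sqrt (2 * pi)) * (2 / (real (Suc n) * d)\<^sup>2)" by (rule mult_left_mono) simp
      moreover have "norm (?c n) = ?c n" by simp
      ultimately show ?thesis by simp
    qed
    show ?thesis by (rule Lim_null_comparison[OF always_eventually lim]) (intro allI le)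
  qed
  have i0: "(\<lambda>n. 1 / real (Suc n)) \<longlonglongrightarrow> 0" using LIMSEQ_inverse_real_of_nat by (simp add: inverse_eq_divide)
  have "(\<lambda>n. (LINT t|lborel. \<bar>f t\<bar>) * ?c n + \<bar>f s\<bar> / d\<^sup>2 * (1 / real (Suc n))\<^sup>2) \<longlonglongrightarrow>
      (LINT t|lborel. \<bar>f t\<bar>) * 0 + \<bar>f s\<bar> / d\<^sup>2 * 0\<^sup>2"
    by (intro tendsto_intros c0 i0)
  then have "\<forall>\<^sub>F n in sequentially. (LINT t|lborel. \<bar>f t\<bar>) * ?c n + \<bar>f s\<bar> / d\<^sup>2 * (1 / real (Suc n))\<^sup>2 < r / 2"
    using r by (intro order_tendstoD(2)) auto
  then obtain N where N: "\<And>n. n \<ge> N \<Longrightarrow> (LINT t|lborel. \<bar>f t\<bar>) * ?c n + \<bar>f s\<bar> / d\<^sup>2 * (1 / real (Suc n))\<^sup>2 < r / 2"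
    unfolding eventually_sequentially by blast
  show "\<exists>no. \<forall>n\<ge>no. norm ((LINT t|lborel. f t * ?N n t) - f s) < r"
  proof (intro exI allI impI)
    fix n assume "n \<ge> N"
    from N[OF this] bound[of n] show "norm ((LINT t|lborel. f t * ?N n t) - f s) < r"
      unfolding real_norm_def by linarith
  qed
qed

text \<open>The damping factor \<open>?g n\<close> makes the double integral absolutely convergent.
  After Fubini the integral over \<omega> is a multiple of the normal density about s with standard
  deviation 1 / (n + 1), so the mollifier lemma applies on one side and dominated convergence on the
  other.\<close>

theorem fourier_inversion:
  assumes cont: "continuous_on UNIV f" and f: "integrable lborel f" and ff: "integrable lborel (fourier f)"
  shows "complex_of_real (f s) = 1 / (2 * pi) * (LINT \<omega>|lborel. iexp (- (s * \<omega>)) * fourier f \<omega>)"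
proof -
  have [measurable]: "f \<in> borel_measurable borel" "fourier f \<in> borel_measurable borel" using f ff by auto
  let ?g = "\<lambda>n \<omega>. exp (- (\<omega> / real (Suc n))\<^sup>2 / 2)"
  let ?N = "\<lambda>n t. normal_density s (1 / real (Suc n)) t"
  have L: "(\<lambda>n. LINT \<omega>|lborel. iexp (- (s * \<omega>)) * fourier f \<omega> * complex_of_real (?g n \<omega>)) \<longlonglongrightarrow>
      (LINT \<omega>|lborel. iexp (- (s * \<omega>)) * fourier f \<omega>)"
  proof (rule integral_dominated_convergence[where w="\<lambda>\<omega>. norm (fourier f \<omega>)"])
    show "integrable lborel (\<lambda>\<omega>. norm (fourier f \<omega>))" using ff by simp
    show "AE \<omega> in lborel. (\<lambda>n. iexp (- (s * \<omega>)) * fourier f \<omega> * complex_of_real (?g n \<omega>)) \<longlonglongrightarrow> iexp (- (s * \<omega>)) * fourier f \<omega>"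
    proof (intro AE_I2)
      fix \<omega>
      have "(\<lambda>n. \<omega> / real (Suc n)) \<longlonglongrightarrow> 0"
        using tendsto_mult_right_zero[OF LIMSEQ_inverse_real_of_nat, of \<omega>] by (simp only: divide_inverse)
      then have "(\<lambda>n. ?g n \<omega>) \<longlonglongrightarrow> exp (- 0\<^sup>2 / 2)" by (intro tendsto_intros) auto
      then have "(\<lambda>n. ?g n \<omega>) \<longlonglongrightarrow> 1" by simp
      then have "(\<lambda>n. iexp (- (s * \<omega>)) * fourier f \<omega> * complex_of_real (?g n \<omega>)) \<longlonglongrightarrow> iexp (- (s * \<omega>)) * fourier f \<omega> * complex_of_real 1"
        by (intro tendsto_intros)
      then show "(\<lambda>n. iexp (- (s * \<omega>)) * fourier f \<omega> * complex_of_real (?g n \<omega>)) \<longlonglongrightarrow> iexp (- (s * \<omega>)) * fourier f \<omega>" by simp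
    qed
    show "AE \<omega> in lborel. norm (iexp (- (s * \<omega>)) * fourier f \<omega> * complex_of_real (?g n \<omega>)) \<le> norm (fourier f \<omega>)" for n
      by (intro AE_I2) (auto simp: norm_mult intro!: mult_right_le_one_le)
  qed auto
  have R: "(LINT \<omega>|lborel. iexp (- (s * \<omega>)) * fourier f \<omega> * complex_of_real (?g n \<omega>)) =
      complex_of_real (2 * pi * (LINT t|lborel. f t * ?N n t))" for n
  proof -
    have gi: "integrable lborel (?g n)"
    proof -
      have "integrable lborel (\<lambda>\<omega>. normal_density 0 (real (Suc n)) \<omega> * (sqrt (2 * pi * (real (Suc n))\<^sup>2)))"
        by (intro integrable_mult_left integrable_normal_density) simp
      then show ?thesis by (simp add: normal_density_def power_divide mult.commute del: of_nat_Suc)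
    qed
    have "(LINT \<omega>|lborel. iexp (- (s * \<omega>)) * fourier f \<omega> * complex_of_real (?g n \<omega>)) =
       (LINT \<omega>|lborel. LINT t|lborel. complex_of_real (f t) * (iexp (\<omega> * (t - s)) * complex_of_real (?g n \<omega>)))"
    proof (intro Bochner_Integration.integral_cong refl)
      fix \<omega>
      have "iexp (- (s * \<omega>)) * fourier f \<omega> * complex_of_real (?g n \<omega>) =
         (LINT t|lborel. iexp (- (s * \<omega>)) * complex_of_real (?g n \<omega>) * (iexp (\<omega> * t) * complex_of_real (f t)))"
        unfolding fourier_def by simp
      also have "\<dots> = (LINT t|lborel. complex_of_real (f t) * (iexp (\<omega> * (t - s)) * complex_of_real (?g n \<omega>)))"
      proof (intro Bochner_Integration.integral_cong refl)
        fix t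
        have "iexp (- (s * \<omega>)) * iexp (\<omega> * t) = iexp (\<omega> * (t - s))"
          by (simp add: exp_add[symmetric] algebra_simps)
        moreover have "a * g * (b * c) = c * (a * b * g)" for a b c g :: complex by (simp only: mult_ac)
        ultimately show "iexp (- (s * \<omega>)) * complex_of_real (?g n \<omega>) * (iexp (\<omega> * t) * complex_of_real (f t)) =
          complex_of_real (f t) * (iexp (\<omega> * (t - s)) * complex_of_real (?g n \<omega>))"
          by (simp only:)
      qed
      finally show "iexp (- (s * \<omega>)) * fourier f \<omega> * complex_of_real (?g n \<omega>) =
        (LINT t|lborel. complex_of_real (f t) * (iexp (\<omega> * (t - s)) * complex_of_real (?g n \<omega>)))" .
    qed
    also have "\<dots> = (LINT t|lborel. LINT \<omega>|lborel. complex_of_real (f t) * (iexp (\<omega> * (t - s)) * complex_of_real (?g n \<omega>)))"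
    proof (rule lborel_pair.Fubini_integral)
      have "integrable (lborel \<Otimes>\<^sub>M lborel) (\<lambda>(t, \<omega>). f t * ?g n \<omega>)"
        using f gi by (intro lborel_pair.Fubini_integrable) (auto simp: abs_mult)
      then show "integrable (lborel \<Otimes>\<^sub>M lborel) (\<lambda>(t, \<omega>). complex_of_real (f t) * (iexp (\<omega> * (t - s)) * complex_of_real (?g n \<omega>)))"
        by (rule Bochner_Integration.integrable_bound) (auto simp: norm_mult abs_mult)
    qed
    also have "\<dots> = (LINT t|lborel. complex_of_real (2 * pi * (f t * ?N n t)))"
    proof (intro Bochner_Integration.integral_cong refl)
      fix t
      have "(LINT \<omega>|lborel. complex_of_real (f t) * (iexp (\<omega> * (t - s)) * complex_of_real (?g n \<omega>))) =
        complex_of_real (f t) * complex_of_real (real (Suc n) * sqrt (2 * pi) * exp (- (real (Suc n) * (t - s))\<^sup>2 / 2))"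
        by (subst integral_iexp_gaussian[symmetric]) auto
      also have "real (Suc n) * sqrt (2 * pi) * exp (- (real (Suc n) * (t - s))\<^sup>2 / 2) = 2 * pi * ?N n t"
      proof -
        have gen: "a * b * c = k * (a / b * c)" if "b * b = k" "b \<noteq> 0" for a b c k :: real
          using that by (auto simp: field_simps)
        have N: "?N n t = real (Suc n) / sqrt (2 * pi) * exp (- (real (Suc n) * (t - s))\<^sup>2 / 2)"
          by (simp add: normal_density_def real_sqrt_divide real_sqrt_mult power_mult_distrib divide_simps)
        show ?thesis unfolding N by (rule gen) simp_all
      qed
      finally show "(LINT \<omega>|lborel. complex_of_real (f t) * (iexp (\<omega> * (t - s)) * complex_of_real (?g n \<omega>))) =
        complex_of_real (2 * pi * (f t * ?N n t))" by (simp only: of_real_mult[symmetric]) (simp only: mult_ac)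
    qed
    also have "\<dots> = complex_of_real (2 * pi * (LINT t|lborel. f t * ?N n t))"
      by (subst integral_complex_of_real) simp
    finally show ?thesis .
  qed
  have "(\<lambda>n. complex_of_real (2 * pi * (LINT t|lborel. f t * ?N n t))) \<longlonglongrightarrow> complex_of_real (2 * pi * f s)"
    using cont by (intro tendsto_intros gaussian_mollifier_tendsto f) (auto simp: continuous_on_eq_continuous_at)
  then have "complex_of_real (2 * pi * f s) = (LINT \<omega>|lborel. iexp (- (s * \<omega>)) * fourier f \<omega>)"
    using L unfolding R by (rule LIMSEQ_unique)
  then show ?thesis by (simp add: field_simps)
qed

section \<open>Gaussian processes with a given covariance\<close>

definition psd_on :: "'a set \<Rightarrow> ('a \<Rightarrow> 'a \<Rightarrow> real) \<Rightarrow> bool" where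
  "psd_on I K \<longleftrightarrow> (\<forall>x\<in>I. \<forall>y\<in>I. K x y = K y x) \<and>
     (\<forall>F c. finite F \<and> F \<subseteq> I \<longrightarrow> 0 \<le> (\<Sum>x\<in>F. \<Sum>y\<in>F. c x * c y * K x y))"

lemma psd_on_sym: "psd_on I K \<Longrightarrow> x \<in> I \<Longrightarrow> y \<in> I \<Longrightarrow> K x y = K y x"
  by (auto simp: psd_on_def)

lemma psd_on_sum: "psd_on I K \<Longrightarrow> finite F \<Longrightarrow> F \<subseteq> I \<Longrightarrow> 0 \<le> (\<Sum>x\<in>F. \<Sum>y\<in>F. c x * c y * K x y)"
  by (auto simp: psd_on_def)

lemma psd_on_diag: "psd_on I K \<Longrightarrow> x \<in> I \<Longrightarrow> 0 \<le> K x x"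
  using psd_on_sum[of I K "{x}" "\<lambda>_. 1"] by simp

text \<open>Moving one coefficient by t makes the quadratic form a polynomial in t, ready for the
  discriminant.\<close>

lemma sum_bilinear_add_point:
  fixes K :: "'a \<Rightarrow> 'a \<Rightarrow> real"
  assumes F: "finite F" "F \<subseteq> I" "p \<in> F" and K: "psd_on I K"
  shows "(\<Sum>x\<in>F. \<Sum>y\<in>F. (c x + (if x = p then t else 0)) * (c y + (if y = p then t else 0)) * K x y) =
    (\<Sum>x\<in>F. \<Sum>y\<in>F. c x * c y * K x y) + 2 * t * (\<Sum>x\<in>F. c x * K x p) + t\<^sup>2 * K p p"
proof -
  have e: "(c x + (if x = p then t else 0)) * (c y + (if y = p then t else 0)) * K x y =
     c x * c y * K x y + (if y = p then c x * t * K x p else 0) + (if x = p then t * c y * K p y else 0)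
      + (if x = p then if y = p then t\<^sup>2 * K p p else 0 else 0)" for x y
    by (simp add: algebra_simps power2_eq_square)
  have s: "(\<Sum>y\<in>F. t * c y * K p y) = (\<Sum>x\<in>F. c x * t * K x p)"
    by (intro sum.cong refl) (use psd_on_sym[OF K] F in auto)
  have 1: "(\<Sum>x\<in>F. \<Sum>y\<in>F. if y = p then c x * t * K x p else 0) = (\<Sum>x\<in>F. c x * t * K x p)"
    using F by simp
  have 2: "(\<Sum>x\<in>F. \<Sum>y\<in>F. if x = p then t * c y * K p y else 0) = (\<Sum>y\<in>F. t * c y * K p y)"
    using F by (subst sum.swap) simp
  have 3: "(\<Sum>x\<in>F. \<Sum>y\<in>F. if x = p then if y = p then t\<^sup>2 * K p p else 0 else 0) = t\<^sup>2 * K p p"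
  proof -
    have "(\<Sum>y\<in>F. if x = p then if y = p then t\<^sup>2 * K p p else 0 else 0) = (if x = p then t\<^sup>2 * K p p else 0)" for x
      using F by (cases "x = p") simp_all
    then show ?thesis using F by simp
  qed
  have "(\<Sum>x\<in>F. c x * t * K x p) = t * (\<Sum>x\<in>F. c x * K x p)" by (simp add: sum_distrib_left mult_ac)
  then show ?thesis unfolding e sum.distrib 1 2 3 s by simp
qed

lemma psd_on_Cauchy_Schwarz_sum:
  assumes K: "psd_on I K" and F: "finite F" "F \<subseteq> I" and p: "p \<in> I"
  shows "(\<Sum>x\<in>F. c x * K x p)\<^sup>2 \<le> (\<Sum>x\<in>F. \<Sum>y\<in>F. c x * c y * K x y) * K p p"
proof -
  let ?F = "insert p F"
  \<comment> \<open>The point p may or may not lie in F; extending the coefficients by zero treats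
    both cases at once.\<close>
  define d where "d x = (if x \<in> F then c x else 0)" for x
  have F': "finite ?F" "?F \<subseteq> I" "p \<in> ?F" using F p by auto
  have e1: "(\<Sum>x\<in>?F. d x * K x p) = (\<Sum>x\<in>F. c x * K x p)"
    using F by (intro sum.mono_neutral_cong_right) (auto simp: d_def)
  have e2: "(\<Sum>x\<in>?F. \<Sum>y\<in>?F. d x * d y * K x y) = (\<Sum>x\<in>F. \<Sum>y\<in>F. c x * c y * K x y)"
  proof -
    have "(\<Sum>y\<in>?F. d x * d y * K x y) = (\<Sum>y\<in>F. d x * c y * K x y)" for x
      using F by (intro sum.mono_neutral_cong_right) (auto simp: d_def)
    then have "(\<Sum>x\<in>?F. \<Sum>y\<in>?F. d x * d y * K x y) = (\<Sum>x\<in>?F. \<Sum>y\<in>F. d x * c y * K x y)" by simp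
    also have "\<dots> = (\<Sum>x\<in>F. \<Sum>y\<in>F. c x * c y * K x y)"
      using F by (intro sum.mono_neutral_cong_right) (auto simp: d_def)
    finally show ?thesis .
  qed
  show ?thesis
  proof (rule nonneg_quadratic_discriminant)
    fix t
    show "0 \<le> (\<Sum>x\<in>F. \<Sum>y\<in>F. c x * c y * K x y) + 2 * t * (\<Sum>x\<in>F. c x * K x p) + t\<^sup>2 * K p p"
      using psd_on_sum[OF K F'(1,2), of "\<lambda>x. d x + (if x = p then t else 0)"]
      unfolding sum_bilinear_add_point[OF F' K] e1 e2 .
  qed
qed

lemma psd_on_Cauchy_Schwarz:
  assumes K: "psd_on I K" and xy: "x \<in> I" "y \<in> I"
  shows "(K x y)\<^sup>2 \<le> K x x * K y y"
  using psd_on_Cauchy_Schwarz_sum[OF K _ _ xy(2), of "{x}" "\<lambda>_. 1"] xy by simp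

text \<open>The covariance left after linear regression on the variable at p. If that variable
  degenerates, division by zero leaves K unchanged, which is right since then \<open>K x p\<close>
  vanishes for a positive semidefinite K.\<close>

definition schur :: "('a \<Rightarrow> 'a \<Rightarrow> real) \<Rightarrow> 'a \<Rightarrow> 'a \<Rightarrow> 'a \<Rightarrow> real" where
  "schur K p x y = K x y - K x p * K y p / K p p"

lemma psd_on_schur:
  assumes K: "psd_on I K" and p: "p \<in> I"
  shows "psd_on I (schur K p)"
  unfolding psd_on_def
proof (intro conjI ballI allI impI)
  show "schur K p x y = schur K p y x" if "x \<in> I" "y \<in> I" for x y
    using psd_on_sym[OF K that] by (simp add: schur_def)
  fix F c assume F: "finite F \<and> F \<subseteq> I"
  let ?Q = "\<Sum>x\<in>F. \<Sum>y\<in>F. c x * c y * K x y" and ?B = "\<Sum>x\<in>F. c x * K x p"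
  have "(\<Sum>x\<in>F. \<Sum>y\<in>F. c x * c y * schur K p x y) = ?Q - (\<Sum>x\<in>F. \<Sum>y\<in>F. (c x * K x p) * (c y * K y p)) / K p p"
    by (simp add: schur_def right_diff_distrib sum_subtractf sum_divide_distrib mult_ac)
  also have "(\<Sum>x\<in>F. \<Sum>y\<in>F. (c x * K x p) * (c y * K y p)) = ?B\<^sup>2"
    by (simp add: sum_product power2_eq_square)
  also have "0 \<le> ?Q - ?B\<^sup>2 / K p p"
  proof (cases "K p p = 0")
    case True then show ?thesis using psd_on_sum[OF K] F by simp
  next
    case False
    then have "0 < K p p" using psd_on_diag[OF K p] by simp
    then show ?thesis using psd_on_Cauchy_Schwarz_sum[OF K _ _ p, of F c] F by (simp add: field_simps)
  qed
  finally show "0 \<le> (\<Sum>x\<in>F. \<Sum>y\<in>F. c x * c y * schur K p x y)" .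
qed

primrec schur_iter :: "('a \<Rightarrow> 'a \<Rightarrow> real) \<Rightarrow> (nat \<Rightarrow> 'a) \<Rightarrow> nat \<Rightarrow> 'a \<Rightarrow> 'a \<Rightarrow> real" where
  "schur_iter K q 0 = K"
| "schur_iter K q (Suc n) = schur (schur_iter K q n) (q n)"

text \<open>The row of x in the Cholesky factor with pivots along q. A vanishing pivot gives the
  entry 0, by division by zero.\<close>

definition cholesky :: "('a \<Rightarrow> 'a \<Rightarrow> real) \<Rightarrow> (nat \<Rightarrow> 'a) \<Rightarrow> 'a \<Rightarrow> nat \<Rightarrow> real" where
  "cholesky K q x n = schur_iter K q n x (q n) / sqrt (schur_iter K q n (q n) (q n))"

context
  fixes I :: "'a set" and K :: "'a \<Rightarrow> 'a \<Rightarrow> real" and q :: "nat \<Rightarrow> 'a"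
  assumes K: "psd_on I K" and q: "\<And>n. q n \<in> I"
begin

lemma psd_on_schur_iter: "psd_on I (schur_iter K q n)"
  by (induction n) (auto intro: K psd_on_schur q)

lemma schur_iter_eq: "schur_iter K q n x y = K x y - (\<Sum>k<n. cholesky K q x k * cholesky K q y k)"
proof (induction n)
  case (Suc n)
  have "0 \<le> schur_iter K q n (q n) (q n)" by (rule psd_on_diag[OF psd_on_schur_iter q])
  then have "cholesky K q x n * cholesky K q y n = schur_iter K q n x (q n) * schur_iter K q n y (q n) / schur_iter K q n (q n) (q n)"
    by (simp add: cholesky_def)
  then show ?case using Suc by (simp add: schur_def)
qed simp

text \<open>An eliminated variable has residual zero at once, by the Cauchy-Schwarz inequality also
  when its pivot vanishes, and later eliminations preserve this.\<close>

lemma schur_iter_pivot: "k < n \<Longrightarrow> y \<in> I \<Longrightarrow> schur_iter K q n (q k) y = 0"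
proof (induction n arbitrary: y)
  case (Suc n)
  show ?case
  proof (cases "k = n")
    case True
    show ?thesis
    proof (cases "schur_iter K q n (q n) (q n) = 0")
      case z: True
      have "(schur_iter K q n (q n) y)\<^sup>2 \<le> 0"
        using psd_on_Cauchy_Schwarz[OF psd_on_schur_iter q Suc.prems(2), of n n] z by simp
      then show ?thesis using True z by (simp add: schur_def)
    next
      case False
      then show ?thesis using True psd_on_sym[OF psd_on_schur_iter q Suc.prems(2), of n n] by (simp add: schur_def)
    qed
  next
    case False
    then have "k < n" using Suc.prems by simp
    then show ?thesis using Suc.IH[OF _ Suc.prems(2)] Suc.IH[OF _ q] by (simp add: schur_def)
  qed
qed simp

text \<open>As the residual of \<open>q k\<close> is zero, the residual variance at z is that of the
  difference between z and \<open>q k\<close>, and elimination can only lower the variance of this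
  difference.\<close>

lemma schur_iter_diag_le:
  assumes "k < n" and z: "z \<in> I"
  shows "schur_iter K q n z z \<le> K z z - 2 * K z (q k) + K (q k) (q k)"
proof -
  let ?S = "schur_iter K q n"
  have 0: "?S (q k) z = 0" "?S (q k) (q k) = 0" using schur_iter_pivot assms q by auto
  have "?S z (q k) = 0" using 0 psd_on_sym[OF psd_on_schur_iter z q] by simp
  then have "?S z z = ?S z z - 2 * ?S z (q k) + ?S (q k) (q k)" using 0 by simp
  also have "\<dots> = K z z - 2 * K z (q k) + K (q k) (q k) - (\<Sum>j<n. (cholesky K q z j - cholesky K q (q k) j)\<^sup>2)"
    unfolding schur_iter_eq by (simp add: power2_diff sum.distrib sum_subtractf sum_distrib_left power2_eq_square algebra_simps)
  also have "\<dots> \<le> K z z - 2 * K z (q k) + K (q k) (q k)" by (simp add: sum_nonneg)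
  finally show ?thesis .
qed

text \<open>Density of q in the metric of the kernel drives the residual variances to 0, and the
  Cauchy-Schwarz inequality then does so for the residual covariances.\<close>

lemma cholesky_sums:
  assumes dense: "\<And>z e. z \<in> I \<Longrightarrow> 0 < e \<Longrightarrow> \<exists>k. K z z - 2 * K z (q k) + K (q k) (q k) < e"
    and xy: "x \<in> I" "y \<in> I"
  shows "(\<lambda>n. \<Sum>k<n. cholesky K q x k * cholesky K q y k) \<longlonglongrightarrow> K x y"
proof -
  have diag: "(\<lambda>n. schur_iter K q n z z) \<longlonglongrightarrow> 0" if z: "z \<in> I" for z
  proof (rule LIMSEQ_I)
    fix r :: real assume "0 < r"
    then obtain k where k: "K z z - 2 * K z (q k) + K (q k) (q k) < r" using dense[OF z] by blast
    show "\<exists>no. \<forall>n\<ge>no. norm (schur_iter K q n z z - 0) < r"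
    proof (intro exI allI impI)
      fix n assume "Suc k \<le> n"
      then have "schur_iter K q n z z < r" using schur_iter_diag_le[of k n z] k z by simp
      then show "norm (schur_iter K q n z z - 0) < r" using psd_on_diag[OF psd_on_schur_iter z, of n] by simp
    qed
  qed
  have "(\<lambda>n. schur_iter K q n x y) \<longlonglongrightarrow> 0"
  proof (rule Lim_null_comparison)
    show "\<forall>\<^sub>F n in sequentially. norm (schur_iter K q n x y) \<le> sqrt (schur_iter K q n x x * schur_iter K q n y y)"
      using psd_on_Cauchy_Schwarz[OF psd_on_schur_iter xy] by (auto intro!: always_eventually real_le_rsqrt)
    show "(\<lambda>n. sqrt (schur_iter K q n x x * schur_iter K q n y y)) \<longlonglongrightarrow> 0"
      using tendsto_real_sqrt[OF tendsto_mult[OF diag[OF xy(1)] diag[OF xy(2)]]] by simp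
  qed
  from tendsto_diff[OF tendsto_const[of "K x y"] this] show ?thesis by (simp add: schur_iter_eq)
qed

end

text \<open>Only the coordinates at the natural numbers are used.\<close>
definition white_noise :: "(real \<Rightarrow> real) measure" where
  "white_noise = PiM UNIV (\<lambda>_. std_normal_distribution)"

lemma prob_space_white_noise: "prob_space white_noise"
  unfolding white_noise_def by (intro prob_space_PiM prob_space_normal_density) simp

lemma white_noise_sum:
  "centered_normal white_noise (\<lambda>w. \<Sum>k<n. a k * w (real k)) (sqrt (\<Sum>k<n. (a k)\<^sup>2))"
proof -
  interpret product_prob_space "\<lambda>_::real. std_normal_distribution" UNIV
    by (intro product_prob_spaceI prob_space_normal_density) simp
  interpret W: prob_space white_noise by (rule prob_space_white_noise)
  have meas: "(\<lambda>w. w x) \<in> borel_measurable white_noise" for x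
    unfolding white_noise_def using measurable_component_singleton[of x UNIV "\<lambda>_. std_normal_distribution"] by simp
  note [measurable] = meas
  have "(LINT w|white_noise. iexp (t * (\<Sum>k<n. a k * w (real k)))) = complex_of_real (exp (- ((sqrt (\<Sum>k<n. (a k)\<^sup>2) * t)\<^sup>2) / 2))" for t
  proof -
    let ?X = "\<lambda>k w. a k * w (real k)"
    have ind: "W.indep_vars (\<lambda>_. borel) ?X {..<n}"
    proof -
      have "W.indep_vars (\<lambda>_. std_normal_distribution) (\<lambda>k w. w (real k)) {..<n}"
      proof (cases "n = 0")
        case True
        then show ?thesis by (simp add: W.indep_vars_def2 W.indep_sets_def)
      next
        case False
        have d: "distr white_noise std_normal_distribution (\<lambda>w. w (real k)) = std_normal_distribution" for k
          unfolding white_noise_def by (rule PiM_component) simp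
        have "distr white_noise (PiM {..<n} (\<lambda>_. std_normal_distribution)) (\<lambda>w. \<lambda>k\<in>{..<n}. w (real k)) =
            PiM {..<n} (\<lambda>_. std_normal_distribution)"
          unfolding white_noise_def by (rule distr_PiM_reindex) (auto intro: prob_space_normal_density)
        then show ?thesis
          using False by (subst W.indep_vars_iff_distr_eq_PiM') (auto simp: d)
      qed
      then show ?thesis by (rule W.indep_vars_compose2) auto
    qed
    have marg: "char (distr white_noise borel (?X k)) t = complex_of_real (exp (- ((a k * t)\<^sup>2) / 2))" for k
    proof -
      have d: "distr white_noise std_normal_distribution (\<lambda>w. w (real k)) = std_normal_distribution"
        unfolding white_noise_def by (rule PiM_component) simp
      have "char (distr white_noise borel (?X k)) t = (LINT w|white_noise. iexp (t * (a k * w (real k))))"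
        by (simp add: char_def integral_distr)
      also have "\<dots> = (LINT x|distr white_noise std_normal_distribution (\<lambda>w. w (real k)). iexp (t * (a k * x)))"
        by (rule integral_distr[symmetric]) (use meas in simp_all)
      also have "\<dots> = complex_of_real (exp (- ((a k * t)\<^sup>2) / 2))" unfolding d by (rule char_std_normal_scaled)
      finally show ?thesis .
    qed
    have "(LINT w|white_noise. iexp (t * (\<Sum>k<n. a k * w (real k)))) = char (distr white_noise borel (\<lambda>w. \<Sum>k<n. ?X k w)) t"
      by (simp add: char_def integral_distr)
    also have "\<dots> = (\<Prod>k<n. char (distr white_noise borel (?X k)) t)" by (rule W.char_distr_sum[OF ind])
    also have "\<dots> = complex_of_real (\<Prod>k<n. exp (- ((a k * t)\<^sup>2) / 2))" unfolding marg by simp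
    also have "(\<Prod>k<n. exp (- ((a k * t)\<^sup>2) / 2)) = exp (\<Sum>k<n. - ((a k * t)\<^sup>2) / 2)" by (rule exp_sum[symmetric]) simp
    also have "(\<Sum>k<n. - ((a k * t)\<^sup>2) / 2) = - ((sqrt (\<Sum>k<n. (a k)\<^sup>2) * t)\<^sup>2) / 2"
      by (simp add: power_mult_distrib sum_nonneg sum_negf sum_divide_distrib sum_distrib_right)
    finally show ?thesis .
  qed
  then show ?thesis by (simp only: centered_normal_def) measurable
qed

lemma (in prob_space) integral_norm_le_sqrt:
  fixes f :: "'a \<Rightarrow> real"
  assumes [measurable]: "f \<in> borel_measurable M" and f: "integrable M (\<lambda>x. (f x)\<^sup>2)"
  shows "integrable M f" "(LINT x|M. \<bar>f x\<bar>) \<le> sqrt (LINT x|M. (f x)\<^sup>2)"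
proof -
  have "integrable M (\<lambda>x. f x * 1)" using f by (intro integrable_mult_of_squares) auto
  then show "integrable M f" by simp
  have "norm (LINT x|M. \<bar>f x\<bar> * 1) \<le> sqrt (LINT x|M. (norm \<bar>f x\<bar>)\<^sup>2) * sqrt (LINT x|M. (norm (1::real))\<^sup>2)"
    using f by (intro Cauchy_Schwarz_integral) auto
  then show "(LINT x|M. \<bar>f x\<bar>) \<le> sqrt (LINT x|M. (f x)\<^sup>2)" by (simp add: prob_space)
qed

definition noise_sum :: "nat \<Rightarrow> (nat \<Rightarrow> real) \<Rightarrow> (real \<Rightarrow> real) \<Rightarrow> real" where
  "noise_sum n a w = (\<Sum>k<n. a k * w (real k))"

lemma noise_sum_centered_normal: "centered_normal white_noise (noise_sum n a) (sqrt (\<Sum>k<n. (a k)\<^sup>2))"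
  unfolding noise_sum_def[abs_def] by (rule white_noise_sum)

lemma noise_sum_measurable[measurable]: "noise_sum n a \<in> borel_measurable white_noise"
  using noise_sum_centered_normal by (auto simp: centered_normal_def)

lemma noise_sum_moments:
  "integrable white_noise (\<lambda>w. (noise_sum n a w)\<^sup>2)" "(LINT w|white_noise. (noise_sum n a w)\<^sup>2) = (\<Sum>k<n. (a k)\<^sup>2)"
  using centered_normal_moments(3,4)[OF prob_space_white_noise noise_sum_centered_normal, of n a] by (simp_all add: sum_nonneg)

text \<open>Polarisation reduces the covariance to the second moments of the combinations a + b and
  a - b.\<close>

lemma noise_sum_covariance:
  "(LINT w|white_noise. noise_sum n a w * noise_sum n b w) = (\<Sum>k<n. a k * b k)"
proof -
  have e: "noise_sum n a w * noise_sum n b w =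
     ((noise_sum n (\<lambda>k. a k + b k) w)\<^sup>2 - (noise_sum n (\<lambda>k. a k - b k) w)\<^sup>2) / 4" for w
    by (simp add: noise_sum_def distrib_right left_diff_distrib sum.distrib sum_subtractf power2_eq_square algebra_simps)
  have "(LINT w|white_noise. noise_sum n a w * noise_sum n b w) = ((\<Sum>k<n. (a k + b k)\<^sup>2) - (\<Sum>k<n. (a k - b k)\<^sup>2)) / 4"
    unfolding e by (simp add: noise_sum_moments)
  also have "\<dots> = (\<Sum>k<n. a k * b k)"
    by (simp add: sum_subtractf[symmetric] sum_divide_distrib power2_eq_square algebra_simps)
  finally show ?thesis .
qed

text \<open>\<open>S x\<close> is the series of white noise with the Cholesky row of x as
  coefficients. The row is square summable with sum \<open>K x x\<close>, and products of rows sum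
  to K.\<close>

theorem gaussian_process_exists:
  fixes K :: "'a \<Rightarrow> 'a \<Rightarrow> real" and q :: "nat \<Rightarrow> 'a"
  assumes K: "psd_on I K" and q: "\<And>n. q n \<in> I"
    and dense: "\<And>z e. z \<in> I \<Longrightarrow> 0 < e \<Longrightarrow> \<exists>k. K z z - 2 * K z (q k) + K (q k) (q k) < e"
  shows "\<exists>S. centered_gaussian_process white_noise I S \<and>
    (\<forall>x\<in>I. \<forall>y\<in>I. (LINT w|white_noise. S x w * S y w) = K x y)"
proof -
  interpret W: prob_space white_noise by (rule prob_space_white_noise)
  define L where "L = cholesky K q"
  define X where "X n x = noise_sum n (L x)" for n x
  have [measurable]: "X n x \<in> borel_measurable white_noise" for n x by (simp add: X_def)
  define s where "s n x = (\<Sum>k<n. (L x k)\<^sup>2)" for n x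
  have sums: "(\<lambda>n. \<Sum>k<n. L x k * L y k) \<longlonglongrightarrow> K x y" if "x \<in> I" "y \<in> I" for x y
    unfolding L_def by (rule cholesky_sums[OF K q dense that])
  have s: "(\<lambda>n. s n x) \<longlonglongrightarrow> K x x" if "x \<in> I" for x
    using sums[OF that that] by (simp add: s_def power2_eq_square)
  have incr: "centered_normal white_noise (\<lambda>w. X m x w - X n x w) (sqrt (s m x - s n x))" if "n \<le> m" for m n x
  proof -
    let ?a = "\<lambda>k. if k < n then 0 else L x k"
    have mn: "{..<m} = {..<n} \<union> {n..<m}" using that by auto
    have "X m x w - X n x w = noise_sum m ?a w" for w
      unfolding X_def noise_sum_def mn by (subst (1 2) sum.union_disjoint) auto
    moreover have "s m x - s n x = (\<Sum>k<m. (?a k)\<^sup>2)"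
      unfolding s_def mn by (subst (1 2) sum.union_disjoint) auto
    ultimately show ?thesis using noise_sum_centered_normal[of m ?a] by simp
  qed
  \<comment> \<open>The variances of differences are differences of the convergent sums
    \<open>s n x\<close>. Hence the series is Cauchy in L1, and almost surely along a subsequence
    that depends on x.\<close>
  have "\<exists>r. strict_mono r \<and> (AE w in white_noise. Cauchy (\<lambda>i. X (r i) x w))" if x: "x \<in> I" for x
  proof -
    have int: "integrable white_noise (X n x)" for n
      unfolding X_def by (rule centered_normal_moments(1)[OF prob_space_white_noise noise_sum_centered_normal])
    have "\<exists>N. \<forall>i\<ge>N. \<forall>j\<ge>N. (LINT w|white_noise. norm (X i x w - X j x w)) < e" if e: "0 < e" for e
    proof -
      have "Cauchy (\<lambda>n. s n x)" using s[OF x] by (auto intro: convergent_Cauchy convergentI)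
      then obtain N where N: "\<And>i j. i \<ge> N \<Longrightarrow> j \<ge> N \<Longrightarrow> \<bar>s i x - s j x\<bar> < e\<^sup>2"
        using e unfolding Cauchy_def dist_real_def by (metis zero_less_power)
      have *: "(LINT w|white_noise. norm (X i x w - X j x w)) < e" if ij: "j \<le> i" "N \<le> j" for i j
      proof -
        note c = incr[OF ij(1), of x]
        have "s j x \<le> s i x" unfolding s_def using ij by (intro sum_mono2) auto
        then have v: "(LINT w|white_noise. (X i x w - X j x w)\<^sup>2) = s i x - s j x"
          using centered_normal_moments(4)[OF prob_space_white_noise c] by simp
        have "(LINT w|white_noise. \<bar>X i x w - X j x w\<bar>) \<le> sqrt (s i x - s j x)"
          using W.integral_norm_le_sqrt(2)[OF _ centered_normal_moments(3)[OF prob_space_white_noise c]] v by simp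
        also have "\<dots> < sqrt (e\<^sup>2)" using N[of i j] ij by (intro real_sqrt_less_mono) auto
        finally show ?thesis using e by simp
      qed
      show ?thesis
      proof (intro exI allI impI)
        fix i j assume "N \<le> i" "N \<le> j"
        then show "(LINT w|white_noise. norm (X i x w - X j x w)) < e"
          using *[of j i] *[of i j] by (cases "j \<le> i") (auto simp: abs_minus_commute)
      qed
    qed
    from cauchy_L1_AE_cauchy_subseq[OF int this] show ?thesis by blast
  qed
  then obtain r where r: "\<And>x. x \<in> I \<Longrightarrow> strict_mono (r x)"
    "\<And>x. x \<in> I \<Longrightarrow> AE w in white_noise. Cauchy (\<lambda>i. X (r x i) x w)" by metis
  \<comment> \<open>\<open>lim\<close> is total, so \<open>S x\<close> is measurable as it stands;
    its values on the null set without convergence do not matter.\<close>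
  define S where "S x w = lim (\<lambda>i. X (r x i) x w)" for x w
  have [measurable]: "S x \<in> borel_measurable white_noise" for x
    unfolding S_def[abs_def] by (rule borel_measurable_lim_metric) simp
  have AES: "AE w in white_noise. (\<lambda>i. X (r x i) x w) \<longlonglongrightarrow> S x w" if "x \<in> I" for x
    using r(2)[OF that] unfolding S_def by eventually_elim (rule iffD1[OF convergent_LIMSEQ_iff Cauchy_convergent])
  have SX: "centered_normal white_noise (\<lambda>w. S x w - X n x w) (sqrt (K x x - s n x))" if x: "x \<in> I" for x n
  proof (rule centered_normal_limit_variance[OF prob_space_white_noise, where X="\<lambda>i w. X (r x (i + n)) x w - X n x w"])
    \<comment> \<open>The shift by n keeps the subsequence beyond n, where the difference is a tail
      of the series.\<close>
    have rn: "n \<le> r x (i + n)" for i using seq_suble[OF r(1)[OF x], of "i + n"] by simp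
    show "centered_normal white_noise (\<lambda>w. X (r x (i + n)) x w - X n x w) (sqrt (s (r x (i + n)) x - s n x))" for i
      by (rule incr[OF rn])
    show "AE w in white_noise. (\<lambda>i. X (r x (i + n)) x w - X n x w) \<longlonglongrightarrow> S x w - X n x w"
      using AES[OF x]
    proof eventually_elim
      case (elim w)
      from LIMSEQ_ignore_initial_segment[OF elim, of n] show ?case by (intro tendsto_diff tendsto_const)
    qed
    have "(\<lambda>i. s (r x (i + n)) x) \<longlonglongrightarrow> K x x"
      using LIMSEQ_ignore_initial_segment[OF LIMSEQ_subseq_LIMSEQ[OF s[OF x] r(1)[OF x]], of n] by (simp add: o_def)
    then have "(\<lambda>i. s (r x (i + n)) x - s n x) \<longlonglongrightarrow> K x x - s n x" by (intro tendsto_intros)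
    moreover have "s n x \<le> s (r x (i + n)) x" for i unfolding s_def using rn by (intro sum_mono2) auto
    ultimately show "(\<lambda>i. (sqrt (s (r x (i + n)) x - s n x))\<^sup>2) \<longlonglongrightarrow> K x x - s n x" by simp
  qed simp
  have sK: "s n x \<le> K x x" if "x \<in> I" for n x
    by (rule incseq_le[OF _ s[OF that]]) (auto simp: s_def incseq_def intro: sum_mono2)
  have L2: "integrable white_noise (\<lambda>w. (S x w - X n x w)\<^sup>2)" "(LINT w|white_noise. (S x w - X n x w)\<^sup>2) = K x x - s n x"
    if x: "x \<in> I" for x n
    using centered_normal_moments(3,4)[OF prob_space_white_noise SX[OF x]] sK[OF x] by simp_all
  have S0: "centered_normal white_noise (S x) (sqrt (K x x))" if "x \<in> I" for x
    using SX[OF that, of 0] by (simp add: X_def noise_sum_def s_def)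
  have cov: "(LINT w|white_noise. S x w * S y w) = K x y" if xy: "x \<in> I" "y \<in> I" for x y
  proof -
    have to0: "(\<lambda>n. LINT w|white_noise. (norm (X n z w - S z w))\<^sup>2) \<longlonglongrightarrow> 0" if z: "z \<in> I" for z
    proof -
      have "(\<lambda>n. K z z - s n z) \<longlonglongrightarrow> K z z - K z z" by (intro tendsto_intros s z)
      then show ?thesis using L2(2)[OF z] by (simp add: power2_commute)
    qed
    have "(\<lambda>n. LINT w|white_noise. X n x w * X n y w) \<longlonglongrightarrow> (LINT w|white_noise. S x w * S y w)"
      by (rule tendsto_integral_mult_L2)
         (use to0[OF xy(1)] to0[OF xy(2)] centered_normal_moments(3)[OF prob_space_white_noise S0[OF xy(1)]]
            centered_normal_moments(3)[OF prob_space_white_noise S0[OF xy(2)]] noise_sum_moments(1) in \<open>simp_all add: X_def\<close>)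
    moreover have "(\<lambda>n. LINT w|white_noise. X n x w * X n y w) \<longlonglongrightarrow> K x y"
      using sums[OF xy] by (simp add: X_def noise_sum_covariance)
    ultimately show ?thesis by (rule LIMSEQ_unique)
  qed
  have comb: "gaussian_rv white_noise (\<lambda>w. \<Sum>i\<in>F. c i * S i w)" if F: "finite F" "F \<subseteq> I" for F c
  proof -
    let ?Y = "\<lambda>w. \<Sum>i\<in>F. c i * S i w"
    let ?Yn = "\<lambda>n w. \<Sum>i\<in>F. c i * X n i w"
    have Yn: "\<exists>v. centered_normal white_noise (?Yn n) v" for n
    proof -
      have "?Yn n = noise_sum n (\<lambda>k. \<Sum>i\<in>F. c i * L i k)"
        unfolding X_def noise_sum_def fun_eq_iff sum_distrib_left sum_distrib_right
        by (subst sum.swap) (simp add: mult.assoc)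
      then show ?thesis using noise_sum_centered_normal by metis
    qed
    have ii: "integrable white_noise (\<lambda>w. X n i w - S i w)" if "i \<in> F" for n i
    proof -
      have "integrable white_noise (\<lambda>w. S i w - X n i w)"
        using centered_normal_moments(1)[OF prob_space_white_noise SX] that F by blast
      from integrable_minus[OF this] show ?thesis by simp
    qed
    have d: "?Yn n w - ?Y w = (\<Sum>i\<in>F. c i * (X n i w - S i w))" for n w
      by (simp add: right_diff_distrib sum_subtractf)
    \<comment> \<open>The subsequences of the individual points differ, so a finite combination goes
      back to L1 convergence of the full sequences and extracts a common one.\<close>
    have "(\<lambda>n. LINT w|white_noise. norm (?Yn n w - ?Y w)) \<longlonglongrightarrow> 0"
    proof (rule Lim_null_comparison)
      show "\<forall>\<^sub>F n in sequentially. norm (LINT w|white_noise. norm (?Yn n w - ?Y w)) \<le> (\<Sum>i\<in>F. \<bar>c i\<bar> * sqrt (K i i - s n i))"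
      proof (intro always_eventually allI)
        fix n
        have "(LINT w|white_noise. norm (?Yn n w - ?Y w)) \<le> (LINT w|white_noise. (\<Sum>i\<in>F. \<bar>c i\<bar> * \<bar>X n i w - S i w\<bar>))"
          unfolding d using ii by (intro integral_mono integrable_norm Bochner_Integration.integrable_sum integrable_mult_right)
            (auto simp: abs_mult[symmetric] intro: order_trans[OF sum_abs])
        also have "\<dots> = (\<Sum>i\<in>F. \<bar>c i\<bar> * (LINT w|white_noise. \<bar>X n i w - S i w\<bar>))"
          using ii by simp
        also have "\<dots> \<le> (\<Sum>i\<in>F. \<bar>c i\<bar> * sqrt (K i i - s n i))"
        proof (intro sum_mono mult_left_mono)
          fix i assume "i \<in> F"
          then have i: "i \<in> I" using F by auto
          show "(LINT w|white_noise. \<bar>X n i w - S i w\<bar>) \<le> sqrt (K i i - s n i)"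
            using W.integral_norm_le_sqrt(2)[OF _ L2(1)[OF i]] L2(2)[OF i] by (simp add: abs_minus_commute)
        qed simp
        finally show "norm (LINT w|white_noise. norm (?Yn n w - ?Y w)) \<le> (\<Sum>i\<in>F. \<bar>c i\<bar> * sqrt (K i i - s n i))" by simp
      qed
      have "(\<lambda>n. \<Sum>i\<in>F. \<bar>c i\<bar> * sqrt (K i i - s n i)) \<longlonglongrightarrow> (\<Sum>i\<in>F. \<bar>c i\<bar> * sqrt (K i i - K i i))"
        using F by (intro tendsto_intros s) auto
      then show "(\<lambda>n. \<Sum>i\<in>F. \<bar>c i\<bar> * sqrt (K i i - s n i)) \<longlonglongrightarrow> 0" by simp
    qed
    moreover have "integrable white_noise (\<lambda>w. ?Yn n w - ?Y w)" for n
      unfolding d using ii by simp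
    ultimately obtain \<rho> where \<rho>: "AE w in white_noise. (\<lambda>n. ?Yn (\<rho> n) w - ?Y w) \<longlonglongrightarrow> 0"
      using tendsto_L1_AE_subseq[of white_noise "\<lambda>n w. ?Yn n w - ?Y w"] by blast
    then have "AE w in white_noise. (\<lambda>n. ?Yn (\<rho> n) w) \<longlonglongrightarrow> ?Y w"
      by eventually_elim (rule LIM_zero_cancel)
    then have "centered_normal white_noise ?Y (sqrt (LINT w|white_noise. (?Y w)\<^sup>2))"
      by (intro centered_normal_limit[OF prob_space_white_noise, where X="\<lambda>n. ?Yn (\<rho> n)"] Yn) simp_all
    then show ?thesis by (rule centered_normal_imp_gaussian_rv[OF prob_space_white_noise])
  qed
  have "centered_gaussian_process white_noise I S"
    unfolding centered_gaussian_process_def gaussian_process_def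
    using comb prob_space_white_noise centered_normal_moments(2)[OF prob_space_white_noise S0] by blast
  then show ?thesis using cov by blast
qed

section \<open>Second moments of random integrals\<close>

lemma abs_powr_integral:
  fixes s c :: real
  assumes s: "- 1 < s" and c: "0 \<le> c"
  shows "integrable lborel (\<lambda>x. indicator {-c..c} x * \<bar>x\<bar> powr s)"
    and "(LINT x|lborel. indicator {-c..c} x * \<bar>x\<bar> powr s) = 2 * c powr (s + 1) / (s + 1)"
proof -
  let ?f = "\<lambda>x::real. indicator {0..c} x * x powr s"
  have "((\<lambda>x. x powr s) has_integral (c powr (s + 1) / (s + 1))) {0..c}" by (rule has_integral_powr_from_0[OF s c])
  then have "((\<lambda>x. if x \<in> {0..c} then x powr s else 0) has_integral (c powr (s + 1) / (s + 1))) UNIV"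
    by (simp only: has_integral_restrict_UNIV)
  moreover have "(\<lambda>x. if x \<in> {0..c} then x powr s else 0) = ?f" by (auto simp: fun_eq_iff split: split_indicator)
  ultimately have hi: "(?f has_integral (c powr (s + 1) / (s + 1))) UNIV" by simp
  have nn: "(\<integral>\<^sup>+x. ennreal (?f x) \<partial>lborel) = ennreal (c powr (s + 1) / (s + 1))"
    by (rule nn_integral_has_integral_lborel[OF _ _ hi]) auto
  have I0: "0 \<le> c powr (s + 1) / (s + 1)" using s by simp
  have f: "has_bochner_integral lborel ?f (c powr (s + 1) / (s + 1))"
    by (rule has_bochner_integral_nn_integral[OF _ _ I0 nn]) auto
  have fr: "has_bochner_integral lborel (\<lambda>x. ?f (0 + (-1) * x)) (c powr (s + 1) / (s + 1))"
    using f lborel_has_bochner_integral_real_affine_iff[of "-1" ?f "c powr (s + 1) / (s + 1)" 0] by simp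
  have "has_bochner_integral lborel (\<lambda>x. ?f x + ?f (0 + (-1) * x)) (c powr (s + 1) / (s + 1) + c powr (s + 1) / (s + 1))"
    by (rule has_bochner_integral_add[OF f fr])
  moreover have "AE x in lborel. x \<noteq> (0::real)" by (rule AE_lborel_singleton)
  then have "AE x in lborel. ?f x + ?f (0 + (-1) * x) = indicator {-c..c} x * \<bar>x\<bar> powr s"
    by eventually_elim (auto split: split_indicator)
  ultimately have "has_bochner_integral lborel (\<lambda>x. indicator {-c..c} x * \<bar>x\<bar> powr s) (c powr (s + 1) / (s + 1) + c powr (s + 1) / (s + 1))"
    by (subst (asm) has_bochner_integral_cong_AE) auto
  then show "integrable lborel (\<lambda>x. indicator {-c..c} x * \<bar>x\<bar> powr s)"
    "(LINT x|lborel. indicator {-c..c} x * \<bar>x\<bar> powr s) = 2 * c powr (s + 1) / (s + 1)"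
    by (simp_all add: has_bochner_integral_iff)
qed

text \<open>For u in the interval all differences lie in \<open>{- (b - a)..b - a}\<close>;
  enlarging to this set makes the bound independent of u.\<close>

lemma riesz_inner_integral:
  fixes s a b u :: real
  assumes s: "- 1 < s" and u: "u \<in> {a..b}"
  shows "integrable lborel (\<lambda>v. indicator {a..b} v * \<bar>u - v\<bar> powr s)"
    and "(LINT v|lborel. indicator {a..b} v * \<bar>u - v\<bar> powr s) \<le> 2 * (b - a) powr (s + 1) / (s + 1)"
proof -
  define c where "c = b - a"
  have c: "0 \<le> c" using u by (simp add: c_def)
  let ?k = "\<lambda>x. indicator {-c..c} x * \<bar>x\<bar> powr s :: real"
  have k: "integrable lborel (\<lambda>v. ?k (- u + 1 * v))"
    by (rule lborel_integrable_real_affine[OF abs_powr_integral(1)[OF s c]]) simp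
  have ki: "(LINT v|lborel. ?k (- u + 1 * v)) = 2 * c powr (s + 1) / (s + 1)"
    using lborel_integral_real_affine[of 1 ?k "- u"] abs_powr_integral(2)[OF s c] by simp
  have le: "indicator {a..b} v * \<bar>u - v\<bar> powr s \<le> ?k (- u + 1 * v)" for v
    using u by (auto simp: c_def abs_minus_commute split: split_indicator)
  show I: "integrable lborel (\<lambda>v. indicator {a..b} v * \<bar>u - v\<bar> powr s)"
    by (rule Bochner_Integration.integrable_bound[OF k]) (use le in \<open>auto intro!: AE_I2 order_trans[OF _ abs_ge_self]\<close>)
  have "(LINT v|lborel. indicator {a..b} v * \<bar>u - v\<bar> powr s) \<le> (LINT v|lborel. ?k (- u + 1 * v))"
    by (intro integral_mono I k le)
  then show "(LINT v|lborel. indicator {a..b} v * \<bar>u - v\<bar> powr s) \<le> 2 * (b - a) powr (s + 1) / (s + 1)"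
    using ki unfolding c_def by (simp only:)
qed

definition riesz :: "real \<Rightarrow> real \<Rightarrow> real \<Rightarrow> real \<times> real \<Rightarrow> real" where
  "riesz s a b = (\<lambda>(u, v). indicator {a..b} u * indicator {a..b} v * \<bar>u - v\<bar> powr s)"

lemma riesz_nonneg: "0 \<le> riesz s a b x"
  by (simp add: riesz_def case_prod_unfold)

lemma riesz_measurable[measurable]: "riesz s a b \<in> borel_measurable (lborel \<Otimes>\<^sub>M lborel)"
  unfolding riesz_def by measurable

text \<open>At s = 2 lo - 2 the exponent s + 2 of the length is 2 lo: this is the origin of the
  regularity of V and W.\<close>

lemma riesz_integrable:
  assumes s: "- 1 < s" and ab: "a \<le> b"
  shows "integrable (lborel \<Otimes>\<^sub>M lborel) (riesz s a b)"
    and "(LINT x|(lborel \<Otimes>\<^sub>M lborel). riesz s a b x) \<le> 2 / (s + 1) * (b - a) powr (s + 2)"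
proof -
  let ?B = "2 * (b - a) powr (s + 1) / (s + 1)"
  have inner: "(LINT v|lborel. riesz s a b (u, v)) = indicator {a..b} u * (LINT v|lborel. indicator {a..b} v * \<bar>u - v\<bar> powr s)" for u
    by (simp add: riesz_def mult.assoc)
  have le: "(LINT v|lborel. riesz s a b (u, v)) \<le> indicator {a..b} u * ?B" for u
    unfolding inner using riesz_inner_integral(2)[OF s, of u a b] by (auto split: split_indicator)
  have ge: "0 \<le> (LINT v|lborel. riesz s a b (u, v))" for u by (simp add: riesz_nonneg)
  have iB: "integrable lborel (\<lambda>u. indicator {a..b} u * ?B)" by (intro integrable_mult_left integrable_real_indicator) (auto simp: emeasure_lborel_Icc_eq)
  have [measurable]: "(\<lambda>u. LINT v|lborel. riesz s a b (u, v)) \<in> borel_measurable lborel"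
    by (rule lborel.borel_measurable_lebesgue_integral) simp
  have ii: "integrable lborel (\<lambda>u. LINT v|lborel. riesz s a b (u, v))"
  proof (rule Bochner_Integration.integrable_bound[OF iB])
    show "AE u in lborel. norm (LINT v|lborel. riesz s a b (u, v)) \<le> norm (indicator {a..b} u * ?B)"
    proof (intro AE_I2)
      fix u show "norm (LINT v|lborel. riesz s a b (u, v)) \<le> norm (indicator {a..b} u * ?B)"
        using order_trans[OF le[of u] abs_ge_self] ge[of u] by (simp only: real_norm_def abs_of_nonneg)
    qed
  qed simp
  show I: "integrable (lborel \<Otimes>\<^sub>M lborel) (riesz s a b)"
  proof (rule lborel_pair.Fubini_integrable)
    show "integrable lborel (\<lambda>u. LINT v|lborel. norm (riesz s a b (u, v)))" using ii by (simp add: riesz_nonneg)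
    show "AE u in lborel. integrable lborel (\<lambda>v. riesz s a b (u, v))"
    proof (intro AE_I2)
      fix u
      show "integrable lborel (\<lambda>v. riesz s a b (u, v))"
        using riesz_inner_integral(1)[OF s, of u a b] by (cases "u \<in> {a..b}") (simp_all add: riesz_def mult.assoc)
    qed
  qed simp
  have "(LINT x|(lborel \<Otimes>\<^sub>M lborel). riesz s a b x) = (LINT u|lborel. LINT v|lborel. riesz s a b (u, v))"
    by (rule lborel_pair.integral_fst'[OF I, symmetric])
  also have "\<dots> \<le> (LINT u|lborel. indicator {a..b} u * ?B)" by (intro integral_mono ii iB le)
  also have "\<dots> = (b - a) * ?B" using ab by simp
  also have "\<dots> = 2 / (s + 1) * (b - a) powr (s + 2)"
  proof (cases "a = b")
    case False
    then have "(b - a) powr (s + 2) = (b - a) powr (s + 1) * (b - a)"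
      using ab powr_add[of "b - a" "s + 1" 1] by (simp add: add.commute)
    then show ?thesis by simp
  qed simp
  finally show "(LINT x|(lborel \<Otimes>\<^sub>M lborel). riesz s a b x) \<le> 2 / (s + 1) * (b - a) powr (s + 2)" .
qed

lemma AE_pair_off_diagonal: "AE x in (lborel \<Otimes>\<^sub>M (lborel :: real measure)). fst x \<noteq> snd x"
proof (rule lborel_pair.AE_pair_measure)
  show "AE x in lborel. AE y in lborel. fst (x, y :: real) \<noteq> snd (x :: real, y)"
  proof (rule AE_I2)
    fix x :: real
    have "AE y in lborel. y \<noteq> x" by (rule AE_lborel_singleton)
    then show "AE y in lborel. fst (x, y :: real) \<noteq> snd (x, y)" by eventually_elim simp
  qed
qed measurable

text \<open>The square is a double integral, exchanged with the expectation. B only secures absolute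
  integrability and does not enter the result, so it may blow up as \<epsilon> tends to 0.\<close>

lemma (in prob_space) second_moment_of_integral:
  fixes X :: "real \<Rightarrow> 'a \<Rightarrow> real" and g :: "real \<Rightarrow> real"
  assumes X[measurable]: "(\<lambda>(u, w). X u w) \<in> borel_measurable (lborel \<Otimes>\<^sub>M M)"
    and g[measurable]: "g \<in> borel_measurable borel" and gb: "\<And>u. \<bar>g u\<bar> \<le> G * indicator {a..b} u"
    and X2: "\<And>u. integrable M (\<lambda>w. (X u w)\<^sup>2)" "\<And>u. (LINT w|M. (X u w)\<^sup>2) \<le> B"
  shows "integrable M (\<lambda>w. (LINT u|lborel. g u * X u w)\<^sup>2)"
    and "(LINT w|M. (LINT u|lborel. g u * X u w)\<^sup>2) =
      (LINT x|(lborel \<Otimes>\<^sub>M lborel). g (fst x) * g (snd x) * (LINT w|M. X (fst x) w * X (snd x) w))"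
proof -
  interpret L: sigma_finite_measure "lborel \<Otimes>\<^sub>M (lborel :: real measure)"
    unfolding lborel_prod by (rule lborel.sigma_finite_measure_axioms)
  interpret P: pair_sigma_finite "lborel \<Otimes>\<^sub>M (lborel :: real measure)" M ..
  let ?L = "lborel \<Otimes>\<^sub>M (lborel :: real measure)"
  let ?F = "\<lambda>x w. g (fst x) * g (snd x) * (X (fst x) w * X (snd x) w)"
  have [measurable]: "(\<lambda>x. X (fst (fst x)) (snd x)) \<in> borel_measurable (?L \<Otimes>\<^sub>M M)"
    "(\<lambda>x. X (snd (fst x)) (snd x)) \<in> borel_measurable (?L \<Otimes>\<^sub>M M)"
    using measurable_compose[OF _ X, of "\<lambda>x. (fst (fst x), snd x)" "?L \<Otimes>\<^sub>M M"]
      measurable_compose[OF _ X, of "\<lambda>x. (snd (fst x), snd x)" "?L \<Otimes>\<^sub>M M"] by simp_all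
  have Xu[measurable]: "X u \<in> borel_measurable M" for u
    using measurable_compose[OF _ X, of "\<lambda>w. (u, w)" M] by simp
  have G0: "0 \<le> G" if "a \<le> b" using gb[of a] that by auto
  have B0: "0 \<le> B" using order_trans[OF integral_nonneg_AE X2(2)[of 0]] by simp
  have XX: "integrable M (\<lambda>w. X u w * X v w)" for u v
    using X2 by (intro integrable_mult_of_squares) auto
  have XXb: "(LINT w|M. \<bar>X u w * X v w\<bar>) \<le> B" for u v
  proof -
    have "norm (LINT w|M. \<bar>X u w\<bar> * \<bar>X v w\<bar>) \<le> sqrt (LINT w|M. (norm \<bar>X u w\<bar>)\<^sup>2) * sqrt (LINT w|M. (norm \<bar>X v w\<bar>)\<^sup>2)"
      using X2 by (intro Cauchy_Schwarz_integral) auto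
    also have "\<dots> \<le> sqrt B * sqrt B" using X2 B0 by (intro mult_mono real_sqrt_le_mono) auto
    finally show ?thesis using B0 by (simp add: abs_mult)
  qed
  have gg: "\<bar>g (fst x) * g (snd x)\<bar> \<le> G\<^sup>2 * indicator ({a..b} \<times> {a..b}) x" for x
  proof -
    have "\<bar>g (fst x) * g (snd x)\<bar> \<le> (G * indicator {a..b} (fst x)) * (G * indicator {a..b} (snd x))"
      unfolding abs_mult using gb order_trans[OF abs_ge_zero gb] by (intro mult_mono) auto
    then show ?thesis by (cases x) (auto simp: power2_eq_square split: split_indicator_asm split_indicator)
  qed
  have fin: "emeasure ?L ({a..b} \<times> {a..b}) < \<infinity>"
    by (subst lborel.emeasure_pair_measure_Times) (auto simp: emeasure_lborel_Icc_eq ennreal_mult_less_top)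
  have int: "integrable (?L \<Otimes>\<^sub>M M) (\<lambda>(x, w). ?F x w)"
  proof (rule P.Fubini_integrable)
    have "integrable ?L (\<lambda>x. G\<^sup>2 * indicator ({a..b} \<times> {a..b}) x * B)"
      using fin by (intro integrable_mult_left integrable_mult_right integrable_real_indicator) auto
    then show "integrable ?L (\<lambda>x. LINT w|M. norm (case (x, w) of (x, w) \<Rightarrow> ?F x w))"
    proof (rule Bochner_Integration.integrable_bound)
      show "AE x in ?L. norm (LINT w|M. norm (case (x, w) of (x, w) \<Rightarrow> ?F x w)) \<le> norm (G\<^sup>2 * indicator ({a..b} \<times> {a..b}) x * B)"
      proof (intro AE_I2)
        fix x
        have "(LINT w|M. norm (?F x w)) = \<bar>g (fst x) * g (snd x)\<bar> * (LINT w|M. \<bar>X (fst x) w * X (snd x) w\<bar>)"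
          by (simp add: abs_mult)
        also have "\<dots> \<le> (G\<^sup>2 * indicator ({a..b} \<times> {a..b}) x) * B"
          by (intro mult_mono gg XXb) auto
        finally show "norm (LINT w|M. norm (case (x, w) of (x, w) \<Rightarrow> ?F x w)) \<le> norm (G\<^sup>2 * indicator ({a..b} \<times> {a..b}) x * B)"
          using B0 by simp
      qed
    qed measurable
    show "AE x in ?L. integrable M (\<lambda>w. case (x, w) of (x, w) \<Rightarrow> ?F x w)" using XX by simp
  qed measurable
  have inner: "AE w in M. (LINT x|?L. ?F x w) = (LINT u|lborel. g u * X u w)\<^sup>2"
    using P.AE_integrable_snd[OF int]
  proof eventually_elim
    case (elim w)
    have "(LINT x|?L. ?F x w) = (LINT u|lborel. LINT v|lborel. ?F (u, v) w)"
      using elim by (intro lborel_pair.integral_fst'[symmetric]) simp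
    also have "\<dots> = (LINT u|lborel. (g u * X u w) * (LINT v|lborel. g v * X v w))"
      by (subst integral_mult_right_zero[symmetric]) (simp add: mult_ac)
    also have "\<dots> = (LINT u|lborel. g u * X u w)\<^sup>2" by (simp add: power2_eq_square)
    finally show ?case .
  qed
  have i2: "integrable M (\<lambda>w. LINT x|?L. ?F x w)" using P.integrable_snd[OF int] by simp
  have m2: "(\<lambda>w. (LINT u|lborel. g u * X u w)\<^sup>2) \<in> borel_measurable M"
  proof -
    have "(\<lambda>(w, u). g u * X u w) \<in> borel_measurable (M \<Otimes>\<^sub>M lborel)"
      using measurable_compose[OF measurable_pair_swap' X] by (simp add: case_prod_unfold)
    then have "(\<lambda>w. LINT u|lborel. g u * X u w) \<in> borel_measurable M"
      by (rule lborel.borel_measurable_lebesgue_integral)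
    then show ?thesis by simp
  qed
  show "integrable M (\<lambda>w. (LINT u|lborel. g u * X u w)\<^sup>2)"
    using i2 m2 inner by (subst integrable_cong_AE[symmetric, where f="\<lambda>w. LINT x|?L. ?F x w"]) auto
  have "(LINT w|M. (LINT u|lborel. g u * X u w)\<^sup>2) = (LINT w|M. LINT x|?L. ?F x w)"
    by (rule integral_cong_AE) (use i2 m2 inner in auto)
  also have "\<dots> = (LINT x|?L. LINT w|M. ?F x w)" by (rule P.Fubini_integral[OF int])
  finally show "(LINT w|M. (LINT u|lborel. g u * X u w)\<^sup>2) =
      (LINT x|?L. g (fst x) * g (snd x) * (LINT w|M. X (fst x) w * X (snd x) w))" by simp
qed

text \<open>The Riemann--Lebesgue lemma in the variable \<open>v\<close>, followed by dominated convergence in \<open>u\<close>.\<close>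
lemma oscillating_double_integral_tendsto:
  fixes F :: "real \<times> real \<Rightarrow> real" and \<mu> :: "nat \<Rightarrow> real" and p :: "nat \<Rightarrow> real \<Rightarrow> real"
  assumes F: "integrable (lborel \<Otimes>\<^sub>M lborel) F"
    and \<mu>: "filterlim \<mu> at_infinity sequentially"
    and p: "\<And>n. p n \<in> borel_measurable borel" "\<And>n u. \<bar>p n u\<bar> \<le> 1"
  shows "(\<lambda>n. LINT x|(lborel \<Otimes>\<^sub>M lborel). F x * p n (fst x) * cos (\<mu> n * snd x)) \<longlonglongrightarrow> 0"
    and "(\<lambda>n. LINT x|(lborel \<Otimes>\<^sub>M lborel). F x * p n (fst x) * sin (\<mu> n * snd x)) \<longlonglongrightarrow> 0"
proof -
  have [measurable]: "F \<in> borel_measurable (lborel \<Otimes>\<^sub>M lborel)" using F by auto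
  note [measurable] = p(1)
  \<comment> \<open>\<open>T\<close> stands for cosine and sine alike. The factor \<open>p n\<close>
    is merely bounded, as oscillation in one of the two variables is enough.\<close>
  have main: "(\<lambda>n. LINT x|(lborel \<Otimes>\<^sub>M lborel). F x * p n (fst x) * T (\<mu> n * snd x)) \<longlonglongrightarrow> 0"
    if T[measurable]: "T \<in> borel_measurable borel" and T1: "\<And>x. \<bar>T x\<bar> \<le> 1"
      and RL: "\<And>f. integrable lborel f \<Longrightarrow> (\<lambda>n. LINT v|lborel. f v * T (\<mu> n * v)) \<longlonglongrightarrow> 0" for T :: "real \<Rightarrow> real"
  proof -
    have pT: "\<bar>p n u * T y\<bar> \<le> 1" for n u y using p(2) T1 by (simp add: abs_mult mult_le_one)
    have I: "integrable (lborel \<Otimes>\<^sub>M lborel) (\<lambda>x. F x * p n (fst x) * T (\<mu> n * snd x))" for n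
    proof (rule Bochner_Integration.integrable_bound[OF F])
      show "AE x in (lborel \<Otimes>\<^sub>M lborel). norm (F x * p n (fst x) * T (\<mu> n * snd x)) \<le> norm (F x)"
      proof (intro AE_I2)
        fix x
        show "norm (F x * p n (fst x) * T (\<mu> n * snd x)) \<le> norm (F x)"
          using mult_left_mono[OF pT[of n "fst x" "\<mu> n * snd x"], of "\<bar>F x\<bar>"] by (simp add: abs_mult mult.assoc)
      qed
    qed measurable
    have "(\<lambda>n. LINT u|lborel. p n u * (LINT v|lborel. F (u, v) * T (\<mu> n * v))) \<longlonglongrightarrow> (LINT u|(lborel::real measure). 0)"
    proof (rule integral_dominated_convergence[where w="\<lambda>u. LINT v|lborel. \<bar>F (u, v)\<bar>"])
      show "integrable lborel (\<lambda>u. LINT v|lborel. \<bar>F (u, v)\<bar>)"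
        using lborel_pair.integrable_fst'[OF integrable_abs[OF F]] by simp
      have ae: "AE u in lborel. integrable lborel (\<lambda>v. F (u, v))" using lborel_pair.AE_integrable_fst'[OF F] by simp
      show "AE u in lborel. (\<lambda>n. p n u * (LINT v|lborel. F (u, v) * T (\<mu> n * v))) \<longlonglongrightarrow> 0"
        using ae
      proof eventually_elim
        case (elim u)
        have "(\<lambda>n. \<bar>LINT v|lborel. F (u, v) * T (\<mu> n * v)\<bar>) \<longlonglongrightarrow> 0" using RL[OF elim] by (rule tendsto_rabs_zero)
        then show ?case
        proof (rule Lim_null_comparison[rotated], intro always_eventually allI)
          fix n show "norm (p n u * (LINT v|lborel. F (u, v) * T (\<mu> n * v))) \<le> \<bar>LINT v|lborel. F (u, v) * T (\<mu> n * v)\<bar>"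
            using mult_right_mono[OF p(2)[of n u], of "\<bar>LINT v|lborel. F (u, v) * T (\<mu> n * v)\<bar>"] by (simp add: abs_mult)
        qed
      qed
      show "AE u in lborel. norm (p n u * (LINT v|lborel. F (u, v) * T (\<mu> n * v))) \<le> (LINT v|lborel. \<bar>F (u, v)\<bar>)" for n
        using ae
      proof eventually_elim
        case (elim u)
        have le: "\<bar>F (u, v) * T (\<mu> n * v)\<bar> \<le> \<bar>F (u, v)\<bar>" for v
          using mult_left_mono[OF T1[of "\<mu> n * v"], of "\<bar>F (u, v)\<bar>"] by (simp add: abs_mult)
        have [measurable]: "(\<lambda>v. F (u, v)) \<in> borel_measurable lborel" using elim by auto
        have "integrable lborel (\<lambda>v. F (u, v) * T (\<mu> n * v))"
          by (rule Bochner_Integration.integrable_bound[OF elim]) (use le in auto)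
        then have "(LINT v|lborel. \<bar>F (u, v) * T (\<mu> n * v)\<bar>) \<le> (LINT v|lborel. \<bar>F (u, v)\<bar>)"
          using elim le by (intro integral_mono) auto
        then have "\<bar>LINT v|lborel. F (u, v) * T (\<mu> n * v)\<bar> \<le> (LINT v|lborel. \<bar>F (u, v)\<bar>)"
          using integral_norm_bound[of lborel "\<lambda>v. F (u, v) * T (\<mu> n * v)"] unfolding real_norm_def by linarith
        moreover have "\<bar>p n u * (LINT v|lborel. F (u, v) * T (\<mu> n * v))\<bar> \<le> \<bar>LINT v|lborel. F (u, v) * T (\<mu> n * v)\<bar>"
          using mult_right_mono[OF p(2)[of n u], of "\<bar>LINT v|lborel. F (u, v) * T (\<mu> n * v)\<bar>"] by (simp add: abs_mult)
        ultimately show ?case by simp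
      qed
    qed measurable
    moreover have "(LINT x|(lborel \<Otimes>\<^sub>M lborel). F x * p n (fst x) * T (\<mu> n * snd x)) =
        (LINT u|lborel. p n u * (LINT v|lborel. F (u, v) * T (\<mu> n * v)))" for n
      unfolding lborel_pair.integral_fst'[OF I, symmetric]
      by (intro Bochner_Integration.integral_cong refl, subst integral_mult_right_zero[symmetric]) (simp add: mult_ac)
    ultimately show ?thesis by simp
  qed
  have RLc: "(\<lambda>n. LINT v|lborel. f v *\<^sub>R iexp (\<mu> n * v)) \<longlonglongrightarrow> 0" if "integrable lborel f" for f :: "real \<Rightarrow> real"
    by (rule filterlim_compose[OF riemann_lebesgue[OF that] \<mu>])
  have ic: "integrable lborel (\<lambda>v. f v *\<^sub>R iexp (l * v))" if "integrable lborel f" for f :: "real \<Rightarrow> real" and l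
    using that by (rule Bochner_Integration.integrable_bound) (use that in \<open>auto intro!: borel_measurable_scaleR\<close>)
  show "(\<lambda>n. LINT x|(lborel \<Otimes>\<^sub>M lborel). F x * p n (fst x) * cos (\<mu> n * snd x)) \<longlonglongrightarrow> 0"
  proof (rule main)
    fix f :: "real \<Rightarrow> real" assume f: "integrable lborel f"
    have "Re (LINT v|lborel. f v *\<^sub>R iexp (l * v)) = (LINT v|lborel. f v * cos (l * v))" for l
      by (subst integral_Re[OF ic[OF f], symmetric]) (simp add: Re_exp)
    then show "(\<lambda>n. LINT v|lborel. f v * cos (\<mu> n * v)) \<longlonglongrightarrow> 0" using tendsto_Re[OF RLc[OF f]] by simp
  qed auto
  show "(\<lambda>n. LINT x|(lborel \<Otimes>\<^sub>M lborel). F x * p n (fst x) * sin (\<mu> n * snd x)) \<longlonglongrightarrow> 0"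
  proof (rule main)
    fix f :: "real \<Rightarrow> real" assume f: "integrable lborel f"
    have "Im (LINT v|lborel. f v *\<^sub>R iexp (l * v)) = (LINT v|lborel. f v * sin (l * v))" for l
      by (subst integral_Im[OF ic[OF f], symmetric]) (simp add: Im_exp)
    then show "(\<lambda>n. LINT v|lborel. f v * sin (\<mu> n * v)) \<longlonglongrightarrow> 0" using tendsto_Im[OF RLc[OF f]] by simp
  qed auto
qed

section \<open>Long-range correlated Gaussian fields\<close>

locale correlated_field = prob_space M for M :: "'w measure" +
  fixes m :: "real \<Rightarrow> real \<Rightarrow> 'w \<Rightarrow> real" and lo hi :: real and r :: "real \<Rightarrow> real \<Rightarrow> real"
  assumes lo_hi: "1/2 < lo" "lo \<le> hi" "hi < 1"
    and gauss: "centered_gaussian_process M ({0..} \<times> {lo..hi}) (\<lambda>(z, H). m z H)"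
    and cont: "\<forall>w\<in>space M. continuous_on ({0..} \<times> {lo..hi}) (\<lambda>(z, H). m z H w)"
    and unit: "\<forall>z\<in>{0..}. \<forall>H\<in>{lo..hi}. (LINT w|M. (m z H w)\<^sup>2) = 1"
    and r_cont: "continuous_on ({lo..hi} \<times> {lo..hi}) (\<lambda>(H\<^sub>1, H\<^sub>2). r H\<^sub>1 H\<^sub>2)"
    and decay: "((\<lambda>(z\<^sub>1, z\<^sub>2). SUP (H\<^sub>1, H\<^sub>2)\<in>{lo..hi} \<times> {lo..hi}.
            \<bar>r H\<^sub>1 H\<^sub>2 - (z\<^sub>1 - z\<^sub>2) powr (2 - H\<^sub>1 - H\<^sub>2) * (LINT w|M. m z\<^sub>1 H\<^sub>1 w * m z\<^sub>2 H\<^sub>2 w)\<bar>)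
          \<longlongrightarrow> 0)
         (inf (filtercomap (\<lambda>(z\<^sub>1, z\<^sub>2). z\<^sub>1 - z\<^sub>2) at_top) (principal ({0..} \<times> {0..})))"
begin

abbreviation "\<H> \<equiv> {lo..hi}"

definition corr :: "real \<Rightarrow> real \<Rightarrow> real \<Rightarrow> real \<Rightarrow> real" where
  "corr z\<^sub>1 H\<^sub>1 z\<^sub>2 H\<^sub>2 = (LINT w|M. m z\<^sub>1 H\<^sub>1 w * m z\<^sub>2 H\<^sub>2 w)"

lemma corr_commute: "corr z\<^sub>1 H\<^sub>1 z\<^sub>2 H\<^sub>2 = corr z\<^sub>2 H\<^sub>2 z\<^sub>1 H\<^sub>1"
  by (simp add: corr_def mult.commute)

lemma combination_gaussian:
  assumes "finite F" "F \<subseteq> {0..} \<times> \<H>"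
  shows "gaussian_rv M (\<lambda>w. \<Sum>i\<in>F. c i * m (fst i) (snd i) w)"
  using gauss assms by (auto simp: centered_gaussian_process_def gaussian_process_def case_prod_unfold)

lemma mean_zero: "0 \<le> z \<Longrightarrow> H \<in> \<H> \<Longrightarrow> (LINT w|M. m z H w) = 0"
  using gauss by (auto simp: centered_gaussian_process_def)

lemma m_standard_normal: assumes "0 \<le> z" "H \<in> \<H>" shows "centered_normal M (m z H) 1"
proof -
  have "gaussian_rv M (m z H)" using combination_gaussian[of "{(z, H)}" "\<lambda>_. 1"] assms by simp
  from gaussian_rv_imp_centered_normal[OF prob_space_axioms this mean_zero[OF assms]] unit assms show ?thesis by simp
qed

lemma m_measurable: "0 \<le> z \<Longrightarrow> H \<in> \<H> \<Longrightarrow> m z H \<in> borel_measurable M"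
  using m_standard_normal by (auto simp: centered_normal_def)

lemma m_square_integrable: "0 \<le> z \<Longrightarrow> H \<in> \<H> \<Longrightarrow> integrable M (\<lambda>w. (m z H w)\<^sup>2)"
  using centered_normal_moments(3)[OF prob_space_axioms m_standard_normal] .

lemma m_gaussian_pair:
  assumes 1: "0 \<le> z\<^sub>1" "H\<^sub>1 \<in> \<H>" and 2: "0 \<le> z\<^sub>2" "H\<^sub>2 \<in> \<H>"
  shows "gaussian_pair M (m z\<^sub>1 H\<^sub>1) (m z\<^sub>2 H\<^sub>2) (corr z\<^sub>1 H\<^sub>1 z\<^sub>2 H\<^sub>2)"
  unfolding gaussian_pair_def
proof (intro conjI allI)
  note meas[measurable] = m_measurable[OF 1] m_measurable[OF 2]
  have int: "integrable M (\<lambda>w. m z\<^sub>1 H\<^sub>1 w * m z\<^sub>2 H\<^sub>2 w)"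
    using m_square_integrable[OF 1] m_square_integrable[OF 2] by (intro integrable_mult_of_squares) auto
  show "m z\<^sub>1 H\<^sub>1 \<in> borel_measurable M" "m z\<^sub>2 H\<^sub>2 \<in> borel_measurable M" by (rule meas)+
  fix s t
  let ?Y = "\<lambda>w. s * m z\<^sub>1 H\<^sub>1 w + t * m z\<^sub>2 H\<^sub>2 w"
  have g: "gaussian_rv M ?Y"
  \<comment> \<open>Gaussian combinations run over sets of indices, so two equal indices collapse to
    one point with coefficient \<open>s + t\<close>.\<close>
  proof (cases "(z\<^sub>1, H\<^sub>1) = (z\<^sub>2, H\<^sub>2)")
    case True
    then show ?thesis using combination_gaussian[of "{(z\<^sub>1, H\<^sub>1)}" "\<lambda>_. s + t"] 1 by (simp add: distrib_right)
  next
    case False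
    then show ?thesis
      using combination_gaussian[of "{(z\<^sub>1, H\<^sub>1), (z\<^sub>2, H\<^sub>2)}" "\<lambda>i. if i = (z\<^sub>1, H\<^sub>1) then s else t"] 1 2 by auto
  qed
  have i1: "integrable M (m z\<^sub>1 H\<^sub>1)" "integrable M (m z\<^sub>2 H\<^sub>2)"
    using centered_normal_moments(1)[OF prob_space_axioms m_standard_normal] 1 2 by auto
  have 0: "(LINT w|M. ?Y w) = 0" using i1 mean_zero 1 2 by simp
  have "(LINT w|M. (?Y w)\<^sup>2) = (LINT w|M. s\<^sup>2 * (m z\<^sub>1 H\<^sub>1 w)\<^sup>2 + 2 * s * t * (m z\<^sub>1 H\<^sub>1 w * m z\<^sub>2 H\<^sub>2 w) + t\<^sup>2 * (m z\<^sub>2 H\<^sub>2 w)\<^sup>2)"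
    by (intro Bochner_Integration.integral_cong refl) (simp add: power2_eq_square algebra_simps)
  also have "\<dots> = s\<^sup>2 + 2 * s * t * corr z\<^sub>1 H\<^sub>1 z\<^sub>2 H\<^sub>2 + t\<^sup>2"
    using int m_square_integrable 1 2 unit by (simp add: corr_def)
  finally have v: "(LINT w|M. (?Y w)\<^sup>2) = s\<^sup>2 + 2 * s * t * corr z\<^sub>1 H\<^sub>1 z\<^sub>2 H\<^sub>2 + t\<^sup>2" .
  have "(LINT w|M. iexp (1 * ?Y w)) = complex_of_real (exp (- ((sqrt (LINT w|M. (?Y w)\<^sup>2) * 1)\<^sup>2) / 2))"
    using gaussian_rv_imp_centered_normal[OF prob_space_axioms g 0] unfolding centered_normal_def by blast
  moreover have "(sqrt (LINT w|M. (?Y w)\<^sup>2) * 1)\<^sup>2 = s\<^sup>2 + 2 * s * t * corr z\<^sub>1 H\<^sub>1 z\<^sub>2 H\<^sub>2 + t\<^sup>2"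
    unfolding v[symmetric] mult_1_right by (rule real_sqrt_pow2) simp
  ultimately show "(LINT w|M. iexp (?Y w)) = complex_of_real (exp (- (s\<^sup>2 + 2 * corr z\<^sub>1 H\<^sub>1 z\<^sub>2 H\<^sub>2 * s * t + t\<^sup>2) / 2))"
    by (simp only: mult_1 mult_ac)
qed

lemma corr_le_1:
  assumes 1: "0 \<le> z\<^sub>1" "H\<^sub>1 \<in> \<H>" and 2: "0 \<le> z\<^sub>2" "H\<^sub>2 \<in> \<H>"
  shows "\<bar>corr z\<^sub>1 H\<^sub>1 z\<^sub>2 H\<^sub>2\<bar> \<le> 1"
proof -
  have "norm (LINT w|M. m z\<^sub>1 H\<^sub>1 w * m z\<^sub>2 H\<^sub>2 w) \<le> sqrt (LINT w|M. (norm (m z\<^sub>1 H\<^sub>1 w))\<^sup>2) * sqrt (LINT w|M. (norm (m z\<^sub>2 H\<^sub>2 w))\<^sup>2)"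
    using assms m_square_integrable m_measurable by (intro Cauchy_Schwarz_integral) auto
  then show ?thesis using unit assms by (simp add: corr_def)
qed

lemma r_bounded: obtains B where "\<And>H\<^sub>1 H\<^sub>2. H\<^sub>1 \<in> \<H> \<Longrightarrow> H\<^sub>2 \<in> \<H> \<Longrightarrow> \<bar>r H\<^sub>1 H\<^sub>2\<bar> \<le> B"
proof -
  have "bounded ((\<lambda>(H\<^sub>1, H\<^sub>2). r H\<^sub>1 H\<^sub>2) ` (\<H> \<times> \<H>))"
    by (intro compact_imp_bounded compact_continuous_image r_cont compact_Times compact_Icc)
  then obtain B where B: "\<forall>x\<in>(\<lambda>(H\<^sub>1, H\<^sub>2). r H\<^sub>1 H\<^sub>2) ` (\<H> \<times> \<H>). norm x \<le> B" unfolding bounded_iff ..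
  have "\<bar>r H\<^sub>1 H\<^sub>2\<bar> \<le> B" if "H\<^sub>1 \<in> \<H>" "H\<^sub>2 \<in> \<H>" for H\<^sub>1 H\<^sub>2
    using B[rule_format, of "r H\<^sub>1 H\<^sub>2"] that by force
  then show ?thesis by (rule that)
qed

lemma corr_asymptotics:
  assumes e: "0 < e"
  shows "\<exists>D\<ge>1. \<forall>z\<^sub>1\<ge>0. \<forall>z\<^sub>2\<ge>0. z\<^sub>1 - z\<^sub>2 \<ge> D \<longrightarrow> (\<forall>H\<^sub>1\<in>\<H>. \<forall>H\<^sub>2\<in>\<H>.
    \<bar>r H\<^sub>1 H\<^sub>2 - (z\<^sub>1 - z\<^sub>2) powr (2 - H\<^sub>1 - H\<^sub>2) * corr z\<^sub>1 H\<^sub>1 z\<^sub>2 H\<^sub>2\<bar> < e)"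
proof -
  let ?g = "\<lambda>z\<^sub>1 z\<^sub>2 H\<^sub>1 H\<^sub>2. \<bar>r H\<^sub>1 H\<^sub>2 - (z\<^sub>1 - z\<^sub>2) powr (2 - H\<^sub>1 - H\<^sub>2) * corr z\<^sub>1 H\<^sub>1 z\<^sub>2 H\<^sub>2\<bar>"
  have "\<forall>\<^sub>F x in inf (filtercomap (\<lambda>(z\<^sub>1, z\<^sub>2). z\<^sub>1 - z\<^sub>2) at_top) (principal ({0..} \<times> {0..})).
      (case x of (z\<^sub>1, z\<^sub>2) \<Rightarrow> SUP (H\<^sub>1, H\<^sub>2)\<in>\<H> \<times> \<H>. ?g z\<^sub>1 z\<^sub>2 H\<^sub>1 H\<^sub>2) < e"
    using order_tendstoD(2)[OF decay e] by (simp add: corr_def)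
  then obtain D where D: "\<And>z\<^sub>1 z\<^sub>2. z\<^sub>1 - z\<^sub>2 \<ge> D \<Longrightarrow> 0 \<le> z\<^sub>1 \<Longrightarrow> 0 \<le> z\<^sub>2 \<Longrightarrow> (SUP (H\<^sub>1, H\<^sub>2)\<in>\<H> \<times> \<H>. ?g z\<^sub>1 z\<^sub>2 H\<^sub>1 H\<^sub>2) < e"
    unfolding eventually_inf_principal eventually_filtercomap_at_top_linorder by fastforce
  obtain B where B: "\<And>H\<^sub>1 H\<^sub>2. H\<^sub>1 \<in> \<H> \<Longrightarrow> H\<^sub>2 \<in> \<H> \<Longrightarrow> \<bar>r H\<^sub>1 H\<^sub>2\<bar> \<le> B" using r_bounded by blast
  have "?g z\<^sub>1 z\<^sub>2 H\<^sub>1 H\<^sub>2 < e"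
    if d: "max D 1 \<le> z\<^sub>1 - z\<^sub>2" and z: "0 \<le> z\<^sub>1" "0 \<le> z\<^sub>2" and H: "H\<^sub>1 \<in> \<H>" "H\<^sub>2 \<in> \<H>" for z\<^sub>1 z\<^sub>2 H\<^sub>1 H\<^sub>2
  proof -
    \<comment> \<open>A supremum of reals dominates its members only when the family is bounded.
      Here this follows from the bounds on r and the correlation, with base at least 1 and exponent
      at most 2.\<close>
    have "bdd_above ((\<lambda>(H\<^sub>1, H\<^sub>2). ?g z\<^sub>1 z\<^sub>2 H\<^sub>1 H\<^sub>2) ` (\<H> \<times> \<H>))"
    proof (rule bdd_aboveI2)
      fix x assume x: "x \<in> \<H> \<times> \<H>"
      obtain K\<^sub>1 K\<^sub>2 where K: "x = (K\<^sub>1, K\<^sub>2)" "K\<^sub>1 \<in> \<H>" "K\<^sub>2 \<in> \<H>" using x by auto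
      have "(z\<^sub>1 - z\<^sub>2) powr (2 - K\<^sub>1 - K\<^sub>2) \<le> (z\<^sub>1 - z\<^sub>2) powr 2"
        using d K lo_hi by (intro powr_mono) auto
      then have "\<bar>(z\<^sub>1 - z\<^sub>2) powr (2 - K\<^sub>1 - K\<^sub>2) * corr z\<^sub>1 K\<^sub>1 z\<^sub>2 K\<^sub>2\<bar> \<le> (z\<^sub>1 - z\<^sub>2) powr 2 * 1"
        unfolding abs_mult using corr_le_1 z K by (intro mult_mono) auto
      then have "?g z\<^sub>1 z\<^sub>2 K\<^sub>1 K\<^sub>2 \<le> B + (z\<^sub>1 - z\<^sub>2) powr 2"
        using B[OF K(2,3)] abs_triangle_ineq4[of "r K\<^sub>1 K\<^sub>2" "(z\<^sub>1 - z\<^sub>2) powr (2 - K\<^sub>1 - K\<^sub>2) * corr z\<^sub>1 K\<^sub>1 z\<^sub>2 K\<^sub>2"] by linarith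
      then show "(case x of (H\<^sub>1, H\<^sub>2) \<Rightarrow> ?g z\<^sub>1 z\<^sub>2 H\<^sub>1 H\<^sub>2) \<le> B + (z\<^sub>1 - z\<^sub>2) powr 2" using K by simp
    qed
    from cSUP_upper[OF _ this, of "(H\<^sub>1, H\<^sub>2)"] H have "?g z\<^sub>1 z\<^sub>2 H\<^sub>1 H\<^sub>2 \<le> (SUP (H\<^sub>1, H\<^sub>2)\<in>\<H> \<times> \<H>. ?g z\<^sub>1 z\<^sub>2 H\<^sub>1 H\<^sub>2)" by simp
    also have "\<dots> < e" using D[of z\<^sub>1 z\<^sub>2] d z by simp
    finally show ?thesis .
  qed
  then show ?thesis by (intro exI[of _ "max D 1"]) auto
qed

text \<open>Beyond the distance D the asymptotics apply; below it the correlation is at most 1, and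
  multiplying by the distance to the power \<open>2 - H\<^sub>1 - H\<^sub>2\<close> gives at most
  D^2. The opposite order of the points follows by symmetry.\<close>

lemma corr_bound:
  obtains C where "0 < C" "\<And>z\<^sub>1 z\<^sub>2 H\<^sub>1 H\<^sub>2. 0 \<le> z\<^sub>1 \<Longrightarrow> 0 \<le> z\<^sub>2 \<Longrightarrow> z\<^sub>1 \<noteq> z\<^sub>2 \<Longrightarrow> H\<^sub>1 \<in> \<H> \<Longrightarrow> H\<^sub>2 \<in> \<H> \<Longrightarrow>
     \<bar>corr z\<^sub>1 H\<^sub>1 z\<^sub>2 H\<^sub>2\<bar> \<le> C * \<bar>z\<^sub>1 - z\<^sub>2\<bar> powr (H\<^sub>1 + H\<^sub>2 - 2)"
proof -
  obtain D where D: "1 \<le> D" "\<And>z\<^sub>1 z\<^sub>2 H\<^sub>1 H\<^sub>2. 0 \<le> z\<^sub>1 \<Longrightarrow> 0 \<le> z\<^sub>2 \<Longrightarrow> z\<^sub>1 - z\<^sub>2 \<ge> D \<Longrightarrow> H\<^sub>1 \<in> \<H> \<Longrightarrow> H\<^sub>2 \<in> \<H> \<Longrightarrow>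
    \<bar>r H\<^sub>1 H\<^sub>2 - (z\<^sub>1 - z\<^sub>2) powr (2 - H\<^sub>1 - H\<^sub>2) * corr z\<^sub>1 H\<^sub>1 z\<^sub>2 H\<^sub>2\<bar> < 1"
    using corr_asymptotics[of 1] by auto
  obtain B where B: "\<And>H\<^sub>1 H\<^sub>2. H\<^sub>1 \<in> \<H> \<Longrightarrow> H\<^sub>2 \<in> \<H> \<Longrightarrow> \<bar>r H\<^sub>1 H\<^sub>2\<bar> \<le> B" using r_bounded by blast
  define C where "C = max (B + 1) (D powr 2)"
  have C0: "0 < C" using D by (simp add: C_def less_max_iff_disj)
  have main: "\<bar>corr z\<^sub>1 H\<^sub>1 z\<^sub>2 H\<^sub>2\<bar> \<le> C * (z\<^sub>1 - z\<^sub>2) powr (H\<^sub>1 + H\<^sub>2 - 2)"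
    if z: "0 \<le> z\<^sub>2" "z\<^sub>2 < z\<^sub>1" and H: "H\<^sub>1 \<in> \<H>" "H\<^sub>2 \<in> \<H>" for z\<^sub>1 z\<^sub>2 H\<^sub>1 H\<^sub>2
  proof -
    define d where "d = z\<^sub>1 - z\<^sub>2"
    define a where "a = 2 - H\<^sub>1 - H\<^sub>2"
    have d: "0 < d" using z by (simp add: d_def)
    have a: "0 \<le> a" "a \<le> 2" using H lo_hi by (auto simp: a_def)
    have "H\<^sub>1 + H\<^sub>2 - 2 = - a" by (simp add: a_def)
    then have pa: "d powr (H\<^sub>1 + H\<^sub>2 - 2) = 1 / d powr a" by (simp only: powr_minus_divide)
    have "d powr a * \<bar>corr z\<^sub>1 H\<^sub>1 z\<^sub>2 H\<^sub>2\<bar> \<le> C"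
    proof (cases "D \<le> d")
      case True
      have "\<bar>r H\<^sub>1 H\<^sub>2 - d powr a * corr z\<^sub>1 H\<^sub>1 z\<^sub>2 H\<^sub>2\<bar> < 1"
        using D(2)[of z\<^sub>1 z\<^sub>2 H\<^sub>1 H\<^sub>2] z H True by (simp add: d_def a_def)
      then have "\<bar>d powr a * corr z\<^sub>1 H\<^sub>1 z\<^sub>2 H\<^sub>2\<bar> \<le> B + 1" using B[OF H] by linarith
      then show ?thesis by (simp add: abs_mult C_def)
    next
      case False
      have "d powr a \<le> D powr a" using d False a by (intro powr_mono2) auto
      also have "\<dots> \<le> D powr 2" using D a by (intro powr_mono) auto
      finally have "d powr a * \<bar>corr z\<^sub>1 H\<^sub>1 z\<^sub>2 H\<^sub>2\<bar> \<le> D powr 2 * 1"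
        using corr_le_1[of z\<^sub>1 H\<^sub>1 z\<^sub>2 H\<^sub>2] z H by (intro mult_mono) auto
      then show ?thesis by (simp add: C_def)
    qed
    then have "\<bar>corr z\<^sub>1 H\<^sub>1 z\<^sub>2 H\<^sub>2\<bar> \<le> C / d powr a" using d by (simp add: field_simps)
    then show ?thesis using pa by (simp add: d_def)
  qed
  show ?thesis
  proof (rule that[OF C0])
    fix z\<^sub>1 z\<^sub>2 H\<^sub>1 H\<^sub>2 :: real assume z: "0 \<le> z\<^sub>1" "0 \<le> z\<^sub>2" "z\<^sub>1 \<noteq> z\<^sub>2" and H: "H\<^sub>1 \<in> \<H>" "H\<^sub>2 \<in> \<H>"
    show "\<bar>corr z\<^sub>1 H\<^sub>1 z\<^sub>2 H\<^sub>2\<bar> \<le> C * \<bar>z\<^sub>1 - z\<^sub>2\<bar> powr (H\<^sub>1 + H\<^sub>2 - 2)"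
      using main[of z\<^sub>2 z\<^sub>1 H\<^sub>1 H\<^sub>2] main[of z\<^sub>1 z\<^sub>2 H\<^sub>2 H\<^sub>1] z H corr_commute[of z\<^sub>1 H\<^sub>1 z\<^sub>2 H\<^sub>2]
      by (cases "z\<^sub>2 < z\<^sub>1") (auto simp: add.commute)
  qed
qed

end

section \<open>The rescaled medium along the profile h\<close>

locale scaled_field = correlated_field M m lo hi r
  for M :: "'w measure" and m lo hi r +
  fixes Z :: real and h :: "real \<Rightarrow> real"
  assumes Z: "0 < Z" and h_cont: "continuous_on {0..Z} h" and h_range: "h ` {0..Z} \<subseteq> {lo..hi}"
begin

text \<open>Freezing the position outside \<open>{0..Z}\<close> makes profile and paths continuous
  on the whole line, so measurability needs no restriction on u.\<close>

definition clip :: "real \<Rightarrow> real" where "clip u = max 0 (min Z u)"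

lemma clip: "clip u \<in> {0..Z}" "0 \<le> clip u" "u \<in> {0..Z} \<Longrightarrow> clip u = u"
  using Z by (auto simp: clip_def)

lemma clip_cont: "continuous_on S clip"
  unfolding clip_def by (intro continuous_intros)

definition hc :: "real \<Rightarrow> real" where "hc u = h (clip u)"

lemma hc: "hc u \<in> \<H>" using h_range clip(1)[of u] unfolding hc_def by blast

lemma hc_cont: "continuous_on S hc"
  unfolding hc_def by (rule continuous_on_compose2[OF h_cont clip_cont]) (use clip(1) in auto)

text \<open>For \<open>\<Psi> = \<Phi>\<close> this is the medium \<open>\<nu>\<close>, made constant in \<open>u\<close> outside \<open>{0..Z}\<close>; other choices of
  \<open>\<Psi>\<close> isolate the contributions of the Hermite coefficients of \<open>\<Phi>\<close>.\<close>
definition X :: "(real \<Rightarrow> real) \<Rightarrow> real \<Rightarrow> real \<Rightarrow> 'w \<Rightarrow> real" where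
  "X \<Psi> \<epsilon> u w = \<epsilon> powr (2 * hc u - 2) * \<Psi> (m (clip u / \<epsilon>\<^sup>2) (hc u) w)"

definition Rt :: "real \<times> real \<Rightarrow> real" where
  "Rt = (\<lambda>(u, v). (if u \<ge> v then r (hc u) (hc v) else r (hc v) (hc u)) * \<bar>u - v\<bar> powr (hc u + hc v - 2))"

lemma Rt_eq: "u \<in> {0..Z} \<Longrightarrow> v \<in> {0..Z} \<Longrightarrow> Rt (u, v) = \<R>_tilde r h u v"
  by (simp add: Rt_def \<R>_tilde_def \<R>_def hc_def clip(3))

lemma hc_measurable[measurable]: "hc \<in> borel_measurable borel"
  by (rule borel_measurable_continuous_onI[OF hc_cont])

lemma Rt_measurable[measurable]: "Rt \<in> borel_measurable (lborel \<Otimes>\<^sub>M lborel)"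
proof -
  have "continuous_on UNIV (\<lambda>x::real \<times> real. (\<lambda>(H\<^sub>1, H\<^sub>2). r H\<^sub>1 H\<^sub>2) (hc (fst x), hc (snd x)))"
    by (rule continuous_on_compose2[OF r_cont])
       (use hc in \<open>auto intro!: continuous_intros continuous_on_compose2[OF hc_cont]\<close>)
  then have "(\<lambda>x::real \<times> real. r (hc (fst x)) (hc (snd x))) \<in> borel_measurable borel"
    by (intro borel_measurable_continuous_onI) simp
  then have 1: "(\<lambda>x::real \<times> real. r (hc (fst x)) (hc (snd x))) \<in> borel_measurable (lborel \<Otimes>\<^sub>M lborel)"
    by (simp add: borel_prod lborel_prod)
  have [measurable]: "(\<lambda>x::real \<times> real. r (hc (snd x)) (hc (fst x))) \<in> borel_measurable (lborel \<Otimes>\<^sub>M lborel)"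
    using measurable_compose[OF measurable_pair_swap' 1] by (simp add: case_prod_unfold)
  note [measurable] = 1
  show ?thesis unfolding Rt_def case_prod_unfold by measurable
qed

lemma Rt_commute: "Rt (u, v) = Rt (v, u)"
  by (simp add: Rt_def abs_minus_commute add.commute)

lemma X_cont: "continuous_on UNIV \<Psi> \<Longrightarrow> 0 < \<epsilon> \<Longrightarrow> w \<in> space M \<Longrightarrow> continuous_on UNIV (\<lambda>u. X \<Psi> \<epsilon> u w)"
proof -
  assume \<Psi>: "continuous_on UNIV \<Psi>" and \<epsilon>: "0 < \<epsilon>" and w: "w \<in> space M"
  have "continuous_on UNIV (\<lambda>u. (\<lambda>(z, H). m z H w) (clip u / \<epsilon>\<^sup>2, hc u))"
    by (rule continuous_on_compose2[OF cont[rule_format, OF w]])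
       (use hc clip(2) \<epsilon> in \<open>auto intro!: continuous_intros clip_cont hc_cont\<close>)
  then have "continuous_on UNIV (\<lambda>u. \<Psi> (m (clip u / \<epsilon>\<^sup>2) (hc u) w))"
    by (intro continuous_on_compose2[OF \<Psi>]) auto
  then show ?thesis unfolding X_def using \<epsilon> by (intro continuous_intros hc_cont) auto
qed

lemma X_measurable: "continuous_on UNIV \<Psi> \<Longrightarrow> X \<Psi> \<epsilon> u \<in> borel_measurable M"
proof -
  assume "continuous_on UNIV \<Psi>"
  then have [measurable]: "\<Psi> \<in> borel_measurable borel" by (rule borel_measurable_continuous_onI)
  have [measurable]: "m (clip u / \<epsilon>\<^sup>2) (hc u) \<in> borel_measurable M" using clip hc by (intro m_measurable) auto
  show ?thesis unfolding X_def by measurable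
qed

text \<open>Rounding u down to multiples of 1 / (n + 1) gives countably many values, hence joint
  measurability; continuity of the paths recovers Y in the limit.\<close>

lemma caratheodory_measurable:
  fixes Y :: "real \<Rightarrow> 'w \<Rightarrow> real"
  assumes c: "\<And>w. w \<in> space M \<Longrightarrow> continuous_on UNIV (\<lambda>u. Y u w)" and m: "\<And>u. Y u \<in> borel_measurable M"
  shows "(\<lambda>(u, w). Y u w) \<in> borel_measurable (lborel \<Otimes>\<^sub>M M)"
proof (rule borel_measurable_LIMSEQ_metric)
  fix n :: nat
  let ?k = "\<lambda>x::real \<times> 'w. \<lfloor>real (Suc n) * fst x\<rfloor>"
  have "(\<lambda>x. (\<lambda>i x. Y (real_of_int i / real (Suc n)) (snd x)) (?k x) x) \<in> borel_measurable (lborel \<Otimes>\<^sub>M M)"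
    by (rule measurable_compose_countable'[where I=UNIV])
       (auto intro!: measurable_compose[OF measurable_snd m])
  then show "(\<lambda>x. Y (real_of_int (?k x) / real (Suc n)) (snd x)) \<in> borel_measurable (lborel \<Otimes>\<^sub>M M)" .
next
  fix x :: "real \<times> 'w" assume "x \<in> space (lborel \<Otimes>\<^sub>M M)"
  then obtain u :: real and w where x: "x = (u, w)" "w \<in> space M" by (auto simp: space_pair_measure)
  have "(\<lambda>n. real_of_int \<lfloor>real (Suc n) * u\<rfloor> / real (Suc n)) \<longlonglongrightarrow> u"
  proof (rule LIM_zero_cancel, rule Lim_null_comparison[OF _ LIMSEQ_inverse_real_of_nat], intro always_eventually allI)
    fix n :: nat
    have "\<bar>real_of_int \<lfloor>real (Suc n) * u\<rfloor> - real (Suc n) * u\<bar> \<le> 1" by linarith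
    then have "\<bar>real_of_int \<lfloor>real (Suc n) * u\<rfloor> - real (Suc n) * u\<bar> / real (Suc n) \<le> 1 / real (Suc n)"
      by (intro divide_right_mono) auto
    moreover have "real_of_int \<lfloor>real (Suc n) * u\<rfloor> / real (Suc n) - u = (real_of_int \<lfloor>real (Suc n) * u\<rfloor> - real (Suc n) * u) / real (Suc n)"
      by (simp add: field_simps)
    ultimately show "norm (real_of_int \<lfloor>real (Suc n) * u\<rfloor> / real (Suc n) - u) \<le> inverse (real (Suc n))"
      by (simp add: inverse_eq_divide del: of_nat_Suc)
  qed
  with c[OF x(2)] have "(\<lambda>n. Y (real_of_int \<lfloor>real (Suc n) * u\<rfloor> / real (Suc n)) w) \<longlonglongrightarrow> Y u w"
    by (auto simp: continuous_on_sequentially o_def)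
  then show "(\<lambda>n. Y (real_of_int \<lfloor>real (Suc n) * fst x\<rfloor> / real (Suc n)) (snd x)) \<longlonglongrightarrow> (case x of (u, w) \<Rightarrow> Y u w)"
    using x by simp
qed

lemma X_joint: "continuous_on UNIV \<Psi> \<Longrightarrow> 0 < \<epsilon> \<Longrightarrow> (\<lambda>(u, w). X \<Psi> \<epsilon> u w) \<in> borel_measurable (lborel \<Otimes>\<^sub>M M)"
  by (rule caratheodory_measurable[OF X_cont X_measurable])

end

section \<open>The covariance of the scaled medium\<close>

context scaled_field
begin

definition cov :: "(real \<Rightarrow> real) \<Rightarrow> real \<Rightarrow> real \<times> real \<Rightarrow> real" where
  "cov \<Psi> \<epsilon> x = (LINT w|M. X \<Psi> \<epsilon> (fst x) w * X \<Psi> \<epsilon> (snd x) w)"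

definition square_ind :: "real \<times> real \<Rightarrow> real" where
  "square_ind x = indicator {0..Z} (fst x) * indicator {0..Z} (snd x)"

lemma square_ind_measurable[measurable]: "square_ind \<in> borel_measurable (lborel \<Otimes>\<^sub>M lborel)"
  unfolding square_ind_def[abs_def] by measurable

abbreviation "R2 \<equiv> (lborel :: real measure) \<Otimes>\<^sub>M (lborel :: real measure)"

lemma r_order_le: "2 * lo - 2 \<le> hc u + hc v - 2" "hc u + hc v - 2 \<le> 0" "- 1 < 2 * lo - 2"
  using hc[of u] hc[of v] lo_hi by auto

text \<open>The exponent varies with the points, while the majorant must not. Near the diagonal the
  smallest exponent is the worst; the constant pays for distances above 1.\<close>

lemma powr_exponent_le:
  assumes "0 < d" "d \<le> Z"
  shows "d powr (hc u + hc v - 2) \<le> max 1 (Z powr 2) * d powr (2 * lo - 2)"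
proof -
  define a where "a = hc u + hc v - 2 * lo"
  have a: "0 \<le> a" "a \<le> 2" using hc[of u] hc[of v] lo_hi by (auto simp: a_def)
  have "d powr (hc u + hc v - 2) = d powr a * d powr (2 * lo - 2)"
    unfolding powr_add[symmetric] a_def by (rule arg_cong[where f="\<lambda>x. d powr x"]) simp
  moreover have "d powr a \<le> max 1 (Z powr 2)"
  proof (cases "1 \<le> Z")
    case True
    have "d powr a \<le> Z powr a" using assms a by (intro powr_mono2) auto
    also have "\<dots> \<le> Z powr 2" using True a by (intro powr_mono) auto
    finally show ?thesis by simp
  next
    case False
    then have "d powr a \<le> 1 powr a" using assms a by (intro powr_mono2) auto
    then show ?thesis by simp
  qed
  ultimately show ?thesis by (simp add: mult_right_mono)
qed

end

text \<open>\<Psi> is left free because three functions are inserted: the given \<Phi>, the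
  identity, whose covariance yields the properties of the limit kernel, and the remainder of \<Phi>
  after its linear part.\<close>

locale hermite_field = scaled_field M m lo hi r Z h
  for M :: "'w measure" and m lo hi r Z h +
  fixes \<Psi> :: "real \<Rightarrow> real"
  assumes \<Psi>: "continuous_on UNIV \<Psi>" and sq: "integrable std_normal_distribution (\<lambda>x. (\<Psi> x)\<^sup>2)"
    and mean: "(LINT x|std_normal_distribution. \<Psi> x) = 0"
begin

abbreviation "square_mean \<equiv> (LINT x|std_normal_distribution. (\<Psi> x)\<^sup>2)"
abbreviation "first_coeff \<equiv> (LINT x|std_normal_distribution. \<Psi> x * x)"

lemma \<Psi>_measurable: "\<Psi> \<in> borel_measurable borel"
  using \<Psi> by (rule borel_measurable_continuous_onI)

text \<open>The bound is crude and explodes as \<epsilon> tends to 0; it only feeds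
  \<open>second_moment_of_integral\<close>.\<close>

lemma X_second_moment:
  assumes \<epsilon>: "0 < \<epsilon>"
  shows "integrable M (\<lambda>w. (X \<Psi> \<epsilon> u w)\<^sup>2)" "(LINT w|M. (X \<Psi> \<epsilon> u w)\<^sup>2) \<le> (1 + \<epsilon> powr (-4)) * square_mean"
proof -
  note s = m_standard_normal[OF _ hc, of "clip u / \<epsilon>\<^sup>2" u]
  have "0 \<le> clip u / \<epsilon>\<^sup>2" using clip(2) by simp
  note I = centered_normal_integral[OF prob_space_axioms s[OF this], of "\<lambda>x. (\<Psi> x)\<^sup>2"]
  have [measurable]: "\<Psi> \<in> borel_measurable borel" by (rule \<Psi>_measurable)
  have i: "integrable M (\<lambda>w. (\<Psi> (m (clip u / \<epsilon>\<^sup>2) (hc u) w))\<^sup>2)" using I(2) sq by simp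
  show "integrable M (\<lambda>w. (X \<Psi> \<epsilon> u w)\<^sup>2)" unfolding X_def power_mult_distrib using i by simp
  have "(\<epsilon> powr (2 * hc u - 2))\<^sup>2 \<le> 1 + \<epsilon> powr (-4)"
  proof -
    have "(\<epsilon> powr (2 * hc u - 2))\<^sup>2 = \<epsilon> powr (4 * hc u - 4)"
      unfolding power2_eq_square powr_add[symmetric] by simp
    also have "\<dots> \<le> 1 + \<epsilon> powr (-4)"
    proof (cases "\<epsilon> \<le> 1")
      case True
      have "\<epsilon> powr (4 * hc u - 4) \<le> \<epsilon> powr (-4)" using True \<epsilon> hc[of u] lo_hi by (intro powr_mono') auto
      then show ?thesis by simp
    next
      case False
      have "\<epsilon> powr (4 * hc u - 4) \<le> \<epsilon> powr 0" using False hc[of u] lo_hi by (intro powr_mono) auto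
      then show ?thesis using \<epsilon> by (simp add: add_increasing2)
    qed
    finally show ?thesis .
  qed
  then have "(\<epsilon> powr (2 * hc u - 2))\<^sup>2 * square_mean \<le> (1 + \<epsilon> powr (-4)) * square_mean" by (intro mult_right_mono) auto
  then show "(LINT w|M. (X \<Psi> \<epsilon> u w)\<^sup>2) \<le> (1 + \<epsilon> powr (-4)) * square_mean"
    unfolding X_def power_mult_distrib using I(1) by simp
qed

lemma cov_eq:
  "cov \<Psi> \<epsilon> (u, v) = \<epsilon> powr (2 * hc u + 2 * hc v - 4) *
    (LINT w|M. \<Psi> (m (clip u / \<epsilon>\<^sup>2) (hc u) w) * \<Psi> (m (clip v / \<epsilon>\<^sup>2) (hc v) w))"
proof -
  have "X \<Psi> \<epsilon> u w * X \<Psi> \<epsilon> v w = \<epsilon> powr (2 * hc u + 2 * hc v - 4) *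
     (\<Psi> (m (clip u / \<epsilon>\<^sup>2) (hc u) w) * \<Psi> (m (clip v / \<epsilon>\<^sup>2) (hc v) w))" for w
  proof -
    have "\<epsilon> powr (2 * hc u - 2) * \<epsilon> powr (2 * hc v - 2) = \<epsilon> powr (2 * hc u + 2 * hc v - 4)"
      unfolding powr_add[symmetric] by (simp add: algebra_simps)
    moreover have "(A * c) * (B * d) = (A * B) * (c * d)" for A B c d :: real by simp
    ultimately show ?thesis unfolding X_def by (simp only:)
  qed
  then show ?thesis by (simp add: cov_def)
qed

lemma cov_corr:
  assumes \<epsilon>: "0 < \<epsilon>" and uv: "u \<in> {0..Z}" "v \<in> {0..Z}"
  defines "\<rho> \<equiv> corr (u / \<epsilon>\<^sup>2) (hc u) (v / \<epsilon>\<^sup>2) (hc v)" and "p \<equiv> \<epsilon> powr (2 * hc u + 2 * hc v - 4)"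
  shows "\<bar>cov \<Psi> \<epsilon> (u, v)\<bar> \<le> p * \<bar>\<rho>\<bar> * square_mean" "\<bar>cov \<Psi> \<epsilon> (u, v) - p * \<rho> * first_coeff\<^sup>2\<bar> \<le> p * \<rho>\<^sup>2 * square_mean"
proof -
  have z: "0 \<le> u / \<epsilon>\<^sup>2" "0 \<le> v / \<epsilon>\<^sup>2" using uv by auto
  have p0: "0 \<le> p" by (simp add: p_def)
  note G = gaussian_pair_covariance[OF prob_space_axioms m_gaussian_pair[OF z(1) hc z(2) hc] corr_le_1[OF z(1) hc z(2) hc] \<Psi> sq mean, of u v, folded \<rho>_def]
  have e: "cov \<Psi> \<epsilon> (u, v) = p * (LINT w|M. \<Psi> (m (u / \<epsilon>\<^sup>2) (hc u) w) * \<Psi> (m (v / \<epsilon>\<^sup>2) (hc v) w))"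
    unfolding cov_eq p_def using uv clip(3) by simp
  show "\<bar>cov \<Psi> \<epsilon> (u, v)\<bar> \<le> p * \<bar>\<rho>\<bar> * square_mean"
    unfolding e abs_mult using mult_left_mono[OF G(1) p0] p0 by (simp add: mult.assoc)
  have "cov \<Psi> \<epsilon> (u, v) - p * \<rho> * first_coeff\<^sup>2 = p * ((LINT w|M. \<Psi> (m (u / \<epsilon>\<^sup>2) (hc u) w) * \<Psi> (m (v / \<epsilon>\<^sup>2) (hc v) w)) - \<rho> * first_coeff\<^sup>2)"
    unfolding e by (simp add: algebra_simps)
  then show "\<bar>cov \<Psi> \<epsilon> (u, v) - p * \<rho> * first_coeff\<^sup>2\<bar> \<le> p * \<rho>\<^sup>2 * square_mean"
    using mult_left_mono[OF G(2) p0] p0 by (simp add: abs_mult mult.assoc)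
qed

text \<open>The exact balance of amplitude and distance that fixes the relation between h and
  \<kappa>.\<close>

lemma scaling:
  fixes a b d \<epsilon> :: real
  assumes \<epsilon>: "0 < \<epsilon>" and d: "0 \<le> d"
  shows "(d / \<epsilon>\<^sup>2) powr (a + b - 2) * \<epsilon> powr (2 * a + 2 * b - 4) = d powr (a + b - 2)"
proof -
  have "(d / \<epsilon>\<^sup>2) powr (a + b - 2) = d powr (a + b - 2) / (\<epsilon>\<^sup>2) powr (a + b - 2)"
    by (rule powr_divide)
  also have "(\<epsilon>\<^sup>2) powr (a + b - 2) = \<epsilon> powr (2 * a + 2 * b - 4)"
  proof -
    have "2 * (a + b - 2) = 2 * a + 2 * b - 4" by simp
    then show ?thesis using \<epsilon> powr_powr[of \<epsilon> 2 "a + b - 2"] by simp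
  qed
  finally show ?thesis using \<epsilon> by simp
qed

lemma cov_bound:
  obtains C where "0 \<le> C" "\<And>\<epsilon> u v. 0 < \<epsilon> \<Longrightarrow> u \<in> {0..Z} \<Longrightarrow> v \<in> {0..Z} \<Longrightarrow> u \<noteq> v \<Longrightarrow>
     \<bar>cov \<Psi> \<epsilon> (u, v)\<bar> \<le> C * \<bar>u - v\<bar> powr (2 * lo - 2)"
proof -
  obtain C where C: "0 < C" "\<And>z\<^sub>1 z\<^sub>2 H\<^sub>1 H\<^sub>2. 0 \<le> z\<^sub>1 \<Longrightarrow> 0 \<le> z\<^sub>2 \<Longrightarrow> z\<^sub>1 \<noteq> z\<^sub>2 \<Longrightarrow> H\<^sub>1 \<in> \<H> \<Longrightarrow> H\<^sub>2 \<in> \<H> \<Longrightarrow>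
     \<bar>corr z\<^sub>1 H\<^sub>1 z\<^sub>2 H\<^sub>2\<bar> \<le> C * \<bar>z\<^sub>1 - z\<^sub>2\<bar> powr (H\<^sub>1 + H\<^sub>2 - 2)" using corr_bound by blast
  let ?C = "C * square_mean * max 1 (Z powr 2)"
  show ?thesis
  proof (rule that[of ?C])
    show "0 \<le> ?C" using C by simp
    fix \<epsilon> u v :: real assume \<epsilon>: "0 < \<epsilon>" and uv: "u \<in> {0..Z}" "v \<in> {0..Z}" "u \<noteq> v"
    define p where "p = \<epsilon> powr (2 * hc u + 2 * hc v - 4)"
    have dd: "\<bar>u / \<epsilon>\<^sup>2 - v / \<epsilon>\<^sup>2\<bar> = \<bar>u - v\<bar> / \<epsilon>\<^sup>2" using \<epsilon> by (simp add: diff_divide_distrib[symmetric] abs_divide)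
    have "\<bar>corr (u / \<epsilon>\<^sup>2) (hc u) (v / \<epsilon>\<^sup>2) (hc v)\<bar> \<le> C * (\<bar>u - v\<bar> / \<epsilon>\<^sup>2) powr (hc u + hc v - 2)"
      using C(2)[of "u / \<epsilon>\<^sup>2" "v / \<epsilon>\<^sup>2" "hc u" "hc v"] uv \<epsilon> hc unfolding dd by simp
    then have "p * \<bar>corr (u / \<epsilon>\<^sup>2) (hc u) (v / \<epsilon>\<^sup>2) (hc v)\<bar> \<le> p * (C * (\<bar>u - v\<bar> / \<epsilon>\<^sup>2) powr (hc u + hc v - 2))"
      by (rule mult_left_mono) (simp add: p_def)
    also have "\<dots> = C * ((\<bar>u - v\<bar> / \<epsilon>\<^sup>2) powr (hc u + hc v - 2) * p)" by (simp only: mult_ac)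
    also have "\<dots> = C * \<bar>u - v\<bar> powr (hc u + hc v - 2)" unfolding p_def by (subst scaling[OF \<epsilon>]) simp_all
    also have "\<dots> \<le> C * (max 1 (Z powr 2) * \<bar>u - v\<bar> powr (2 * lo - 2))"
      using C uv by (intro mult_left_mono powr_exponent_le) auto
    finally have "p * \<bar>corr (u / \<epsilon>\<^sup>2) (hc u) (v / \<epsilon>\<^sup>2) (hc v)\<bar> * square_mean \<le> C * (max 1 (Z powr 2) * \<bar>u - v\<bar> powr (2 * lo - 2)) * square_mean"
      by (rule mult_right_mono) simp
    then show "\<bar>cov \<Psi> \<epsilon> (u, v)\<bar> \<le> ?C * \<bar>u - v\<bar> powr (2 * lo - 2)"
      using cov_corr(1)[OF \<epsilon> uv(1,2)] by (simp add: p_def mult_ac)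
  qed
qed

text \<open>\<open>q n * \<rho> n\<close> is the normalised correlation of the decay hypothesis at
  distance d / \<epsilon>^2, and \<open>p n\<close> equals q n times a constant. So
  \<open>p n * \<rho> n\<close> converges while \<open>\<rho> n\<close> tends to 0, and the error
  \<open>p n * (\<rho> n)\<^sup>2\<close> of the first Hermite term vanishes.\<close>

lemma cov_limit:
  assumes \<epsilon>: "\<And>n. 0 < \<epsilon> n" "\<epsilon> \<longlonglongrightarrow> 0" and uv: "u \<in> {0..Z}" "v \<in> {0..Z}" "u \<noteq> v"
  shows "(\<lambda>n. cov \<Psi> (\<epsilon> n) (u, v)) \<longlonglongrightarrow> first_coeff\<^sup>2 * Rt (u, v)"
proof -
  define H where "H = hc u + hc v - 2"
  have H: "H < 0" using hc[of u] hc[of v] lo_hi by (auto simp: H_def)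
  define d where "d = \<bar>u - v\<bar>"
  have d: "0 < d" using uv by (simp add: d_def)
  define R where "R = (if u \<ge> v then r (hc u) (hc v) else r (hc v) (hc u))"
  define \<rho> where "\<rho> n = corr (u / (\<epsilon> n)\<^sup>2) (hc u) (v / (\<epsilon> n)\<^sup>2) (hc v)" for n
  define p where "p n = \<epsilon> n powr (2 * hc u + 2 * hc v - 4)" for n
  define q where "q n = (d / (\<epsilon> n)\<^sup>2) powr (- H)" for n
  have large: "filterlim (\<lambda>n. d / (\<epsilon> n)\<^sup>2) at_top sequentially"
  proof -
    have "filterlim (\<lambda>n. (\<epsilon> n)\<^sup>2) (at_right 0) sequentially"
    proof -
      have "\<epsilon> n \<noteq> 0" for n using \<epsilon>(1)[of n] by simp
      then show ?thesis
        using tendsto_power[OF \<epsilon>(2), of 2] by (auto simp: filterlim_at intro!: always_eventually)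
    qed
    then have "filterlim (\<lambda>n. inverse ((\<epsilon> n)\<^sup>2)) at_top sequentially"
      by (rule filterlim_compose[OF filterlim_inverse_at_top_right])
    then show ?thesis unfolding divide_inverse by (rule filterlim_tendsto_pos_mult_at_top[OF tendsto_const d])
  qed
  have q\<rho>: "(\<lambda>n. q n * \<rho> n) \<longlonglongrightarrow> R"
  proof (rule LIMSEQ_I)
    fix e :: real assume e: "0 < e"
    obtain D where D: "1 \<le> D" "\<And>z\<^sub>1 z\<^sub>2 H\<^sub>1 H\<^sub>2. 0 \<le> z\<^sub>1 \<Longrightarrow> 0 \<le> z\<^sub>2 \<Longrightarrow> z\<^sub>1 - z\<^sub>2 \<ge> D \<Longrightarrow> H\<^sub>1 \<in> \<H> \<Longrightarrow> H\<^sub>2 \<in> \<H> \<Longrightarrow>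
      \<bar>r H\<^sub>1 H\<^sub>2 - (z\<^sub>1 - z\<^sub>2) powr (2 - H\<^sub>1 - H\<^sub>2) * corr z\<^sub>1 H\<^sub>1 z\<^sub>2 H\<^sub>2\<bar> < e"
      using corr_asymptotics[OF e] by auto
    obtain N where N: "\<And>n. n \<ge> N \<Longrightarrow> D \<le> d / (\<epsilon> n)\<^sup>2"
      using large unfolding filterlim_at_top eventually_sequentially by blast
    show "\<exists>no. \<forall>n\<ge>no. norm (q n * \<rho> n - R) < e"
    proof (intro exI allI impI)
      fix n assume n: "N \<le> n"
      show "norm (q n * \<rho> n - R) < e"
      proof (cases "u \<ge> v")
        case True
        then have du: "u / (\<epsilon> n)\<^sup>2 - v / (\<epsilon> n)\<^sup>2 = d / (\<epsilon> n)\<^sup>2" by (simp add: d_def diff_divide_distrib)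
        have "2 - hc u - hc v = - H" by (simp add: H_def)
        then show ?thesis
          using D(2)[of "u / (\<epsilon> n)\<^sup>2" "v / (\<epsilon> n)\<^sup>2" "hc u" "hc v"] N[OF n] uv hc True unfolding du
          by (simp add: R_def q_def \<rho>_def abs_minus_commute)
      next
        case False
        then have du: "v / (\<epsilon> n)\<^sup>2 - u / (\<epsilon> n)\<^sup>2 = d / (\<epsilon> n)\<^sup>2" by (simp add: d_def diff_divide_distrib)
        have "2 - hc v - hc u = - H" by (simp add: H_def)
        then show ?thesis
          using D(2)[of "v / (\<epsilon> n)\<^sup>2" "u / (\<epsilon> n)\<^sup>2" "hc v" "hc u"] N[OF n] uv hc False unfolding du
          by (simp add: R_def q_def \<rho>_def abs_minus_commute corr_commute[of "u / (\<epsilon> n)\<^sup>2"])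
      qed
    qed
  qed
  have qinv: "(\<lambda>n. (d / (\<epsilon> n)\<^sup>2) powr H) \<longlonglongrightarrow> 0"
    by (rule tendsto_neg_powr[OF H large])
  have pq: "p n = q n * d powr H" for n
  proof -
    have "(d / (\<epsilon> n)\<^sup>2) powr H * p n = d powr H"
      unfolding H_def p_def using scaling[OF \<epsilon>(1), of d] d by simp
    moreover have "(d / (\<epsilon> n)\<^sup>2) powr H * q n = 1"
      using d \<epsilon>(1)[of n] unfolding q_def powr_add[symmetric] by simp
    ultimately show ?thesis by (metis mult.assoc mult.commute mult.right_neutral)
  qed
  have q0: "q n * (d / (\<epsilon> n)\<^sup>2) powr H = 1" for n
    using d \<epsilon>(1)[of n] unfolding q_def powr_add[symmetric] by simp
  have "(\<lambda>n. q n * \<rho> n * (d / (\<epsilon> n)\<^sup>2) powr H) \<longlonglongrightarrow> R * 0" by (intro tendsto_mult q\<rho> qinv)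
  moreover have "q n * \<rho> n * (d / (\<epsilon> n)\<^sup>2) powr H = \<rho> n" for n using q0[of n] by (simp add: mult_ac)
  ultimately have \<rho>0: "\<rho> \<longlonglongrightarrow> 0" by simp
  have p\<rho>: "(\<lambda>n. p n * \<rho> n) \<longlonglongrightarrow> R * d powr H"
    unfolding pq using tendsto_mult[OF q\<rho> tendsto_const[of "d powr H"]] by (simp add: mult_ac)
  have "(\<lambda>n. cov \<Psi> (\<epsilon> n) (u, v) - p n * \<rho> n * first_coeff\<^sup>2) \<longlonglongrightarrow> 0"
  proof (rule Lim_null_comparison, intro always_eventually allI)
    show "norm (cov \<Psi> (\<epsilon> n) (u, v) - p n * \<rho> n * first_coeff\<^sup>2) \<le> p n * \<rho> n * \<rho> n * square_mean" for n
      using cov_corr(2)[OF \<epsilon>(1) uv(1,2)] by (simp add: p_def \<rho>_def power2_eq_square mult.assoc)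
    show "(\<lambda>n. p n * \<rho> n * \<rho> n * square_mean) \<longlonglongrightarrow> 0"
      using tendsto_mult[OF tendsto_mult[OF p\<rho> \<rho>0] tendsto_const[of square_mean]] by simp
  qed
  from tendsto_add[OF this tendsto_mult[OF p\<rho> tendsto_const[of "first_coeff\<^sup>2"]]]
  have "(\<lambda>n. cov \<Psi> (\<epsilon> n) (u, v)) \<longlonglongrightarrow> R * d powr H * first_coeff\<^sup>2" by simp
  moreover have "Rt (u, v) = R * d powr H" by (simp add: Rt_def R_def d_def H_def)
  ultimately show ?thesis by (simp add: mult.commute)
qed

lemma cov_measurable: "0 < \<epsilon> \<Longrightarrow> cov \<Psi> \<epsilon> \<in> borel_measurable R2"
proof -
  assume \<epsilon>: "0 < \<epsilon>"
  note X = X_joint[OF \<Psi> \<epsilon>]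
  have [measurable]: "(\<lambda>x. X \<Psi> \<epsilon> (fst (fst x)) (snd x)) \<in> borel_measurable (R2 \<Otimes>\<^sub>M M)"
    "(\<lambda>x. X \<Psi> \<epsilon> (snd (fst x)) (snd x)) \<in> borel_measurable (R2 \<Otimes>\<^sub>M M)"
    using measurable_compose[OF _ X, of "\<lambda>x. (fst (fst x), snd x)" "R2 \<Otimes>\<^sub>M M"]
      measurable_compose[OF _ X, of "\<lambda>x. (snd (fst x), snd x)" "R2 \<Otimes>\<^sub>M M"] by simp_all
  have "(\<lambda>(x, w). X \<Psi> \<epsilon> (fst x) w * X \<Psi> \<epsilon> (snd x) w) \<in> borel_measurable (R2 \<Otimes>\<^sub>M M)"
    unfolding case_prod_unfold by measurable
  then show ?thesis unfolding cov_def[abs_def] by (rule borel_measurable_lebesgue_integral)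
qed

end

lemma id_L2: "integrable std_normal_distribution (\<lambda>x::real. x\<^sup>2)" "(LINT x|std_normal_distribution. x\<^sup>2) = (1::real)"
    "(LINT x|std_normal_distribution. x) = (0::real)" "(LINT x|std_normal_distribution. x * x) = (1::real)"
  using integrable_std_normal_distribution_moment[of 2] std_normal_distribution_even_moments(1)[of 1]
    integral_std_normal_distribution_moment_odd[of 1]
  by (simp_all add: power2_eq_square)

section \<open>Second moments of weighted integrals of the medium\<close>

context scaled_field
begin

lemma hermite_field_id: "hermite_field M m lo hi r Z h (\<lambda>x. x)"
  by unfold_locales (use id_L2 in auto)

text \<open>The bound on the covariance for the identity is uniform in \<epsilon> and passes to the
  limit, so kernel and covariances have a majorant of the same form.\<close>

lemma Rt_bound:
  obtains C where "0 \<le> C" "\<And>u v. u \<in> {0..Z} \<Longrightarrow> v \<in> {0..Z} \<Longrightarrow> u \<noteq> v \<Longrightarrow> \<bar>Rt (u, v)\<bar> \<le> C * \<bar>u - v\<bar> powr (2 * lo - 2)"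
proof -
  interpret I: hermite_field M m lo hi r Z h "\<lambda>x. x" by (rule hermite_field_id)
  obtain C where C: "0 \<le> C" "\<And>\<epsilon> u v. 0 < \<epsilon> \<Longrightarrow> u \<in> {0..Z} \<Longrightarrow> v \<in> {0..Z} \<Longrightarrow> u \<noteq> v \<Longrightarrow>
     \<bar>cov (\<lambda>x. x) \<epsilon> (u, v)\<bar> \<le> C * \<bar>u - v\<bar> powr (2 * lo - 2)" using I.cov_bound by blast
  show ?thesis
  proof (rule that[OF C(1)])
    fix u v assume uv: "u \<in> {0..Z}" "v \<in> {0..Z}" "u \<noteq> v"
    have "(\<lambda>n. cov (\<lambda>x. x) (inverse (real (Suc n))) (u, v)) \<longlonglongrightarrow> Rt (u, v)"
      using I.cov_limit[OF _ LIMSEQ_inverse_real_of_nat uv] id_L2 by simp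
    then have "(\<lambda>n. \<bar>cov (\<lambda>x. x) (inverse (real (Suc n))) (u, v)\<bar>) \<longlonglongrightarrow> \<bar>Rt (u, v)\<bar>" by (rule tendsto_rabs)
    then show "\<bar>Rt (u, v)\<bar> \<le> C * \<bar>u - v\<bar> powr (2 * lo - 2)"
      by (rule LIMSEQ_le_const2) (use C(2) uv in auto)
  qed
qed

lemma riesz_eq: "square_ind x * \<bar>fst x - snd x\<bar> powr s = riesz s 0 Z x"
  by (simp add: square_ind_def riesz_def case_prod_unfold)

lemma riesz_square_integrable: "integrable R2 (riesz (2 * lo - 2) 0 Z)"
  using riesz_integrable(1)[OF r_order_le(3)] Z by simp

lemma le_riesz_AE:
  assumes "\<And>u v. u \<in> {0..Z} \<Longrightarrow> v \<in> {0..Z} \<Longrightarrow> u \<noteq> v \<Longrightarrow> \<bar>F (u, v)\<bar> \<le> C * \<bar>u - v\<bar> powr (2 * lo - 2)"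
  shows "AE x in R2. \<bar>square_ind x * F x\<bar> \<le> C * riesz (2 * lo - 2) 0 Z x"
  using AE_pair_off_diagonal
proof eventually_elim
  case (elim x)
  then show ?case using assms[of "fst x" "snd x"]
    by (auto simp: riesz_eq[symmetric] square_ind_def split: split_indicator)
qed

lemma riesz_dominated_integrable:
  assumes C: "0 \<le> C" and F: "F \<in> borel_measurable R2"
    and le: "\<And>u v. u \<in> {0..Z} \<Longrightarrow> v \<in> {0..Z} \<Longrightarrow> u \<noteq> v \<Longrightarrow> \<bar>F (u, v)\<bar> \<le> C * \<bar>u - v\<bar> powr (2 * lo - 2)"
  shows "integrable R2 (\<lambda>x. square_ind x * F x)"
proof (rule Bochner_Integration.integrable_bound)
  show "integrable R2 (\<lambda>x. C * riesz (2 * lo - 2) 0 Z x)" using riesz_square_integrable by simp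
  show "(\<lambda>x. square_ind x * F x) \<in> borel_measurable R2" using F by simp
  have "AE x in R2. \<bar>square_ind x * F x\<bar> \<le> C * riesz (2 * lo - 2) 0 Z x" by (rule le_riesz_AE[of F C, OF le])
  then show "AE x in R2. norm (square_ind x * F x) \<le> norm (C * riesz (2 * lo - 2) 0 Z x)"
  proof eventually_elim
    case (elim x)
    then show ?case unfolding real_norm_def by (rule order_trans[OF _ abs_ge_self])
  qed
qed

lemma Rt_integrable: "integrable R2 (\<lambda>x. square_ind x * Rt x)"
proof -
  obtain C where C: "0 \<le> C" "\<And>u v. u \<in> {0..Z} \<Longrightarrow> v \<in> {0..Z} \<Longrightarrow> u \<noteq> v \<Longrightarrow> \<bar>Rt (u, v)\<bar> \<le> C * \<bar>u - v\<bar> powr (2 * lo - 2)"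
    using Rt_bound by blast
  show ?thesis by (rule riesz_dominated_integrable[OF C(1) Rt_measurable C(2)])
qed

lemma ind_mult_bound:
  assumes "\<And>u. \<bar>g u\<bar> \<le> G * indicator {0..Z} u"
  shows "\<bar>g (fst x) * g (snd x) * y\<bar> \<le> G\<^sup>2 * \<bar>square_ind x * y\<bar>"
proof -
  have "\<bar>g (fst x) * g (snd x)\<bar> \<le> (G * indicator {0..Z} (fst x)) * (G * indicator {0..Z} (snd x))"
    unfolding abs_mult using assms order_trans[OF abs_ge_zero assms] by (intro mult_mono) auto
  also have "\<dots> = G\<^sup>2 * \<bar>square_ind x\<bar>" by (simp add: square_ind_def power2_eq_square)
  finally have "\<bar>g (fst x) * g (snd x)\<bar> * \<bar>y\<bar> \<le> G\<^sup>2 * \<bar>square_ind x\<bar> * \<bar>y\<bar>" by (rule mult_right_mono) simp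
  then show ?thesis by (simp add: abs_mult mult.assoc)
qed

lemma g_mult_integrable:
  assumes [measurable]: "g \<in> borel_measurable borel" and g: "\<And>u. \<bar>g u\<bar> \<le> G * indicator {0..Z} u"
    and F: "integrable R2 (\<lambda>x. square_ind x * F x)" and [measurable]: "F \<in> borel_measurable R2"
  shows "integrable R2 (\<lambda>x. g (fst x) * g (snd x) * F x)"
proof (rule Bochner_Integration.integrable_bound)
  show "integrable R2 (\<lambda>x. G\<^sup>2 * \<bar>square_ind x * F x\<bar>)" using F by simp
  show "AE x in R2. norm (g (fst x) * g (snd x) * F x) \<le> norm (G\<^sup>2 * \<bar>square_ind x * F x\<bar>)"
    using ind_mult_bound[of g G, OF g] by (auto intro!: AE_I2 simp: abs_mult)
qed measurable

definition limit_variance :: "(real \<Rightarrow> real) \<Rightarrow> real" where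
  "limit_variance g = (LINT x|R2. g (fst x) * g (snd x) * Rt x)"

end

context hermite_field
begin

definition Y :: "(real \<Rightarrow> real) \<Rightarrow> real \<Rightarrow> 'w \<Rightarrow> real" where
  "Y g \<epsilon> w = (LINT u|lborel. g u * X \<Psi> \<epsilon> u w)"

lemma Y_second_moment:
  assumes \<epsilon>: "0 < \<epsilon>" and g: "g \<in> borel_measurable borel" "\<And>u. \<bar>g u\<bar> \<le> G * indicator {a..b} u"
  shows "integrable M (\<lambda>w. (Y g \<epsilon> w)\<^sup>2)"
    and "(LINT w|M. (Y g \<epsilon> w)\<^sup>2) = (LINT x|R2. g (fst x) * g (snd x) * cov \<Psi> \<epsilon> x)"
  unfolding Y_def[abs_def] cov_def
  by (rule second_moment_of_integral[of "X \<Psi> \<epsilon>" g G a b, OF X_joint[OF \<Psi> \<epsilon>] g X_second_moment[OF \<epsilon>]])+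

lemma Y_measurable: "0 < \<epsilon> \<Longrightarrow> g \<in> borel_measurable borel \<Longrightarrow> Y g \<epsilon> \<in> borel_measurable M"
proof -
  assume \<epsilon>: "0 < \<epsilon>" and [measurable]: "g \<in> borel_measurable borel"
  have [measurable]: "(\<lambda>x. X \<Psi> \<epsilon> (snd x) (fst x)) \<in> borel_measurable (M \<Otimes>\<^sub>M lborel)"
    using measurable_compose[OF measurable_pair_swap' X_joint[OF \<Psi> \<epsilon>]] by (simp add: case_prod_unfold)
  have "(\<lambda>(w, u). g u * X \<Psi> \<epsilon> u w) \<in> borel_measurable (M \<Otimes>\<^sub>M lborel)" unfolding case_prod_unfold by measurable
  then show ?thesis unfolding Y_def[abs_def] by (rule lborel.borel_measurable_lebesgue_integral)
qed

lemma cov_integrable: "0 < \<epsilon> \<Longrightarrow> integrable R2 (\<lambda>x. square_ind x * cov \<Psi> \<epsilon> x)"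
proof -
  assume \<epsilon>: "0 < \<epsilon>"
  obtain C where C: "0 \<le> C" "\<And>\<epsilon> u v. 0 < \<epsilon> \<Longrightarrow> u \<in> {0..Z} \<Longrightarrow> v \<in> {0..Z} \<Longrightarrow> u \<noteq> v \<Longrightarrow>
     \<bar>cov \<Psi> \<epsilon> (u, v)\<bar> \<le> C * \<bar>u - v\<bar> powr (2 * lo - 2)" using cov_bound by blast
  show ?thesis by (rule riesz_dominated_integrable[OF C(1) cov_measurable[OF \<epsilon>] C(2)[OF \<epsilon>]])
qed

text \<open>Only the modulus of g enters, so the bound is uniform over all oscillating factors and
  serves V and W together.\<close>

lemma Y_moment_bound:
  obtains C where "0 \<le> C" "\<And>\<epsilon> a b g. 0 < \<epsilon> \<Longrightarrow> 0 \<le> a \<Longrightarrow> a \<le> b \<Longrightarrow> b \<le> Z \<Longrightarrow> g \<in> borel_measurable borel \<Longrightarrow>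
     (\<And>u. \<bar>g u\<bar> \<le> indicator {a..b} u) \<Longrightarrow> (LINT w|M. (Y g \<epsilon> w)\<^sup>2) \<le> C * (b - a) powr (2 * lo)"
proof -
  obtain C where C: "0 \<le> C" "\<And>\<epsilon> u v. 0 < \<epsilon> \<Longrightarrow> u \<in> {0..Z} \<Longrightarrow> v \<in> {0..Z} \<Longrightarrow> u \<noteq> v \<Longrightarrow>
     \<bar>cov \<Psi> \<epsilon> (u, v)\<bar> \<le> C * \<bar>u - v\<bar> powr (2 * lo - 2)" using cov_bound by blast
  let ?s = "2 * lo - 2"
  have s: "- 1 < ?s" by (rule r_order_le(3))
  show ?thesis
  proof (rule that[of "C * (2 / (?s + 1))"])
    show "0 \<le> C * (2 / (?s + 1))" using C s by simp
    fix \<epsilon> a b :: real and g :: "real \<Rightarrow> real"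
    assume \<epsilon>: "0 < \<epsilon>" and ab: "0 \<le> a" "a \<le> b" "b \<le> Z" and gm[measurable]: "g \<in> borel_measurable borel"
      and g: "\<And>u. \<bar>g u\<bar> \<le> indicator {a..b} u"
    have [measurable]: "cov \<Psi> \<epsilon> \<in> borel_measurable R2" by (rule cov_measurable[OF \<epsilon>])
    have le: "AE x in R2. \<bar>g (fst x) * g (snd x) * cov \<Psi> \<epsilon> x\<bar> \<le> C * riesz ?s a b x"
      using AE_pair_off_diagonal
    proof eventually_elim
      case (elim x)
      show ?case
      proof (cases "fst x \<in> {a..b} \<and> snd x \<in> {a..b}")
        case True
        then have "\<bar>cov \<Psi> \<epsilon> x\<bar> \<le> C * \<bar>fst x - snd x\<bar> powr ?s" using C(2)[OF \<epsilon>, of "fst x" "snd x"] ab elim by auto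
        moreover have "\<bar>g (fst x)\<bar> * \<bar>g (snd x)\<bar> \<le> 1"
          using g[of "fst x"] g[of "snd x"] True by (intro mult_le_one) auto
        ultimately have "(\<bar>g (fst x)\<bar> * \<bar>g (snd x)\<bar>) * \<bar>cov \<Psi> \<epsilon> x\<bar> \<le> 1 * (C * \<bar>fst x - snd x\<bar> powr ?s)"
          by (intro mult_mono) auto
        then show ?thesis using True by (simp add: abs_mult riesz_def case_prod_unfold)
      next
        case False
        then have "g (fst x) * g (snd x) = 0" using g[of "fst x"] g[of "snd x"] by (auto split: split_indicator_asm)
        then have "\<bar>g (fst x) * g (snd x) * cov \<Psi> \<epsilon> x\<bar> = 0" by (simp only: mult_zero_left abs_zero)
        also have "0 \<le> C * riesz ?s a b x" using C(1) riesz_nonneg by (rule mult_nonneg_nonneg)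
        finally show ?thesis .
      qed
    qed
    have ir: "integrable R2 (\<lambda>x. C * riesz ?s a b x)" using riesz_integrable(1)[OF s ab(2)] by simp
    have i: "integrable R2 (\<lambda>x. g (fst x) * g (snd x) * cov \<Psi> \<epsilon> x)"
    proof (rule Bochner_Integration.integrable_bound[OF ir])
      show "AE x in R2. norm (g (fst x) * g (snd x) * cov \<Psi> \<epsilon> x) \<le> norm (C * riesz ?s a b x)"
        using le
      proof eventually_elim
        case (elim x)
        then show ?case unfolding real_norm_def by (rule order_trans[OF _ abs_ge_self])
      qed
    qed measurable
    have "(LINT w|M. (Y g \<epsilon> w)\<^sup>2) = (LINT x|R2. g (fst x) * g (snd x) * cov \<Psi> \<epsilon> x)"
      by (rule Y_second_moment(2)[OF \<epsilon> gm, where G=1]) (use g in simp)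
    also have "\<dots> \<le> (LINT x|R2. C * riesz ?s a b x)"
    proof (rule integral_mono_AE[OF i ir])
      show "AE x in R2. g (fst x) * g (snd x) * cov \<Psi> \<epsilon> x \<le> C * riesz ?s a b x"
        using le by eventually_elim (rule order_trans[OF abs_ge_self])
    qed
    also have "\<dots> \<le> C * (2 / (?s + 1) * (b - a) powr (?s + 2))"
      unfolding integral_mult_right_zero by (rule mult_left_mono[OF riesz_integrable(2)[OF s ab(2)] C(1)])
    finally show "(LINT w|M. (Y g \<epsilon> w)\<^sup>2) \<le> C * (2 / (?s + 1)) * (b - a) powr (2 * lo)" by simp
  qed
qed

lemma cov_L1_tendsto:
  assumes \<epsilon>: "\<And>n. 0 < \<epsilon> n" "\<epsilon> \<longlonglongrightarrow> 0"
  shows "(\<lambda>n. LINT x|R2. \<bar>square_ind x * (cov \<Psi> (\<epsilon> n) x - first_coeff\<^sup>2 * Rt x)\<bar>) \<longlonglongrightarrow> 0"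
proof -
  obtain C where C: "0 \<le> C" "\<And>\<epsilon> u v. 0 < \<epsilon> \<Longrightarrow> u \<in> {0..Z} \<Longrightarrow> v \<in> {0..Z} \<Longrightarrow> u \<noteq> v \<Longrightarrow>
     \<bar>cov \<Psi> \<epsilon> (u, v)\<bar> \<le> C * \<bar>u - v\<bar> powr (2 * lo - 2)" using cov_bound by blast
  obtain D where D: "0 \<le> D" "\<And>u v. u \<in> {0..Z} \<Longrightarrow> v \<in> {0..Z} \<Longrightarrow> u \<noteq> v \<Longrightarrow> \<bar>Rt (u, v)\<bar> \<le> D * \<bar>u - v\<bar> powr (2 * lo - 2)"
    using Rt_bound by blast
  note [measurable] = cov_measurable[OF \<epsilon>(1)]
  have "(\<lambda>n. LINT x|R2. \<bar>square_ind x * (cov \<Psi> (\<epsilon> n) x - first_coeff\<^sup>2 * Rt x)\<bar>) \<longlonglongrightarrow> (LINT x|R2. (0::real))"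
  proof (rule integral_dominated_convergence[where w="\<lambda>x. (C + first_coeff\<^sup>2 * D) * riesz (2 * lo - 2) 0 Z x"])
    show "integrable R2 (\<lambda>x. (C + first_coeff\<^sup>2 * D) * riesz (2 * lo - 2) 0 Z x)" using riesz_square_integrable by simp
    show "AE x in R2. (\<lambda>n. \<bar>square_ind x * (cov \<Psi> (\<epsilon> n) x - first_coeff\<^sup>2 * Rt x)\<bar>) \<longlonglongrightarrow> 0"
      using AE_pair_off_diagonal
    proof eventually_elim
      case (elim x)
      show ?case
      proof (cases "fst x \<in> {0..Z} \<and> snd x \<in> {0..Z}")
        case True
        have "(\<lambda>n. cov \<Psi> (\<epsilon> n) x - first_coeff\<^sup>2 * Rt x) \<longlonglongrightarrow> 0"
          using cov_limit[OF \<epsilon>, of "fst x" "snd x"] True elim by (simp add: LIM_zero)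
        from tendsto_rabs_zero[OF tendsto_mult_right_zero[OF this, of "square_ind x"]] show ?thesis .
      next
        case False
        then have "square_ind x = 0" by (auto simp: square_ind_def)
        then show ?thesis by simp
      qed
    qed
    show "AE x in R2. norm \<bar>square_ind x * (cov \<Psi> (\<epsilon> n) x - first_coeff\<^sup>2 * Rt x)\<bar> \<le> (C + first_coeff\<^sup>2 * D) * riesz (2 * lo - 2) 0 Z x" for n
    proof -
      have "AE x in R2. \<bar>square_ind x * cov \<Psi> (\<epsilon> n) x\<bar> \<le> C * riesz (2 * lo - 2) 0 Z x"
        by (rule le_riesz_AE[of "cov \<Psi> (\<epsilon> n)" C, OF C(2)[OF \<epsilon>(1)]])
      moreover have "AE x in R2. \<bar>square_ind x * Rt x\<bar> \<le> D * riesz (2 * lo - 2) 0 Z x"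
        by (rule le_riesz_AE[of Rt D, OF D(2)])
      ultimately show ?thesis
    proof eventually_elim
      case (elim x)
      have "\<bar>s * (c - a * t)\<bar> \<le> (p + a * q) * R"
        if "\<bar>s * c\<bar> \<le> p * R" "\<bar>s * t\<bar> \<le> q * R" "0 \<le> a" for s c a t p q R :: real
      proof -
        have "\<bar>a * (s * t)\<bar> \<le> a * (q * R)" using mult_left_mono[OF that(2,3)] that(3) by (simp add: abs_mult)
        then show ?thesis using that(1) abs_triangle_ineq4[of "s * c" "a * (s * t)"] by (simp add: algebra_simps)
      qed
      from this[OF elim] show ?case by simp
    qed
    qed
  qed measurable
  then show ?thesis by simp
qed

text \<open>Convergence of the covariances in L1 allows the weight to change with n, arbitrarily
  fast, as long as it stays bounded.\<close>

lemma Y_moment_tendsto: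
  assumes \<epsilon>: "\<And>n. 0 < \<epsilon> n" "\<epsilon> \<longlonglongrightarrow> 0"
    and gm: "\<And>n. g n \<in> borel_measurable borel" and g: "\<And>n u. \<bar>g n u\<bar> \<le> G * indicator {0..Z} u"
  shows "(\<lambda>n. (LINT w|M. (Y (g n) (\<epsilon> n) w)\<^sup>2) - first_coeff\<^sup>2 * limit_variance (g n)) \<longlonglongrightarrow> 0"
proof (rule Lim_null_comparison, intro always_eventually allI)
  note [measurable] = gm cov_measurable[OF \<epsilon>(1)]
  fix n
  have i1: "integrable R2 (\<lambda>x. g n (fst x) * g n (snd x) * cov \<Psi> (\<epsilon> n) x)"
    by (rule g_mult_integrable[OF gm g cov_integrable[OF \<epsilon>(1)]]) measurable
  have i2: "integrable R2 (\<lambda>x. g n (fst x) * g n (snd x) * Rt x)"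
    by (rule g_mult_integrable[OF gm g Rt_integrable]) measurable
  have i3: "integrable R2 (\<lambda>x. square_ind x * (cov \<Psi> (\<epsilon> n) x - first_coeff\<^sup>2 * Rt x))"
    using cov_integrable[OF \<epsilon>(1)[of n]] integrable_mult_right[OF Rt_integrable, of "first_coeff\<^sup>2"]
    by (simp add: right_diff_distrib mult.left_commute)
  have "(LINT w|M. (Y (g n) (\<epsilon> n) w)\<^sup>2) - first_coeff\<^sup>2 * limit_variance (g n) =
     (LINT x|R2. g n (fst x) * g n (snd x) * (cov \<Psi> (\<epsilon> n) x - first_coeff\<^sup>2 * Rt x))"
  proof -
    have "(LINT x|R2. g n (fst x) * g n (snd x) * (cov \<Psi> (\<epsilon> n) x - first_coeff\<^sup>2 * Rt x)) =
      (LINT x|R2. g n (fst x) * g n (snd x) * cov \<Psi> (\<epsilon> n) x - first_coeff\<^sup>2 * (g n (fst x) * g n (snd x) * Rt x))"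
      by (intro Bochner_Integration.integral_cong refl) (simp add: algebra_simps)
    also have "\<dots> = (LINT x|R2. g n (fst x) * g n (snd x) * cov \<Psi> (\<epsilon> n) x) - first_coeff\<^sup>2 * (LINT x|R2. g n (fst x) * g n (snd x) * Rt x)"
      using i1 i2 by simp
    finally show ?thesis using Y_second_moment(2)[OF \<epsilon>(1) gm g] by (simp add: limit_variance_def)
  qed
  note e = this
  have l1: "norm (LINT x|R2. g n (fst x) * g n (snd x) * (cov \<Psi> (\<epsilon> n) x - first_coeff\<^sup>2 * Rt x)) \<le> (LINT x|R2. \<bar>g n (fst x) * g n (snd x) * (cov \<Psi> (\<epsilon> n) x - first_coeff\<^sup>2 * Rt x)\<bar>)"
    using integral_norm_bound[of R2 "\<lambda>x. g n (fst x) * g n (snd x) * (cov \<Psi> (\<epsilon> n) x - first_coeff\<^sup>2 * Rt x)"] by simp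
  have i4: "integrable R2 (\<lambda>x. \<bar>g n (fst x) * g n (snd x) * (cov \<Psi> (\<epsilon> n) x - first_coeff\<^sup>2 * Rt x)\<bar>)"
    by (rule integrable_abs, rule g_mult_integrable[OF gm g i3]) measurable
  have i5: "integrable R2 (\<lambda>x. G\<^sup>2 * \<bar>square_ind x * (cov \<Psi> (\<epsilon> n) x - first_coeff\<^sup>2 * Rt x)\<bar>)"
    by (rule integrable_mult_right[OF integrable_abs[OF i3]])
  have l2: "(LINT x|R2. \<bar>g n (fst x) * g n (snd x) * (cov \<Psi> (\<epsilon> n) x - first_coeff\<^sup>2 * Rt x)\<bar>) \<le> (LINT x|R2. G\<^sup>2 * \<bar>square_ind x * (cov \<Psi> (\<epsilon> n) x - first_coeff\<^sup>2 * Rt x)\<bar>)"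
    by (rule integral_mono[OF i4 i5 ind_mult_bound[of "g n" G, OF g]])
  show "norm ((LINT w|M. (Y (g n) (\<epsilon> n) w)\<^sup>2) - first_coeff\<^sup>2 * limit_variance (g n)) \<le>
     G\<^sup>2 * (LINT x|R2. \<bar>square_ind x * (cov \<Psi> (\<epsilon> n) x - first_coeff\<^sup>2 * Rt x)\<bar>)"
    using l1 l2 unfolding e integral_mult_right_zero by (rule order_trans)
next
  show "(\<lambda>n. G\<^sup>2 * (LINT x|R2. \<bar>square_ind x * (cov \<Psi> (\<epsilon> n) x - first_coeff\<^sup>2 * Rt x)\<bar>)) \<longlonglongrightarrow> 0"
    by (rule tendsto_mult_right_zero[OF cov_L1_tendsto[OF \<epsilon>]])
qed

text \<open>The moving weight is first transferred to the fixed kernel \<open>Rt\<close>, up to a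
  vanishing error; there the Riemann-Lebesgue lemma applies. In this way no relation between the two
  scales of oscillation is required.\<close>

lemma Y_oscillating_tendsto:
  fixes \<mu> :: "nat \<Rightarrow> real"
  assumes \<epsilon>: "\<And>n. 0 < \<epsilon> n" "\<epsilon> \<longlonglongrightarrow> 0" and \<mu>: "filterlim \<mu> at_infinity sequentially"
    and ab: "0 \<le> a" "b \<le> Z"
  shows "(\<lambda>n. LINT w|M. (Y (\<lambda>u. indicator {a..b} u * cos (\<mu> n * u)) (\<epsilon> n) w)\<^sup>2) \<longlonglongrightarrow> 0"
    and "(\<lambda>n. LINT w|M. (Y (\<lambda>u. indicator {a..b} u * sin (\<mu> n * u)) (\<epsilon> n) w)\<^sup>2) \<longlonglongrightarrow> 0"
proof -
  let ?F = "\<lambda>x. (indicator {a..b} (fst x) :: real) * indicator {a..b} (snd x) * Rt x"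
  have le: "\<bar>indicator {a..b} u :: real\<bar> \<le> 1 * indicator {0..Z} u" for u using ab by (auto split: split_indicator)
  have F: "integrable R2 ?F" by (rule g_mult_integrable[OF _ le Rt_integrable]) measurable
  have gen: "(\<lambda>n. LINT w|M. (Y (\<lambda>u. indicator {a..b} u * T (\<mu> n * u)) (\<epsilon> n) w)\<^sup>2) \<longlonglongrightarrow> 0"
    if T[measurable]: "T \<in> borel_measurable borel" and T1: "\<And>x. \<bar>T x\<bar> \<le> 1"
      and lim: "(\<lambda>n. LINT x|R2. ?F x * T (\<mu> n * fst x) * T (\<mu> n * snd x)) \<longlonglongrightarrow> 0" for T :: "real \<Rightarrow> real"
  proof -
    have "\<bar>indicator {a..b} u * T (\<mu> n * u)\<bar> \<le> 1 * indicator {0..Z} u" for n u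
      using T1[of "\<mu> n * u"] ab by (auto simp: abs_mult split: split_indicator)
    note 1 = Y_moment_tendsto[where g="\<lambda>n u. indicator {a..b} u * T (\<mu> n * u)", OF \<epsilon> _ this]
    have "limit_variance (\<lambda>u. indicator {a..b} u * T (\<mu> n * u)) = (LINT x|R2. ?F x * T (\<mu> n * fst x) * T (\<mu> n * snd x))" for n
      unfolding limit_variance_def by (intro Bochner_Integration.integral_cong refl) (simp only: mult_ac)
    then have "(\<lambda>n. first_coeff\<^sup>2 * limit_variance (\<lambda>u. indicator {a..b} u * T (\<mu> n * u))) \<longlonglongrightarrow> 0"
      using tendsto_mult_right_zero[OF lim] by simp
    from tendsto_add[OF 1 this] show ?thesis by simp
  qed
  show "(\<lambda>n. LINT w|M. (Y (\<lambda>u. indicator {a..b} u * cos (\<mu> n * u)) (\<epsilon> n) w)\<^sup>2) \<longlonglongrightarrow> 0"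
    by (rule gen[of cos, OF _ _ oscillating_double_integral_tendsto(1)[where p="\<lambda>n u. cos (\<mu> n * u)", OF F \<mu>]]) auto
  show "(\<lambda>n. LINT w|M. (Y (\<lambda>u. indicator {a..b} u * sin (\<mu> n * u)) (\<epsilon> n) w)\<^sup>2) \<longlonglongrightarrow> 0"
    by (rule gen[of sin, OF _ _ oscillating_double_integral_tendsto(2)[where p="\<lambda>n u. sin (\<mu> n * u)", OF F \<mu>]]) auto
qed

end

section \<open>Approximation of the transmission coefficient\<close>

text \<open>Markov's inequality at each level and countable subadditivity; this is how a bound
  holding at all dyadic levels at once gets its probability.\<close>

lemma (in prob_space) prob_ex_gt_le_suminf:
  fixes A :: "nat \<Rightarrow> 'a \<Rightarrow> real"
  assumes A: "\<And>l. integrable M (A l)" "\<And>l w. 0 \<le> A l w" and b: "\<And>l. 0 < b l"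
    and s: "summable (\<lambda>l. (LINT w|M. A l w) / b l)"
  shows "{w\<in>space M. \<exists>l. b l < A l w} \<in> events"
    and "prob {w\<in>space M. \<exists>l. b l < A l w} \<le> (\<Sum>l. (LINT w|M. A l w) / b l)"
proof -
  have [measurable]: "A l \<in> borel_measurable M" for l using A(1) by auto
  show "{w\<in>space M. \<exists>l. b l < A l w} \<in> events" by measurable
  let ?S = "\<lambda>l. {w\<in>space M. b l \<le> A l w}"
  have le: "prob (?S l) \<le> (LINT w|M. A l w) / b l" for l
    by (rule integral_Markov_inequality_measure[OF A(1) sets.top]) (use A b in auto)
  have sm: "summable (\<lambda>l. prob (?S l))"
    by (rule summable_comparison_test'[OF s, of 0]) (use le in simp)
  have "prob {w\<in>space M. \<exists>l. b l < A l w} \<le> prob (\<Union>l. ?S l)"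
    by (rule finite_measure_mono) (auto intro: less_imp_le)
  also have "\<dots> \<le> (\<Sum>l. prob (?S l))" by (rule finite_measure_subadditive_countably[OF _ sm]) auto
  also have "\<dots> \<le> (\<Sum>l. (LINT w|M. A l w) / b l)" by (rule suminf_le[OF le sm s])
  finally show "prob {w\<in>space M. \<exists>l. b l < A l w} \<le> (\<Sum>l. (LINT w|M. A l w) / b l)" .
qed

lemma (in finite_measure) integrable_indicator_real: "A \<in> sets M \<Longrightarrow> integrable M (indicator A :: 'a \<Rightarrow> real)"
  by (rule integrable_real_indicator) (auto simp: emeasure_eq_measure)

lemma set_lint_Icc_eq_integral:
  fixes f :: "real \<Rightarrow> real"
  assumes "continuous_on {a..b} f"
  shows "(LINT u|lborel. indicator {a..b} u * f u) = integral {a..b} f"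
  using set_borel_integral_eq_integral(2)[OF borel_integrable_atLeastAtMost'[OF assms]]
  by (simp add: set_lebesgue_integral_def)

lemma integral_Icc_diff:
  fixes f :: "real \<Rightarrow> 'a::banach"
  assumes "continuous_on UNIV f" "0 \<le> a" "a \<le> b"
  shows "integral {0..b} f - integral {0..a} f = integral {a..b} f"
proof -
  have "f integrable_on {0..b}"
    by (rule integrable_continuous_real[OF continuous_on_subset[OF assms(1)]]) simp
  from Henstock_Kurzweil_Integration.integral_combine[OF assms(2,3) this] show ?thesis by (metis add_diff_cancel_left')
qed

section \<open>Dyadic energies of V and W\<close>

context scaled_field
begin

text \<open>At level \<open>l\<close> there are \<open>2 ^ l\<close> increments with variance of order \<open>2 powr (- 2 * lo * l)\<close>, in sum
  \<open>dyadic_ratio ^ (4 * l)\<close>. A bound \<open>K * dyadic_ratio ^ l\<close> on the dyadic variation thus fails with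
  probability summable in \<open>l\<close>, while \<open>1 / 2 \<le> dyadic_ratio\<^sup>2\<close> admits smooth functions.\<close>
definition dyadic_ratio :: real where "dyadic_ratio = 2 powr (- (2 * lo - 1) / 4)"

lemma dyadic_ratio: "0 < dyadic_ratio" "dyadic_ratio < 1" "1 / 2 \<le> dyadic_ratio\<^sup>2" "dyadic_ratio ^ 4 = 2 powr (1 - 2 * lo)"
proof -
  show "0 < dyadic_ratio" by (simp add: dyadic_ratio_def)
  show "dyadic_ratio < 1" unfolding dyadic_ratio_def using lo_hi by (subst powr_less_one) auto
  have p: "dyadic_ratio ^ n = 2 powr (- (2 * lo - 1) / 4 * n)" for n
    unfolding dyadic_ratio_def powr_powr[symmetric] by (simp add: powr_realpow)
  have "1 / 2 = 2 powr (-1 :: real)" by (simp add: powr_minus_divide)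
  also have "\<dots> \<le> 2 powr (- (2 * lo - 1) / 4 * 2)" using lo_hi by (intro powr_mono) auto
  finally show "1 / 2 \<le> dyadic_ratio\<^sup>2" unfolding p by simp
  have "- (2 * lo - 1) / 4 * real 4 = 1 - 2 * lo" by (simp add: field_simps)
  then show "dyadic_ratio ^ 4 = 2 powr (1 - 2 * lo)" unfolding p by (simp only:)
qed

definition dyadic_piece :: "nat \<Rightarrow> nat \<Rightarrow> (real \<Rightarrow> real) \<Rightarrow> real \<Rightarrow> real" where
  "dyadic_piece l k \<phi> u = indicator {Z * real k / 2 ^ l..Z * real (Suc k) / 2 ^ l} u * \<phi> u"

lemma dyadic_ends:
  assumes "k < 2 ^ l"
  shows "0 \<le> Z * real k / 2 ^ l" "Z * real k / 2 ^ l \<le> Z * real (Suc k) / 2 ^ l" "Z * real (Suc k) / 2 ^ l \<le> Z"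
proof -
  show "0 \<le> Z * real k / 2 ^ l" using Z by simp
  show "Z * real k / 2 ^ l \<le> Z * real (Suc k) / 2 ^ l" using Z by (intro divide_right_mono mult_left_mono) auto
  have "real (Suc k) \<le> 2 ^ l" using assms by (metis Suc_leI of_nat_le_iff of_nat_numeral of_nat_power)
  then have "Z * real (Suc k) \<le> Z * 2 ^ l" using Z by (intro mult_left_mono) auto
  then show "Z * real (Suc k) / 2 ^ l \<le> Z" by (simp add: divide_le_eq)
qed

lemma dyadic_piece_measurable[measurable]: "\<phi> \<in> borel_measurable borel \<Longrightarrow> dyadic_piece l k \<phi> \<in> borel_measurable borel"
  unfolding dyadic_piece_def[abs_def] by measurable

lemma dyadic_piece_bound:
  assumes "\<And>u. \<bar>\<phi> u\<bar> \<le> 1"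
  shows "\<bar>dyadic_piece l k \<phi> u\<bar> \<le> indicator {Z * real k / 2 ^ l..Z * real (Suc k) / 2 ^ l} u"
  unfolding dyadic_piece_def abs_mult using assms[of u] by (auto split: split_indicator)

end

context hermite_field
begin

text \<open>The squared dyadic variation of a primitive of \<phi> times the medium, written with
  \<open>Y\<close> so that its mean is a sum of second moments.\<close>

definition dyadic_energy :: "(real \<Rightarrow> real) \<Rightarrow> real \<Rightarrow> nat \<Rightarrow> 'w \<Rightarrow> real" where
  "dyadic_energy \<phi> \<epsilon> l w = (\<Sum>k<2 ^ l. (Y (dyadic_piece l k \<phi>) \<epsilon> w)\<^sup>2)"

lemma dyadic_energy_nonneg: "0 \<le> dyadic_energy \<phi> \<epsilon> l w"
  by (simp add: dyadic_energy_def sum_nonneg)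

lemma Y_dyadic_integrable:
  assumes "0 < \<epsilon>" "\<phi> \<in> borel_measurable borel" "\<And>u. \<bar>\<phi> u\<bar> \<le> 1"
  shows "integrable M (\<lambda>w. (Y (dyadic_piece l k \<phi>) \<epsilon> w)\<^sup>2)"
proof (rule Y_second_moment(1)[OF assms(1) dyadic_piece_measurable[OF assms(2)]])
  show "\<bar>dyadic_piece l k \<phi> u\<bar> \<le> 1 * indicator {Z * real k / 2 ^ l..Z * real (Suc k) / 2 ^ l} u" for u
    using dyadic_piece_bound[OF assms(3)] by simp
qed

lemma dyadic_energy_integrable:
  assumes "0 < \<epsilon>" "\<phi> \<in> borel_measurable borel" "\<And>u. \<bar>\<phi> u\<bar> \<le> 1"
  shows "integrable M (dyadic_energy \<phi> \<epsilon> l)"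
    and "(LINT w|M. dyadic_energy \<phi> \<epsilon> l w) = (\<Sum>k<2 ^ l. LINT w|M. (Y (dyadic_piece l k \<phi>) \<epsilon> w)\<^sup>2)"
  using Y_dyadic_integrable[OF assms] unfolding dyadic_energy_def[abs_def]
  by (auto intro!: Bochner_Integration.integrable_sum Bochner_Integration.integral_sum)

lemma dyadic_energy_bound:
  obtains C where "0 \<le> C" "\<And>\<epsilon> \<phi> l. 0 < \<epsilon> \<Longrightarrow> \<phi> \<in> borel_measurable borel \<Longrightarrow> (\<And>u. \<bar>\<phi> u\<bar> \<le> 1) \<Longrightarrow>
    (LINT w|M. dyadic_energy \<phi> \<epsilon> l w) \<le> C * (dyadic_ratio ^ 4) ^ l"
proof -
  obtain C where C: "0 \<le> C" "\<And>\<epsilon> a b g. 0 < \<epsilon> \<Longrightarrow> 0 \<le> a \<Longrightarrow> a \<le> b \<Longrightarrow> b \<le> Z \<Longrightarrow> g \<in> borel_measurable borel \<Longrightarrow>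
     (\<And>u. \<bar>g u\<bar> \<le> indicator {a..b} u) \<Longrightarrow> (LINT w|M. (Y g \<epsilon> w)\<^sup>2) \<le> C * (b - a) powr (2 * lo)"
    using Y_moment_bound by blast
  show ?thesis
  proof (rule that[of "C * Z powr (2 * lo)"])
    show "0 \<le> C * Z powr (2 * lo)" using C by simp
    fix \<epsilon> :: real and \<phi> :: "real \<Rightarrow> real" and l
    assume \<epsilon>: "0 < \<epsilon>" and m: "\<phi> \<in> borel_measurable borel" and b: "\<And>u. \<bar>\<phi> u\<bar> \<le> 1"
    have "(LINT w|M. (Y (dyadic_piece l k \<phi>) \<epsilon> w)\<^sup>2) \<le> C * (Z / 2 ^ l) powr (2 * lo)" if k: "k < 2 ^ l" for k
    proof -
      have "Z * real (Suc k) / 2 ^ l - Z * real k / 2 ^ l = Z / 2 ^ l" by (simp add: field_simps)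
      with C(2)[OF \<epsilon> dyadic_ends[OF k] dyadic_piece_measurable[OF m] dyadic_piece_bound[OF b]] show ?thesis by simp
    qed
    then have "(LINT w|M. dyadic_energy \<phi> \<epsilon> l w) \<le> (\<Sum>k<(2::nat) ^ l. C * (Z / 2 ^ l) powr (2 * lo))"
      unfolding dyadic_energy_integrable(2)[OF \<epsilon> m b] by (intro sum_mono) simp
    also have "\<dots> = C * Z powr (2 * lo) * (2 ^ l / (2 ^ l) powr (2 * lo))"
      using Z by (simp add: powr_divide)
    also have "2 ^ l / (2 ^ l) powr (2 * lo) = (dyadic_ratio ^ 4) ^ l"
    proof -
      have "(2 ^ l) powr (2 * lo) = 2 powr (real l * (2 * lo))"
        by (simp add: powr_realpow[symmetric] powr_powr)
      moreover have "(dyadic_ratio ^ 4) ^ l = 2 powr (real l - real l * (2 * lo))"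
        unfolding dyadic_ratio(4) by (simp add: powr_realpow[symmetric] powr_powr algebra_simps)
      ultimately show ?thesis by (simp add: powr_diff powr_realpow)
    qed
    finally show "(LINT w|M. dyadic_energy \<phi> \<epsilon> l w) \<le> C * Z powr (2 * lo) * (dyadic_ratio ^ 4) ^ l" .
  qed
qed

text \<open>The limit is taken at a fixed level and is not uniform in l; the geometric bound over
  the levels compensates for this later.\<close>

lemma dyadic_energy_tendsto:
  fixes \<mu> :: "nat \<Rightarrow> real"
  assumes \<epsilon>: "\<And>n. 0 < \<epsilon> n" "\<epsilon> \<longlonglongrightarrow> 0" and \<mu>: "filterlim \<mu> at_infinity sequentially"
  shows "(\<lambda>n. LINT w|M. dyadic_energy (\<lambda>u. cos (\<mu> n * u)) (\<epsilon> n) l w) \<longlonglongrightarrow> 0"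
    and "(\<lambda>n. LINT w|M. dyadic_energy (\<lambda>u. sin (\<mu> n * u)) (\<epsilon> n) l w) \<longlonglongrightarrow> 0"
proof -
  have 1: "(LINT w|M. dyadic_energy (\<lambda>u. cos (\<mu> n * u)) (\<epsilon> n) l w) =
      (\<Sum>k<2 ^ l. LINT w|M. (Y (dyadic_piece l k (\<lambda>u. cos (\<mu> n * u))) (\<epsilon> n) w)\<^sup>2)" for n
    by (rule dyadic_energy_integrable(2)[OF \<epsilon>(1)]) auto
  have 2: "(LINT w|M. dyadic_energy (\<lambda>u. sin (\<mu> n * u)) (\<epsilon> n) l w) =
      (\<Sum>k<2 ^ l. LINT w|M. (Y (dyadic_piece l k (\<lambda>u. sin (\<mu> n * u))) (\<epsilon> n) w)\<^sup>2)" for n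
    by (rule dyadic_energy_integrable(2)[OF \<epsilon>(1)]) auto
  show "(\<lambda>n. LINT w|M. dyadic_energy (\<lambda>u. cos (\<mu> n * u)) (\<epsilon> n) l w) \<longlonglongrightarrow> 0"
    unfolding 1 dyadic_piece_def[abs_def]
  proof (rule tendsto_null_sum)
    fix k :: nat assume "k \<in> {..<2 ^ l}"
    then have k: "k < 2 ^ l" by simp
    show "(\<lambda>n. LINT w|M. (Y (\<lambda>u. indicator {Z * real k / 2 ^ l..Z * real (Suc k) / 2 ^ l} u * cos (\<mu> n * u)) (\<epsilon> n) w)\<^sup>2) \<longlonglongrightarrow> 0"
      by (rule Y_oscillating_tendsto(1)[OF \<epsilon> \<mu> dyadic_ends(1,3)[OF k]])
  qed
  show "(\<lambda>n. LINT w|M. dyadic_energy (\<lambda>u. sin (\<mu> n * u)) (\<epsilon> n) l w) \<longlonglongrightarrow> 0"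
    unfolding 2 dyadic_piece_def[abs_def]
  proof (rule tendsto_null_sum)
    fix k :: nat assume "k \<in> {..<2 ^ l}"
    then have k: "k < 2 ^ l" by simp
    show "(\<lambda>n. LINT w|M. (Y (\<lambda>u. indicator {Z * real k / 2 ^ l..Z * real (Suc k) / 2 ^ l} u * sin (\<mu> n * u)) (\<epsilon> n) w)\<^sup>2) \<longlonglongrightarrow> 0"
      by (rule Y_oscillating_tendsto(2)[OF \<epsilon> \<mu> dyadic_ends(1,3)[OF k]])
  qed
qed

text \<open>Moments are computed with the Lebesgue integral, the differential equation with the
  gauge integral; on continuous paths they agree.\<close>

lemma Y_indicator_eq_integral:
  assumes "0 < \<epsilon>" "w \<in> space M" "continuous_on UNIV \<phi>"
  shows "Y (\<lambda>u. indicator {a..b} u * \<phi> u) \<epsilon> w = integral {a..b} (\<lambda>u. X \<Psi> \<epsilon> u w * \<phi> u)"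
proof -
  have "continuous_on {a..b} (\<lambda>u. X \<Psi> \<epsilon> u w * \<phi> u)"
    by (rule continuous_on_subset[OF continuous_on_mult[OF X_cont[OF \<Psi> assms(1,2)] assms(3)]]) simp
  from set_lint_Icc_eq_integral[OF this] show ?thesis by (simp add: Y_def mult_ac)
qed

lemma dyadic_var_V:
  assumes \<epsilon>: "0 < \<epsilon>" and w: "w \<in> space M"
  shows "(dyadic_var Z l (\<lambda>x. integral {0..x} (\<lambda>u. X \<Psi> \<epsilon> u w)))\<^sup>2 = dyadic_energy (\<lambda>_. 1) \<epsilon> l w"
proof -
  note c = X_cont[OF \<Psi> \<epsilon> w]
  have "norm (integral {0..Z * real (Suc k) / 2 ^ l} (\<lambda>u. X \<Psi> \<epsilon> u w) - integral {0..Z * real k / 2 ^ l} (\<lambda>u. X \<Psi> \<epsilon> u w)) =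
     \<bar>Y (dyadic_piece l k (\<lambda>_. 1)) \<epsilon> w\<bar>" if k: "k < 2 ^ l" for k
    unfolding integral_Icc_diff[OF c dyadic_ends(1,2)[OF k]]
    using Y_indicator_eq_integral[OF \<epsilon> w, of "\<lambda>_. 1" "Z * real k / 2 ^ l" "Z * real (Suc k) / 2 ^ l"]
    by (simp add: dyadic_piece_def[abs_def])
  then show ?thesis
    unfolding dyadic_var_def L2_set_def dyadic_energy_def by (subst real_sqrt_pow2) (auto intro!: sum_nonneg sum.cong)
qed

text \<open>Squared moduli of increments split into real and imaginary parts, so the complex
  integral needs no moment estimate of its own.\<close>

lemma dyadic_var_W:
  assumes \<epsilon>: "0 < \<epsilon>" and w: "w \<in> space M"
  shows "(dyadic_var Z l (\<lambda>x. integral {0..x} (\<lambda>u. X \<Psi> \<epsilon> u w * iexp (c * u))))\<^sup>2 =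
    dyadic_energy (\<lambda>u. cos (c * u)) \<epsilon> l w + dyadic_energy (\<lambda>u. sin (c * u)) \<epsilon> l w"
proof -
  let ?f = "\<lambda>u. complex_of_real (X \<Psi> \<epsilon> u w) * iexp (c * u)"
  have ct: "continuous_on UNIV ?f" by (intro continuous_intros X_cont[OF \<Psi> \<epsilon> w])
  have "(norm (integral {0..Z * real (Suc k) / 2 ^ l} ?f - integral {0..Z * real k / 2 ^ l} ?f))\<^sup>2 =
     (Y (dyadic_piece l k (\<lambda>u. cos (c * u))) \<epsilon> w)\<^sup>2 + (Y (dyadic_piece l k (\<lambda>u. sin (c * u))) \<epsilon> w)\<^sup>2" if k: "k < 2 ^ l" for k
  proof -
    let ?a = "Z * real k / 2 ^ l" and ?b = "Z * real (Suc k) / 2 ^ l"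
    have i: "?f integrable_on {?a..?b}" by (rule integrable_continuous_real[OF continuous_on_subset[OF ct]]) simp
    have "Re (integral {?a..?b} ?f) = Y (dyadic_piece l k (\<lambda>u. cos (c * u))) \<epsilon> w"
      unfolding integral_linear[OF i bounded_linear_Re, symmetric] dyadic_piece_def[abs_def]
      by (subst Y_indicator_eq_integral[OF \<epsilon> w]) (auto intro!: continuous_intros simp: o_def Re_exp)
    moreover have "Im (integral {?a..?b} ?f) = Y (dyadic_piece l k (\<lambda>u. sin (c * u))) \<epsilon> w"
      unfolding integral_linear[OF i bounded_linear_Im, symmetric] dyadic_piece_def[abs_def]
      by (subst Y_indicator_eq_integral[OF \<epsilon> w]) (auto intro!: continuous_intros simp: o_def Im_exp)
    ultimately show ?thesis unfolding integral_Icc_diff[OF ct dyadic_ends(1,2)[OF k]] cmod_power2 by simp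
  qed
  then show ?thesis
    unfolding dyadic_var_def L2_set_def dyadic_energy_def sum.distrib[symmetric]
    by (subst real_sqrt_pow2) (auto intro!: sum_nonneg sum.cong)
qed

lemma dyadic_boundI_energy:
  assumes "\<And>l. (dyadic_var Z l g)\<^sup>2 \<le> K\<^sup>2 * (dyadic_ratio ^ l)\<^sup>2" "0 < K"
  shows "dyadic_bound Z dyadic_ratio K g"
  unfolding dyadic_bound_def power_mult_distrib[symmetric]
  using assms dyadic_ratio(1) by (auto intro!: power2_le_imp_le[OF assms(1)[unfolded power_mult_distrib[symmetric]]])

text \<open>The energies decay like the fourth power of the ratio. Half of it is spent on the
  squared threshold, the other half remains for summing over the levels.\<close>

lemma energy_ratio:
  assumes "E \<le> C * (dyadic_ratio ^ 4) ^ l" "0 < K"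
  shows "E / (K\<^sup>2 * (dyadic_ratio ^ l)\<^sup>2) \<le> C / K\<^sup>2 * (dyadic_ratio\<^sup>2) ^ l"
proof -
  have "(dyadic_ratio ^ 4) ^ l = (dyadic_ratio\<^sup>2) ^ l * (dyadic_ratio ^ l)\<^sup>2" by (simp add: power_mult[symmetric] power_add[symmetric])
  then show ?thesis using assms dyadic_ratio(1) by (simp add: field_simps)
qed

end

context hermite_field
begin

abbreviation "path_V \<epsilon> w x \<equiv> integral {0..x} (\<lambda>u. X \<Psi> \<epsilon> u w)"
abbreviation "path_W c \<epsilon> w x \<equiv> integral {0..x} (\<lambda>u. complex_of_real (X \<Psi> \<epsilon> u w) * iexp (c * u))"

lemma path_V_eq: "0 < \<epsilon> \<Longrightarrow> w \<in> space M \<Longrightarrow> path_V \<epsilon> w Z = Y (indicator {0..Z}) \<epsilon> w"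
  using Y_indicator_eq_integral[of \<epsilon> w "\<lambda>_. 1" 0 Z] by simp

lemma path_V_measurable: "0 < \<epsilon> \<Longrightarrow> (\<lambda>w. path_V \<epsilon> w Z) \<in> borel_measurable M"
proof -
  assume \<epsilon>: "0 < \<epsilon>"
  have "Y (indicator {0..Z}) \<epsilon> \<in> borel_measurable M" by (rule Y_measurable[OF \<epsilon>]) simp
  then show ?thesis by (rule measurable_cong[THEN iffD2, rotated]) (rule path_V_eq[OF \<epsilon>])
qed

text \<open>Where V has the dyadic bound K and W the dyadic bound \<delta>, the hypothesis
  \<open>close\<close> applies; elsewhere the difference is at most 2. K is fixed first, large
  enough for V uniformly in n, then \<delta> small in terms of K, and only then n grows.\<close>

lemma path_approximation_L1:
  fixes T :: "nat \<Rightarrow> 'w \<Rightarrow> complex" and \<mu> :: "nat \<Rightarrow> real" and \<omega> :: real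
  assumes \<epsilon>: "\<And>n. 0 < \<epsilon> n" "\<epsilon> \<longlonglongrightarrow> 0" and \<mu>: "filterlim \<mu> at_infinity sequentially"
    and T[measurable]: "\<And>n. T n \<in> borel_measurable M" and T1: "\<And>n w. norm (T n w) \<le> 1"
    and close: "\<And>n w K \<delta> B. w \<in> space M \<Longrightarrow> dyadic_bound Z dyadic_ratio K (path_V (\<epsilon> n) w) \<Longrightarrow>
      dyadic_bound Z dyadic_ratio \<delta> (path_W (\<mu> n) (\<epsilon> n) w) \<Longrightarrow> B = \<bar>\<omega>\<bar> / 2 * (\<delta> * (1 + \<bar>\<omega>\<bar> * K / (1 - dyadic_ratio))) \<Longrightarrow>
      4 * B / (1 - dyadic_ratio) \<le> 1 \<Longrightarrow> norm (T n w - iexp (\<omega> / 2 * path_V (\<epsilon> n) w Z)) \<le> B"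
  shows "(\<lambda>n. LINT w|M. norm (T n w - iexp (\<omega> / 2 * path_V (\<epsilon> n) w Z))) \<longlonglongrightarrow> 0"
proof -
  define q where "q = dyadic_ratio"
  have q: "0 < q" "q < 1" "1 / 2 \<le> q\<^sup>2" using dyadic_ratio by (auto simp: q_def)
  have q2: "norm (q\<^sup>2) < 1" using q by (simp add: power_less_one_iff)
  obtain C where C: "0 \<le> C" "\<And>\<epsilon> \<phi> l. 0 < \<epsilon> \<Longrightarrow> \<phi> \<in> borel_measurable borel \<Longrightarrow> (\<And>u. \<bar>\<phi> u\<bar> \<le> 1) \<Longrightarrow>
    (LINT w|M. dyadic_energy \<phi> \<epsilon> l w) \<le> C * (q ^ 4) ^ l" unfolding q_def using dyadic_energy_bound by blast
  let ?D = "\<lambda>n w. norm (T n w - iexp (\<omega> / 2 * path_V (\<epsilon> n) w Z))"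
  let ?EV = "\<lambda>n. dyadic_energy (\<lambda>_. 1) (\<epsilon> n)"
  let ?EW = "\<lambda>n l w. dyadic_energy (\<lambda>u. cos (\<mu> n * u)) (\<epsilon> n) l w + dyadic_energy (\<lambda>u. sin (\<mu> n * u)) (\<epsilon> n) l w"
  have iV: "integrable M (?EV n l)" for n l by (rule dyadic_energy_integrable(1)[OF \<epsilon>(1)]) auto
  have ic: "integrable M (dyadic_energy (\<lambda>u. cos (\<mu> n * u)) (\<epsilon> n) l)" for n l by (rule dyadic_energy_integrable(1)[OF \<epsilon>(1)]) auto
  have isn: "integrable M (dyadic_energy (\<lambda>u. sin (\<mu> n * u)) (\<epsilon> n) l)" for n l by (rule dyadic_energy_integrable(1)[OF \<epsilon>(1)]) auto
  have iW: "integrable M (?EW n l)" for n l using ic isn by simp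
  have eW: "(LINT w|M. ?EW n l w) = (LINT w|M. dyadic_energy (\<lambda>u. cos (\<mu> n * u)) (\<epsilon> n) l w) +
      (LINT w|M. dyadic_energy (\<lambda>u. sin (\<mu> n * u)) (\<epsilon> n) l w)" for n l using ic isn by simp
  have bV: "(LINT w|M. ?EV n l w) \<le> C * (q ^ 4) ^ l" for n l by (rule C(2)[OF \<epsilon>(1)]) auto
  have bW: "(LINT w|M. ?EW n l w) \<le> 2 * C * (q ^ 4) ^ l" for n l
  proof -
    have "(LINT w|M. dyadic_energy (\<lambda>u. cos (\<mu> n * u)) (\<epsilon> n) l w) \<le> C * (q ^ 4) ^ l" by (rule C(2)[OF \<epsilon>(1)]) auto
    moreover have "(LINT w|M. dyadic_energy (\<lambda>u. sin (\<mu> n * u)) (\<epsilon> n) l w) \<le> C * (q ^ 4) ^ l" by (rule C(2)[OF \<epsilon>(1)]) auto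
    ultimately show ?thesis unfolding eW by simp
  qed
  have geo: "summable (\<lambda>l. c * (q\<^sup>2) ^ l)" for c by (rule summable_mult[OF summable_geometric[OF q2]])
  have rV: "(LINT w|M. ?EV n l w) / (K\<^sup>2 * (q ^ l)\<^sup>2) \<le> C / K\<^sup>2 * (q\<^sup>2) ^ l" if "0 < K" for n l K
    unfolding q_def by (rule energy_ratio[OF bV[unfolded q_def] that])
  have rW: "(LINT w|M. ?EW n l w) / (K\<^sup>2 * (q ^ l)\<^sup>2) \<le> 2 * C / K\<^sup>2 * (q\<^sup>2) ^ l" if "0 < K" for n l K
    unfolding q_def by (rule energy_ratio[OF bW[unfolded q_def] that])
  have nV: "0 \<le> (LINT w|M. ?EV n l w) / (K\<^sup>2 * (q ^ l)\<^sup>2)" for n l K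
    by (intro divide_nonneg_nonneg Bochner_Integration.integral_nonneg dyadic_energy_nonneg) simp
  have nW: "0 \<le> (LINT w|M. ?EW n l w) / (K\<^sup>2 * (q ^ l)\<^sup>2)" for n l K
    by (intro divide_nonneg_nonneg Bochner_Integration.integral_nonneg add_nonneg_nonneg dyadic_energy_nonneg) simp
  have sV: "summable (\<lambda>l. (LINT w|M. ?EV n l w) / (K\<^sup>2 * (q ^ l)\<^sup>2))" if "0 < K" for n K
    by (rule summable_comparison_test'[OF geo[of "C / K\<^sup>2"], of 0])
       (use nV[of n _ K] rV[OF that, of n] in \<open>simp only: real_norm_def abs_of_nonneg\<close>)
  have sW: "summable (\<lambda>l. (LINT w|M. ?EW n l w) / (K\<^sup>2 * (q ^ l)\<^sup>2))" if "0 < K" for n K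
    by (rule summable_comparison_test'[OF geo[of "2 * C / K\<^sup>2"], of 0])
       (use nW[of n _ K] rW[OF that, of n] in \<open>simp only: real_norm_def abs_of_nonneg\<close>)
  define S where "S = (\<Sum>l. (q\<^sup>2) ^ l)"
  have S: "0 \<le> S" unfolding S_def by (rule suminf_nonneg[OF summable_geometric[OF q2]]) simp
  have main: "\<forall>\<^sub>F n in sequentially. (LINT w|M. ?D n w) < 8 * e" if e: "0 < e" for e :: real
  proof -
    \<comment> \<open>Then \<open>C * S \<le> e * K \<le> e * K\<^sup>2\<close>, so the bound for V
      fails with probability at most e.\<close>
    define K where "K = 1 + C * S / e"
    have CS: "0 \<le> C * S / e" using C S e by simp
    have K: "1 \<le> K" "0 < K" using CS by (auto simp: K_def)
    have "C / K\<^sup>2 * S \<le> e"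
    proof -
      have "C * S \<le> e * K" using e by (simp add: K_def field_simps)
      also have "\<dots> \<le> e * K\<^sup>2" using K e by (intro mult_left_mono) (auto simp: power2_eq_square)
      finally show ?thesis using K by (simp add: field_simps)
    qed
    then have KV: "(\<Sum>l. (LINT w|M. ?EV n l w) / (K\<^sup>2 * (q ^ l)\<^sup>2)) \<le> e" for n
      using suminf_le[OF rV[OF K(2)] sV[OF K(2)] geo, of n] unfolding suminf_mult[OF summable_geometric[OF q2]] S_def
      by (meson order_trans)
    define L where "L = \<bar>\<omega>\<bar> / 2 * (1 + \<bar>\<omega>\<bar> * K / (1 - q))"
    have L: "0 \<le> L" using K q by (simp add: L_def)
    \<comment> \<open>The first term makes the pointwise error small, the second is the smallness
      condition under which the absorption argument works.\<close>
    define b where "b = min e ((1 - q) / 4)"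
    have b: "0 < b" "b \<le> e" using q e by (auto simp: b_def)
    have "b \<le> (1 - q) / 4" unfolding b_def by (rule min.cobounded2)
    then have b3: "4 * b / (1 - q) \<le> 1" using q by (simp add: field_simps)
    \<comment> \<open>The denominator \<open>L + 1\<close> avoids a division by zero at \<omega> = 0
      and still gives \<open>\<delta> * L \<le> b\<close>.\<close>
    define \<delta> where "\<delta> = b / (L + 1)"
    have \<delta>: "0 < \<delta>" using b L by (simp add: \<delta>_def)
    have Bb: "\<delta> * L \<le> b"
    proof -
      have "\<delta> * L \<le> \<delta> * (L + 1)" using \<delta> by (intro mult_left_mono) auto
      also have "\<dots> = b" using L by (simp add: \<delta>_def)
      finally show ?thesis .
    qed
    have B: "\<bar>\<omega>\<bar> / 2 * (\<delta> * (1 + \<bar>\<omega>\<bar> * K / (1 - dyadic_ratio))) = \<delta> * L" by (simp add: L_def q_def)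
    have small: "4 * (\<delta> * L) / (1 - dyadic_ratio) \<le> 1"
    proof -
      have "4 * (\<delta> * L) / (1 - q) \<le> 4 * b / (1 - q)" using Bb q by (intro divide_right_mono) auto
      then show ?thesis using b3 by (simp add: q_def)
    qed
    define F where "F n = (\<Sum>l. (LINT w|M. ?EW n l w) / (\<delta>\<^sup>2 * (q ^ l)\<^sup>2))" for n
    \<comment> \<open>Tannery's theorem: each level tends to 0 and the levels have a summable
      majorant independent of n.\<close>
    have F: "F \<longlonglongrightarrow> 0"
    proof -
      have "(\<lambda>n. \<Sum>l. (LINT w|M. ?EW n l w) / (\<delta>\<^sup>2 * (q ^ l)\<^sup>2)) \<longlonglongrightarrow> (\<Sum>l. 0)"
      proof (rule conjunct2[OF conjunct2[OF tannerys_theorem]])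
        fix l
        have "(\<lambda>n. LINT w|M. ?EW n l w) \<longlonglongrightarrow> 0 + 0"
          unfolding eW by (rule tendsto_add[OF dyadic_energy_tendsto[OF \<epsilon> \<mu>]])
        then show "(\<lambda>n. (LINT w|M. ?EW n l w) / (\<delta>\<^sup>2 * (q ^ l)\<^sup>2)) \<longlonglongrightarrow> 0"
          using tendsto_mult_left_zero[of "\<lambda>n. LINT w|M. ?EW n l w" sequentially "inverse (\<delta>\<^sup>2 * (q ^ l)\<^sup>2)"]
          by (simp only: divide_inverse add_0)
      next
        show "\<forall>\<^sub>F (l, n) in sequentially \<times>\<^sub>F sequentially.
            norm ((LINT w|M. ?EW n l w) / (\<delta>\<^sup>2 * (q ^ l)\<^sup>2)) \<le> 2 * C / \<delta>\<^sup>2 * (q\<^sup>2) ^ l"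
        proof (intro always_eventually allI)
          fix x :: "nat \<times> nat"
          show "case x of (l, n) \<Rightarrow> norm ((LINT w|M. ?EW n l w) / (\<delta>\<^sup>2 * (q ^ l)\<^sup>2)) \<le> 2 * C / \<delta>\<^sup>2 * (q\<^sup>2) ^ l"
            unfolding case_prod_unfold real_norm_def abs_of_nonneg[OF nW] by (rule rW[OF \<delta>])
        qed
      qed (rule geo, simp)
      then show ?thesis by (simp add: F_def[abs_def])
    qed
    let ?BV = "\<lambda>n. {w \<in> space M. \<exists>l. K\<^sup>2 * (q ^ l)\<^sup>2 < ?EV n l w}"
    let ?BW = "\<lambda>n. {w \<in> space M. \<exists>l. \<delta>\<^sup>2 * (q ^ l)\<^sup>2 < ?EW n l w}"
    have PV: "?BV n \<in> events" "prob (?BV n) \<le> e" for n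
      using prob_ex_gt_le_suminf[of "?EV n" "\<lambda>l. K\<^sup>2 * (q ^ l)\<^sup>2", OF iV dyadic_energy_nonneg _ sV[OF K(2)]] KV[of n] K q by auto
    have PW: "?BW n \<in> events" "prob (?BW n) \<le> F n" for n
      unfolding F_def
      by (rule prob_ex_gt_le_suminf[of "?EW n" "\<lambda>l. \<delta>\<^sup>2 * (q ^ l)\<^sup>2", OF iW add_nonneg_nonneg[OF dyadic_energy_nonneg dyadic_energy_nonneg] _ sW[OF \<delta>]];
          use \<delta> q in simp)+
    have pt: "?D n w \<le> b + 2 * indicator (?BV n) w + 2 * indicator (?BW n) w" if w: "w \<in> space M" for n w
    proof (cases "w \<in> ?BV n \<or> w \<in> ?BW n")
      case True
      have "?D n w \<le> norm (T n w) + norm (iexp (\<omega> / 2 * path_V (\<epsilon> n) w Z))" by (rule norm_triangle_ineq4)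
      also have "\<dots> \<le> 2" using T1[of n w] norm_exp_i_times[of "\<omega> / 2 * path_V (\<epsilon> n) w Z"] by simp
      also have "2 \<le> b + 2 * indicator (?BV n) w + 2 * indicator (?BW n) w"
        using True b(1) by (elim disjE) (auto simp: indicator_def)
      finally show ?thesis .
    next
      case False
      have le: "?EV n l w \<le> K\<^sup>2 * (dyadic_ratio ^ l)\<^sup>2" "?EW n l w \<le> \<delta>\<^sup>2 * (dyadic_ratio ^ l)\<^sup>2" for l
        using False w by (auto simp: not_less q_def)
      have 1: "dyadic_bound Z dyadic_ratio K (path_V (\<epsilon> n) w)"
        by (rule dyadic_boundI_energy[OF _ K(2)], unfold dyadic_var_V[OF \<epsilon>(1) w], rule le(1))
      have 2: "dyadic_bound Z dyadic_ratio \<delta> (path_W (\<mu> n) (\<epsilon> n) w)"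
        by (rule dyadic_boundI_energy[OF _ \<delta>], unfold dyadic_var_W[OF \<epsilon>(1) w], rule le(2))
      have "?D n w \<le> \<delta> * L" by (rule close[OF w 1 2 B[symmetric] small])
      also have "\<dots> \<le> b" by (rule Bb)
      finally show ?thesis using False by simp
    qed
    have ev: "\<forall>\<^sub>F n in sequentially. F n < e" by (rule order_tendstoD(2)[OF F e])
    then show ?thesis
    proof eventually_elim
      case (elim n)
      note [measurable] = path_V_measurable[OF \<epsilon>(1)[of n]] PV(1)[of n] PW(1)[of n]
      have "(LINT w|M. ?D n w) \<le> (LINT w|M. b + 2 * indicator (?BV n) w + 2 * indicator (?BW n) w)"
      proof (rule integral_mono)
        show "integrable M (?D n)"
        proof (rule integrable_const_bound[of _ 2])
          show "AE w in M. norm (?D n w) \<le> 2"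
          proof (rule AE_I2)
            fix w
            have "?D n w \<le> norm (T n w) + norm (iexp (\<omega> / 2 * path_V (\<epsilon> n) w Z))" by (rule norm_triangle_ineq4)
            also have "\<dots> \<le> 2" using T1[of n w] norm_exp_i_times[of "\<omega> / 2 * path_V (\<epsilon> n) w Z"] by simp
            finally show "norm (?D n w) \<le> 2" by simp
          qed
        qed measurable
        show "integrable M (\<lambda>w. b + 2 * indicator (?BV n) w + 2 * indicator (?BW n) w :: real)"
          by (intro Bochner_Integration.integrable_add integrable_mult_right integrable_const
              integrable_indicator_real PV(1) PW(1))
      qed (rule pt)
      also have "\<dots> = b + 2 * prob (?BV n) + 2 * prob (?BW n)"
        using PV(1)[of n] PW(1)[of n] by (simp add: prob_space emeasure_eq_measure)
      also have "\<dots> < 8 * e" using b(2) PV(2)[of n] PW(2)[of n] elim e by linarith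
      finally show ?case .
    qed
  qed
  show ?thesis
  proof (rule tendstoI)
    fix e :: real assume "0 < e"
    then have "\<forall>\<^sub>F n in sequentially. (LINT w|M. ?D n w) < 8 * (e / 8)" by (intro main) simp
    then show "\<forall>\<^sub>F n in sequentially. dist (LINT w|M. ?D n w) 0 < e"
      by eventually_elim (simp add: abs_of_nonneg)
  qed
qed

end

section \<open>The Gaussian limit\<close>

text \<open>Stronger than uniform continuity on K, since x ranges over the whole space. A sequence
  of counterexamples would have a limit point in K at which \<phi> is discontinuous.\<close>

lemma continuous_near_compact:
  fixes \<phi> :: "'b::metric_space \<Rightarrow> real"
  assumes \<phi>: "continuous_on UNIV \<phi>" and K: "compact K" and e: "0 < e"
  shows "\<exists>d>0. \<forall>y\<in>K. \<forall>x. dist x y < d \<longrightarrow> \<bar>\<phi> x - \<phi> y\<bar> < e"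
proof (rule ccontr)
  assume "\<not> ?thesis"
  then have n: "\<exists>y x. y \<in> K \<and> dist x y < d \<and> e \<le> \<bar>\<phi> x - \<phi> y\<bar>" if "0 < d" for d
    using that by (meson not_less)
  have "\<forall>n. \<exists>y x. y \<in> K \<and> dist x y < inverse (real (Suc n)) \<and> e \<le> \<bar>\<phi> x - \<phi> y\<bar>"
    by (intro allI n) simp
  then obtain y x where yx: "\<And>n. y n \<in> K" "\<And>n. dist (x n) (y n) < inverse (real (Suc n))" "\<And>n. e \<le> \<bar>\<phi> (x n) - \<phi> (y n)\<bar>"
    by metis
  obtain l s where l: "strict_mono (s :: nat \<Rightarrow> nat)" "(y \<circ> s) \<longlonglongrightarrow> l"
    using K yx(1) unfolding compact_def by metis
  have "(\<lambda>n. dist (x n) (y n)) \<longlonglongrightarrow> 0"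
    by (rule tendsto_sandwich[OF _ _ tendsto_const LIMSEQ_inverse_real_of_nat])
       (use yx(2) in \<open>auto intro!: always_eventually less_imp_le\<close>)
  from LIMSEQ_subseq_LIMSEQ[OF this l(1)] have d: "(\<lambda>n. dist (x (s n)) (y (s n))) \<longlonglongrightarrow> 0" by (simp add: o_def)
  have y: "(\<lambda>n. y (s n)) \<longlonglongrightarrow> l" using l(2) by (simp add: o_def)
  have x: "(\<lambda>n. x (s n)) \<longlonglongrightarrow> l"
  proof (rule tendsto_dist_iff[THEN iffD2], rule tendsto_sandwich[OF _ _ tendsto_const])
    show "(\<lambda>n. dist (x (s n)) (y (s n)) + dist (y (s n)) l) \<longlonglongrightarrow> 0"
      using tendsto_add[OF d tendsto_dist_iff[THEN iffD1, OF y]] by simp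
  qed (auto intro!: always_eventually dist_triangle)
  have c: "isCont \<phi> l" using \<phi> by (simp add: continuous_on_eq_continuous_at)
  have "(\<lambda>n. \<bar>\<phi> (x (s n)) - \<phi> (y (s n))\<bar>) \<longlonglongrightarrow> \<bar>\<phi> l - \<phi> l\<bar>"
    by (intro tendsto_rabs tendsto_diff isCont_tendsto_compose[OF c] x y)
  then have "e \<le> \<bar>\<phi> l - \<phi> l\<bar>" by (rule LIMSEQ_le_const) (use yx(3) in auto)
  with e show False by simp
qed

text \<open>A tight sequence of the form \<open>F \<circ> V\<^sub>n\<close> stays, up to small probability, in a compact set, near
  which any continuous test function is uniformly continuous.\<close>
lemma (in prob_space) converging_together:
  fixes X :: "nat \<Rightarrow> 'a \<Rightarrow> 'b::metric_space" and V D :: "nat \<Rightarrow> 'a \<Rightarrow> real" and \<phi> :: "'b \<Rightarrow> real"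
  assumes F: "continuous_on UNIV F" and \<phi>: "continuous_on UNIV \<phi>" and B: "\<And>x. \<bar>\<phi> x\<bar> \<le> B"
    and mX[measurable]: "\<And>n. (\<lambda>w. \<phi> (X n w)) \<in> borel_measurable M" and mV[measurable]: "\<And>n. V n \<in> borel_measurable M"
    and V: "\<And>n. integrable M (\<lambda>w. (V n w)\<^sup>2)" "\<And>n. (LINT w|M. (V n w)\<^sup>2) \<le> C"
    and D: "\<And>n. integrable M (D n)" "\<And>n w. w \<in> space M \<Longrightarrow> dist (X n w) (F (V n w)) \<le> D n w"
    and lim: "(\<lambda>n. LINT w|M. D n w) \<longlonglongrightarrow> 0"
  shows "(\<lambda>n. (LINT w|M. \<phi> (X n w)) - (LINT w|M. \<phi> (F (V n w)))) \<longlonglongrightarrow> 0"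
proof -
  have B0: "0 \<le> B" using order_trans[OF abs_ge_zero B] .
  have C0: "0 \<le> C" using order_trans[OF Bochner_Integration.integral_nonneg V(2)[of 0]] by simp
  have \<phi>F: "continuous_on UNIV (\<lambda>v. \<phi> (F v))" using continuous_on_compose2[OF \<phi> F] by simp
  have [measurable]: "(\<lambda>v. \<phi> (F v)) \<in> borel_measurable borel" by (rule borel_measurable_continuous_onI[OF \<phi>F])
  have [measurable]: "(\<lambda>w. \<phi> (F (V n w))) \<in> borel_measurable M" for n by measurable
  have [measurable]: "D n \<in> borel_measurable M" for n using D(1) by auto
  have i1: "integrable M (\<lambda>w. \<phi> (X n w))" for n by (rule integrable_const_bound[of _ B]) (use B in auto)
  have i2: "integrable M (\<lambda>w. \<phi> (F (V n w)))" for n by (rule integrable_const_bound[of _ B]) (use B in auto)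
  have main: "\<forall>\<^sub>F n in sequentially. \<bar>(LINT w|M. \<phi> (X n w)) - (LINT w|M. \<phi> (F (V n w)))\<bar> \<le> e * (1 + 4 * B)"
    if e: "0 < e" for e :: real
  proof -
    define K where "K = 1 + C / e"
    have K: "1 \<le> K" using C0 e by (simp add: K_def)
    have CK: "C / K\<^sup>2 \<le> e"
    proof -
      have "C \<le> e * K" using e by (simp add: K_def field_simps)
      also have "\<dots> \<le> e * K\<^sup>2" using K e by (intro mult_left_mono) (auto simp: power2_eq_square)
      finally show ?thesis using K by (simp add: field_simps)
    qed
    have "compact (F ` {-K..K})" by (rule compact_continuous_image[OF continuous_on_subset[OF F]]) auto
    from continuous_near_compact[OF \<phi> this e]
    obtain d where d: "0 < d" "\<And>v x. v \<in> {-K..K} \<Longrightarrow> dist x (F v) < d \<Longrightarrow> \<bar>\<phi> x - \<phi> (F v)\<bar> < e" by blast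
    let ?A1 = "\<lambda>n. {w \<in> space M. K\<^sup>2 \<le> (V n w)\<^sup>2}" and ?A2 = "\<lambda>n. {w \<in> space M. d \<le> D n w}"
    have m: "?A1 n \<in> events" "?A2 n \<in> events" for n by measurable
    have P1: "prob (?A1 n) \<le> e" for n
    proof -
      have "prob (?A1 n) \<le> (LINT w|M. (V n w)\<^sup>2) / K\<^sup>2"
        by (rule integral_Markov_inequality_measure[OF V(1) sets.top]) (use K in auto)
      also have "\<dots> \<le> C / K\<^sup>2" by (rule divide_right_mono[OF V(2)]) simp
      finally show ?thesis using CK by simp
    qed
    have D0: "0 \<le> D n w" if "w \<in> space M" for n w using order_trans[OF zero_le_dist D(2)[OF that]] .
    have P2: "prob (?A2 n) \<le> (LINT w|M. D n w) / d" for n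
      by (rule integral_Markov_inequality_measure[OF D(1) sets.top]) (use d(1) D0 in auto)
    have pt: "\<bar>\<phi> (X n w) - \<phi> (F (V n w))\<bar> \<le> e + 2 * B * indicator (?A1 n) w + 2 * B * indicator (?A2 n) w"
      if w: "w \<in> space M" for n w
    proof (cases "w \<in> ?A1 n \<or> w \<in> ?A2 n")
      case True
      have "\<bar>\<phi> (X n w) - \<phi> (F (V n w))\<bar> \<le> 2 * B" using B[of "X n w"] B[of "F (V n w)"] by linarith
      also have "\<dots> \<le> e + 2 * B * indicator (?A1 n) w + 2 * B * indicator (?A2 n) w"
        using True e B0 by (elim disjE) (auto simp: indicator_def)
      finally show ?thesis .
    next
      case False
      then have "(V n w)\<^sup>2 \<le> K\<^sup>2" "dist (X n w) (F (V n w)) < d" using w D(2)[OF w, of n] by auto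
      then have "V n w \<in> {-K..K}" "dist (X n w) (F (V n w)) < d" using K by (auto simp: abs_le_square_iff[symmetric])
      from d(2)[OF this] show ?thesis using False by simp
    qed
    have "\<forall>\<^sub>F n in sequentially. (LINT w|M. D n w) < e * d" by (rule order_tendstoD(2)[OF lim]) (use e d in simp)
    then show ?thesis
    proof eventually_elim
      case (elim n)
      have ii: "integrable M (\<lambda>w. e + 2 * B * indicator (?A1 n) w + 2 * B * indicator (?A2 n) w)"
        by (intro Bochner_Integration.integrable_add integrable_mult_right integrable_const integrable_indicator_real m)
      have "\<bar>(LINT w|M. \<phi> (X n w)) - (LINT w|M. \<phi> (F (V n w)))\<bar> = \<bar>LINT w|M. \<phi> (X n w) - \<phi> (F (V n w))\<bar>"
        using i1 i2 by simp
      also have "\<dots> \<le> (LINT w|M. \<bar>\<phi> (X n w) - \<phi> (F (V n w))\<bar>)"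
        using integral_norm_bound[of M "\<lambda>w. \<phi> (X n w) - \<phi> (F (V n w))"] by simp
      also have "\<dots> \<le> (LINT w|M. e + 2 * B * indicator (?A1 n) w + 2 * B * indicator (?A2 n) w)"
        by (rule integral_mono[OF _ ii pt]) (use i1 i2 in auto)
      also have "\<dots> = e + 2 * B * prob (?A1 n) + 2 * B * prob (?A2 n)"
        using m by (simp add: prob_space emeasure_eq_measure)
      also have "\<dots> \<le> e + 2 * B * e + 2 * B * e"
      proof -
        have "(LINT w|M. D n w) / d \<le> e" using elim d(1) by (simp add: divide_le_eq)
        then have "prob (?A2 n) \<le> e" using P2[of n] by linarith
        then show ?thesis using P1[of n] B0 by (intro add_mono mult_left_mono) auto
      qed
      finally show ?case by (simp add: algebra_simps)
    qed
  qed
  show ?thesis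
  proof (rule tendstoI)
    fix e :: real assume e: "0 < e"
    have "\<forall>\<^sub>F n in sequentially. \<bar>(LINT w|M. \<phi> (X n w)) - (LINT w|M. \<phi> (F (V n w)))\<bar> \<le> (e / 2 / (1 + 4 * B)) * (1 + 4 * B)"
      by (rule main) (use e B0 in auto)
    then show "\<forall>\<^sub>F n in sequentially. dist ((LINT w|M. \<phi> (X n w)) - (LINT w|M. \<phi> (F (V n w)))) 0 < e"
    proof eventually_elim
      case (elim n)
      have "1 + 4 * B \<noteq> 0" using B0 by linarith
      then have "e / 2 / (1 + 4 * B) * (1 + 4 * B) = e / 2" by (rule nonzero_eq_divide_eq[THEN iffD1, OF _ refl])
      with elim have "\<bar>(LINT w|M. \<phi> (X n w)) - (LINT w|M. \<phi> (F (V n w)))\<bar> \<le> e / 2" by (simp only:)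
      with e show ?case by (simp add: dist_real_def)
    qed
  qed
qed

text \<open>A right-hand side independent of the state turns the Euler scheme into a Riemann sum, so
  \<open>euler_tendsto\<close> covers both.\<close>

lemma euler_constant_rhs: "euler (\<lambda>k _. c k) \<delta> x n = x + (\<Sum>k<n. \<delta> *\<^sub>R c k)"
  by (induction n) (simp_all add: algebra_simps)

lemma centered_normal_scale:
  assumes "centered_normal M X \<sigma>" shows "centered_normal M (\<lambda>w. a * X w) (a * \<sigma>)"
  unfolding centered_normal_def
proof (intro conjI allI)
  show "(\<lambda>w. a * X w) \<in> borel_measurable M" using assms by (auto simp: centered_normal_def)
  fix t
  have "(LINT w|M. iexp ((t * a) * X w)) = complex_of_real (exp (- ((\<sigma> * (t * a))\<^sup>2) / 2))"
    using assms unfolding centered_normal_def by blast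
  then show "(LINT w|M. iexp (t * (a * X w))) = complex_of_real (exp (- ((a * \<sigma> * t)\<^sup>2) / 2))"
    by (simp only: mult_ac)
qed

context scaled_field
begin

text \<open>The hypothesis on the field concerns sums over sets of index pairs; injectivity of u
  carries a sum over k to such a set.\<close>

lemma X_id_sum_gaussian:
  assumes \<epsilon>: "0 < \<epsilon>" and u: "inj_on u {..<n}" "\<And>k. k < n \<Longrightarrow> u k \<in> {0..Z}"
  shows "gaussian_rv M (\<lambda>w. \<Sum>k<(n::nat). a k * X (\<lambda>x. x) \<epsilon> (u k) w)"
proof -
  define idx where "idx k = (u k / \<epsilon>\<^sup>2, hc (u k))" for k
  have inj: "inj_on idx {..<n}" using u(1) \<epsilon> by (auto simp: inj_on_def idx_def)
  define c where "c i = a (the_inv_into {..<n} idx i) * \<epsilon> powr (2 * hc (u (the_inv_into {..<n} idx i)) - 2)" for i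
  have "(\<Sum>k<n. a k * X (\<lambda>x. x) \<epsilon> (u k) w) = (\<Sum>i\<in>idx ` {..<n}. c i * m (fst i) (snd i) w)" for w
    unfolding sum.reindex[OF inj] o_def
  proof (rule sum.cong[OF refl])
    fix k assume k: "k \<in> {..<n}"
    have "the_inv_into {..<n} idx (idx k) = k" by (rule the_inv_into_f_f[OF inj k])
    then show "a k * X (\<lambda>x. x) \<epsilon> (u k) w = c (idx k) * m (fst (idx k)) (snd (idx k)) w"
      using u(2)[of k] k by (simp add: c_def X_def clip(3)) (simp add: idx_def)
  qed
  moreover have "gaussian_rv M (\<lambda>w. \<Sum>i\<in>idx ` {..<n}. c i * m (fst i) (snd i) w)"
    by (rule combination_gaussian) (use u(2) hc in \<open>auto simp: idx_def\<close>)
  ultimately show ?thesis by simp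
qed

text \<open>Up to its coefficient this is the part of V(Z) that comes from the first Hermite
  polynomial.\<close>

definition G :: "real \<Rightarrow> 'w \<Rightarrow> real" where
  "G \<epsilon> w = (LINT u|lborel. indicator {0..Z} u * X (\<lambda>x. x) \<epsilon> u w)"

lemma G_eq_integral:
  assumes "0 < \<epsilon>" "w \<in> space M"
  shows "G \<epsilon> w = integral {0..Z} (\<lambda>u. X (\<lambda>x. x) \<epsilon> u w)"
  unfolding G_def
  by (rule set_lint_Icc_eq_integral[OF continuous_on_subset[OF X_cont[OF continuous_on_id assms]]]) simp

lemma G_second_moment:
  shows "0 < \<epsilon> \<Longrightarrow> G \<epsilon> \<in> borel_measurable M" "0 < \<epsilon> \<Longrightarrow> integrable M (\<lambda>w. (G \<epsilon> w)\<^sup>2)"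
    and "(\<And>n. 0 < e n) \<Longrightarrow> e \<longlonglongrightarrow> 0 \<Longrightarrow> (\<lambda>n. LINT w|M. (G (e n) w)\<^sup>2) \<longlonglongrightarrow> limit_variance (indicator {0..Z})"
proof -
  interpret I: hermite_field M m lo hi r Z h "\<lambda>x. x" by (rule hermite_field_id)
  have Y: "I.Y (indicator {0..Z}) \<epsilon> w = G \<epsilon> w" for \<epsilon> w by (simp add: I.Y_def G_def)
  show "0 < \<epsilon> \<Longrightarrow> G \<epsilon> \<in> borel_measurable M"
    using I.Y_measurable[of \<epsilon> "indicator {0..Z}"] by (simp add: Y[abs_def])
  show "0 < \<epsilon> \<Longrightarrow> integrable M (\<lambda>w. (G \<epsilon> w)\<^sup>2)"
    using I.Y_second_moment(1)[of \<epsilon> "indicator {0..Z}" 1 0 Z] by (simp add: Y)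
  assume e: "\<And>n. 0 < e n" "e \<longlonglongrightarrow> 0"
  have "(\<lambda>n. (LINT w|M. (G (e n) w)\<^sup>2) - limit_variance (indicator {0..Z})) \<longlonglongrightarrow> 0"
    using I.Y_moment_tendsto[OF e, of "\<lambda>_. indicator {0..Z}" 1] by (simp add: Y id_L2)
  then show "(\<lambda>n. LINT w|M. (G (e n) w)\<^sup>2) \<longlonglongrightarrow> limit_variance (indicator {0..Z})" by (rule LIM_zero_cancel)
qed

text \<open>Riemann sums of the field are Gaussian and converge on every path. Their variances need
  not be followed, since \<open>centered_normal_limit\<close> identifies that of the limit.\<close>

lemma G_centered_normal:
  assumes \<epsilon>: "0 < \<epsilon>"
  shows "centered_normal M (G \<epsilon>) (sqrt (LINT w|M. (G \<epsilon> w)\<^sup>2))"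
proof -
  let ?\<delta> = "\<lambda>n. Z / real (Suc n)" and ?u = "\<lambda>n k. Z * real k / real (Suc n)"
  let ?R = "\<lambda>n w. \<Sum>k<Suc n. ?\<delta> n * X (\<lambda>x. x) \<epsilon> (?u n k) w"
  have id: "continuous_on UNIV (\<lambda>x::real. x)" by (rule continuous_on_id)
  have normal: "\<exists>s. centered_normal M (?R n) s" for n
  proof -
    have g: "gaussian_rv M (?R n)"
    proof (rule X_id_sum_gaussian[OF \<epsilon>])
      show "inj_on (?u n) {..<Suc n}" using Z by (auto simp: inj_on_def)
      show "?u n k \<in> {0..Z}" if "k < Suc n" for k
        using that Z by (auto simp: divide_le_eq intro!: mult_left_mono)
    qed
    have x: "integrable M (X (\<lambda>x. x) \<epsilon> u)" "(LINT w|M. X (\<lambda>x. x) \<epsilon> u w) = 0" for u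
    proof -
      have z: "0 \<le> clip u / \<epsilon>\<^sup>2" using clip(2) by simp
      show "integrable M (X (\<lambda>x. x) \<epsilon> u)"
        unfolding X_def[abs_def] by (rule integrable_mult_right[OF centered_normal_moments(1)[OF prob_space_axioms m_standard_normal[OF z hc]]])
      show "(LINT w|M. X (\<lambda>x. x) \<epsilon> u w) = 0" unfolding X_def using mean_zero[OF z hc] by simp
    qed
    have "(LINT w|M. ?R n w) = 0" using x by (subst Bochner_Integration.integral_sum) auto
    from gaussian_rv_imp_centered_normal[OF prob_space_axioms g this] show ?thesis by blast
  qed
  have lim: "(\<lambda>n. ?R n w) \<longlonglongrightarrow> G \<epsilon> w" if w: "w \<in> space M" for w
  proof -
    let ?f = "\<lambda>u. X (\<lambda>x. x) \<epsilon> u w"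
    have c: "continuous_on {0..Z} ?f" by (rule continuous_on_subset[OF X_cont[OF id \<epsilon> w]]) simp
    have "(\<lambda>n. euler (\<lambda>k _. ?f (Z * real k / real (Suc n))) (Z / real (Suc n)) (integral {0..0} ?f) (Suc n)) \<longlonglongrightarrow> integral {0..Z} ?f"
      by (rule euler_tendsto[where F="\<lambda>s _. ?f s" and L=0 and x="\<lambda>s. integral {0..s} ?f", OF Z integral_has_vector_derivative[OF c] c]) auto
    then show ?thesis unfolding euler_constant_rhs G_eq_integral[OF \<epsilon> w] by simp
  qed
  show ?thesis
    by (rule centered_normal_limit[of M ?R, OF prob_space_axioms normal G_second_moment(1)[OF \<epsilon>] AE_I2[OF lim]])
qed

lemma limit_variance_nonneg: "0 \<le> limit_variance (indicator {0..Z})"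
  by (rule LIMSEQ_le_const[OF G_second_moment(3)[OF _ LIMSEQ_inverse_real_of_nat]]) auto

end

section \<open>The limit covariance and the process that has it\<close>

context scaled_field
begin

definition limit_covariance :: "real \<Rightarrow> real \<Rightarrow> real" where
  "limit_covariance x y = (LINT z|R2. indicator {0..x} (fst z) * indicator {0..y} (snd z) * Rt z)"

lemma limit_covariance_integrable:
  assumes "x \<in> {0..Z}" "y \<in> {0..Z}"
  shows "integrable R2 (\<lambda>z. indicator {0..x} (fst z) * indicator {0..y} (snd z) * Rt z)"
proof (rule Bochner_Integration.integrable_bound[OF Rt_integrable])
  show "AE z in R2. norm (indicator {0..x} (fst z) * indicator {0..y} (snd z) * Rt z) \<le> norm (square_ind z * Rt z)"
    using assms by (intro AE_I2) (auto simp: square_ind_def split: split_indicator)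
qed measurable

lemma limit_covariance_commute: "limit_covariance x y = limit_covariance y x"
proof -
  have "limit_covariance x y = (LINT z|R2. (\<lambda>(u, v). indicator {0..x} u * indicator {0..y} v * Rt (u, v)) z)"
    unfolding limit_covariance_def by (intro Bochner_Integration.integral_cong) auto
  also have "\<dots> = (LINT (u, v)|R2. (\<lambda>(u, v). indicator {0..x} u * indicator {0..y} v * Rt (u, v)) (v, u))"
    by (subst lborel_pair.integral_product_swap) (auto simp: case_prod_unfold)
  also have "\<dots> = limit_covariance y x"
    unfolding limit_covariance_def by (intro Bochner_Integration.integral_cong) (auto simp: Rt_commute mult_ac)
  finally show ?thesis .
qed

lemma limit_variance_combination:
  assumes F: "finite F" "F \<subseteq> {0..Z}"
  shows "limit_variance (\<lambda>u. \<Sum>x\<in>F. c x * indicator {0..x} u) = (\<Sum>x\<in>F. \<Sum>y\<in>F. c x * c y * limit_covariance x y)"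
proof -
  have i: "integrable R2 (\<lambda>z. c x * c y * (indicator {0..x} (fst z) * indicator {0..y} (snd z) * Rt z))"
    if "x \<in> F" "y \<in> F" for x y
  proof -
    have "x \<in> {0..Z}" "y \<in> {0..Z}" using that F by auto
    from integrable_mult_right[OF limit_covariance_integrable[OF this]] show ?thesis .
  qed
  have "limit_variance (\<lambda>u. \<Sum>x\<in>F. c x * indicator {0..x} u) =
     (LINT z|R2. (\<Sum>x\<in>F. \<Sum>y\<in>F. c x * c y * (indicator {0..x} (fst z) * indicator {0..y} (snd z) * Rt z)))"
  proof -
    have "(\<Sum>x\<in>F. a x) * (\<Sum>y\<in>F. b y) * R = (\<Sum>x\<in>F. \<Sum>y\<in>F. a x * b y * R)" for a b :: "real \<Rightarrow> real" and R
      unfolding sum_product by (simp only: sum_distrib_right)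
    moreover have "c x * i * (c y * j) * R = c x * c y * (i * j * R)" for x y i j R :: real by simp
    ultimately show ?thesis unfolding limit_variance_def by (simp only:)
  qed
  also have "\<dots> = (\<Sum>x\<in>F. LINT z|R2. (\<Sum>y\<in>F. c x * c y * (indicator {0..x} (fst z) * indicator {0..y} (snd z) * Rt z)))"
    by (rule Bochner_Integration.integral_sum) (rule Bochner_Integration.integrable_sum[OF i])
  also have "\<dots> = (\<Sum>x\<in>F. \<Sum>y\<in>F. LINT z|R2. c x * c y * (indicator {0..x} (fst z) * indicator {0..y} (snd z) * Rt z))"
    by (rule sum.cong[OF refl], rule Bochner_Integration.integral_sum) (rule i)
  also have "\<dots> = (\<Sum>x\<in>F. \<Sum>y\<in>F. c x * c y * limit_covariance x y)"
    unfolding integral_mult_right_zero limit_covariance_def ..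
  finally show ?thesis .
qed

text \<open>As a limit of second moments the quadratic form of \<open>Rt\<close> inherits their
  positivity and their bounds, neither of which is visible in the kernel.\<close>

lemma limit_variance_moment_limit:
  assumes g: "g \<in> borel_measurable borel" "\<And>u. \<bar>g u\<bar> \<le> B * indicator {0..Z} u"
  shows "0 \<le> limit_variance g"
    and "(\<And>\<epsilon>. 0 < \<epsilon> \<Longrightarrow> (LINT w|M. (LINT u|lborel. g u * X (\<lambda>x. x) \<epsilon> u w)\<^sup>2) \<le> C) \<Longrightarrow> limit_variance g \<le> C"
proof -
  interpret I: hermite_field M m lo hi r Z h "\<lambda>x. x" by (rule hermite_field_id)
  have "(\<lambda>n. (LINT w|M. (I.Y g (inverse (real (Suc n))) w)\<^sup>2) - limit_variance g) \<longlonglongrightarrow> 0"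
    using I.Y_moment_tendsto[OF _ LIMSEQ_inverse_real_of_nat, of "\<lambda>_. g" B] g by (simp add: id_L2)
  then have l: "(\<lambda>n. LINT w|M. (I.Y g (inverse (real (Suc n))) w)\<^sup>2) \<longlonglongrightarrow> limit_variance g" by (rule LIM_zero_cancel)
  show "0 \<le> limit_variance g" by (rule LIMSEQ_le_const[OF l]) auto
  assume "\<And>\<epsilon>. 0 < \<epsilon> \<Longrightarrow> (LINT w|M. (LINT u|lborel. g u * X (\<lambda>x. x) \<epsilon> u w)\<^sup>2) \<le> C"
  then show "limit_variance g \<le> C" by (intro LIMSEQ_le_const2[OF l]) (auto simp: I.Y_def)
qed

lemma psd_on_limit_covariance: "psd_on {0..Z} (\<lambda>x y. J\<^sup>2 * limit_covariance x y)"
  unfolding psd_on_def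
proof (intro conjI allI impI ballI)
  show "J\<^sup>2 * limit_covariance x y = J\<^sup>2 * limit_covariance y x" for x y by (simp add: limit_covariance_commute[of x y])
  fix F and c :: "real \<Rightarrow> real" assume F: "finite F \<and> F \<subseteq> {0..Z}"
  let ?g = "\<lambda>u. \<Sum>x\<in>F. c x * indicator {0..x} u"
  have "\<bar>?g u\<bar> \<le> (\<Sum>x\<in>F. \<bar>c x\<bar>) * indicator {0..Z} u" for u
  proof -
    have "\<bar>?g u\<bar> \<le> (\<Sum>x\<in>F. \<bar>c x * indicator {0..x} u\<bar>)" by (rule sum_abs)
    also have "\<dots> \<le> (\<Sum>x\<in>F. \<bar>c x\<bar> * indicator {0..Z} u)"
      using F by (intro sum_mono) (auto simp: abs_mult split: split_indicator)
    finally show ?thesis by (simp add: sum_distrib_right)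
  qed
  then have "0 \<le> limit_variance ?g" by (intro limit_variance_moment_limit(1)) measurable
  then have "0 \<le> J\<^sup>2 * limit_variance ?g" by simp
  also have "\<dots> = (\<Sum>x\<in>F. \<Sum>y\<in>F. c x * c y * (J\<^sup>2 * limit_covariance x y))"
    unfolding limit_variance_combination[OF conjunct1[OF F] conjunct2[OF F]] sum_distrib_left by (simp only: mult_ac)
  finally show "0 \<le> (\<Sum>x\<in>F. \<Sum>y\<in>F. c x * c y * (J\<^sup>2 * limit_covariance x y))" .
qed

lemma limit_covariance_increment:
  obtains C where "0 \<le> C" "\<And>p q. 0 \<le> p \<Longrightarrow> p \<le> q \<Longrightarrow> q \<le> Z \<Longrightarrow> limit_covariance q q - 2 * limit_covariance q p + limit_covariance p p \<le> C * (q - p) powr (2 * lo)"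
proof -
  interpret I: hermite_field M m lo hi r Z h "\<lambda>x. x" by (rule hermite_field_id)
  obtain C where C: "0 \<le> C" "\<And>\<epsilon> a b g. 0 < \<epsilon> \<Longrightarrow> 0 \<le> a \<Longrightarrow> a \<le> b \<Longrightarrow> b \<le> Z \<Longrightarrow> g \<in> borel_measurable borel \<Longrightarrow>
     (\<And>u. \<bar>g u\<bar> \<le> indicator {a..b} u) \<Longrightarrow> (LINT w|M. (I.Y g \<epsilon> w)\<^sup>2) \<le> C * (b - a) powr (2 * lo)"
    using I.Y_moment_bound by blast
  show ?thesis
  proof (rule that[OF C(1)])
    fix p q assume pq: "0 \<le> p" "p \<le> q" "q \<le> Z"
    show "limit_covariance q q - 2 * limit_covariance q p + limit_covariance p p \<le> C * (q - p) powr (2 * lo)"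
    proof (cases "p = q")
      case False
      \<comment> \<open>The increment as a combination over the set of its two end points, which is
        why p and q must differ here.\<close>
      define c :: "real \<Rightarrow> real" where "c x = (if x = q then 1 else -1)" for x
      define g where "g u = (\<Sum>x\<in>{q, p}. c x * indicator {0..x} u)" for u
      have g: "g u = indicator {0..q} u - indicator {0..p} u" for u
      proof -
        have "sum f {q, p} = f q + f p" for f :: "real \<Rightarrow> real" using False by simp
        then have "g u = c q * indicator {0..q} u + c p * indicator {0..p} u" unfolding g_def .
        then show ?thesis using False by (simp add: c_def)
      qed
      have gm: "g \<in> borel_measurable borel" unfolding g[abs_def] by measurable
      have gb: "\<bar>g u\<bar> \<le> indicator {p..q} u" for u unfolding g using pq by (auto split: split_indicator)
      have "limit_variance g = limit_covariance q q - 2 * limit_covariance q p + limit_covariance p p"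
        unfolding g_def[abs_def] using pq False limit_covariance_commute[of p q] by (subst limit_variance_combination) (auto simp: c_def)
      moreover have "limit_variance g \<le> C * (q - p) powr (2 * lo)"
      proof (rule limit_variance_moment_limit(2)[OF gm])
        show "\<bar>g u\<bar> \<le> 1 * indicator {0..Z} u" for u using gb[of u] pq by (auto split: split_indicator_asm split_indicator)
        show "(LINT w|M. (LINT u|lborel. g u * X (\<lambda>x. x) \<epsilon> u w)\<^sup>2) \<le> C * (q - p) powr (2 * lo)" if "0 < \<epsilon>" for \<epsilon>
          using C(2)[OF that pq gm gb] by (simp add: I.Y_def)
      qed
      ultimately show ?thesis by simp
    qed simp
  qed
qed

lemma dense_times: "\<exists>q :: nat \<Rightarrow> real. (\<forall>n. q n \<in> {0..Z}) \<and> (\<forall>z\<in>{0..Z}. \<forall>d>0. \<exists>n. \<bar>z - q n\<bar> < d)"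
proof (intro exI[of _ "\<lambda>n. clip (from_nat_into \<rat> n)"] conjI allI ballI impI)
  show "clip (from_nat_into \<rat> n) \<in> {0..Z}" for n by (rule clip(1))
  fix z d :: real assume z: "z \<in> {0..Z}" and d: "0 < d"
  obtain x where x: "x \<in> \<rat>" "z < x" "x < z + d" using Rats_dense_in_real[of z "z + d"] d by auto
  have "\<bar>z - clip x\<bar> < d" using x z by (auto simp: clip_def)
  moreover obtain n where "from_nat_into \<rat> n = x" using from_nat_into_surj[OF countable_rat x(1)] by blast
  ultimately show "\<exists>n. \<bar>z - clip (from_nat_into \<rat> n)\<bar> < d" by blast
qed

lemma interval_covariance:
  assumes "x \<in> {0..Z}" "y \<in> {0..Z}"
  shows "(LBINT u\<^sub>1=0..x. (LBINT u\<^sub>2=0..y. \<R>_tilde r h u\<^sub>1 u\<^sub>2)) = limit_covariance x y"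
proof -
  have icc: "(LBINT u=0..z. f u) = (LINT u|lborel. indicator {0..z} u * f u)" if "z \<in> {0..Z}" for z and f :: "real \<Rightarrow> real"
    using interval_integral_Icc[of 0 z f] that by (simp add: set_lebesgue_integral_def zero_ereal_def)
  have "limit_covariance x y = (LINT u|lborel. LINT v|lborel. indicator {0..x} u * indicator {0..y} v * Rt (u, v))"
    unfolding limit_covariance_def using lborel_pair.integral_fst'[OF limit_covariance_integrable[OF assms]] by simp
  also have "\<dots> = (LINT u|lborel. indicator {0..x} u * (LINT v|lborel. indicator {0..y} v * \<R>_tilde r h u v))"
  proof (rule Bochner_Integration.integral_cong[OF refl])
    fix u :: real
    have "(LINT v|lborel. indicator {0..x} u * indicator {0..y} v * Rt (u, v)) =
       (LINT v|lborel. indicator {0..x} u * (indicator {0..y} v * \<R>_tilde r h u v))"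
      using assms by (intro Bochner_Integration.integral_cong refl) (auto simp: Rt_eq split: split_indicator)
    then show "(LINT v|lborel. indicator {0..x} u * indicator {0..y} v * Rt (u, v)) =
       indicator {0..x} u * (LINT v|lborel. indicator {0..y} v * \<R>_tilde r h u v)" by simp
  qed
  finally show ?thesis unfolding icc[OF assms(1)] icc[OF assms(2)] by simp
qed

lemma is_S_process_exists: "\<exists>S. is_S_process Z J r h white_noise S"
proof -
  obtain q :: "nat \<Rightarrow> real" where q: "\<And>n. q n \<in> {0..Z}" "\<And>z d. z \<in> {0..Z} \<Longrightarrow> 0 < d \<Longrightarrow> \<exists>n. \<bar>z - q n\<bar> < d"
    using dense_times by blast
  obtain C where C: "0 \<le> C" "\<And>p q. 0 \<le> p \<Longrightarrow> p \<le> q \<Longrightarrow> q \<le> Z \<Longrightarrow> limit_covariance q q - 2 * limit_covariance q p + limit_covariance p p \<le> C * (q - p) powr (2 * lo)"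
    using limit_covariance_increment by blast
  let ?K = "\<lambda>x y. J\<^sup>2 * limit_covariance x y"
  have inc: "limit_covariance z z - 2 * limit_covariance z p + limit_covariance p p \<le> C * \<bar>z - p\<bar> powr (2 * lo)" if "z \<in> {0..Z}" "p \<in> {0..Z}" for z p
    using C(2)[of p z] C(2)[of z p] that limit_covariance_commute[of p z] by (cases "p \<le> z") auto
  have dense: "\<exists>k. ?K z z - 2 * ?K z (q k) + ?K (q k) (q k) < e" if z: "z \<in> {0..Z}" and e: "0 < e" for z e
  proof -
    define a where "a = e / (J\<^sup>2 * C + 1)"
    have JC: "0 \<le> J\<^sup>2 * C" using C(1) by simp
    \<comment> \<open>The tolerance a satisfies \<open>J\<^sup>2 * C * a < e\<close>, and a distance
      below both 1 and a is enough because \<open>2 * lo\<close> exceeds 1.\<close>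
    have a: "0 < a" using JC e by (simp add: a_def)
    obtain k where k: "\<bar>z - q k\<bar> < min 1 a" using q(2)[OF z, of "min 1 a"] a by auto
    have "\<bar>z - q k\<bar> powr (2 * lo) \<le> \<bar>z - q k\<bar> powr 1" using k lo_hi by (intro powr_mono') auto
    then have p: "\<bar>z - q k\<bar> powr (2 * lo) \<le> a" using k by simp
    have "?K z z - 2 * ?K z (q k) + ?K (q k) (q k) = J\<^sup>2 * (limit_covariance z z - 2 * limit_covariance z (q k) + limit_covariance (q k) (q k))"
      by (simp add: algebra_simps)
    also have "\<dots> \<le> J\<^sup>2 * (C * \<bar>z - q k\<bar> powr (2 * lo))" by (rule mult_left_mono[OF inc[OF z q(1)]]) simp
    also have "\<dots> \<le> J\<^sup>2 * (C * a)" using p C(1) by (intro mult_left_mono) auto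
    also have "\<dots> = (J\<^sup>2 * C) * a" by simp
    also have "\<dots> < e" using JC e by (simp add: a_def field_simps)
    finally show ?thesis by blast
  qed
  obtain S where "centered_gaussian_process white_noise {0..Z} S"
    "\<And>x y. x \<in> {0..Z} \<Longrightarrow> y \<in> {0..Z} \<Longrightarrow> (LINT w|white_noise. S x w * S y w) = ?K x y"
    using gaussian_process_exists[of "{0..Z}" ?K q, OF psd_on_limit_covariance q(1) dense] by blast
  then have "is_S_process Z J r h white_noise S" unfolding is_S_process_def by (simp add: interval_covariance)
  then show ?thesis by blast
qed

lemma is_S_process_normal:
  assumes "is_S_process Z J r h N S"
  shows "prob_space N" "centered_normal N (S Z) (J * sqrt (limit_variance (indicator {0..Z})))"
proof -
  have Z': "Z \<in> {0..Z}" using Z by simp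
  have g: "gaussian_process N {0..Z} S" and mean: "(LINT v|N. S Z v) = 0"
    and cv: "(LINT v|N. S Z v * S Z v) = J\<^sup>2 * limit_covariance Z Z"
    using assms Z' interval_covariance[OF Z' Z'] by (auto simp: is_S_process_def centered_gaussian_process_def)
  show p: "prob_space N" using g by (simp add: gaussian_process_def)
  have "\<forall>F c. finite F \<and> F \<subseteq> {0..Z} \<longrightarrow> gaussian_rv N (\<lambda>v. \<Sum>i\<in>F. c i * S i v)"
    using g unfolding gaussian_process_def by (rule conjunct2)
  from this[rule_format, of "{Z}" "\<lambda>_. 1"] Z' have "gaussian_rv N (S Z)" by simp
  from gaussian_rv_imp_centered_normal[OF p this mean]
  have c: "centered_normal N (S Z) (sqrt (J\<^sup>2 * limit_variance (indicator {0..Z})))"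
    unfolding power2_eq_square[of "S Z v" for v] cv limit_covariance_def limit_variance_def .
  \<comment> \<open>J may be negative; only its square affects the law.\<close>
  have e: "(sqrt (J\<^sup>2 * limit_variance (indicator {0..Z})) * t)\<^sup>2 = (J * sqrt (limit_variance (indicator {0..Z})) * t)\<^sup>2" for t
    using limit_variance_nonneg by (simp add: power_mult_distrib)
  show "centered_normal N (S Z) (J * sqrt (limit_variance (indicator {0..Z})))"
    using c unfolding centered_normal_def e .
qed

end

section \<open>Reduction of V(Z) to its Gaussian part\<close>

context hermite_field
begin

text \<open>Subtracting the projection on the first Hermite polynomial leaves the mean at zero and
  makes the first coefficient vanish, so the limit variance for the remainder is multiplied by
  0.\<close>

lemma residual_field: "hermite_field M m lo hi r Z h (\<lambda>x. \<Psi> x - first_coeff * x)"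
  and residual_coefficient: "(LINT x|std_normal_distribution. (\<Psi> x - first_coeff * x) * x) = 0"
proof -
  interpret \<gamma>: prob_space std_normal_distribution by (rule prob_space_normal_density) simp
  note [measurable] = \<Psi>_measurable
  have [measurable]: "(\<lambda>x. x) \<in> borel_measurable std_normal_distribution" "\<Psi> \<in> borel_measurable std_normal_distribution" by simp_all
  have i1: "integrable std_normal_distribution \<Psi>" "integrable std_normal_distribution (\<lambda>x::real. x)"
    by (rule \<gamma>.integral_norm_le_sqrt(1)[OF _ sq], simp) (rule \<gamma>.integral_norm_le_sqrt(1)[OF _ id_L2(1)], simp)
  have i2: "integrable std_normal_distribution (\<lambda>x. \<Psi> x * x)" "integrable std_normal_distribution (\<lambda>x::real. x * x)"
    using sq id_L2(1) by (auto intro!: integrable_mult_of_squares)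
  have "integrable std_normal_distribution (\<lambda>x. (norm (\<Psi> x + - first_coeff * x))\<^sup>2)"
    using sq id_L2(1) by (intro integrable_square_add(1)) (auto simp: power_mult_distrib)
  then have sq': "integrable std_normal_distribution (\<lambda>x. (\<Psi> x - first_coeff * x)\<^sup>2)" by simp
  show "hermite_field M m lo hi r Z h (\<lambda>x. \<Psi> x - first_coeff * x)"
  proof unfold_locales
    show "continuous_on UNIV (\<lambda>x. \<Psi> x - first_coeff * x)" by (intro continuous_intros \<Psi>)
    show "(LINT x|std_normal_distribution. \<Psi> x - first_coeff * x) = 0" using i1 mean id_L2(3) by simp
  qed (rule sq')
  show "(LINT x|std_normal_distribution. (\<Psi> x - first_coeff * x) * x) = 0"
    using i2 id_L2(4) by (simp add: left_diff_distrib mult.assoc)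
qed

lemma path_V_square_integrable: "0 < \<epsilon> \<Longrightarrow> integrable M (\<lambda>w. (path_V \<epsilon> w Z)\<^sup>2)"
proof -
  assume \<epsilon>: "0 < \<epsilon>"
  have "integrable M (\<lambda>w. (Y (indicator {0..Z}) \<epsilon> w)\<^sup>2)"
    by (rule Y_second_moment(1)[OF \<epsilon>, where G=1 and a=0 and b=Z]) auto
  then show ?thesis
    by (rule Bochner_Integration.integrable_cong[OF refl, THEN iffD2, rotated]) (simp only: path_V_eq[OF \<epsilon>])
qed

lemma path_V_second_moment_bound: "\<exists>C. \<forall>\<epsilon>>0. (LINT w|M. (path_V \<epsilon> w Z)\<^sup>2) \<le> C"
proof -
  obtain C where C: "0 \<le> C" "\<And>\<epsilon> a b g. 0 < \<epsilon> \<Longrightarrow> 0 \<le> a \<Longrightarrow> a \<le> b \<Longrightarrow> b \<le> Z \<Longrightarrow> g \<in> borel_measurable borel \<Longrightarrow>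
     (\<And>u. \<bar>g u\<bar> \<le> indicator {a..b} u) \<Longrightarrow> (LINT w|M. (Y g \<epsilon> w)\<^sup>2) \<le> C * (b - a) powr (2 * lo)"
    using Y_moment_bound by blast
  show ?thesis
  proof (intro exI[of _ "C * (Z - 0) powr (2 * lo)"] allI impI)
    fix \<epsilon> :: real assume \<epsilon>: "0 < \<epsilon>"
    have "(LINT w|M. (path_V \<epsilon> w Z)\<^sup>2) = (LINT w|M. (Y (indicator {0..Z}) \<epsilon> w)\<^sup>2)"
      by (rule Bochner_Integration.integral_cong[OF refl]) (simp only: path_V_eq[OF \<epsilon>])
    moreover have "(LINT w|M. (Y (indicator {0..Z}) \<epsilon> w)\<^sup>2) \<le> C * (Z - 0) powr (2 * lo)"
      by (rule C(2)[OF \<epsilon>]) (use Z in auto)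
    ultimately show "(LINT w|M. (path_V \<epsilon> w Z)\<^sup>2) \<le> C * (Z - 0) powr (2 * lo)" by (simp only:)
  qed
qed

text \<open>Only the first Hermite coefficient survives: the remainder of \<open>\<Psi>\<close> has Hermite index at least
  two, and its integral vanishes in the mean square.\<close>
lemma path_V_minus_G:
  assumes \<epsilon>: "\<And>n. 0 < \<epsilon> n" "\<epsilon> \<longlonglongrightarrow> 0"
  shows "integrable M (\<lambda>w. \<bar>path_V (\<epsilon> n) w Z - first_coeff * G (\<epsilon> n) w\<bar>)"
    and "(\<lambda>n. LINT w|M. \<bar>path_V (\<epsilon> n) w Z - first_coeff * G (\<epsilon> n) w\<bar>) \<longlonglongrightarrow> 0"
proof -
  interpret R: hermite_field M m lo hi r Z h "\<lambda>x. \<Psi> x - first_coeff * x" by (rule residual_field)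
  let ?V = "\<lambda>n w. R.path_V (\<epsilon> n) w Z"
  have eq: "?V n w = path_V (\<epsilon> n) w Z - first_coeff * G (\<epsilon> n) w" if w: "w \<in> space M" for n w
  proof -
    have i: "(\<lambda>u. X \<Psi>' (\<epsilon> n) u w) integrable_on {0..Z}" if "continuous_on UNIV \<Psi>'" for \<Psi>'
      by (rule integrable_continuous_real[OF continuous_on_subset[OF X_cont[OF that \<epsilon>(1) w]]]) simp
    have "X (\<lambda>x. \<Psi> x - first_coeff * x) (\<epsilon> n) u w = X \<Psi> (\<epsilon> n) u w - first_coeff * X (\<lambda>x. x) (\<epsilon> n) u w" for u
      by (simp add: X_def algebra_simps)
    then have "?V n w = integral {0..Z} (\<lambda>u. X \<Psi> (\<epsilon> n) u w - first_coeff * X (\<lambda>x. x) (\<epsilon> n) u w)" by simp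
    also have "\<dots> = path_V (\<epsilon> n) w Z - integral {0..Z} (\<lambda>u. first_coeff * X (\<lambda>x. x) (\<epsilon> n) u w)"
      by (rule integral_diff[OF i[OF \<Psi>] integrable_on_mult_right[OF i[OF continuous_on_id]]])
    finally show ?thesis unfolding integral_mult_right G_eq_integral[OF \<epsilon>(1) w] .
  qed
  note L = integral_norm_le_sqrt[OF R.path_V_measurable[OF \<epsilon>(1)] R.path_V_square_integrable[OF \<epsilon>(1)]]
  have e: "(LINT w|M. \<bar>path_V (\<epsilon> n) w Z - first_coeff * G (\<epsilon> n) w\<bar>) = (LINT w|M. \<bar>?V n w\<bar>)" for n
    by (rule Bochner_Integration.integral_cong[OF refl]) (simp only: eq)
  have "integrable M (\<lambda>w. \<bar>?V n w\<bar>)" by (rule integrable_abs[OF L(1)])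
  then show "integrable M (\<lambda>w. \<bar>path_V (\<epsilon> n) w Z - first_coeff * G (\<epsilon> n) w\<bar>)"
    by (rule Bochner_Integration.integrable_cong[OF refl, THEN iffD1, rotated]) (simp only: eq)
  have "(\<lambda>n. LINT w|M. (R.Y (indicator {0..Z}) (\<epsilon> n) w)\<^sup>2) \<longlonglongrightarrow> 0"
    using R.Y_moment_tendsto[OF \<epsilon>, of "\<lambda>_. indicator {0..Z}" 1] by (simp add: residual_coefficient)
  moreover have "(LINT w|M. (R.Y (indicator {0..Z}) (\<epsilon> n) w)\<^sup>2) = (LINT w|M. (?V n w)\<^sup>2)" for n
    by (rule Bochner_Integration.integral_cong[OF refl]) (simp only: R.path_V_eq[OF \<epsilon>(1)])
  ultimately have "(\<lambda>n. LINT w|M. (?V n w)\<^sup>2) \<longlonglongrightarrow> 0" by simp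
  from tendsto_real_sqrt[OF this] have s: "(\<lambda>n. sqrt (LINT w|M. (?V n w)\<^sup>2)) \<longlonglongrightarrow> 0" by simp
  show "(\<lambda>n. LINT w|M. \<bar>path_V (\<epsilon> n) w Z - first_coeff * G (\<epsilon> n) w\<bar>) \<longlonglongrightarrow> 0"
    unfolding e by (rule tendsto_sandwich[OF _ _ tendsto_const s]) (use L(2) in auto)
qed

text \<open>For the Gaussian part the expectation is an integral against the standard normal law
  with a converging scale factor, so dominated convergence suffices. The non-Gaussian part is
  removed by \<open>converging_together\<close> with the identity as F.\<close>

lemma path_V_weak_limit:
  fixes \<psi> :: "real \<Rightarrow> real"
  assumes \<epsilon>: "\<And>n. 0 < \<epsilon> n" "\<epsilon> \<longlonglongrightarrow> 0" and \<psi>: "continuous_on UNIV \<psi>" and B: "\<And>x. \<bar>\<psi> x\<bar> \<le> B"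
  shows "(\<lambda>n. LINT w|M. \<psi> (path_V (\<epsilon> n) w Z)) \<longlonglongrightarrow>
    (LINT x|std_normal_distribution. \<psi> (first_coeff * sqrt (limit_variance (indicator {0..Z})) * x))"
proof -
  interpret \<gamma>: prob_space std_normal_distribution by (rule prob_space_normal_density) simp
  have m[measurable]: "\<psi> \<in> borel_measurable borel" by (rule borel_measurable_continuous_onI[OF \<psi>])
  let ?v = "\<lambda>n. LINT w|M. (G (\<epsilon> n) w)\<^sup>2"
  have v: "?v \<longlonglongrightarrow> limit_variance (indicator {0..Z})" by (rule G_second_moment(3)[OF \<epsilon>])
  obtain C where C: "\<And>n. ?v n \<le> C"
    using convergent_imp_Bseq[OF convergentI[OF v]] unfolding Bseq_def by (auto simp: abs_le_iff)
  have n: "centered_normal M (\<lambda>w. first_coeff * G (\<epsilon> n) w) (first_coeff * sqrt (?v n))" for n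
    by (rule centered_normal_scale[OF G_centered_normal[OF \<epsilon>(1)]])
  have "(\<lambda>n. LINT x|std_normal_distribution. \<psi> (first_coeff * sqrt (?v n) * x)) \<longlonglongrightarrow>
      (LINT x|std_normal_distribution. \<psi> (first_coeff * sqrt (limit_variance (indicator {0..Z})) * x))"
  proof (rule integral_dominated_convergence[where w="\<lambda>_. B"])
    show "AE x in std_normal_distribution. (\<lambda>n. \<psi> (first_coeff * sqrt (?v n) * x)) \<longlonglongrightarrow> \<psi> (first_coeff * sqrt (limit_variance (indicator {0..Z})) * x)"
    proof (rule AE_I2)
      fix x :: real
      have "isCont \<psi> y" for y using \<psi> by (simp add: continuous_on_eq_continuous_at)
      then show "(\<lambda>n. \<psi> (first_coeff * sqrt (?v n) * x)) \<longlonglongrightarrow> \<psi> (first_coeff * sqrt (limit_variance (indicator {0..Z})) * x)"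
        by (rule isCont_tendsto_compose) (intro tendsto_intros v)
    qed
  qed (use B in auto)
  then have lim: "(\<lambda>n. LINT w|M. \<psi> (first_coeff * G (\<epsilon> n) w)) \<longlonglongrightarrow>
      (LINT x|std_normal_distribution. \<psi> (first_coeff * sqrt (limit_variance (indicator {0..Z})) * x))"
    unfolding centered_normal_integral(1)[OF prob_space_axioms n m] .
  note pm = path_V_measurable[OF \<epsilon>(1)]
  have "(\<lambda>n. (LINT w|M. \<psi> (path_V (\<epsilon> n) w Z)) - (LINT w|M. \<psi> (first_coeff * G (\<epsilon> n) w))) \<longlonglongrightarrow> 0"
  proof (rule converging_together[where F="\<lambda>x. x" and X="\<lambda>n w. path_V (\<epsilon> n) w Z" and V="\<lambda>n w. first_coeff * G (\<epsilon> n) w"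
        and D="\<lambda>n w. \<bar>path_V (\<epsilon> n) w Z - first_coeff * G (\<epsilon> n) w\<bar>" and C="first_coeff\<^sup>2 * C" and \<phi>=\<psi> and B=B])
    show "(\<lambda>w. \<psi> (path_V (\<epsilon> n) w Z)) \<in> borel_measurable M" for n by (rule measurable_compose[OF pm m])
    show "(\<lambda>w. first_coeff * G (\<epsilon> n) w) \<in> borel_measurable M" for n
      using G_second_moment(1)[OF \<epsilon>(1)] by (rule borel_measurable_times[OF borel_measurable_const])
    show "integrable M (\<lambda>w. (first_coeff * G (\<epsilon> n) w)\<^sup>2)" for n
      unfolding power_mult_distrib by (rule integrable_mult_right[OF G_second_moment(2)[OF \<epsilon>(1)]])
    show "(LINT w|M. (first_coeff * G (\<epsilon> n) w)\<^sup>2) \<le> first_coeff\<^sup>2 * C" for n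
      unfolding power_mult_distrib integral_mult_right_zero by (rule mult_left_mono[OF C]) simp
  qed (use \<psi> B path_V_minus_G[OF \<epsilon>] in \<open>auto simp: dist_real_def continuous_on_id\<close>)
  from tendsto_add[OF this lim] show ?thesis by simp
qed

end

lemma is_propagator_two_mode_system:
  assumes P: "is_propagator Z \<tau> \<epsilon> \<nu> \<omega> P" and \<nu>: "continuous_on {0..Z} \<nu>" and Z: "0 < Z"
  shows "two_mode_system Z \<omega> (2 * \<omega> / \<epsilon> powr \<tau>) \<nu> (\<lambda>z. P z $ 1 $ 1) (\<lambda>z. P z $ 2 $ 1)"
proof -
  have entry: "map_matrix (\<lambda>c. k * c) ((vector [vector [1, - x], vector [y, - 1]] :: complex^2^2) ** A) $ 1 $ 1 = k * (A $ 1 $ 1 - x * A $ 2 $ 1)"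
    "map_matrix (\<lambda>c. k * c) ((vector [vector [1, - x], vector [y, - 1]] :: complex^2^2) ** A) $ 2 $ 1 = k * (y * A $ 1 $ 1 - A $ 2 $ 1)"
    for k x y :: complex and A :: "complex^2^2"
    by (simp_all add: map_matrix_def matrix_matrix_mult_def sum_2)
  have bl: "bounded_linear (\<lambda>A::complex^2^2. A $ i $ j)" for i j
    by (rule bounded_linear_compose[OF bounded_linear_vec_nth bounded_linear_vec_nth])
  have d: "((\<lambda>z. P z $ i $ j) has_vector_derivative
       map_matrix (\<lambda>c. \<i> * complex_of_real \<omega> / 2 * complex_of_real (\<nu> z) * c) (oscillation_matrix \<tau> \<epsilon> \<omega> z ** P z) $ i $ j)
     (at z within {0..Z})" if "z \<in> {0..Z}" for i j z
    using bounded_linear.has_vector_derivative[OF bl] P that unfolding is_propagator_def by blast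
  have o: "oscillation_matrix \<tau> \<epsilon> \<omega> z = vector [vector [1, - iexp (- (2 * \<omega> / \<epsilon> powr \<tau> * z))],
      vector [iexp (2 * \<omega> / \<epsilon> powr \<tau> * z), - 1]]" for z
    unfolding oscillation_matrix_def times_divide_eq_left ..
  show ?thesis
  proof unfold_locales
    show "((\<lambda>z. P z $ 1 $ 1) has_vector_derivative \<i> * \<omega> / 2 * \<nu> x *
        (P x $ 1 $ 1 - iexp (- (2 * \<omega> / \<epsilon> powr \<tau> * x)) * P x $ 2 $ 1)) (at x within {0..Z})" if "x \<in> {0..Z}" for x
      using d[OF that, of 1 1] unfolding o entry .
    show "((\<lambda>z. P z $ 2 $ 1) has_vector_derivative \<i> * \<omega> / 2 * \<nu> x *
        (iexp (2 * \<omega> / \<epsilon> powr \<tau> * x) * P x $ 1 $ 1 - P x $ 2 $ 1)) (at x within {0..Z})" if "x \<in> {0..Z}" for x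
      using d[OF that, of 2 1] unfolding o entry .
    show "P 0 $ 1 $ 1 = 1" "P 0 $ 2 $ 1 = 0" using P by (auto simp: is_propagator_def mat_def)
  qed (use Z \<nu> in auto)
qed

section \<open>Convergence of the transmitted wave\<close>

lemma is_propagator_cong:
  assumes "\<And>z. z \<in> {0..Z} \<Longrightarrow> \<nu> z = \<nu>' z"
  shows "is_propagator Z \<tau> \<epsilon> \<nu> \<omega> P = is_propagator Z \<tau> \<epsilon> \<nu>' \<omega> P"
  unfolding is_propagator_def by (intro arg_cong2[where f="(\<and>)"] refl ball_cong) (simp only: assms)

locale transmission_problem = hermite_field M m lo hi r Z h \<Phi>
  for M :: "'w measure" and m lo hi r Z h \<Phi> +
  fixes \<tau> :: real and f :: "real \<Rightarrow> real" and P :: "real \<Rightarrow> 'w \<Rightarrow> real \<Rightarrow> real \<Rightarrow> complex^2^2"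
  assumes \<tau>: "0 < \<tau>" and f_cont: "continuous_on UNIV f" and f_int: "integrable lborel f"
    and ff_int: "integrable lborel (fourier f)"
    and P: "\<And>\<epsilon> w \<omega>. 0 < \<epsilon> \<Longrightarrow> w \<in> space M \<Longrightarrow> is_propagator Z \<tau> \<epsilon> (\<lambda>z. X \<Phi> \<epsilon> z w) \<omega> (P \<epsilon> w \<omega>)"
begin

text \<open>The bounded extension \<open>inv_cnj\<close> gives modulus at most 1 without side
  conditions on \<epsilon> and w; for admissible ones it is the true coefficient.\<close>

definition transmission :: "real \<Rightarrow> 'w \<Rightarrow> real \<Rightarrow> complex" where
  "transmission \<epsilon> w \<omega> = inv_cnj (P \<epsilon> w \<omega> Z $ 1 $ 1)"

lemma norm_Tr: "norm (transmission \<epsilon> w \<omega>) \<le> 1"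
  unfolding transmission_def by (rule norm_inv_cnj_le)

lemma two_mode:
  assumes "0 < \<epsilon>" "w \<in> space M"
  shows "two_mode_system Z \<omega> (2 * \<omega> / \<epsilon> powr \<tau>) (\<lambda>z. X \<Phi> \<epsilon> z w) (\<lambda>z. P \<epsilon> w \<omega> z $ 1 $ 1) (\<lambda>z. P \<epsilon> w \<omega> z $ 2 $ 1)"
  by (rule is_propagator_two_mode_system[OF P[OF assms] continuous_on_subset[OF X_cont[OF \<Psi> assms]] Z]) simp

lemma transmission_eq:
  assumes "0 < \<epsilon>" "w \<in> space M"
  shows "transmission \<epsilon> w \<omega> = 1 / cnj (P \<epsilon> w \<omega> Z $ 1 $ 1)"
proof -
  interpret S: two_mode_system Z \<omega> "2 * \<omega> / \<epsilon> powr \<tau>" "\<lambda>z. X \<Phi> \<epsilon> z w" "\<lambda>z. P \<epsilon> w \<omega> z $ 1 $ 1" "\<lambda>z. P \<epsilon> w \<omega> z $ 2 $ 1"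
    by (rule two_mode[OF assms])
  show ?thesis unfolding transmission_def by (rule inv_cnj_eq[OF S.norm_\<alpha>_ge_1])
qed

lemma transmission_close:
  assumes \<epsilon>: "0 < \<epsilon>" and w: "w \<in> space M"
    and K: "dyadic_bound Z dyadic_ratio K (path_V \<epsilon> w)" and \<delta>: "dyadic_bound Z dyadic_ratio \<delta> (path_W (2 * \<omega> / \<epsilon> powr \<tau>) \<epsilon> w)"
    and B: "B = \<bar>\<omega>\<bar> / 2 * (\<delta> * (1 + \<bar>\<omega>\<bar> * K / (1 - dyadic_ratio)))" and small: "4 * B / (1 - dyadic_ratio) \<le> 1"
  shows "norm (transmission \<epsilon> w \<omega> - iexp (\<omega> / 2 * path_V \<epsilon> w Z)) \<le> B"
proof -
  interpret S: two_mode_system Z \<omega> "2 * \<omega> / \<epsilon> powr \<tau>" "\<lambda>z. X \<Phi> \<epsilon> z w" "\<lambda>z. P \<epsilon> w \<omega> z $ 1 $ 1" "\<lambda>z. P \<epsilon> w \<omega> z $ 2 $ 1"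
    by (rule two_mode[OF \<epsilon> w])
  show ?thesis
    using S.close[OF dyadic_ratio(3,1,2) K[folded S.V_def[abs_def]] \<delta>[folded S.W_def[abs_def]] B small]
    unfolding transmission_eq[OF \<epsilon> w] S.V_def .
qed

abbreviation "transmission_approx \<epsilon> n \<omega> y \<equiv> inv_cnj (mode_euler Z \<omega> (2 * \<omega> / \<epsilon> powr \<tau>) n y)"
abbreviation "samples \<epsilon> n w k \<equiv> X \<Phi> \<epsilon> (Z * real k / real (Suc n)) w"

lemma inv_cnj_measurable[measurable]: "inv_cnj \<in> borel_measurable borel"
  by (rule borel_measurable_continuous_onI[OF inv_cnj_continuous])

lemma transmission_approx_tendsto:
  assumes "0 < \<epsilon>" "w \<in> space M"
  shows "(\<lambda>n. transmission_approx \<epsilon> n \<omega> (samples \<epsilon> n w)) \<longlonglongrightarrow> transmission \<epsilon> w \<omega>"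
proof -
  interpret S: two_mode_system Z \<omega> "2 * \<omega> / \<epsilon> powr \<tau>" "\<lambda>z. X \<Phi> \<epsilon> z w" "\<lambda>z. P \<epsilon> w \<omega> z $ 1 $ 1" "\<lambda>z. P \<epsilon> w \<omega> z $ 2 $ 1"
    by (rule two_mode[OF assms])
  have "isCont inv_cnj y" for y using inv_cnj_continuous by (simp add: continuous_on_eq_continuous_at)
  from isCont_tendsto_compose[OF this S.mode_euler_tendsto] show ?thesis unfolding transmission_def .
qed

text \<open>P is given separately for each path and frequency. Its joint measurability, which
  Fubini's theorem requires, is inherited from the Euler schemes, as these converge to the given
  solution.\<close>

lemma transmission_joint:
  assumes \<epsilon>: "0 < \<epsilon>"
  shows "(\<lambda>x. transmission \<epsilon> (fst x) (snd x)) \<in> borel_measurable (M \<Otimes>\<^sub>M lborel)"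
proof (rule borel_measurable_LIMSEQ_metric)
  fix n
  have "(\<lambda>x. mode_euler Z (snd x) (2 * snd x / \<epsilon> powr \<tau>) n (\<lambda>k. samples \<epsilon> n (fst x) k)) \<in> borel_measurable (M \<Otimes>\<^sub>M lborel)"
  proof (rule mode_euler_measurable)
    show "(\<lambda>x. samples \<epsilon> n (fst x) k) \<in> borel_measurable (M \<Otimes>\<^sub>M lborel)" for k
      by (rule measurable_compose[OF measurable_fst X_measurable[OF \<Psi>]])
  qed measurable
  from measurable_compose[OF this inv_cnj_measurable]
  show "(\<lambda>x. transmission_approx \<epsilon> n (snd x) (samples \<epsilon> n (fst x))) \<in> borel_measurable (M \<Otimes>\<^sub>M lborel)" .
next
  fix x assume "x \<in> space (M \<Otimes>\<^sub>M (lborel :: real measure))"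
  then have "fst x \<in> space M" by (auto simp: space_pair_measure)
  then show "(\<lambda>n. transmission_approx \<epsilon> n (snd x) (samples \<epsilon> n (fst x))) \<longlonglongrightarrow> transmission \<epsilon> (fst x) (snd x)"
    by (rule transmission_approx_tendsto[OF \<epsilon>])
qed

lemma transmission_approx_measurable: "(\<lambda>\<omega>. transmission_approx \<epsilon> n \<omega> y) \<in> borel_measurable borel"
proof -
  have "(\<lambda>\<omega>. mode_euler Z \<omega> (2 * \<omega> / \<epsilon> powr \<tau>) n (\<lambda>k. y k)) \<in> borel_measurable borel"
    by (rule mode_euler_measurable) measurable
  from measurable_compose[OF this inv_cnj_measurable] show ?thesis .
qed

lemma transmission_measurable:
  assumes "0 < \<epsilon>" "w \<in> space M"
  shows "transmission \<epsilon> w \<in> borel_measurable borel"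
  by (rule borel_measurable_LIMSEQ_metric[OF transmission_approx_measurable transmission_approx_tendsto[OF assms]])

lemma transmission_measurable_w: "0 < \<epsilon> \<Longrightarrow> (\<lambda>w. transmission \<epsilon> w \<omega>) \<in> borel_measurable M"
  using measurable_compose[OF _ transmission_joint, of "\<lambda>w. (w, \<omega>)" M \<epsilon>] by simp

definition Wave :: "(real \<Rightarrow> complex) \<Rightarrow> real \<Rightarrow>\<^sub>C complex" where
  "Wave u = (1 / (2 * pi)) *\<^sub>R fourier_bcf (fourier f) u"

abbreviation "shifted c \<equiv> Wave (\<lambda>\<omega>. iexp (c * \<omega>))"

lemma iexp_measurable[measurable]: "(\<lambda>\<omega>. iexp (c * \<omega>)) \<in> borel_measurable borel"
  by measurable

lemma transmitted_wave_eq: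
  assumes "0 < \<epsilon>" "w \<in> space M"
  shows "transmitted_wave f (P \<epsilon> w) Z = apply_bcontfun (Wave (transmission \<epsilon> w))"
proof
  fix s
  have "apply_bcontfun (Wave (transmission \<epsilon> w)) s =
      1 / (2 * pi) * (LINT \<omega>|lborel. iexp (- (s * \<omega>)) * transmission \<epsilon> w \<omega> * fourier f \<omega>)"
    unfolding Wave_def using apply_fourier_bcf[OF ff_int transmission_measurable[OF assms] norm_Tr, of s]
    by (simp add: scaleR_conv_of_real)
  then show "transmitted_wave f (P \<epsilon> w) Z s = apply_bcontfun (Wave (transmission \<epsilon> w)) s"
    unfolding transmitted_wave_def transmission_coeff_def transmission_eq[OF assms] by (simp only:)
qed

text \<open>A translation of f by c multiplies its transform by exp (i c \<omega>); the rest is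
  Fourier inversion.\<close>

lemma shifted_eq: "(\<lambda>s. complex_of_real (f (s - c))) = apply_bcontfun (shifted c)"
proof
  fix s
  have n: "norm (iexp (c * \<omega>)) \<le> 1" for \<omega> by simp
  have e: "iexp (- ((s - c) * \<omega>)) = iexp (- (s * \<omega>)) * iexp (c * \<omega>)" for \<omega>
    unfolding exp_add[symmetric] by (simp add: algebra_simps)
  have "apply_bcontfun (shifted c) s = 1 / (2 * pi) * (LINT \<omega>|lborel. iexp (- (s * \<omega>)) * iexp (c * \<omega>) * fourier f \<omega>)"
    unfolding Wave_def using apply_fourier_bcf[OF ff_int iexp_measurable n, of s]
    by (simp add: scaleR_conv_of_real)
  also have "\<dots> = complex_of_real (f (s - c))"
    unfolding fourier_inversion[OF f_cont f_int ff_int] e ..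
  finally show "complex_of_real (f (s - c)) = apply_bcontfun (shifted c) s" ..
qed

text \<open>Translation of f is continuous in the uniform norm because the multipliers converge
  pointwise and the transform is integrable.\<close>

lemma shifted_continuous: "continuous_on UNIV shifted"
  unfolding continuous_on_sequentially
proof (intro ballI allI impI)
  fix x and a :: real assume x: "(\<forall>n. x n \<in> UNIV) \<and> x \<longlonglongrightarrow> a"
  have "(\<lambda>n. fourier_bcf (fourier f) (\<lambda>\<omega>. iexp (x n * \<omega>))) \<longlonglongrightarrow> fourier_bcf (fourier f) (\<lambda>\<omega>. iexp (a * \<omega>))"
  proof (rule fourier_bcf_tendsto[OF ff_int iexp_measurable])
    show "norm (iexp (x n * \<omega>)) \<le> 1" for n \<omega> by simp
    show "(\<lambda>n. iexp (x n * \<omega>)) \<longlonglongrightarrow> iexp (a * \<omega>)" for \<omega> using x by (intro tendsto_intros) auto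
  qed
  then show "(shifted \<circ> x) \<longlonglongrightarrow> shifted a" unfolding o_def Wave_def by (intro tendsto_intros)
qed

lemma Wave_Tr_measurable:
  assumes \<epsilon>: "0 < \<epsilon>"
  shows "(\<lambda>w. Wave (transmission \<epsilon> w)) \<in> borel_measurable M"
proof -
  have "(\<lambda>w. fourier_bcf (fourier f) (transmission \<epsilon> w)) \<in> borel_measurable M"
  proof (rule fourier_bcf_measurable[OF ff_int, where t="\<lambda>n \<omega> y. transmission_approx \<epsilon> n \<omega> y" and y="samples \<epsilon>" and C=1])
    show "continuous_on UNIV (\<lambda>y. transmission_approx \<epsilon> n \<omega> y)" for n \<omega>
      by (rule continuous_on_compose2[OF inv_cnj_continuous mode_euler_continuous]) simp
  qed (use transmission_approx_measurable norm_inv_cnj_le X_measurable[OF \<Psi>] transmission_approx_tendsto[OF \<epsilon>] in auto)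
  moreover have "continuous_on UNIV (\<lambda>x :: real \<Rightarrow>\<^sub>C complex. (1 / (2 * pi)) *\<^sub>R x)" by (intro continuous_intros)
  ultimately show ?thesis
    unfolding Wave_def using measurable_compose borel_measurable_continuous_onI by blast
qed

text \<open>A measurable majorant of the distance between the wave and the translated source, in a
  form whose expectation is accessible to Fubini's theorem.\<close>

definition deviation :: "real \<Rightarrow> 'w \<Rightarrow> real" where
  "deviation \<epsilon> w = 1 / (2 * pi) * (LINT \<omega>|lborel. norm (transmission \<epsilon> w \<omega> - iexp (\<omega> / 2 * path_V \<epsilon> w Z)) * norm (fourier f \<omega>))"

lemma dist_Wave_le:
  assumes "0 < \<epsilon>" "w \<in> space M"
  shows "dist (Wave (transmission \<epsilon> w)) (shifted (path_V \<epsilon> w Z / 2)) \<le> deviation \<epsilon> w"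
proof -
  let ?v = "path_V \<epsilon> w Z"
  have n: "norm (iexp (?v / 2 * \<omega>)) \<le> 1" for \<omega> by simp
  have "dist (Wave (transmission \<epsilon> w)) (shifted (?v / 2)) =
      1 / (2 * pi) * dist (fourier_bcf (fourier f) (transmission \<epsilon> w)) (fourier_bcf (fourier f) (\<lambda>\<omega>. iexp (?v / 2 * \<omega>)))"
    unfolding Wave_def dist_norm scaleR_right_diff_distrib[symmetric] norm_scaleR by simp
  also have "\<dots> \<le> 1 / (2 * pi) * (LINT \<omega>|lborel. norm (transmission \<epsilon> w \<omega> - iexp (?v / 2 * \<omega>)) * norm (fourier f \<omega>))"
    by (rule mult_left_mono[OF dist_fourier_bcf_le[OF ff_int transmission_measurable[OF assms] norm_Tr iexp_measurable n]]) simp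
  finally have d: "dist (Wave (transmission \<epsilon> w)) (shifted (?v / 2)) \<le>
      1 / (2 * pi) * (LINT \<omega>|lborel. norm (transmission \<epsilon> w \<omega> - iexp (?v / 2 * \<omega>)) * norm (fourier f \<omega>))" .
  have e: "?v / 2 * \<omega> = \<omega> / 2 * ?v" for \<omega> by simp
  show ?thesis using d unfolding deviation_def e .
qed

lemma norm_difference_le_2: "norm (transmission \<epsilon> w \<omega> - iexp x) \<le> 2"
  using norm_triangle_ineq4[of "transmission \<epsilon> w \<omega>" "iexp x"] norm_Tr[of \<epsilon> w \<omega>] norm_exp_i_times[of x] by linarith

lemma deviation_L1:
  assumes \<epsilon>: "\<And>n. 0 < \<epsilon> n" "\<epsilon> \<longlonglongrightarrow> 0"
  shows "integrable M (deviation (\<epsilon> n))" and "(\<lambda>n. LINT w|M. deviation (\<epsilon> n) w) \<longlonglongrightarrow> 0"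
proof -
  interpret P2: pair_sigma_finite M "lborel :: real measure" ..
  let ?g = "\<lambda>n w \<omega>. norm (transmission (\<epsilon> n) w \<omega> - iexp (\<omega> / 2 * path_V (\<epsilon> n) w Z))"
  let ?F = "\<lambda>\<omega>. norm (fourier f \<omega>)"
  have [measurable]: "fourier f \<in> borel_measurable borel" by (rule fourier_measurable[OF f_int])
  have F: "integrable lborel ?F" by (rule integrable_norm[OF ff_int])
  have gm[measurable]: "(\<lambda>(w, \<omega>). ?g n w \<omega> * ?F \<omega>) \<in> borel_measurable (M \<Otimes>\<^sub>M lborel)" for n
  proof -
    note [measurable] = transmission_joint[OF \<epsilon>(1)]
    have [measurable]: "(\<lambda>x. path_V (\<epsilon> n) (fst x) Z) \<in> borel_measurable (M \<Otimes>\<^sub>M (lborel :: real measure))"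
      by (rule measurable_compose[OF measurable_fst path_V_measurable[OF \<epsilon>(1)]])
    show ?thesis unfolding case_prod_unfold by measurable
  qed
  have le: "?g n w \<omega> * ?F \<omega> \<le> 2 * ?F \<omega>" for n w \<omega>
    by (rule mult_right_mono[OF norm_difference_le_2]) simp
  have gw: "(\<lambda>\<omega>. ?g n w \<omega> * ?F \<omega>) \<in> borel_measurable lborel" if "w \<in> space M" for n w
    using measurable_compose[OF measurable_Pair1'[OF that] gm] by simp
  have ig: "integrable lborel (\<lambda>\<omega>. ?g n w \<omega> * ?F \<omega>)" if "w \<in> space M" for n w
    by (rule Bochner_Integration.integrable_bound[OF integrable_mult_right[OF F, of 2] gw[OF that]])
       (use le in \<open>auto simp: abs_mult\<close>)
  have int: "integrable (M \<Otimes>\<^sub>M lborel) (\<lambda>(w, \<omega>). ?g n w \<omega> * ?F \<omega>)" for n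
  proof (rule P2.Fubini_integrable[OF gm])
    show "AE w in M. integrable lborel (\<lambda>\<omega>. case (w, \<omega>) of (w, \<omega>) \<Rightarrow> ?g n w \<omega> * ?F \<omega>)"
      unfolding prod.case by (rule AE_I2[OF ig])
    show "integrable M (\<lambda>w. LINT \<omega>|lborel. norm (case (w, \<omega>) of (w, \<omega>) \<Rightarrow> ?g n w \<omega> * ?F \<omega>))"
    proof (rule integrable_const_bound[of _ "LINT \<omega>|lborel. 2 * ?F \<omega>"])
      show "AE w in M. norm (LINT \<omega>|lborel. norm (case (w, \<omega>) of (w, \<omega>) \<Rightarrow> ?g n w \<omega> * ?F \<omega>)) \<le> (LINT \<omega>|lborel. 2 * ?F \<omega>)"
      proof (rule AE_I2)
        fix w assume w: "w \<in> space M"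
        have "(LINT \<omega>|lborel. ?g n w \<omega> * ?F \<omega>) \<le> (LINT \<omega>|lborel. 2 * ?F \<omega>)"
          by (rule integral_mono[OF ig[OF w] integrable_mult_right[OF F] le])
        then show "norm (LINT \<omega>|lborel. norm (case (w, \<omega>) of (w, \<omega>) \<Rightarrow> ?g n w \<omega> * ?F \<omega>)) \<le> (LINT \<omega>|lborel. 2 * ?F \<omega>)"
          by (simp add: abs_mult)
      qed
      have nn: "norm (?g n w \<omega> * ?F \<omega>) = ?g n w \<omega> * ?F \<omega>" for n w \<omega> by simp
      show "(\<lambda>w. LINT \<omega>|lborel. norm (case (w, \<omega>) of (w, \<omega>) \<Rightarrow> ?g n w \<omega> * ?F \<omega>)) \<in> borel_measurable M"
        unfolding prod.case nn by (rule lborel.borel_measurable_lebesgue_integral[OF gm])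
    qed
  qed
  show "integrable M (deviation (\<epsilon> n))"
    unfolding deviation_def[abs_def] using P2.integrable_fst[OF int] by (rule integrable_mult_right)
  have E: "(LINT w|M. deviation (\<epsilon> n) w) = 1 / (2 * pi) * (LINT \<omega>|lborel. (LINT w|M. ?g n w \<omega>) * ?F \<omega>)" for n
    unfolding deviation_def integral_mult_right_zero P2.Fubini_integral[OF int, symmetric] by simp
  have "(\<lambda>n. LINT \<omega>|lborel. (LINT w|M. ?g n w \<omega>) * ?F \<omega>) \<longlonglongrightarrow> (LINT \<omega>|(lborel :: real measure). 0)"
  proof (rule integral_dominated_convergence[where w="\<lambda>\<omega>. 2 * ?F \<omega>"])
    show "integrable lborel (\<lambda>\<omega>. 2 * ?F \<omega>)" using F by simp
    show "(\<lambda>\<omega>. (LINT w|M. ?g n w \<omega>) * ?F \<omega>) \<in> borel_measurable lborel" for n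
      using borel_measurable_integrable[OF P2.integrable_snd[OF int[of n]]] by simp
    show "AE \<omega> in lborel. norm ((LINT w|M. ?g n w \<omega>) * ?F \<omega>) \<le> 2 * ?F \<omega>" for n
    proof (rule AE_I2)
      fix \<omega> :: real
      have m: "?g n w \<omega> \<le> 2" for w by (rule norm_difference_le_2)
      have "(LINT w|M. ?g n w \<omega>) \<le> (LINT w|M. 2)"
      proof (rule integral_mono)
        note [measurable] = transmission_measurable_w[OF \<epsilon>(1)] path_V_measurable[OF \<epsilon>(1)]
        show "integrable M (\<lambda>w. ?g n w \<omega>)"
          by (rule integrable_const_bound[of _ 2]) (use m in auto)
      qed (use m in auto)
      then have "(LINT w|M. ?g n w \<omega>) \<le> 2" by (simp add: prob_space)
      then show "norm ((LINT w|M. ?g n w \<omega>) * ?F \<omega>) \<le> 2 * ?F \<omega>"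
        by (simp add: abs_mult mult_right_mono)
    qed
    \<comment> \<open>At \<omega> = 0 the phase does not oscillate and the Riemann-Lebesgue lemma
      says nothing; this single frequency is a null set.\<close>
    have "AE \<omega> in lborel. \<omega> \<noteq> (0::real)" by (rule AE_lborel_singleton)
    then show "AE \<omega> in lborel. (\<lambda>n. (LINT w|M. ?g n w \<omega>) * ?F \<omega>) \<longlonglongrightarrow> 0"
    proof eventually_elim
      case (elim \<omega>)
      have "(\<lambda>n. \<epsilon> n powr \<tau>) \<longlonglongrightarrow> 0"
        by (rule tendsto_zero_powrI[OF \<epsilon>(2) tendsto_const]) (use \<tau> in \<open>auto intro!: always_eventually less_imp_le[OF \<epsilon>(1)]\<close>)
      moreover have "\<epsilon> n powr \<tau> \<noteq> 0" for n using \<epsilon>(1)[of n] by simp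
      ultimately have "filterlim (\<lambda>n. \<epsilon> n powr \<tau>) (at 0) sequentially" by (intro filterlim_atI) auto
      then have "filterlim (\<lambda>n. inverse (\<epsilon> n powr \<tau>)) at_infinity sequentially"
        by (rule filterlim_compose[OF filterlim_inverse_at_infinity])
      then have \<mu>: "filterlim (\<lambda>n. 2 * \<omega> / \<epsilon> n powr \<tau>) at_infinity sequentially"
        unfolding divide_inverse by (rule tendsto_mult_filterlim_at_infinity[OF tendsto_const, rotated]) (use elim in simp)
      have "(\<lambda>n. LINT w|M. ?g n w \<omega>) \<longlonglongrightarrow> 0"
        by (rule path_approximation_L1[where T="\<lambda>n w. transmission (\<epsilon> n) w \<omega>", OF \<epsilon> \<mu> transmission_measurable_w[OF \<epsilon>(1)] norm_Tr transmission_close[OF \<epsilon>(1)]])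
      then show ?case by (rule tendsto_mult_left_zero)
    qed
  qed simp
  from tendsto_mult_right_zero[OF this[unfolded Bochner_Integration.integral_zero], of "1 / (2 * pi)"]
  show "(\<lambda>n. LINT w|M. deviation (\<epsilon> n) w) \<longlonglongrightarrow> 0" unfolding E .
qed

text \<open>The wave is first replaced by the translate of f by V(Z) / 2. Composed with the
  continuous translation map, a test function becomes a function of one real variable, for which
  only the law of V(Z) counts.\<close>

lemma Wave_weak_limit:
  fixes \<phi> :: "(real \<Rightarrow>\<^sub>C complex) \<Rightarrow> real"
  assumes \<epsilon>: "\<And>n. 0 < \<epsilon> n" "\<epsilon> \<longlonglongrightarrow> 0" and \<phi>: "continuous_on UNIV \<phi>" and B: "\<And>x. \<bar>\<phi> x\<bar> \<le> B"
    and S: "is_S_process Z first_coeff r h N S"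
  shows "(\<lambda>n. LINT w|M. \<phi> (Wave (transmission (\<epsilon> n) w))) \<longlonglongrightarrow> (LINT v|N. \<phi> (shifted (S Z v / 2)))"
proof -
  let ?F = "\<lambda>v. shifted (v / 2)"
  have F: "continuous_on UNIV ?F"
    by (rule continuous_on_compose2[OF shifted_continuous]) (auto intro!: continuous_intros)
  have \<psi>: "continuous_on UNIV (\<lambda>v. \<phi> (?F v))" using continuous_on_compose2[OF \<phi> F] by simp
  have \<phi>m: "\<phi> \<in> borel_measurable borel" by (rule borel_measurable_continuous_onI[OF \<phi>])
  obtain C where C: "\<forall>\<epsilon>>0. (LINT w|M. (path_V \<epsilon> w Z)\<^sup>2) \<le> C"
    using path_V_second_moment_bound ..
  have 1: "(\<lambda>n. (LINT w|M. \<phi> (Wave (transmission (\<epsilon> n) w))) - (LINT w|M. \<phi> (?F (path_V (\<epsilon> n) w Z)))) \<longlonglongrightarrow> 0"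
    by (rule converging_together[where F="?F" and X="\<lambda>n w. Wave (transmission (\<epsilon> n) w)" and V="\<lambda>n w. path_V (\<epsilon> n) w Z"
          and D="\<lambda>n. deviation (\<epsilon> n)" and C=C and \<phi>=\<phi> and B=B,
        OF F \<phi> B measurable_compose[OF Wave_Tr_measurable[OF \<epsilon>(1)] \<phi>m] path_V_measurable[OF \<epsilon>(1)]
          path_V_square_integrable[OF \<epsilon>(1)] C[rule_format, OF \<epsilon>(1)] deviation_L1(1)[OF \<epsilon>] dist_Wave_le[OF \<epsilon>(1)] deviation_L1(2)[OF \<epsilon>]])
  have 2: "(\<lambda>n. LINT w|M. \<phi> (?F (path_V (\<epsilon> n) w Z))) \<longlonglongrightarrow>
      (LINT x|std_normal_distribution. \<phi> (?F (first_coeff * sqrt (limit_variance (indicator {0..Z})) * x)))"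
    by (rule path_V_weak_limit[where \<psi>="\<lambda>v. \<phi> (?F v)", OF \<epsilon> \<psi> B])
  have 3: "(LINT v|N. \<phi> (?F (S Z v))) = (LINT x|std_normal_distribution. \<phi> (?F (first_coeff * sqrt (limit_variance (indicator {0..Z})) * x)))"
    by (rule centered_normal_integral(1)[OF is_S_process_normal[OF S] borel_measurable_continuous_onI[OF \<psi>]])
  from tendsto_add[OF 1 2] show ?thesis unfolding 3 by simp
qed

theorem transmitted_wave_converges:
  assumes S: "is_S_process Z first_coeff r h N S"
  shows "conv_in_distribution_uniform (at_right 0)
     M (\<lambda>\<epsilon> w s. transmitted_wave f (P \<epsilon> w) Z s) N (\<lambda>v s. complex_of_real (f (s - S Z v / 2)))"
proof -
  have pos: "\<forall>\<^sub>F \<epsilon> in at_right 0. 0 < (\<epsilon> :: real)" by (rule eventually_at_right_less)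
  have X: "Bcontfun (\<lambda>s. transmitted_wave f (P \<epsilon> w) Z s) = Wave (transmission \<epsilon> w)" if "0 < \<epsilon>" "w \<in> space M" for \<epsilon> w
    using transmitted_wave_eq[OF that] by (simp add: apply_bcontfun_inverse)
  have Y: "Bcontfun (\<lambda>s. complex_of_real (f (s - c))) = shifted c" for c
    unfolding shifted_eq apply_bcontfun_inverse ..
  have SZ: "S Z \<in> borel_measurable N" using is_S_process_normal(2)[OF S] by (simp add: centered_normal_def)
  show ?thesis
    unfolding conv_in_distribution_uniform_def conv_in_distribution_def Y
  proof (intro conjI allI impI ballI)
    show "\<forall>\<^sub>F \<epsilon> in at_right 0. \<forall>w\<in>space M. (\<lambda>s. transmitted_wave f (P \<epsilon> w) Z s) \<in> bcontfun"
      using pos by eventually_elim (simp add: transmitted_wave_eq apply_bcontfun)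
    show "(\<lambda>s. complex_of_real (f (s - S Z v / 2))) \<in> bcontfun" for v
      unfolding shifted_eq by (rule apply_bcontfun)
    show "\<forall>\<^sub>F \<epsilon> in at_right 0. (\<lambda>w. Bcontfun (\<lambda>s. transmitted_wave f (P \<epsilon> w) Z s)) \<in> borel_measurable M"
      using pos
    proof eventually_elim
      case (elim \<epsilon>)
      show ?case
        by (rule measurable_cong[THEN iffD2, OF X[OF elim] Wave_Tr_measurable[OF elim]])
    qed
    show "(\<lambda>v. shifted (S Z v / 2)) \<in> borel_measurable N"
      by (rule measurable_compose[OF borel_measurable_divide[OF SZ borel_measurable_const] borel_measurable_continuous_onI[OF shifted_continuous]])
    fix \<phi> :: "(real \<Rightarrow>\<^sub>C complex) \<Rightarrow> real" assume \<phi>: "continuous_on UNIV \<phi> \<and> bounded (range \<phi>)"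
    then obtain B where B: "\<And>x. \<bar>\<phi> x\<bar> \<le> B" unfolding bounded_iff by auto
    show "((\<lambda>\<epsilon>. LINT w|M. \<phi> (Bcontfun (\<lambda>s. transmitted_wave f (P \<epsilon> w) Z s))) \<longlongrightarrow> (LINT v|N. \<phi> (shifted (S Z v / 2)))) (at_right 0)"
    \<comment> \<open>All limits so far run along sequences of positive \<epsilon>; arbitrary null
      sequences determine the one-sided limit.\<close>
    proof (rule tendsto_at_right_sequentially[of 0 1])
      fix \<epsilon> :: "nat \<Rightarrow> real" assume \<epsilon>: "\<And>n. 0 < \<epsilon> n" "\<epsilon> \<longlonglongrightarrow> 0"
      have "(LINT w|M. \<phi> (Bcontfun (\<lambda>s. transmitted_wave f (P (\<epsilon> n) w) Z s))) = (LINT w|M. \<phi> (Wave (transmission (\<epsilon> n) w)))" for n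
        by (rule Bochner_Integration.integral_cong[OF refl]) (simp only: X[OF \<epsilon>(1)])
      then show "(\<lambda>n. LINT w|M. \<phi> (Bcontfun (\<lambda>s. transmitted_wave f (P (\<epsilon> n) w) Z s))) \<longlonglongrightarrow> (LINT v|N. \<phi> (shifted (S Z v / 2)))"
        using Wave_weak_limit[OF \<epsilon> conjunct1[OF \<phi>] B S] by simp
    qed simp
  qed
qed

end

text \<open>The first conjunct keeps the second from being vacuous: a process with the prescribed
  covariance exists. The second holds for every such process, on whatever probability space it
  lives.\<close>

theorem theorem5p1:
  fixes Z \<tau> h_lo h_hi J1 :: real
    and \<kappa> h \<gamma> \<Phi> f :: "real \<Rightarrow> real"
    and r :: "real \<Rightarrow> real \<Rightarrow> real"
    and M :: "'w measure"
    and m :: "real \<Rightarrow> real \<Rightarrow> 'w \<Rightarrow> real"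
    and \<nu> :: "real \<Rightarrow> 'w \<Rightarrow> real \<Rightarrow> real"
    and P :: "real \<Rightarrow> 'w \<Rightarrow> real \<Rightarrow> real \<Rightarrow> complex^2^2"
    and N :: "'v measure"
    and S :: "real \<Rightarrow> 'v \<Rightarrow> real"
  assumes "0 < Z" and "0 < \<tau>"
    and "\<forall>z\<in>{0..Z}. 0 < \<kappa> z"
    and "1/2 < h_lo" and "h_lo \<le> h_hi" and "h_hi < 1"
    and "continuous_on {0..Z} h" and "h ` {0..Z} \<subseteq> {h_lo..h_hi}"
    and "continuous_on UNIV \<Phi>" and "hermite_index \<Phi> 1"
    and "J1 = (LINT x|std_normal_distribution. \<Phi> x * x)"
    and "centered_gaussian_process M ({0..} \<times> {h_lo..h_hi}) (\<lambda>(z, H). m z H)"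
    and "\<forall>w\<in>space M. continuous_on ({0..} \<times> {h_lo..h_hi}) (\<lambda>(z, H). m z H w)"
    and "\<forall>z\<in>{0..}. \<forall>H\<in>{h_lo..h_hi}. (LINT w|M. (m z H w)\<^sup>2) = 1"
    and "continuous_on ({h_lo..h_hi} \<times> {h_lo..h_hi}) (\<lambda>(H\<^sub>1, H\<^sub>2). r H\<^sub>1 H\<^sub>2)"
    and "\<forall>H\<^sub>1\<in>{h_lo..h_hi}. \<forall>H\<^sub>2\<in>{h_lo..h_hi}. 0 < r H\<^sub>1 H\<^sub>2"
    and "((\<lambda>(z\<^sub>1, z\<^sub>2). SUP (H\<^sub>1, H\<^sub>2)\<in>{h_lo..h_hi} \<times> {h_lo..h_hi}.
            \<bar>r H\<^sub>1 H\<^sub>2 - (z\<^sub>1 - z\<^sub>2) powr (2 - H\<^sub>1 - H\<^sub>2) * (LINT w|M. m z\<^sub>1 H\<^sub>1 w * m z\<^sub>2 H\<^sub>2 w)\<bar>)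
          \<longlongrightarrow> 0)
         (inf (filtercomap (\<lambda>(z\<^sub>1, z\<^sub>2). z\<^sub>1 - z\<^sub>2) at_top) (principal ({0..} \<times> {0..})))"
    and "\<forall>\<epsilon>>0. \<forall>w\<in>space M. \<forall>z\<in>{0..Z}.
           \<nu> \<epsilon> w z = \<epsilon> powr (\<kappa> z - \<tau>) * \<Phi> (m (z / \<epsilon>\<^sup>2) (h z) w)"
    and "\<forall>z\<in>{0..Z}. \<gamma> z = \<tau> - \<kappa> z"
    and "\<forall>z\<in>{0..Z}. h z = (2 - \<gamma> z) / 2"
    and "continuous_on UNIV f" and "integrable lborel f" and "integrable lborel (fourier f)"
    and "\<forall>\<epsilon>>0. \<forall>w\<in>space M. \<forall>\<omega>. is_propagator Z \<tau> \<epsilon> (\<nu> \<epsilon> w) \<omega> (P \<epsilon> w \<omega>)"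
  shows "(\<exists>(N' :: (real \<Rightarrow> real) measure) S'. is_S_process Z J1 r h N' S') \<and>
         (is_S_process Z J1 r h N S \<longrightarrow>
            conv_in_distribution_uniform (at_right 0)
              M (\<lambda>\<epsilon> w s. transmitted_wave f (P \<epsilon> w) Z s)
              N (\<lambda>v s. complex_of_real (f (s - S Z v / 2))))"
proof -
  have ps: "prob_space M"
    using assms(12) by (simp add: centered_gaussian_process_def gaussian_process_def)
  have "\<forall>k<1. (LINT x|std_normal_distribution. \<Phi> x * poly (hermite k) x) = 0"
    using assms(10) unfolding hermite_index_def by blast
  then have mean: "(LINT x|std_normal_distribution. \<Phi> x) = 0" by simp
  have sq: "integrable std_normal_distribution (\<lambda>x. (\<Phi> x)\<^sup>2)"
    using assms(10) by (simp add: hermite_index_def)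
  have scaled: "scaled_field M m h_lo h_hi r Z h"
    unfolding scaled_field_def correlated_field_def correlated_field_axioms_def scaled_field_axioms_def
    using ps assms by blast
  interpret H: hermite_field M m h_lo h_hi r Z h \<Phi>
    unfolding hermite_field_def hermite_field_axioms_def using scaled assms(9) sq mean by blast
  have \<nu>: "\<nu> \<epsilon> w z = H.X \<Phi> \<epsilon> z w" if "0 < \<epsilon>" "w \<in> space M" "z \<in> {0..Z}" for \<epsilon> w z
  proof -
    \<comment> \<open>The relation between h and \<gamma> makes the amplitude exponent depend on h
      alone, in the form used by \<open>X\<close>.\<close>
    have "h z = (2 - (\<tau> - \<kappa> z)) / 2" using assms(19,20) that(3) by simp
    then have "2 * h z - 2 = \<kappa> z - \<tau>" by simp
    then show ?thesis using assms(18) that by (simp add: H.X_def H.hc_def H.clip(3))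
  qed
  have P: "is_propagator Z \<tau> \<epsilon> (\<lambda>z. H.X \<Phi> \<epsilon> z w) \<omega> (P \<epsilon> w \<omega>)" if "0 < \<epsilon>" "w \<in> space M" for \<epsilon> w \<omega>
    using assms(24) that is_propagator_cong[of Z "\<nu> \<epsilon> w" "\<lambda>z. H.X \<Phi> \<epsilon> z w", OF \<nu>[OF that]] by blast
  interpret T: transmission_problem M m h_lo h_hi r Z h \<Phi> \<tau> f P
    by unfold_locales (use assms(2,21,22,23) P in auto)
  show ?thesis
    unfolding assms(11) using H.is_S_process_exists T.transmitted_wave_converges by blast
qed

end
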